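(* Suppose $\Gamma\vdash s:A$ and $\Gamma\vdash t:A$ are derivable in the annotated language. If $[\![s]\!]_p=[\![t]\!]_p$ in every categorical model of the annotated language, then $\Gamma\vdash s=t:A$ is derivable.
   Context: Fix a set $\mathbf{Q}$ of qubits and a set $\mathbf{G}$ of gates; each gate $G$ comes with a tuple $(q_1,\dots,q_n)$ of distinct qubits and a duration $d_G\in\mathbb{R}_{\ge0}$; write $(G,d_G,q_1,\dots,q_n)\in\mathbf{G}$. **Annotated language.** Types: $A,B::=1\mid q\mid A\otimes B\mid \Box_d A$ ($q\in\mathbf{Q}$, $d\in\mathbb{R}$). Contexts: lists of graded declarations $x:^d A$ with distinct variables, $d\in\mathbb{R}$. $d+\Gamma$ adds $d$ to every grade of $\Gamma$. Terms: $x$, $*$, $\mathrm{let}\ *=s\ \mathrm{in}\ t$, $G(t_1,\dots,t_n)$, $(s,t)$, $\mathrm{let}\ (x,y)=s\ \mathrm{in}\ t$, $\mathrm{box}\ d\ t$, $\mathrm{let\ box}\ d\ x=s\ \mathrm{in}\ t$, $\mathrm{delay}_d(t)$, $\mathrm{let}\ x=s\ \mathrm{in}\ t$. Typing rules: - Swap: from $\Gamma,x:^dA,y:^eB,\Delta\vdash t:C$ infer $\Gamma,y:^eB,x:^dA,\Delta\vdash t:C$. - Var: $x:^0A\vdash x:A$. Unit-I: $\vdash *:1$. - Unit-E: from $\Gamma\vdash s:1$, $\Delta\vdash t:A$ infer $d+\Gamma,\Delta\vdash\mathrm{let}\ *=s\ \mathrm{in}\ t:A$ ($d$ any real). - Gate: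 for $(G,d,q_1,\dots,q_n)\in\mathbf{G}$, from $\Gamma_i\vdash t_i:q_i$ infer $-d+\Gamma_1,\dots,-d+\Gamma_n\vdash G(t_1,\dots,t_n):q_1\otimes\cdots\otimes q_n$. - Tens-I: from $\Gamma\vdash s:A$, $\Delta\vdash t:B$ infer $\Gamma,\Delta\vdash(s,t):A\otimes B$. - Tens-E: from $\Gamma\vdash s:A\otimes B$ and $x:^dA,y:^dB,\Delta\vdash t:C$ infer $d+\Gamma,\Delta\vdash\mathrm{let}\ (x,y)=s\ \mathrm{in}\ t:C$. - Box-I: from $\Gamma\vdash t:A$ infer $d+\Gamma\vdash\mathrm{box}\ d\ t:\Box_dA$. - Box-E: from $\Gamma\vdash s:\Box_dA$ and $x:^eA,\Delta\vdash t:B$ infer $(e-d)+\Gamma,\Delta\vdash\mathrm{let\ box}\ d\ x=s\ \mathrm{in}\ t:B$. - Delay: from $\Gamma\vdash t:q$, $d\ge0$ infer $-d+\Gamma\vdash\mathrm{delay}_d(t):q$. - Let: from $\Gamma\vdash s:A$ and $x:^dA,\Delta\vdash t:C$ infer $d+\Gamma,\Delta\vdash\mathrm{let}\ x=s\ \mathrm{in}\ t:C$. **Judgemental equality** $\Gamma\vdash s=t:A$ is the least equivalence relation on well-typed terms (up to renaming of bound variables) that is a congruence for all constructors and contains, whenever both sides are well typed with the same context and type and no variable capture occurs: - $\beta$: $(\mathrm{let}\ *=*\ \mathrm{in}\ t)=t$; $(\mathrm{let}\ (x,y)=(s,t)\ \mathrm{in}\ u)=u[x:=s,y:=t]$; $(\mathrm{let\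 box}\ d\ x=\mathrm{box}\ d\ s\ \mathrm{in}\ t)=t[x:=s]$; $(\mathrm{let}\ x=s\ \mathrm{in}\ t)=t[x:=s]$. - $\eta$: $(\mathrm{let}\ *=t\ \mathrm{in}\ * )=t$; $(\mathrm{let}\ (x,y)=t\ \mathrm{in}\ (x,y))=t$; $(\mathrm{let\ box}\ d\ x=t\ \mathrm{in\ box}\ d\ x)=t$. - Commuting conversions, for $P$ any of the patterns $*$, $(x,y)$, $\mathrm{box}\ d\ z$: $(\mathrm{let}\ P=s\ \mathrm{in}\ \mathrm{let}\ R=t\ \mathrm{in}\ u)=(\mathrm{let}\ R=(\mathrm{let}\ P=s\ \mathrm{in}\ t)\ \mathrm{in}\ u)$ for $R$ any of $*$, $(x',y')$, or $R=\mathrm{box}\ d'\ x'$ when $P$ is $*$ or $(x,y)$; $(\mathrm{let}\ P=s\ \mathrm{in}\ \mathrm{let}\ R=t\ \mathrm{in}\ u)=(\mathrm{let}\ R=t\ \mathrm{in}\ \mathrm{let}\ P=s\ \mathrm{in}\ u)$ for $R$ any of the three patterns; $(\mathrm{let}\ P=s\ \mathrm{in}\ G(t_1,\dots,t_n))=G(t_1,\dots,\mathrm{let}\ P=s\ \mathrm{in}\ t_i,\dots,t_n)$; $(\mathrm{let}\ P=s\ \mathrm{in}\ (t,u))=(\mathrm{let}\ P=s\ \mathrm{in}\ t,\,u)$ and $=(t,\,\mathrm{let}\ P=s\ \mathrm{in}\ u)$; $(\mathrm{let}\ P=s\ \mathrm{in\ box}\ d'\ t)=\mathrm{box}\ d'\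 (\mathrm{let}\ P=s\ \mathrm{in}\ t)$. **Models.** A categorical model of the annotated language is a symmetric monoidal category $\mathcal{C}^\otimes$ with an object $X_q$ for each $q\in\mathbf{Q}$; a (strong) monoidal functor $\mathrm{Shift}(-)$ from the discrete category $\mathbb{R}$ (monoidal under $+$) to the category of strong symmetric monoidal endofunctors of $\mathcal{C}^\otimes$ (monoidal under composition); for each gate $(G,d,q_1,\dots,q_n)$ a morphism $f_G:\mathrm{Shift}(-d)(\bigotimes_iX_{q_i})\to\bigotimes_iX_{q_i}$; and for each $x\ge0$, $q\in\mathbf{Q}$ a morphism $\mathrm{delay}_x:\mathrm{Shift}(-x)(X_q)\to X_q$. **Interpretation.** Types: $[\![1]\!]_p=I$, $[\![q]\!]_p=X_q$, $[\![A\otimes B]\!]_p=[\![A]\!]_p\otimes[\![B]\!]_p$, $[\![\Box_dA]\!]_p=\mathrm{Shift}(d)[\![A]\!]_p$. Contexts: $[\![[]]\!]_p=I$, $[\![x:^dA,\Gamma]\!]_p=\mathrm{Shift}(d)[\![A]\!]_p\otimes[\![\Gamma]\!]_p$; hence $[\![d+\Gamma]\!]_p\simeq\mathrm{Shift}(d)[\![\Gamma]\!]_p$ canonically. A derivation of $\Gamma\vdash t:A$ is interpreted as a morphism $[\![t]\!]_p:[\![\Gamma]\!]_p\to[\![A]\!]_p$, inserting canonical coherence isomorphisms where needed: Swap is precomposition with the symmetry; Var and Unit-I are identities; Unit-E is $\mathrm{Shift}(d)[\![s]\!]_p\otimes[\![t]\!]_p$; Tens-I is $[\![s]\!]_p\otimes[\![t]\!]_p$;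 Tens-E and Let are $[\![t]\!]_p\circ(\mathrm{Shift}(d)[\![s]\!]_p\otimes\mathrm{Id}_{[\![\Delta]\!]_p})$; Gate is $f_G\circ\mathrm{Shift}(-d)(\bigotimes_i[\![t_i]\!]_p)$; Delay is $\mathrm{delay}_d\circ\mathrm{Shift}(-d)[\![t]\!]_p$; Box-I is $\mathrm{Shift}(d)[\![t]\!]_p$; Box-E is $[\![t]\!]_p\circ(\phi\otimes\mathrm{Id}_{[\![\Delta]\!]_p})$ with $\phi=\mathrm{Shift}(e-d)[\![s]\!]_p$ followed by $\mathrm{Shift}(e-d)\mathrm{Shift}(d)[\![A]\!]_p\simeq\mathrm{Shift}(e)[\![A]\!]_p$. *)

theory Defs
  imports Complex_Main
begin

section \<open>Signatures, types, contexts and terms\<close>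

record ('q, 'g) signature =
  qubits :: "'q set"
  gates :: "'g set"
  duration :: "'g \<Rightarrow> real"
  wires :: "'g \<Rightarrow> 'q list"

definition wf_signature :: "('q, 'g) signature \<Rightarrow> bool" where
  "wf_signature S \<longleftrightarrow>
    (\<forall>g \<in> gates S. duration S g \<ge> 0 \<and> distinct (wires S g) \<and> set (wires S g) \<subseteq> qubits S)"

datatype 'q ty =
    One
  | Qubit 'q
  | Tens "'q ty" "'q ty"
  | BoxTy real "'q ty"

text \<open>The type \<open>q\<^sub>1 \<otimes> \<dots> \<otimes> q\<^sub>n\<close>, bracketed to the right; it is the unit type for \<open>n = 0\<close>.\<close>

fun tensor_ty :: "'q list \<Rightarrow> 'q ty" where
  "tensor_ty [] = One"
| "tensor_ty [q] = Qubit q"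
| "tensor_ty (q # q' # qs) = Tens (Qubit q) (tensor_ty (q' # qs))"

type_synonym var = nat

type_synonym 'q decl = "var \<times> real \<times> 'q ty"

type_synonym 'q ctx = "'q decl list"

definition distinct_vars :: "'q ctx \<Rightarrow> bool" where
  "distinct_vars \<Gamma> \<longleftrightarrow> distinct (map fst \<Gamma>)"

definition shift_ctx :: "real \<Rightarrow> 'q ctx \<Rightarrow> 'q ctx" where
  "shift_ctx d \<Gamma> = map (\<lambda>(x, e, A). (x, d + e, A)) \<Gamma>"

text \<open>
  \<open>LetIn P s t\<close> is \<open>let P = s in t\<close>. The four patterns give the four let-constructs of the
  language: \<open>PVar x\<close> is \<open>x\<close>, \<open>PUnit\<close> is \<open>*\<close>, \<open>PPair x y\<close> is \<open>(x, y)\<close> and \<open>PBox d x\<close> is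
  \<open>box d x\<close>. The variables bound by \<open>P\<close> are \<open>set_pat P\<close>; their scope is \<open>t\<close>.
\<close>

datatype 'v pat =
    is_PVar: PVar 'v
  | is_PUnit: PUnit
  | is_PPair: PPair 'v 'v
  | is_PBox: PBox real 'v

datatype 'g tm =
    V var
  | Star
  | Gate 'g "'g tm list"
  | Tup "'g tm" "'g tm"
  | BoxTm real "'g tm"
  | Delay real "'g tm"
  | LetIn "var pat" "'g tm" "'g tm"

primrec fv :: "'g tm \<Rightarrow> var set" where
  "fv (V x) = {x}"
| "fv Star = {}"
| "fv (Gate g ts) = \<Union> (set (map fv ts))"
| "fv (Tup s t) = fv s \<union> fv t"
| "fv (BoxTm d t) = fv t"
| "fv (Delay d t) = fv t"
| "fv (LetIn P s t) = fv s \<union> (fv t - set_pat P)"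

primrec bv :: "'g tm \<Rightarrow> var set" where
  "bv (V x) = {}"
| "bv Star = {}"
| "bv (Gate g ts) = \<Union> (set (map bv ts))"
| "bv (Tup s t) = bv s \<union> bv t"
| "bv (BoxTm d t) = bv t"
| "bv (Delay d t) = bv t"
| "bv (LetIn P s t) = bv s \<union> set_pat P \<union> bv t"

text \<open>
  Simultaneous substitution. It does not rename bound variables, so it is only meaningful when
  nothing is captured; every use below carries a side condition that ensures this.
\<close>

primrec subst :: "'g tm \<Rightarrow> (var \<Rightarrow> 'g tm) \<Rightarrow> 'g tm" where
  "subst (V x) \<sigma> = \<sigma> x"
| "subst Star \<sigma> = Star"
| "subst (Gate g ts) \<sigma> = Gate g (map (\<lambda>t. subst t \<sigma>) ts)"
| "subst (Tup s t) \<sigma> = Tup (subst s \<sigma>) (subst t \<sigma>)"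
| "subst (BoxTm d t) \<sigma> = BoxTm d (subst t \<sigma>)"
| "subst (Delay d t) \<sigma> = Delay d (subst t \<sigma>)"
| "subst (LetIn P s t) \<sigma> =
     LetIn P (subst s \<sigma>) (subst t (\<lambda>x. if x \<in> set_pat P then V x else \<sigma> x))"


section \<open>Typing\<close>

text \<open>
  Typing derivations are explicit trees, since it is derivations that are interpreted in a model.
  A tree records every instance of a rule: for example, \<open>D_UnitE \<Gamma> \<Delta> d D E\<close> concludes a judgement
  in the context \<open>d + \<Gamma>, \<Delta>\<close>, and \<open>d\<close> need not be determined by that judgement.
\<close>

datatype ('q, 'g) deriv =
    D_Swap "'q ctx" "'q decl" "'q decl" "'q ctx" "('q, 'g) deriv"
  | D_Var var "'q ty"
  | D_UnitI
  | D_UnitE "'q ctx" "'q ctx" real "'q ty" "('q, 'g) deriv" "('q, 'g) deriv"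
  | D_Gate 'g "'q ctx list" "('q, 'g) deriv list"
  | D_TensI "'q ctx" "'q ctx" "('q, 'g) deriv" "('q, 'g) deriv"
  | D_TensE "'q ctx" "'q ctx" real var var "'q ty" "'q ty" "('q, 'g) deriv" "('q, 'g) deriv"
  | D_BoxI "'q ctx" real "('q, 'g) deriv"
  | D_BoxE "'q ctx" "'q ctx" real real var "'q ty" "('q, 'g) deriv" "('q, 'g) deriv"
  | D_Delay "'q ctx" real 'q "('q, 'g) deriv"
  | D_Let "'q ctx" "'q ctx" real var "'q ty" "('q, 'g) deriv" "('q, 'g) deriv"

text \<open>
  \<open>derives S D \<Gamma> t A\<close>: the tree \<open>D\<close> is a derivation of \<open>\<Gamma> \<turnstile> t : A\<close>. Types are built from the
  qubits of \<open>S\<close>; it suffices to require this where a type is introduced, in rule \<open>Var\<close>.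
\<close>

inductive derives ::
  "('q, 'g) signature \<Rightarrow> ('q, 'g) deriv \<Rightarrow> 'q ctx \<Rightarrow> 'g tm \<Rightarrow> 'q ty \<Rightarrow> bool"
  for S where
  Swap: "derives S D (\<Gamma> @ (x, d, A) # (y, e, B) # \<Delta>) t C \<Longrightarrow>
    derives S (D_Swap \<Gamma> (x, d, A) (y, e, B) \<Delta> D) (\<Gamma> @ (y, e, B) # (x, d, A) # \<Delta>) t C"
| Var: "set_ty A \<subseteq> qubits S \<Longrightarrow>
    derives S (D_Var x A) [(x, 0, A)] (V x) A"
| UnitI: "derives S D_UnitI [] Star One"
| UnitE: "derives S D \<Gamma> s One \<Longrightarrow> derives S E \<Delta> t A \<Longrightarrow>
    distinct_vars (shift_ctx d \<Gamma> @ \<Delta>) \<Longrightarrow>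
    derives S (D_UnitE \<Gamma> \<Delta> d A D E) (shift_ctx d \<Gamma> @ \<Delta>) (LetIn PUnit s t) A"
| Gate: "g \<in> gates S \<Longrightarrow>
    length \<Gamma>s = length (wires S g) \<Longrightarrow>
    length Ds = length (wires S g) \<Longrightarrow>
    length ts = length (wires S g) \<Longrightarrow>
    \<forall>i < length (wires S g). derives S (Ds ! i) (\<Gamma>s ! i) (ts ! i) (Qubit (wires S g ! i)) \<Longrightarrow>
    distinct_vars (concat (map (shift_ctx (- duration S g)) \<Gamma>s)) \<Longrightarrow>
    derives S (D_Gate g \<Gamma>s Ds) (concat (map (shift_ctx (- duration S g)) \<Gamma>s))
      (Gate g ts) (tensor_ty (wires S g))"
| TensI: "derives S D \<Gamma> s A \<Longrightarrow> derives S E \<Delta> t B \<Longrightarrow>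
    distinct_vars (\<Gamma> @ \<Delta>) \<Longrightarrow>
    derives S (D_TensI \<Gamma> \<Delta> D E) (\<Gamma> @ \<Delta>) (Tup s t) (Tens A B)"
| TensE: "derives S D \<Gamma> s (Tens A B) \<Longrightarrow> derives S E ((x, d, A) # (y, d, B) # \<Delta>) t C \<Longrightarrow>
    distinct_vars (shift_ctx d \<Gamma> @ \<Delta>) \<Longrightarrow>
    derives S (D_TensE \<Gamma> \<Delta> d x y A B D E) (shift_ctx d \<Gamma> @ \<Delta>) (LetIn (PPair x y) s t) C"
| BoxI: "derives S D \<Gamma> t A \<Longrightarrow>
    derives S (D_BoxI \<Gamma> d D) (shift_ctx d \<Gamma>) (BoxTm d t) (BoxTy d A)"
| BoxE: "derives S D \<Gamma> s (BoxTy d A) \<Longrightarrow> derives S E ((x, e, A) # \<Delta>) t B \<Longrightarrow>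
    distinct_vars (shift_ctx (e - d) \<Gamma> @ \<Delta>) \<Longrightarrow>
    derives S (D_BoxE \<Gamma> \<Delta> d e x A D E) (shift_ctx (e - d) \<Gamma> @ \<Delta>) (LetIn (PBox d x) s t) B"
| Delay: "derives S D \<Gamma> t (Qubit q) \<Longrightarrow> d \<ge> 0 \<Longrightarrow>
    derives S (D_Delay \<Gamma> d q D) (shift_ctx (- d) \<Gamma>) (Delay d t) (Qubit q)"
| Let: "derives S D \<Gamma> s A \<Longrightarrow> derives S E ((x, d, A) # \<Delta>) t C \<Longrightarrow>
    distinct_vars (shift_ctx d \<Gamma> @ \<Delta>) \<Longrightarrow>
    derives S (D_Let \<Gamma> \<Delta> d x A D E) (shift_ctx d \<Gamma> @ \<Delta>) (LetIn (PVar x) s t) C"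

definition typed :: "('q, 'g) signature \<Rightarrow> 'q ctx \<Rightarrow> 'g tm \<Rightarrow> 'q ty \<Rightarrow> bool" where
  "typed S \<Gamma> t A \<longleftrightarrow> (\<exists>D. derives S D \<Gamma> t A)"


section \<open>Judgemental equality\<close>

text \<open>
  The generating equations, on raw terms. Rule \<open>alpha\<close> renames one bound variable to one that does
  not occur in its scope; up to congruence this generates renaming of bound variables. The other
  side conditions rule out variable capture. In \<open>beta\<close> they ask for bound variables that are
  disjoint from the free variables of the substituted terms, which \<open>alpha\<close> can always achieve.
\<close>

inductive conv :: "'g tm \<Rightarrow> 'g tm \<Rightarrow> bool" where
  alpha: "x \<in> set_pat P \<Longrightarrow> y \<notin> set_pat P \<union> fv t \<union> bv t \<Longrightarrow>
    conv (LetIn P s t) (LetIn (map_pat (id(x := y)) P) s (subst t (V(x := V y))))"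
| beta_unit: "conv (LetIn PUnit Star t) t"
| beta_pair: "bv u \<inter> (fv s \<union> fv t) = {} \<Longrightarrow>
    conv (LetIn (PPair x y) (Tup s t) u) (subst u (V(x := s, y := t)))"
| beta_box: "bv t \<inter> fv s = {} \<Longrightarrow>
    conv (LetIn (PBox d x) (BoxTm d s) t) (subst t (V(x := s)))"
| beta_let: "bv t \<inter> fv s = {} \<Longrightarrow>
    conv (LetIn (PVar x) s t) (subst t (V(x := s)))"
| eta_unit: "conv (LetIn PUnit t Star) t"
| eta_pair: "conv (LetIn (PPair x y) t (Tup (V x) (V y))) t"
| eta_box: "conv (LetIn (PBox d x) t (BoxTm d (V x))) t"
| comm_let: "\<not> is_PVar P \<Longrightarrow> is_PUnit R \<or> is_PPair R \<or> is_PBox R \<and> \<not> is_PBox P \<Longrightarrow>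
    set_pat P \<inter> (fv u - set_pat R) = {} \<Longrightarrow>
    conv (LetIn P s (LetIn R t u)) (LetIn R (LetIn P s t) u)"
| comm_exchange: "\<not> is_PVar P \<Longrightarrow> \<not> is_PVar R \<Longrightarrow>
    set_pat P \<inter> fv t = {} \<Longrightarrow> set_pat R \<inter> fv s = {} \<Longrightarrow> set_pat P \<inter> set_pat R = {} \<Longrightarrow>
    conv (LetIn P s (LetIn R t u)) (LetIn R t (LetIn P s u))"
| comm_gate: "\<not> is_PVar P \<Longrightarrow> i < length ts \<Longrightarrow>
    \<forall>j < length ts. j \<noteq> i \<longrightarrow> set_pat P \<inter> fv (ts ! j) = {} \<Longrightarrow>
    conv (LetIn P s (Gate g ts)) (Gate g (ts[i := LetIn P s (ts ! i)]))"
| comm_tup1: "\<not> is_PVar P \<Longrightarrow> set_pat P \<inter> fv u = {} \<Longrightarrow>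
    conv (LetIn P s (Tup t u)) (Tup (LetIn P s t) u)"
| comm_tup2: "\<not> is_PVar P \<Longrightarrow> set_pat P \<inter> fv t = {} \<Longrightarrow>
    conv (LetIn P s (Tup t u)) (Tup t (LetIn P s u))"
| comm_box: "\<not> is_PVar P \<Longrightarrow>
    conv (LetIn P s (BoxTm d t)) (BoxTm d (LetIn P s t))"

text \<open>\<open>jeq S \<Gamma> s t A\<close> is the judgement \<open>\<Gamma> \<turnstile> s = t : A\<close>. There is a congruence rule for each typing
  rule with premises, including the exchange of adjacent declarations.\<close>

inductive jeq ::
  "('q, 'g) signature \<Rightarrow> 'q ctx \<Rightarrow> 'g tm \<Rightarrow> 'g tm \<Rightarrow> 'q ty \<Rightarrow> bool"
  for S where
  Conv: "conv s t \<Longrightarrow> typed S \<Gamma> s A \<Longrightarrow> typed S \<Gamma> t A \<Longrightarrow> jeq S \<Gamma> s t A"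
| Refl: "typed S \<Gamma> t A \<Longrightarrow> jeq S \<Gamma> t t A"
| Sym: "jeq S \<Gamma> s t A \<Longrightarrow> jeq S \<Gamma> t s A"
| Trans: "jeq S \<Gamma> s t A \<Longrightarrow> jeq S \<Gamma> t u A \<Longrightarrow> jeq S \<Gamma> s u A"
| Swap_cong: "jeq S (\<Gamma> @ (x, d, A) # (y, e, B) # \<Delta>) t t' C \<Longrightarrow>
    jeq S (\<Gamma> @ (y, e, B) # (x, d, A) # \<Delta>) t t' C"
| UnitE_cong: "jeq S \<Gamma> s s' One \<Longrightarrow> jeq S \<Delta> t t' A \<Longrightarrow>
    distinct_vars (shift_ctx d \<Gamma> @ \<Delta>) \<Longrightarrow>
    jeq S (shift_ctx d \<Gamma> @ \<Delta>) (LetIn PUnit s t) (LetIn PUnit s' t') A"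
| Gate_cong: "g \<in> gates S \<Longrightarrow>
    length \<Gamma>s = length (wires S g) \<Longrightarrow>
    length ts = length (wires S g) \<Longrightarrow>
    length ts' = length (wires S g) \<Longrightarrow>
    \<forall>i < length (wires S g). jeq S (\<Gamma>s ! i) (ts ! i) (ts' ! i) (Qubit (wires S g ! i)) \<Longrightarrow>
    distinct_vars (concat (map (shift_ctx (- duration S g)) \<Gamma>s)) \<Longrightarrow>
    jeq S (concat (map (shift_ctx (- duration S g)) \<Gamma>s))
      (Gate g ts) (Gate g ts') (tensor_ty (wires S g))"
| TensI_cong: "jeq S \<Gamma> s s' A \<Longrightarrow> jeq S \<Delta> t t' B \<Longrightarrow>
    distinct_vars (\<Gamma> @ \<Delta>) \<Longrightarrow>
    jeq S (\<Gamma> @ \<Delta>) (Tup s t) (Tup s' t') (Tens A B)"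
| TensE_cong: "jeq S \<Gamma> s s' (Tens A B) \<Longrightarrow> jeq S ((x, d, A) # (y, d, B) # \<Delta>) t t' C \<Longrightarrow>
    distinct_vars (shift_ctx d \<Gamma> @ \<Delta>) \<Longrightarrow>
    jeq S (shift_ctx d \<Gamma> @ \<Delta>) (LetIn (PPair x y) s t) (LetIn (PPair x y) s' t') C"
| BoxI_cong: "jeq S \<Gamma> t t' A \<Longrightarrow>
    jeq S (shift_ctx d \<Gamma>) (BoxTm d t) (BoxTm d t') (BoxTy d A)"
| BoxE_cong: "jeq S \<Gamma> s s' (BoxTy d A) \<Longrightarrow> jeq S ((x, e, A) # \<Delta>) t t' B \<Longrightarrow>
    distinct_vars (shift_ctx (e - d) \<Gamma> @ \<Delta>) \<Longrightarrow>
    jeq S (shift_ctx (e - d) \<Gamma> @ \<Delta>) (LetIn (PBox d x) s t) (LetIn (PBox d x) s' t') B"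
| Delay_cong: "jeq S \<Gamma> t t' (Qubit q) \<Longrightarrow> d \<ge> 0 \<Longrightarrow>
    jeq S (shift_ctx (- d) \<Gamma>) (Delay d t) (Delay d t') (Qubit q)"
| Let_cong: "jeq S \<Gamma> s s' A \<Longrightarrow> jeq S ((x, d, A) # \<Delta>) t t' C \<Longrightarrow>
    distinct_vars (shift_ctx d \<Gamma> @ \<Delta>) \<Longrightarrow>
    jeq S (shift_ctx d \<Gamma> @ \<Delta>) (LetIn (PVar x) s t) (LetIn (PVar x) s' t') C"


section \<open>Symmetric monoidal categories\<close>

record ('o, 'm) category =
  Obj :: "'o set"
  Arr :: "'m set"
  Dom :: "'m \<Rightarrow> 'o"
  Cod :: "'m \<Rightarrow> 'o"
  Id :: "'o \<Rightarrow> 'm"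
  Comp :: "'m \<Rightarrow> 'm \<Rightarrow> 'm" (infixr "\<cdot>\<index>" 65)

definition hom :: "('o, 'm, 'x) category_scheme \<Rightarrow> 'o \<Rightarrow> 'o \<Rightarrow> 'm set" where
  "hom C a b = {f \<in> Arr C. Dom C f = a \<and> Cod C f = b}"

definition inverse_arrows :: "('o, 'm, 'x) category_scheme \<Rightarrow> 'm \<Rightarrow> 'm \<Rightarrow> bool" where
  "inverse_arrows C f g \<longleftrightarrow>
     f \<in> Arr C \<and> g \<in> hom C (Cod C f) (Dom C f) \<and>
     g \<cdot>\<^bsub>C\<^esub> f = Id C (Dom C f) \<and> f \<cdot>\<^bsub>C\<^esub> g = Id C (Cod C f)"

definition is_iso :: "('o, 'm, 'x) category_scheme \<Rightarrow> 'm \<Rightarrow> bool" where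
  "is_iso C f \<longleftrightarrow> (\<exists>g. inverse_arrows C f g)"

definition arr_inv :: "('o, 'm, 'x) category_scheme \<Rightarrow> 'm \<Rightarrow> 'm" where
  "arr_inv C f = (THE g. inverse_arrows C f g)"

locale category =
  fixes C :: "('o, 'm, 'x) category_scheme" (structure)
  assumes Dom_Obj: "f \<in> Arr C \<Longrightarrow> Dom C f \<in> Obj C"
    and Cod_Obj: "f \<in> Arr C \<Longrightarrow> Cod C f \<in> Obj C"
    and Id_hom: "a \<in> Obj C \<Longrightarrow> Id C a \<in> hom C a a"
    and Comp_hom: "f \<in> hom C a b \<Longrightarrow> g \<in> hom C b c \<Longrightarrow> g \<cdot> f \<in> hom C a c"
    and Comp_Id: "f \<in> hom C a b \<Longrightarrow> f \<cdot> Id C a = f"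
    and Id_Comp: "f \<in> hom C a b \<Longrightarrow> Id C b \<cdot> f = f"
    and Comp_assoc: "f \<in> hom C a b \<Longrightarrow> g \<in> hom C b c \<Longrightarrow> h \<in> hom C c d \<Longrightarrow>
      (h \<cdot> g) \<cdot> f = h \<cdot> (g \<cdot> f)"

record ('o, 'm) sm_category = "('o, 'm) category" +
  Unit :: 'o ("\<I>\<index>")
  tens_ob :: "'o \<Rightarrow> 'o \<Rightarrow> 'o" (infixr "\<otimes>\<index>" 75)
  tens_ar :: "'m \<Rightarrow> 'm \<Rightarrow> 'm" (infixr "\<boxtimes>\<index>" 75)
  assoc :: "'o \<Rightarrow> 'o \<Rightarrow> 'o \<Rightarrow> 'm"
  lunit :: "'o \<Rightarrow> 'm"
  runit :: "'o \<Rightarrow> 'm"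
  symm :: "'o \<Rightarrow> 'o \<Rightarrow> 'm"

locale symmetric_monoidal_category = category C
  for C :: "('o, 'm, 'x) sm_category_scheme" (structure) +
  assumes Unit_Obj: "\<I> \<in> Obj C"
    and tens_Obj: "a \<in> Obj C \<Longrightarrow> b \<in> Obj C \<Longrightarrow> a \<otimes> b \<in> Obj C"
    and tens_hom: "f \<in> hom C a b \<Longrightarrow> g \<in> hom C c d \<Longrightarrow> f \<boxtimes> g \<in> hom C (a \<otimes> c) (b \<otimes> d)"
    and tens_Id: "a \<in> Obj C \<Longrightarrow> b \<in> Obj C \<Longrightarrow> Id C a \<boxtimes> Id C b = Id C (a \<otimes> b)"
    and tens_Comp: "f \<in> hom C a b \<Longrightarrow> g \<in> hom C b c \<Longrightarrow> f' \<in> hom C a' b' \<Longrightarrow> g' \<in> hom C b' c' \<Longrightarrow>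
      (g \<cdot> f) \<boxtimes> (g' \<cdot> f') = (g \<boxtimes> g') \<cdot> (f \<boxtimes> f')"
    and assoc_hom: "a \<in> Obj C \<Longrightarrow> b \<in> Obj C \<Longrightarrow> c \<in> Obj C \<Longrightarrow>
      assoc C a b c \<in> hom C ((a \<otimes> b) \<otimes> c) (a \<otimes> (b \<otimes> c))"
    and assoc_iso: "a \<in> Obj C \<Longrightarrow> b \<in> Obj C \<Longrightarrow> c \<in> Obj C \<Longrightarrow> is_iso C (assoc C a b c)"
    and assoc_natural: "f \<in> hom C a a' \<Longrightarrow> g \<in> hom C b b' \<Longrightarrow> h \<in> hom C c c' \<Longrightarrow>
      assoc C a' b' c' \<cdot> ((f \<boxtimes> g) \<boxtimes> h) = (f \<boxtimes> (g \<boxtimes> h)) \<cdot> assoc C a b c"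
    and lunit_hom: "a \<in> Obj C \<Longrightarrow> lunit C a \<in> hom C (\<I> \<otimes> a) a"
    and lunit_iso: "a \<in> Obj C \<Longrightarrow> is_iso C (lunit C a)"
    and lunit_natural: "f \<in> hom C a b \<Longrightarrow> lunit C b \<cdot> (Id C \<I> \<boxtimes> f) = f \<cdot> lunit C a"
    and runit_hom: "a \<in> Obj C \<Longrightarrow> runit C a \<in> hom C (a \<otimes> \<I>) a"
    and runit_iso: "a \<in> Obj C \<Longrightarrow> is_iso C (runit C a)"
    and runit_natural: "f \<in> hom C a b \<Longrightarrow> runit C b \<cdot> (f \<boxtimes> Id C \<I>) = f \<cdot> runit C a"
    and symm_hom: "a \<in> Obj C \<Longrightarrow> b \<in> Obj C \<Longrightarrow> symm C a b \<in> hom C (a \<otimes> b) (b \<otimes> a)"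
    and symm_natural: "f \<in> hom C a a' \<Longrightarrow> g \<in> hom C b b' \<Longrightarrow>
      symm C a' b' \<cdot> (f \<boxtimes> g) = (g \<boxtimes> f) \<cdot> symm C a b"
    and symm_symm: "a \<in> Obj C \<Longrightarrow> b \<in> Obj C \<Longrightarrow> symm C b a \<cdot> symm C a b = Id C (a \<otimes> b)"
    and pentagon: "a \<in> Obj C \<Longrightarrow> b \<in> Obj C \<Longrightarrow> c \<in> Obj C \<Longrightarrow> d \<in> Obj C \<Longrightarrow>
      (Id C a \<boxtimes> assoc C b c d) \<cdot> assoc C a (b \<otimes> c) d \<cdot> (assoc C a b c \<boxtimes> Id C d) =
      assoc C a b (c \<otimes> d) \<cdot> assoc C (a \<otimes> b) c d"
    and triangle: "a \<in> Obj C \<Longrightarrow> b \<in> Obj C \<Longrightarrow>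
      (Id C a \<boxtimes> lunit C b) \<cdot> assoc C a \<I> b = runit C a \<boxtimes> Id C b"
    and hexagon: "a \<in> Obj C \<Longrightarrow> b \<in> Obj C \<Longrightarrow> c \<in> Obj C \<Longrightarrow>
      (Id C b \<boxtimes> symm C a c) \<cdot> assoc C b a c \<cdot> (symm C a b \<boxtimes> Id C c) =
      assoc C b c a \<cdot> symm C a (b \<otimes> c) \<cdot> assoc C a b c"


section \<open>Strong symmetric monoidal endofunctors\<close>

record ('o, 'm) endofunctor =
  f_ob :: "'o \<Rightarrow> 'o"
  f_ar :: "'m \<Rightarrow> 'm"
  f_mul :: "'o \<Rightarrow> 'o \<Rightarrow> 'm"
  f_unit :: 'm

text \<open>\<open>f_mul F a b : F a \<otimes> F b \<rightarrow> F (a \<otimes> b)\<close> and \<open>f_unit F : I \<rightarrow> F I\<close>.\<close>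

locale strong_symmetric_monoidal_endofunctor = symmetric_monoidal_category C
  for C :: "('o, 'm, 'x) sm_category_scheme" (structure) +
  fixes F :: "('o, 'm) endofunctor"
  assumes f_ob_Obj: "a \<in> Obj C \<Longrightarrow> f_ob F a \<in> Obj C"
    and f_ar_hom: "f \<in> hom C a b \<Longrightarrow> f_ar F f \<in> hom C (f_ob F a) (f_ob F b)"
    and f_ar_Id: "a \<in> Obj C \<Longrightarrow> f_ar F (Id C a) = Id C (f_ob F a)"
    and f_ar_Comp: "f \<in> hom C a b \<Longrightarrow> g \<in> hom C b c \<Longrightarrow> f_ar F (g \<cdot> f) = f_ar F g \<cdot> f_ar F f"
    and f_mul_hom: "a \<in> Obj C \<Longrightarrow> b \<in> Obj C \<Longrightarrow>
      f_mul F a b \<in> hom C (f_ob F a \<otimes> f_ob F b) (f_ob F (a \<otimes> b))"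
    and f_mul_iso: "a \<in> Obj C \<Longrightarrow> b \<in> Obj C \<Longrightarrow> is_iso C (f_mul F a b)"
    and f_mul_natural: "f \<in> hom C a a' \<Longrightarrow> g \<in> hom C b b' \<Longrightarrow>
      f_mul F a' b' \<cdot> (f_ar F f \<boxtimes> f_ar F g) = f_ar F (f \<boxtimes> g) \<cdot> f_mul F a b"
    and f_unit_hom: "f_unit F \<in> hom C \<I> (f_ob F \<I>)"
    and f_unit_iso: "is_iso C (f_unit F)"
    and f_assoc: "a \<in> Obj C \<Longrightarrow> b \<in> Obj C \<Longrightarrow> c \<in> Obj C \<Longrightarrow>
      f_ar F (assoc C a b c) \<cdot> f_mul F (a \<otimes> b) c \<cdot> (f_mul F a b \<boxtimes> Id C (f_ob F c)) =
      f_mul F a (b \<otimes> c) \<cdot> (Id C (f_ob F a) \<boxtimes> f_mul F b c) \<cdot>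
        assoc C (f_ob F a) (f_ob F b) (f_ob F c)"
    and f_lunit: "a \<in> Obj C \<Longrightarrow>
      f_ar F (lunit C a) \<cdot> f_mul F \<I> a \<cdot> (f_unit F \<boxtimes> Id C (f_ob F a)) = lunit C (f_ob F a)"
    and f_runit: "a \<in> Obj C \<Longrightarrow>
      f_ar F (runit C a) \<cdot> f_mul F a \<I> \<cdot> (Id C (f_ob F a) \<boxtimes> f_unit F) = runit C (f_ob F a)"
    and f_symm: "a \<in> Obj C \<Longrightarrow> b \<in> Obj C \<Longrightarrow>
      f_ar F (symm C a b) \<cdot> f_mul F a b = f_mul F b a \<cdot> symm C (f_ob F a) (f_ob F b)"

definition id_endofunctor :: "('o, 'm, 'x) sm_category_scheme \<Rightarrow> ('o, 'm) endofunctor" where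
  "id_endofunctor C =
     \<lparr>f_ob = (\<lambda>a. a), f_ar = (\<lambda>f. f), f_mul = (\<lambda>a b. Id C (a \<otimes>\<^bsub>C\<^esub> b)), f_unit = Id C \<I>\<^bsub>C\<^esub>\<rparr>"

definition comp_endofunctor ::
  "('o, 'm, 'x) sm_category_scheme \<Rightarrow> ('o, 'm) endofunctor \<Rightarrow> ('o, 'm) endofunctor \<Rightarrow>
    ('o, 'm) endofunctor" where
  "comp_endofunctor C F G =
     \<lparr>f_ob = (\<lambda>a. f_ob F (f_ob G a)),
      f_ar = (\<lambda>f. f_ar F (f_ar G f)),
      f_mul = (\<lambda>a b. f_ar F (f_mul G a b) \<cdot>\<^bsub>C\<^esub> f_mul F (f_ob G a) (f_ob G b)),
      f_unit = f_ar F (f_unit G) \<cdot>\<^bsub>C\<^esub> f_unit F\<rparr>"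

locale monoidal_natural_isomorphism = symmetric_monoidal_category C
  for C :: "('o, 'm, 'x) sm_category_scheme" (structure) +
  fixes F G :: "('o, 'm) endofunctor" and \<tau> :: "'o \<Rightarrow> 'm"
  assumes n_hom: "a \<in> Obj C \<Longrightarrow> \<tau> a \<in> hom C (f_ob F a) (f_ob G a)"
    and n_iso: "a \<in> Obj C \<Longrightarrow> is_iso C (\<tau> a)"
    and n_natural: "f \<in> hom C a b \<Longrightarrow> \<tau> b \<cdot> f_ar F f = f_ar G f \<cdot> \<tau> a"
    and n_mul: "a \<in> Obj C \<Longrightarrow> b \<in> Obj C \<Longrightarrow>
      \<tau> (a \<otimes> b) \<cdot> f_mul F a b = f_mul G a b \<cdot> (\<tau> a \<boxtimes> \<tau> b)"
    and n_unit: "\<tau> \<I> \<cdot> f_unit F = f_unit G"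


section \<open>Categorical models\<close>

text \<open>
  \<open>Shift_mul M d e a : Shift d (Shift e a) \<rightarrow> Shift (d + e) a\<close> and
  \<open>Shift_unit M a : a \<rightarrow> Shift 0 a\<close> are the components of the structure isomorphisms of the strong
  monoidal functor \<open>Shift\<close>.
\<close>

record ('o, 'm, 'q, 'g) model = "('o, 'm) sm_category" +
  qubit_ob :: "'q \<Rightarrow> 'o"
  Shift :: "real \<Rightarrow> ('o, 'm) endofunctor"
  Shift_mul :: "real \<Rightarrow> real \<Rightarrow> 'o \<Rightarrow> 'm"
  Shift_unit :: "'o \<Rightarrow> 'm"
  gate_ar :: "'g \<Rightarrow> 'm"
  delay_ar :: "real \<Rightarrow> 'q \<Rightarrow> 'm"

fun tensor_obs :: "('o, 'm, 'x) sm_category_scheme \<Rightarrow> 'o list \<Rightarrow> 'o" where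
  "tensor_obs C [] = \<I>\<^bsub>C\<^esub>"
| "tensor_obs C [a] = a"
| "tensor_obs C (a # b # as) = a \<otimes>\<^bsub>C\<^esub> tensor_obs C (b # as)"

fun tensor_ars :: "('o, 'm, 'x) sm_category_scheme \<Rightarrow> 'm list \<Rightarrow> 'm" where
  "tensor_ars C [] = Id C \<I>\<^bsub>C\<^esub>"
| "tensor_ars C [f] = f"
| "tensor_ars C (f # g # fs) = f \<boxtimes>\<^bsub>C\<^esub> tensor_ars C (g # fs)"

locale categorical_model = symmetric_monoidal_category M
  for S :: "('q, 'g) signature" and M :: "('o, 'm, 'q, 'g) model" (structure) +
  assumes qubit_Obj: "q \<in> qubits S \<Longrightarrow> qubit_ob M q \<in> Obj M"
    and Shift_endofunctor: "strong_symmetric_monoidal_endofunctor M (Shift M d)"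
    and Shift_mul_iso:
      "monoidal_natural_isomorphism M
        (comp_endofunctor M (Shift M d) (Shift M e)) (Shift M (d + e)) (Shift_mul M d e)"
    and Shift_unit_iso:
      "monoidal_natural_isomorphism M (id_endofunctor M) (Shift M 0) (Shift_unit M)"
    and Shift_assoc: "a \<in> Obj M \<Longrightarrow>
      Shift_mul M (c + d) e a \<cdot> Shift_mul M c d (f_ob (Shift M e) a) =
      Shift_mul M c (d + e) a \<cdot> f_ar (Shift M c) (Shift_mul M d e a)"
    and Shift_lunit: "a \<in> Obj M \<Longrightarrow>
      Shift_mul M 0 d a \<cdot> Shift_unit M (f_ob (Shift M d) a) = Id M (f_ob (Shift M d) a)"
    and Shift_runit: "a \<in> Obj M \<Longrightarrow>
      Shift_mul M d 0 a \<cdot> f_ar (Shift M d) (Shift_unit M a) = Id M (f_ob (Shift M d) a)"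
    and gate_hom: "g \<in> gates S \<Longrightarrow>
      gate_ar M g \<in> hom M
        (f_ob (Shift M (- duration S g)) (tensor_obs M (map (qubit_ob M) (wires S g))))
        (tensor_obs M (map (qubit_ob M) (wires S g)))"
    and delay_hom: "x \<ge> 0 \<Longrightarrow> q \<in> qubits S \<Longrightarrow>
      delay_ar M x q \<in> hom M (f_ob (Shift M (- x)) (qubit_ob M q)) (qubit_ob M q)"


section \<open>Interpretation\<close>

context
  fixes M :: "('o, 'm, 'q, 'g) model" (structure)
begin

primrec ty_sem :: "'q ty \<Rightarrow> 'o" where
  "ty_sem One = \<I>"
| "ty_sem (Qubit q) = qubit_ob M q"
| "ty_sem (Tens A B) = ty_sem A \<otimes> ty_sem B"
| "ty_sem (BoxTy d A) = f_ob (Shift M d) (ty_sem A)"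

fun decl_sem :: "'q decl \<Rightarrow> 'o" where
  "decl_sem (x, d, A) = f_ob (Shift M d) (ty_sem A)"

primrec ctx_sem :: "'q ctx \<Rightarrow> 'o" where
  "ctx_sem [] = \<I>"
| "ctx_sem (a # \<Gamma>) = decl_sem a \<otimes> ctx_sem \<Gamma>"

text \<open>
  The coherence isomorphisms \<open>\<lbrakk>\<Gamma>, \<Delta>\<rbrakk> \<rightarrow> \<lbrakk>\<Gamma>\<rbrakk> \<otimes> \<lbrakk>\<Delta>\<rbrakk>\<close>,
  \<open>\<lbrakk>\<Gamma>\<^sub>1, \<dots>, \<Gamma>\<^sub>n\<rbrakk> \<rightarrow> \<lbrakk>\<Gamma>\<^sub>1\<rbrakk> \<otimes> \<dots> \<otimes> \<lbrakk>\<Gamma>\<^sub>n\<rbrakk>\<close>,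
  \<open>\<lbrakk>d + \<Gamma>\<rbrakk> \<rightarrow> Shift d \<lbrakk>\<Gamma>\<rbrakk>\<close> and \<open>\<lbrakk>\<Gamma>, b, a, \<Delta>\<rbrakk> \<rightarrow> \<lbrakk>\<Gamma>, a, b, \<Delta>\<rbrakk>\<close>.
\<close>

primrec ctx_split :: "'q ctx \<Rightarrow> 'q ctx \<Rightarrow> 'm" where
  "ctx_split [] \<Delta> = arr_inv M (lunit M (ctx_sem \<Delta>))"
| "ctx_split (a # \<Gamma>) \<Delta> =
     arr_inv M (assoc M (decl_sem a) (ctx_sem \<Gamma>) (ctx_sem \<Delta>)) \<cdot>
     (Id M (decl_sem a) \<boxtimes> ctx_split \<Gamma> \<Delta>)"

fun ctxs_split :: "'q ctx list \<Rightarrow> 'm" where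
  "ctxs_split [] = Id M \<I>"
| "ctxs_split [\<Gamma>] = Id M (ctx_sem \<Gamma>)"
| "ctxs_split (\<Gamma> # \<Delta> # \<Gamma>s) =
     (Id M (ctx_sem \<Gamma>) \<boxtimes> ctxs_split (\<Delta> # \<Gamma>s)) \<cdot> ctx_split \<Gamma> (concat (\<Delta> # \<Gamma>s))"

fun ctx_shift :: "real \<Rightarrow> 'q ctx \<Rightarrow> 'm" where
  "ctx_shift d [] = f_unit (Shift M d)"
| "ctx_shift d ((x, e, A) # \<Gamma>) =
     f_mul (Shift M d) (f_ob (Shift M e) (ty_sem A)) (ctx_sem \<Gamma>) \<cdot>
     (arr_inv M (Shift_mul M d e (ty_sem A)) \<boxtimes> ctx_shift d \<Gamma>)"

primrec ctx_swap :: "'q ctx \<Rightarrow> 'q decl \<Rightarrow> 'q decl \<Rightarrow> 'q ctx \<Rightarrow> 'm" where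
  "ctx_swap [] a b \<Delta> =
     assoc M (decl_sem a) (decl_sem b) (ctx_sem \<Delta>) \<cdot>
     (symm M (decl_sem b) (decl_sem a) \<boxtimes> Id M (ctx_sem \<Delta>)) \<cdot>
     arr_inv M (assoc M (decl_sem b) (decl_sem a) (ctx_sem \<Delta>))"
| "ctx_swap (c # \<Gamma>) a b \<Delta> = Id M (decl_sem c) \<boxtimes> ctx_swap \<Gamma> a b \<Delta>"

text \<open>\<open>shift_sem d \<Gamma> f : \<lbrakk>d + \<Gamma>\<rbrakk> \<rightarrow> Shift d a\<close> is \<open>Shift d f\<close> for \<open>f : \<lbrakk>\<Gamma>\<rbrakk> \<rightarrow> a\<close>, precomposed with
  the coherence isomorphism.\<close>

definition shift_sem :: "real \<Rightarrow> 'q ctx \<Rightarrow> 'm \<Rightarrow> 'm" where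
  "shift_sem d \<Gamma> f = f_ar (Shift M d) f \<cdot> ctx_shift d \<Gamma>"

end

primrec sem ::
  "('q, 'g) signature \<Rightarrow> ('o, 'm, 'q, 'g) model \<Rightarrow> ('q, 'g) deriv \<Rightarrow> 'm" where
  "sem S M (D_Swap \<Gamma> a b \<Delta> D) = sem S M D \<cdot>\<^bsub>M\<^esub> ctx_swap M \<Gamma> a b \<Delta>"
| "sem S M (D_Var x A) =
     arr_inv M (Shift_unit M (ty_sem M A)) \<cdot>\<^bsub>M\<^esub> runit M (f_ob (Shift M 0) (ty_sem M A))"
| "sem S M D_UnitI = Id M \<I>\<^bsub>M\<^esub>"
| "sem S M (D_UnitE \<Gamma> \<Delta> d A D E) =
     lunit M (ty_sem M A) \<cdot>\<^bsub>M\<^esub>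
     ((arr_inv M (f_unit (Shift M d)) \<cdot>\<^bsub>M\<^esub> shift_sem M d \<Gamma> (sem S M D)) \<boxtimes>\<^bsub>M\<^esub> sem S M E) \<cdot>\<^bsub>M\<^esub>
     ctx_split M (shift_ctx d \<Gamma>) \<Delta>"
| "sem S M (D_Gate g \<Gamma>s Ds) =
     gate_ar M g \<cdot>\<^bsub>M\<^esub>
     shift_sem M (- duration S g) (concat \<Gamma>s)
       (tensor_ars M (map (sem S M) Ds) \<cdot>\<^bsub>M\<^esub> ctxs_split M \<Gamma>s)"
| "sem S M (D_TensI \<Gamma> \<Delta> D E) =
     (sem S M D \<boxtimes>\<^bsub>M\<^esub> sem S M E) \<cdot>\<^bsub>M\<^esub> ctx_split M \<Gamma> \<Delta>"
| "sem S M (D_TensE \<Gamma> \<Delta> d x y A B D E) =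
     sem S M E \<cdot>\<^bsub>M\<^esub>
     assoc M (f_ob (Shift M d) (ty_sem M A)) (f_ob (Shift M d) (ty_sem M B)) (ctx_sem M \<Delta>) \<cdot>\<^bsub>M\<^esub>
     ((arr_inv M (f_mul (Shift M d) (ty_sem M A) (ty_sem M B)) \<cdot>\<^bsub>M\<^esub>
       shift_sem M d \<Gamma> (sem S M D)) \<boxtimes>\<^bsub>M\<^esub> Id M (ctx_sem M \<Delta>)) \<cdot>\<^bsub>M\<^esub>
     ctx_split M (shift_ctx d \<Gamma>) \<Delta>"
| "sem S M (D_BoxI \<Gamma> d D) = shift_sem M d \<Gamma> (sem S M D)"
| "sem S M (D_BoxE \<Gamma> \<Delta> d e x A D E) =
     sem S M E \<cdot>\<^bsub>M\<^esub>
     ((Shift_mul M (e - d) d (ty_sem M A) \<cdot>\<^bsub>M\<^esub>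
       shift_sem M (e - d) \<Gamma> (sem S M D)) \<boxtimes>\<^bsub>M\<^esub> Id M (ctx_sem M \<Delta>)) \<cdot>\<^bsub>M\<^esub>
     ctx_split M (shift_ctx (e - d) \<Gamma>) \<Delta>"
| "sem S M (D_Delay \<Gamma> d q D) = delay_ar M d q \<cdot>\<^bsub>M\<^esub> shift_sem M (- d) \<Gamma> (sem S M D)"
| "sem S M (D_Let \<Gamma> \<Delta> d x A D E) =
     sem S M E \<cdot>\<^bsub>M\<^esub>
     (shift_sem M d \<Gamma> (sem S M D) \<boxtimes>\<^bsub>M\<^esub> Id M (ctx_sem M \<Delta>)) \<cdot>\<^bsub>M\<^esub>
     ctx_split M (shift_ctx d \<Gamma>) \<Delta>"

text \<open>
  HOL cannot quantify over types inside a formula, so "every model" has to fix the types from which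
  objects and arrows are drawn. The types below are large enough for the types of the language as
  objects and, between two given types, sets of terms as arrows. Restricting a hypothesis about
  every model to these models only weakens the hypothesis.
\<close>

type_synonym ('q, 'g) small_model =
  "('q ty, 'q ty \<times> 'q ty \<times> 'g tm set, 'q, 'g) model"

end

theory Submission
  imports Defs "HOL-Library.Multiset"
begin

text \<open>
  The term model separates any two terms that are not judgementally equal. Its objects are the types
  and a morphism \<open>A \<rightarrow> B\<close> is a class of provably equal terms of type \<open>B\<close> whose variables name the
  shifted qubits of which \<open>A\<close> is a tensor product. Since a tensor product, a \<open>\<box>\<close> and the unit disappear
  from this list of qubits, every coherence isomorphism is the class of an identity tuple. A morphism is
  determined by its value on the generic element of its domain, so the axioms of a model are verified by
  computing with nested \<open>let\<close>s; by induction, the interpretation of a derivation of \<open>\<Gamma> \<turnstile> t : A\<close>, applied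
  to the tuple of the variables of \<open>\<Gamma>\<close>, is the class of \<open>t\<close>.

  The computations rest on two devices. Linearity makes typing syntax-directed, so that terms can be
  rewritten without carrying contexts along. And \<open>let y = t in u\<close> equals
  \<open>let (y, v) = (t, *) in let * = v in u\<close>, which transfers the commuting conversions for pairs to plain
  \<open>let\<close>s and so to all pattern combinations, including those the language does not postulate.
\<close>

section \<open>Variables and substitution\<close>

text \<open>Two kinds of bookkeeping shape the proof. The first is contexts: a typing rule splits
  its context and translates the grades of one part, so a term meets many contexts. Relative to one
  environment \<open>\<rho>\<close> and an offset \<open>c\<close> this disappears: a box, a gate or
  a delay changes only \<open>c\<close>, a \<open>let\<close> places its scrutinee at an offset of
  its own, and only binders change \<open>\<rho>\<close>. The second is capture: the generating
  equations carry conditions on bound variables. Every term is provably equal to one whose bound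
  variables avoid a given finite set; with this the equations are proved once with a plain
  \<open>let\<close> where beta would substitute, and most later computations use that form. One
  difficulty is peculiar to the unit. In \<open>let * = s in t\<close> the offset of
  \<open>s\<close> leaves no trace in \<open>t\<close>, so a value of type \<open>1\<close> may sit
  at any grade. Eta for the unit is therefore an equation for a term of known type and offset, but
  not a rewrite step on raw terms.\<close>

lemma finite_fv [simp]: "finite (fv t)"
  by (induction t) auto

lemma finite_set_pat [simp]: "finite (set_pat P)"
  by (cases P) auto

lemma finite_bv [simp]: "finite (bv t)"
  by (induction t) auto

lemma subst_cong_fv: "\<forall>x \<in> fv t. \<sigma> x = \<tau> x \<Longrightarrow> subst t \<sigma> = subst t \<tau>"
proof (induction t arbitrary: \<sigma> \<tau>)
  case (LetIn P s t)
  have "subst s \<sigma> = subst s \<tau>"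
    by (rule LetIn.IH) (use LetIn.prems in auto)
  moreover have "subst t (\<lambda>x. if x \<in> set_pat P then V x else \<sigma> x) =
      subst t (\<lambda>x. if x \<in> set_pat P then V x else \<tau> x)"
    by (rule LetIn.IH) (use LetIn.prems in auto)
  ultimately show ?case by simp
next
  case (Gate g ts)
  have "subst t \<sigma> = subst t \<tau>" if "t \<in> set ts" for t
    by (rule Gate.IH[OF that]) (use Gate.prems that in auto)
  then show ?case by simp
next
  case (Tup s t)
  have "subst s \<sigma> = subst s \<tau>" "subst t \<sigma> = subst t \<tau>"
    by (rule Tup.IH, use Tup.prems in auto)+
  then show ?case by simp
qed auto

lemma subst_V [simp]: "subst t V = t"
proof (induction t)
  case (LetIn P s t)
  have "(\<lambda>x. if x \<in> set_pat P then V x else V x) = V" by auto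
  with LetIn show ?case by simp
qed (auto intro: map_idI)

lemma subst_id: "\<forall>x \<in> fv t. \<sigma> x = V x \<Longrightarrow> subst t \<sigma> = t"
  using subst_cong_fv[of t \<sigma> V] by simp

text \<open>The disjunct \<open>\<sigma> x = V x\<close> is what makes the condition stable under binders: a bound variable
  that is rebound further inside violates the second disjunct.\<close>

definition capture_free :: "'g tm \<Rightarrow> (var \<Rightarrow> 'g tm) \<Rightarrow> bool" where
  "capture_free t \<sigma> \<longleftrightarrow> (\<forall>x \<in> fv t. \<sigma> x = V x \<or> bv t \<inter> fv (\<sigma> x) = {})"

lemma capture_free_simps [simp]:
  "capture_free (V x) \<sigma>"
  "capture_free Star \<sigma>"
  "capture_free (BoxTm d t) \<sigma> = capture_free t \<sigma>"
  "capture_free (Delay d t) \<sigma> = capture_free t \<sigma>"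
  by (auto simp: capture_free_def)

lemma capture_free_Tup:
  assumes "capture_free (Tup s t) \<sigma>"
  shows "capture_free s \<sigma>" "capture_free t \<sigma>"
  using assms unfolding capture_free_def by (simp_all add: Int_Un_distrib2) blast+

lemma capture_free_Gate: "capture_free (Gate g ts) \<sigma> \<Longrightarrow> t \<in> set ts \<Longrightarrow> capture_free t \<sigma>"
  unfolding capture_free_def by fastforce

lemma capture_free_LetIn:
  assumes "capture_free (LetIn P s t) \<sigma>"
  shows "capture_free s \<sigma>" "capture_free t (\<lambda>x. if x \<in> set_pat P then V x else \<sigma> x)"
    and "\<forall>x \<in> fv t - set_pat P. set_pat P \<inter> fv (\<sigma> x) = {}"
proof -
  have *: "\<sigma> x = V x \<or> (bv s \<union> set_pat P \<union> bv t) \<inter> fv (\<sigma> x) = {}"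
    if "x \<in> fv s \<union> (fv t - set_pat P)" for x
    using assms that unfolding capture_free_def by simp
  show "capture_free s \<sigma>"
    unfolding capture_free_def using * by blast
  show "capture_free t (\<lambda>x. if x \<in> set_pat P then V x else \<sigma> x)"
    unfolding capture_free_def
  proof
    fix x assume "x \<in> fv t"
    then show "(if x \<in> set_pat P then V x else \<sigma> x) = V x \<or>
        bv t \<inter> fv (if x \<in> set_pat P then V x else \<sigma> x) = {}"
      using *[of x] by (cases "x \<in> set_pat P") auto
  qed
  show "\<forall>x \<in> fv t - set_pat P. set_pat P \<inter> fv (\<sigma> x) = {}"
  proof
    fix x assume "x \<in> fv t - set_pat P"
    then show "set_pat P \<inter> fv (\<sigma> x) = {}"
      using *[of x] by auto
  qed
qed

lemma fv_subst: "capture_free t \<sigma> \<Longrightarrow> fv (subst t \<sigma>) = (\<Union>x\<in>fv t. fv (\<sigma> x))"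
proof (induction t arbitrary: \<sigma>)
  case (LetIn P s t)
  note cf = capture_free_LetIn[OF LetIn.prems]
  let ?\<sigma> = "\<lambda>x. if x \<in> set_pat P then V x else \<sigma> x"
  have "fv (subst t ?\<sigma>) - set_pat P = (\<Union>x\<in>fv t. fv (?\<sigma> x) - set_pat P)"
    unfolding LetIn.IH(2)[OF cf(2)] by blast
  \<comment> \<open>Absence of capture: a term put in for a variable outside \<open>P\<close>
    contains no variable of \<open>P\<close>, so removing these variables leaves it
    unchanged.\<close>
  also have "\<dots> = (\<Union>x\<in>fv t. if x \<in> set_pat P then {} else fv (\<sigma> x))"
    by (intro SUP_cong refl) (use cf(3) in auto)
  also have "\<dots> = (\<Union>x\<in>fv t - set_pat P. fv (\<sigma> x))"
    by (auto split: if_splits)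
  finally show ?case
    using LetIn.IH(1)[OF cf(1)] by auto
next
  case (Gate g ts)
  have "fv (subst t \<sigma>) = (\<Union>x\<in>fv t. fv (\<sigma> x))" if "t \<in> set ts" for t
    by (rule Gate.IH[OF that capture_free_Gate[OF Gate.prems that]])
  then show ?case by auto
next
  case (Tup s t)
  show ?case
    using Tup.IH capture_free_Tup[OF Tup.prems] by simp
qed auto

lemma subst_subst:
  "capture_free t \<sigma> \<Longrightarrow> subst (subst t \<sigma>) \<tau> = subst t (\<lambda>x. subst (\<sigma> x) \<tau>)"
proof (induction t arbitrary: \<sigma> \<tau>)
  case (LetIn P s t)
  note cf = capture_free_LetIn[OF LetIn.prems]
  let ?\<sigma> = "\<lambda>x. if x \<in> set_pat P then V x else \<sigma> x"
  let ?\<tau> = "\<lambda>x. if x \<in> set_pat P then V x else \<tau> x"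
  have "subst t (\<lambda>x. subst (?\<sigma> x) ?\<tau>) =
      subst t (\<lambda>x. if x \<in> set_pat P then V x else subst (\<sigma> x) \<tau>)"
  proof (rule subst_cong_fv, intro ballI)
    fix x assume x: "x \<in> fv t"
    show "subst (?\<sigma> x) ?\<tau> = (if x \<in> set_pat P then V x else subst (\<sigma> x) \<tau>)"
    proof (cases "x \<in> set_pat P")
      case False
      \<comment> \<open>\<open>?\<tau>\<close> may differ from \<open>\<tau>\<close> only on
        variables of \<open>P\<close>, and none of them is free in
        \<open>\<sigma> x\<close>.\<close>
      have "subst (\<sigma> x) ?\<tau> = subst (\<sigma> x) \<tau>"
        by (rule subst_cong_fv) (use cf(3) x False in auto)
      with False show ?thesis by simp
    qed simp
  qed
  with LetIn.IH(1)[OF cf(1)] LetIn.IH(2)[OF cf(2)] show ?case by simp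
next
  case (Gate g ts)
  then show ?case by (auto intro: Gate.IH dest: capture_free_Gate)
next
  case (Tup s t)
  show ?case
    using Tup.IH capture_free_Tup[OF Tup.prems] by simp
qed auto

lemma bv_subst_var: "\<forall>x. bv (\<sigma> x) = {} \<Longrightarrow> bv (subst t \<sigma>) = bv t"
  by (induction t arbitrary: \<sigma>) auto

lemma subst_upd_notin [simp]: "x \<notin> fv t \<Longrightarrow> subst t (V(x := s)) = t"
  by (rule subst_id) auto

lemma subst_LetIn_upd [simp]:
  "x \<notin> set_pat P \<Longrightarrow> subst (LetIn P t u) (V(x := s)) = LetIn P (subst t (V(x := s))) (subst u (V(x := s)))"
  by (auto intro!: subst_cong_fv)

lemma capture_free_upd: "bv t \<inter> fv s = {} \<Longrightarrow> capture_free t (V(x := s))"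
  by (auto simp: capture_free_def)

lemma fv_subst_upd:
  "bv t \<inter> fv s = {} \<Longrightarrow> x \<in> fv t \<Longrightarrow> fv (subst t (V(x := s))) = fv s \<union> (fv t - {x})"
  by (subst fv_subst[OF capture_free_upd]) (auto split: if_splits)


section \<open>Syntax-directed typing\<close>

text \<open>\<open>pat_typed P e A \<beta>\<close>: matching a term of type \<open>A\<close>, placed at grade \<open>e\<close>, against \<open>P\<close> declares the
  variables of \<open>P\<close> as prescribed by \<open>\<beta>\<close>.\<close>

type_synonym 'q env = "var \<Rightarrow> real \<times> 'q ty"

fun pat_typed :: "var pat \<Rightarrow> real \<Rightarrow> 'q ty \<Rightarrow> 'q env \<Rightarrow> bool" where
  "pat_typed (PVar x) e A \<beta> \<longleftrightarrow> \<beta> x = (e, A)"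
| "pat_typed PUnit e A \<beta> \<longleftrightarrow> A = One"
| "pat_typed (PPair x y) e A \<beta> \<longleftrightarrow> x \<noteq> y \<and> (\<exists>B C. A = Tens B C \<and> \<beta> x = (e, B) \<and> \<beta> y = (e, C))"
| "pat_typed (PBox d x) e A \<beta> \<longleftrightarrow> (\<exists>B. A = BoxTy d B \<and> \<beta> x = (e + d, B))"

lemma set_ty_pat_typed:
  "pat_typed P e A \<beta> \<Longrightarrow> set_ty A \<subseteq> Q \<Longrightarrow> x \<in> set_pat P \<Longrightarrow> set_ty (snd (\<beta> x)) \<subseteq> Q"
  by (cases P) auto

abbreviation shift_env :: "real \<Rightarrow> 'q env \<Rightarrow> 'q env" where
  "shift_env d \<rho> \<equiv> (\<lambda>x. (d + fst (\<rho> x), snd (\<rho> x)))"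

lemma pat_typed_shift: "pat_typed P e A \<beta> \<Longrightarrow> pat_typed P (d + e) A (shift_env d \<beta>)"
  by (cases P) (auto simp: algebra_simps)

lemma shift_env_override_on:
  "shift_env d (override_on \<rho> \<beta> X) = override_on (shift_env d \<rho>) (shift_env d \<beta>) X"
  by (auto simp: override_on_def)

lemma wires_finite_ty: "set_ty (tensor_ty qs) = set qs"
  by (induction qs rule: tensor_ty.induct) auto

text \<open>Positions are compared, not elements: linearity also forbids that one and the same open
  term is passed to a gate twice.\<close>

definition pairwise_disjoint :: "'g tm list \<Rightarrow> bool" where
  "pairwise_disjoint ts \<longleftrightarrow>
    (\<forall>i < length ts. \<forall>j < length ts. i \<noteq> j \<longrightarrow> fv (ts ! i) \<inter> fv (ts ! j) = {})"

locale annotated =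
  fixes S :: "('q, 'g) signature"
  assumes wf: "wf_signature S"
begin

text \<open>\<open>wt \<rho> c t A\<close>: with the free variables declared by \<open>\<rho>\<close>, the term \<open>t\<close> has type \<open>A\<close> at grade \<open>c\<close>,
  that is, \<open>\<rho>\<close> restricted to \<open>fv t\<close> is of the form \<open>c + \<Gamma>\<close> with \<open>\<Gamma> \<turnstile> t : A\<close>. As the language is
  linear, no splitting of contexts has to be guessed.\<close>

inductive wt :: "'q env \<Rightarrow> real \<Rightarrow> 'g tm \<Rightarrow> 'q ty \<Rightarrow> bool" where
  wt_V: "\<rho> x = (c, A) \<Longrightarrow> set_ty A \<subseteq> qubits S \<Longrightarrow> wt \<rho> c (V x) A"
| wt_Star: "wt \<rho> c Star One"
| wt_Gate: "g \<in> gates S \<Longrightarrow> length ts = length (wires S g) \<Longrightarrow>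
    \<forall>i < length ts. wt \<rho> (c - duration S g) (ts ! i) (Qubit (wires S g ! i)) \<Longrightarrow>
    pairwise_disjoint ts \<Longrightarrow> A = tensor_ty (wires S g) \<Longrightarrow> wt \<rho> c (Gate g ts) A"
| wt_Tup: "wt \<rho> c s A \<Longrightarrow> wt \<rho> c t B \<Longrightarrow> fv s \<inter> fv t = {} \<Longrightarrow> wt \<rho> c (Tup s t) (Tens A B)"
| wt_BoxTm: "wt \<rho> (c + d) t A \<Longrightarrow> wt \<rho> c (BoxTm d t) (BoxTy d A)"
| wt_Delay: "wt \<rho> (c - d) t (Qubit q) \<Longrightarrow> d \<ge> 0 \<Longrightarrow> wt \<rho> c (Delay d t) (Qubit q)"
| wt_LetIn: "wt \<rho> e s A \<Longrightarrow> pat_typed P e A \<beta> \<Longrightarrow> wt (override_on \<rho> \<beta> (set_pat P)) c t B \<Longrightarrow>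
    set_pat P \<subseteq> fv t \<Longrightarrow> fv s \<inter> (fv t - set_pat P) = {} \<Longrightarrow> wt \<rho> c (LetIn P s t) B"

inductive_cases wt_VE [elim!]: "wt \<rho> c (V x) A"
inductive_cases wt_StarE [elim!]: "wt \<rho> c Star A"
inductive_cases wt_GateE [elim!]: "wt \<rho> c (Gate g ts) A"
inductive_cases wt_TupE [elim!]: "wt \<rho> c (Tup s t) A"
inductive_cases wt_BoxTmE [elim!]: "wt \<rho> c (BoxTm d t) A"
inductive_cases wt_DelayE [elim!]: "wt \<rho> c (Delay d t) A"
inductive_cases wt_LetInE [elim!]: "wt \<rho> c (LetIn P s t) A"

lemma wt_cong_env: "wt \<rho> c t A \<Longrightarrow> \<forall>x \<in> fv t. \<rho> x = \<rho>' x \<Longrightarrow> wt \<rho>' c t A"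
proof (induction arbitrary: \<rho>' rule: wt.induct)
  case (wt_Gate g ts \<rho> c A)
  have "wt \<rho>' (c - duration S g) (ts ! i) (Qubit (wires S g ! i))" if "i < length ts" for i
  proof -
    have "\<forall>x \<in> fv (ts ! i). \<rho> x = \<rho>' x"
    proof
      fix x assume "x \<in> fv (ts ! i)"
      then have "x \<in> fv (Gate g ts)" using that by auto
      with wt_Gate.prems show "\<rho> x = \<rho>' x" by blast
    qed
    with wt_Gate.IH that show ?thesis by blast
  qed
  then show ?case using wt_Gate.hyps by (auto intro!: wt.wt_Gate)
next
  case (wt_LetIn \<rho> e s A P \<beta> c t B)
  show ?case
    by (rule wt.wt_LetIn[of _ e s A _ \<beta>])
      (use wt_LetIn in \<open>auto simp: override_on_def intro!: wt_LetIn.IH\<close>)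
qed (auto intro: wt.intros)

lemma wt_set_ty: "wt \<rho> c t A \<Longrightarrow> set_ty A \<subseteq> qubits S"
  by (induction rule: wt.induct)
    (use wf in \<open>auto simp: wf_signature_def wires_finite_ty\<close>)

text \<open>The rules involve only differences of grades, so the grades of the environment and the
  offset may be translated together. The analogue for equality lets a morphism, which is typed at
  offset 0, act at any offset.\<close>

lemma wt_shift: "wt \<rho> c t A \<Longrightarrow> wt (shift_env d \<rho>) (d + c) t A"
proof (induction rule: wt.induct)
  case (wt_LetIn \<rho> e s A P \<beta> c t B)
  then show ?case
    by (auto intro!: wt.wt_LetIn[of _ "d + e" s A _ "shift_env d \<beta>"] pat_typed_shift
        simp: shift_env_override_on[symmetric])
qed (auto intro!: wt.intros simp: algebra_simps)

text \<open>The grade that \<open>\<rho>\<close> gives to \<open>x\<close> is the offset at which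
  \<open>\<sigma> x\<close> is placed, whatever the offset of \<open>t\<close> itself. Linearity
  becomes the last assumption: terms put in for distinct variables must not share a
  variable.\<close>

lemma wt_subst:
  assumes "wt \<rho> c t A" "capture_free t \<sigma>"
    and "\<forall>x \<in> fv t. wt \<rho>' (fst (\<rho> x)) (\<sigma> x) (snd (\<rho> x))"
    and "\<forall>x \<in> fv t. \<forall>y \<in> fv t. x \<noteq> y \<longrightarrow> fv (\<sigma> x) \<inter> fv (\<sigma> y) = {}"
  shows "wt \<rho>' c (subst t \<sigma>) A"
  using assms
proof (induction arbitrary: \<rho>' \<sigma> rule: wt.induct)
  case (wt_Gate g ts \<rho> c A)
  have cf: "capture_free (ts ! i) \<sigma>" if "i < length ts" for i
    using wt_Gate.prems(1) that by (auto intro: capture_free_Gate)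
  have mem: "x \<in> fv (Gate g ts)" if "i < length ts" "x \<in> fv (ts ! i)" for i x
    using that by auto
  have "wt \<rho>' (c - duration S g) (subst (ts ! i) \<sigma>) (Qubit (wires S g ! i))" if "i < length ts" for i
  proof -
    have "wt \<rho>' (c - duration S g) (subst (ts ! i) \<sigma>) (Qubit (wires S g ! i))"
      if "\<forall>x\<in>fv (ts ! i). wt \<rho>' (fst (\<rho> x)) (\<sigma> x) (snd (\<rho> x))"
        "\<forall>x\<in>fv (ts ! i). \<forall>y\<in>fv (ts ! i). x \<noteq> y \<longrightarrow> fv (\<sigma> x) \<inter> fv (\<sigma> y) = {}"
      using wt_Gate.IH \<open>i < length ts\<close> cf[OF \<open>i < length ts\<close>] that by simp
    moreover have "\<forall>x\<in>fv (ts ! i). wt \<rho>' (fst (\<rho> x)) (\<sigma> x) (snd (\<rho> x))"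
      using wt_Gate.prems(2) mem[OF that] by blast
    moreover have "\<forall>x\<in>fv (ts ! i). \<forall>y\<in>fv (ts ! i). x \<noteq> y \<longrightarrow> fv (\<sigma> x) \<inter> fv (\<sigma> y) = {}"
      using wt_Gate.prems(3) mem[OF that] by blast
    ultimately show ?thesis by blast
  qed
  moreover have "fv (subst (ts ! i) \<sigma>) \<inter> fv (subst (ts ! j) \<sigma>) = {}"
    if ij: "i < length ts" "j < length ts" "i \<noteq> j" for i j
  proof -
    have "fv (\<sigma> x) \<inter> fv (\<sigma> y) = {}" if "x \<in> fv (ts ! i)" "y \<in> fv (ts ! j)" for x y
    proof -
      have "fv (ts ! i) \<inter> fv (ts ! j) = {}"
        using wt_Gate.hyps(3) ij unfolding pairwise_disjoint_def by simp
      with that have "x \<noteq> y" by auto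
      then show ?thesis by (rule wt_Gate.prems(3)[THEN bspec, OF mem[OF ij(1) that(1)], THEN bspec, OF mem[OF ij(2) that(2)], THEN mp])
    qed
    then show ?thesis
      unfolding fv_subst[OF cf[OF ij(1)]] fv_subst[OF cf[OF ij(2)]] by blast
  qed
  ultimately show ?case
    using wt_Gate.hyps by (auto intro!: wt.wt_Gate simp: pairwise_disjoint_def)
next
  case (wt_Tup \<rho> c s A t B)
  note cf = capture_free_Tup[OF wt_Tup.prems(1)]
  have "fv (\<sigma> x) \<inter> fv (\<sigma> y) = {}" if "x \<in> fv s" "y \<in> fv t" for x y
    using wt_Tup.prems(3) wt_Tup.hyps(3) that by (metis UnI1 UnI2 disjoint_iff fv.simps(4))
  then have "fv (subst s \<sigma>) \<inter> fv (subst t \<sigma>) = {}"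
    unfolding fv_subst[OF cf(1)] fv_subst[OF cf(2)] by blast
  then show ?case
    using wt_Tup cf by (auto intro!: wt.wt_Tup)
next
  case (wt_LetIn \<rho> e s A P \<beta> c t B)
  note cf = capture_free_LetIn[OF wt_LetIn.prems(1)]
  let ?\<sigma> = "\<lambda>x. if x \<in> set_pat P then V x else \<sigma> x"
  have dis: "set_pat P \<inter> fv (\<sigma> x) = {}" if "x \<in> fv t - set_pat P" for x
    using cf(3) that by auto
  have fvt: "fv (subst t ?\<sigma>) = (\<Union>x\<in>fv t. fv (?\<sigma> x))"
    by (rule fv_subst[OF cf(2)])
  have 1: "wt \<rho>' e (subst s \<sigma>) A"
    by (rule wt_LetIn.IH(1)[OF cf(1)]) (use wt_LetIn.prems in auto)
  have 2: "wt (override_on \<rho>' \<beta> (set_pat P)) c (subst t ?\<sigma>) B"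
  proof (rule wt_LetIn.IH(2)[OF cf(2)]; intro ballI impI)
    fix x assume x: "x \<in> fv t"
    show "wt (override_on \<rho>' \<beta> (set_pat P)) (fst (override_on \<rho> \<beta> (set_pat P) x)) (?\<sigma> x)
        (snd (override_on \<rho> \<beta> (set_pat P) x))"
    proof (cases "x \<in> set_pat P")
      \<comment> \<open>Variables of \<open>P\<close> stay in place. Rule \<open>wt_V\<close> wants
        their types built from qubits of \<open>S\<close>, which they inherit from the type of the
        scrutinee.\<close>
      case True
      then show ?thesis
        using set_ty_pat_typed[OF wt_LetIn.hyps(2) wt_set_ty[OF wt_LetIn.hyps(1)] True]
        by (auto intro!: wt_V)
    next
      case False
      then have "wt \<rho>' (fst (\<rho> x)) (\<sigma> x) (snd (\<rho> x))"
        using wt_LetIn.prems(2) x by auto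
      then have "wt (override_on \<rho>' \<beta> (set_pat P)) (fst (\<rho> x)) (\<sigma> x) (snd (\<rho> x))"
        by (rule wt_cong_env) (use dis x False in \<open>auto simp: override_on_def\<close>)
      with False show ?thesis by simp
    qed
  next
    fix x y assume "x \<in> fv t" "y \<in> fv t" "x \<noteq> y"
    then show "fv (?\<sigma> x) \<inter> fv (?\<sigma> y) = {}"
      using dis wt_LetIn.prems(3) by (cases "x \<in> set_pat P"; cases "y \<in> set_pat P") auto
  qed
  have "fv (subst s \<sigma>) \<inter> (fv (subst t ?\<sigma>) - set_pat P) = {}"
  proof -
    have "fv (\<sigma> x) \<inter> fv (\<sigma> y) = {}" if "x \<in> fv s" "y \<in> fv t - set_pat P" for x y
    proof -
      have "x \<noteq> y" using that wt_LetIn.hyps(5) by auto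
      with that wt_LetIn.prems(3) show ?thesis by auto
    qed
    then have "(\<Union>x\<in>fv s. fv (\<sigma> x)) \<inter> (\<Union>x\<in>fv t - set_pat P. fv (\<sigma> x)) = {}"
      by blast
    moreover have "fv (subst t ?\<sigma>) - set_pat P \<subseteq> (\<Union>x\<in>fv t - set_pat P. fv (\<sigma> x))"
      unfolding fvt by (auto split: if_splits)
    ultimately show ?thesis
      unfolding fv_subst[OF cf(1)] by blast
  qed
  moreover have "set_pat P \<subseteq> fv (subst t ?\<sigma>)"
    unfolding fvt using wt_LetIn.hyps(4) by force
  ultimately show ?case
    using 1 2 wt_LetIn.hyps(2) by (auto intro: wt.wt_LetIn)
qed (auto intro!: wt.intros)

end

section \<open>Contexts up to permutation, and how free variables split them\<close>

lemma swap_closed_mset: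
  assumes "\<And>\<Gamma> a b \<Delta>. Q (\<Gamma> @ a # b # \<Delta>) \<Longrightarrow> Q (\<Gamma> @ b # a # \<Delta>)"
    and "mset \<Gamma> = mset \<Gamma>'" and "Q \<Gamma>"
  shows "Q \<Gamma>'"
  using assms
proof (induction \<Gamma>' arbitrary: \<Gamma> Q)
  case (Cons a \<Delta>)
  have "a \<in> set \<Gamma>"
    using Cons.prems(2) by (metis list.set_intros(1) set_mset_mset)
  then obtain \<Gamma>1 \<Gamma>2 where \<Gamma>: "\<Gamma> = \<Gamma>1 @ a # \<Gamma>2"
    by (meson split_list)
  \<comment> \<open>\<open>a\<close> is moved to the front by exchanging it with its left neighbours
    one at a time. The remaining list is permuted by the induction hypothesis, applied to the
    predicate in which the head \<open>a\<close> is fixed.\<close>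
  have front: "Q (\<Psi> @ a # \<Gamma>2) \<Longrightarrow> Q (a # \<Psi> @ \<Gamma>2)" for \<Psi> \<Gamma>2
  proof (induction \<Psi> arbitrary: \<Gamma>2 rule: rev_induct)
    case (snoc b \<Psi>)
    from snoc.prems have "Q (\<Psi> @ a # b # \<Gamma>2)"
      using Cons.prems(1)[of \<Psi> b a \<Gamma>2] by simp
    from snoc.IH[OF this] show ?case by simp
  qed simp
  show ?case
  proof (rule Cons.IH[of "\<lambda>\<Gamma>. Q (a # \<Gamma>)" "\<Gamma>1 @ \<Gamma>2"])
    show "Q (a # \<Gamma> @ c # b # \<Delta>)" if "Q (a # \<Gamma> @ b # c # \<Delta>)" for \<Gamma> b c \<Delta>
      using Cons.prems(1)[of "a # \<Gamma>" b c \<Delta>] that by simp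
    show "mset (\<Gamma>1 @ \<Gamma>2) = mset \<Delta>"
      using Cons.prems(2) \<Gamma> by simp
    show "Q (a # \<Gamma>1 @ \<Gamma>2)"
      using front Cons.prems(3) \<Gamma> by simp
  qed
qed simp

lemma map_fst_shift_ctx [simp]: "map fst (shift_ctx d \<Gamma>) = map fst \<Gamma>"
  by (auto simp: shift_ctx_def)

lemma shift_ctx_Nil [simp]: "shift_ctx d [] = []"
  and shift_ctx_Cons [simp]: "shift_ctx d ((x, e, A) # \<Gamma>) = (x, d + e, A) # shift_ctx d \<Gamma>"
  and shift_ctx_append [simp]: "shift_ctx d (\<Gamma> @ \<Delta>) = shift_ctx d \<Gamma> @ shift_ctx d \<Delta>"
  and shift_ctx_concat: "shift_ctx d (concat \<Gamma>s) = concat (map (shift_ctx d) \<Gamma>s)"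
  and fst_set_shift_ctx [simp]: "fst ` set (shift_ctx d \<Gamma>) = fst ` set \<Gamma>"
  by (auto simp: shift_ctx_def[abs_def] map_concat image_image split_def)

lemma shift_ctx_shift_ctx [simp]: "shift_ctx d (shift_ctx e \<Gamma>) = shift_ctx (d + e) \<Gamma>"
  and shift_ctx_0 [simp]: "shift_ctx 0 \<Gamma> = \<Gamma>"
  by (auto simp: shift_ctx_def algebra_simps intro!: map_idI)

lemma derives_distinct: "derives S D \<Gamma> t A \<Longrightarrow> distinct_vars \<Gamma>"
proof (induction rule: derives.induct)
  case (Swap D \<Gamma> x d A y e B \<Delta> t C)
  then show ?case by (auto simp: distinct_vars_def)
qed (auto simp: distinct_vars_def)

text \<open>For given \<open>\<rho>\<close>, \<open>c\<close> and finite \<open>X\<close> such a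
  context is unique up to the order of its declarations, which the exchange rule makes irrelevant.
  So one judgement about \<open>\<rho>\<close> and \<open>c\<close> stands for judgements in all
  these contexts.\<close>

definition declares :: "'q ctx \<Rightarrow> 'q env \<Rightarrow> real \<Rightarrow> var set \<Rightarrow> bool" where
  "declares \<Gamma> \<rho> c X \<longleftrightarrow> distinct_vars \<Gamma> \<and> fst ` set \<Gamma> = X \<and> (\<forall>(x, d, B) \<in> set \<Gamma>. \<rho> x = (c + d, B))"

lemma declares_shift: "declares (shift_ctx d \<Gamma>) \<rho> c X \<longleftrightarrow> declares \<Gamma> \<rho> (c + d) X"
proof -
  have "(\<forall>(x, e, B) \<in> set (shift_ctx d \<Gamma>). \<rho> x = (c + e, B)) \<longleftrightarrow>
      (\<forall>(x, e, B) \<in> set \<Gamma>. \<rho> x = (c + d + e, B))"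
    by (induction \<Gamma>) (auto simp: algebra_simps)
  then show ?thesis by (simp add: declares_def distinct_vars_def)
qed

lemma declares_filter:
  assumes "declares \<Gamma> \<rho> c X" "Y \<subseteq> X"
  shows "declares (filter (\<lambda>a. fst a \<in> Y) \<Gamma>) \<rho> c Y"
proof -
  have "fst ` set (filter (\<lambda>a. fst a \<in> Y) \<Gamma>) = fst ` set \<Gamma> \<inter> Y" by auto
  with assms show ?thesis
    unfolding declares_def distinct_vars_def by (auto simp: distinct_map_filter)
qed

text \<open>By linearity the split of a context between two premises is no choice: each declaration
  goes to the subterm in which its variable is free.\<close>

lemma declares_split:
  assumes "declares \<Gamma> \<rho> c (X \<union> Y)" "X \<inter> Y = {}"
  obtains \<Gamma>1 \<Gamma>2 where "declares \<Gamma>1 \<rho> c X" "declares \<Gamma>2 \<rho> c Y" "mset \<Gamma> = mset (\<Gamma>1 @ \<Gamma>2)"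
    "distinct_vars (\<Gamma>1 @ \<Gamma>2)"
proof
  let ?\<Gamma>1 = "filter (\<lambda>a. fst a \<in> X) \<Gamma>" and ?\<Gamma>2 = "filter (\<lambda>a. fst a \<in> Y) \<Gamma>"
  show 1: "declares ?\<Gamma>1 \<rho> c X" and 2: "declares ?\<Gamma>2 \<rho> c Y"
    using assms(1) by (auto intro: declares_filter)
  have "?\<Gamma>2 = filter (\<lambda>a. fst a \<notin> X) \<Gamma>"
    by (rule filter_cong) (use assms in \<open>auto simp: declares_def\<close>)
  then show "mset \<Gamma> = mset (?\<Gamma>1 @ ?\<Gamma>2)"
    using multiset_partition[of "mset \<Gamma>" "\<lambda>a. fst a \<in> X"] by simp
  show "distinct_vars (?\<Gamma>1 @ ?\<Gamma>2)"
    using 1 2 assms(2) unfolding declares_def distinct_vars_def by auto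
qed

lemma declares_split_list:
  assumes "declares \<Gamma> \<rho> c (\<Union> (set (map fv ts)))" "pairwise_disjoint ts"
  shows "\<exists>\<Gamma>s. length \<Gamma>s = length ts \<and> (\<forall>i < length ts. declares (\<Gamma>s ! i) \<rho> c (fv (ts ! i))) \<and>
    mset \<Gamma> = mset (concat \<Gamma>s)"
  using assms
proof (induction ts arbitrary: \<Gamma>)
  case Nil
  then show ?case by (auto simp: declares_def)
next
  case (Cons t ts)
  have dis: "fv t \<inter> \<Union> (set (map fv ts)) = {}"
  proof -
    have "fv t \<inter> fv (ts ! i) = {}" if "i < length ts" for i
      using Cons.prems(2) that unfolding pairwise_disjoint_def by force
    then show ?thesis by (fastforce simp: in_set_conv_nth)
  qed
  have pd: "pairwise_disjoint ts"
    using Cons.prems(2) unfolding pairwise_disjoint_def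
    by (metis Suc_less_eq length_Cons nat.inject nth_Cons_Suc)
  from Cons.prems(1) have "declares \<Gamma> \<rho> c (fv t \<union> \<Union> (set (map fv ts)))" by simp
  from declares_split[OF this dis] obtain \<Gamma>1 \<Gamma>2 where
    1: "declares \<Gamma>1 \<rho> c (fv t)" "declares \<Gamma>2 \<rho> c (\<Union> (set (map fv ts)))" "mset \<Gamma> = mset (\<Gamma>1 @ \<Gamma>2)"
    by metis
  from Cons.IH[OF 1(2) pd] obtain \<Gamma>s where
    2: "length \<Gamma>s = length ts" "\<forall>i < length ts. declares (\<Gamma>s ! i) \<rho> c (fv (ts ! i))"
      "mset \<Gamma>2 = mset (concat \<Gamma>s)"
    by auto
  have "length (\<Gamma>1 # \<Gamma>s) = length (t # ts)" "mset \<Gamma> = mset (concat (\<Gamma>1 # \<Gamma>s))"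
    using 1 2 by auto
  moreover have "\<forall>i < length (t # ts). declares ((\<Gamma>1 # \<Gamma>s) ! i) \<rho> c (fv ((t # ts) ! i))"
    using 1 2 by (auto simp: nth_Cons split: nat.split)
  ultimately show ?case by blast
qed

section \<open>Congruence rules of the judgement, uniform in the pattern\<close>

primrec pat_vars :: "'v pat \<Rightarrow> 'v list" where
  "pat_vars (PVar x) = [x]"
| "pat_vars PUnit = []"
| "pat_vars (PPair x y) = [x, y]"
| "pat_vars (PBox d x) = [x]"

lemma set_pat_vars [simp]: "set (pat_vars P) = set_pat P"
  by (cases P) auto

text \<open>The grades of \<open>\<beta>\<close> are absolute, while those of a context are relative
  to the offset \<open>c\<close> of the body; hence the subtraction.\<close>

definition pat_ctx :: "var pat \<Rightarrow> 'q env \<Rightarrow> real \<Rightarrow> 'q ctx" where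
  "pat_ctx P \<beta> c = map (\<lambda>x. (x, fst (\<beta> x) - c, snd (\<beta> x))) (pat_vars P)"

lemma declares_pat_ctx:
  assumes "declares \<Delta> \<rho> c (fv t - set_pat P)" "pat_typed P e A \<beta>" "set_pat P \<subseteq> fv t"
  shows "declares (pat_ctx P \<beta> c @ \<Delta>) (override_on \<rho> \<beta> (set_pat P)) c (fv t)"
proof -
  have "distinct (pat_vars P)" using assms(2) by (cases P) auto
  moreover have "map fst (pat_ctx P \<beta> c) = pat_vars P"
    by (simp add: pat_ctx_def comp_def)
  moreover have "fst ` set (pat_ctx P \<beta> c) = set_pat P"
    by (simp add: pat_ctx_def image_image)
  moreover have "fst ` set \<Delta> = fv t - set_pat P"
    using assms(1) by (simp add: declares_def)
  moreover have "\<forall>(x, d, B) \<in> set (pat_ctx P \<beta> c). override_on \<rho> \<beta> (set_pat P) x = (c + d, B)"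
    by (auto simp: pat_ctx_def)
  moreover have "override_on \<rho> \<beta> (set_pat P) x = (c + d, B)" if "(x, d, B) \<in> set \<Delta>" for x d B
  proof -
    have "x \<notin> set_pat P" using calculation(4) that by force
    moreover have "\<rho> x = (c + d, B)" using assms(1) that by (auto simp: declares_def)
    ultimately show ?thesis by simp
  qed
  moreover have "fst ` set (pat_ctx P \<beta> c @ \<Delta>) = fv t"
    using calculation(3,4) assms(3) by (auto simp: image_Un)
  ultimately show ?thesis
    using assms(1,3) unfolding declares_def distinct_vars_def by auto
qed

text \<open>Typing is carried along so that one induction also supplies the typing premises of rule
  \<open>Conv\<close>.\<close>

definition typed_jeq :: "('q, 'g) signature \<Rightarrow> 'q ctx \<Rightarrow> 'g tm \<Rightarrow> 'g tm \<Rightarrow> 'q ty \<Rightarrow> bool" where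
  "typed_jeq S \<Gamma> s t A \<longleftrightarrow> typed S \<Gamma> s A \<and> typed S \<Gamma> t A \<and> jeq S \<Gamma> s t A"

lemma typed_jeq_mset: "typed_jeq S \<Gamma> s t A \<Longrightarrow> mset \<Gamma> = mset \<Gamma>' \<Longrightarrow> typed_jeq S \<Gamma>' s t A"
proof (erule swap_closed_mset[rotated 1])
  show "typed_jeq S (\<Gamma> @ b # a # \<Delta>) s t A" if "typed_jeq S (\<Gamma> @ a # b # \<Delta>) s t A" for \<Gamma> a b \<Delta>
  proof (cases a; cases b)
    fix x d A y e B assume [simp]: "a = (x, d, A)" "b = (y, e, B)"
    show ?thesis
      using that by (auto simp: typed_jeq_def typed_def intro: derives.Swap jeq.Swap_cong)
  qed
qed

text \<open>In all four rules for \<open>let\<close> the context of the scrutinee is translated by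
  the difference between its offset and that of the body. For a box pattern the bound variable has
  relative grade \<open>e + d - c\<close>, and the rule takes \<open>d\<close> off again, which
  gives the same difference.\<close>

lemma typed_jeq_LetIn:
  assumes "typed_jeq S \<Gamma> s s' A" "pat_typed P e A \<beta>"
    and "typed_jeq S (pat_ctx P \<beta> c @ \<Delta>) t t' C" "distinct_vars (shift_ctx (e - c) \<Gamma> @ \<Delta>)"
  shows "typed_jeq S (shift_ctx (e - c) \<Gamma> @ \<Delta>) (LetIn P s t) (LetIn P s' t') C"
proof -
  let ?\<Gamma> = "shift_ctx (e - c) \<Gamma> @ \<Delta>"
  have s: "typed S \<Gamma> s A" "typed S \<Gamma> s' A" "jeq S \<Gamma> s s' A"
    using assms(1) by (simp_all add: typed_jeq_def)
  have t: "typed S (pat_ctx P \<beta> c @ \<Delta>) t C" "typed S (pat_ctx P \<beta> c @ \<Delta>) t' C"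
    "jeq S (pat_ctx P \<beta> c @ \<Delta>) t t' C"
    using assms(3) by (simp_all add: typed_jeq_def)
  have "typed S ?\<Gamma> (LetIn P s t) C" if "typed S \<Gamma> s A" "typed S (pat_ctx P \<beta> c @ \<Delta>) t C" for s t
  proof -
    from that obtain D E where D: "derives S D \<Gamma> s A" and E: "derives S E (pat_ctx P \<beta> c @ \<Delta>) t C"
      unfolding typed_def by blast
    have "\<exists>F. derives S F ?\<Gamma> (LetIn P s t) C"
    proof (cases P)
      case (PVar x)
      with assms(2) E have "derives S E ((x, e - c, A) # \<Delta>) t C" by (simp add: pat_ctx_def)
      from derives.Let[OF D this assms(4)] PVar show ?thesis by blast
    next
      case PUnit
      with assms(2) D E have "derives S D \<Gamma> s One" "derives S E \<Delta> t C" by (simp_all add: pat_ctx_def)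
      from derives.UnitE[OF this assms(4)] PUnit show ?thesis by blast
    next
      case (PPair x y)
      with assms(2) obtain A1 A2 where "A = Tens A1 A2" "\<beta> x = (e, A1)" "\<beta> y = (e, A2)" by auto
      with PPair D E have "derives S D \<Gamma> s (Tens A1 A2)"
        "derives S E ((x, e - c, A1) # (y, e - c, A2) # \<Delta>) t C" by (simp_all add: pat_ctx_def)
      from derives.TensE[OF this assms(4)] PPair show ?thesis by blast
    next
      case (PBox d x)
      with assms(2) obtain B where "A = BoxTy d B" "\<beta> x = (e + d, B)" by auto
      with PBox D E have DE: "derives S D \<Gamma> s (BoxTy d B)" "derives S E ((x, e + d - c, B) # \<Delta>) t C"
        by (simp_all add: pat_ctx_def)
      have *: "e + d - c - d = e - c" by simp
      from derives.BoxE[OF DE, unfolded *, OF assms(4)] PBox show ?thesis by blast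
    qed
    then show ?thesis by (simp add: typed_def)
  qed
  with s t have "typed S ?\<Gamma> (LetIn P s t) C" "typed S ?\<Gamma> (LetIn P s' t') C" by blast+
  moreover have "jeq S ?\<Gamma> (LetIn P s t) (LetIn P s' t') C"
  proof (cases P)
    case (PVar x)
    with assms(2) t have "jeq S ((x, e - c, A) # \<Delta>) t t' C" by (simp add: pat_ctx_def)
    from jeq.Let_cong[OF s(3) this assms(4)] PVar show ?thesis by simp
  next
    case PUnit
    with assms(2) s t have "jeq S \<Gamma> s s' One" "jeq S \<Delta> t t' C" by (simp_all add: pat_ctx_def)
    from jeq.UnitE_cong[OF this assms(4)] PUnit show ?thesis by simp
  next
    case (PPair x y)
    with assms(2) obtain A1 A2 where "A = Tens A1 A2" "\<beta> x = (e, A1)" "\<beta> y = (e, A2)" by auto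
    with PPair s t have "jeq S \<Gamma> s s' (Tens A1 A2)"
      "jeq S ((x, e - c, A1) # (y, e - c, A2) # \<Delta>) t t' C" by (simp_all add: pat_ctx_def)
    from jeq.TensE_cong[OF this assms(4)] PPair show ?thesis by simp
  next
    case (PBox d x)
    with assms(2) obtain B where "A = BoxTy d B" "\<beta> x = (e + d, B)" by auto
    with PBox s t have st: "jeq S \<Gamma> s s' (BoxTy d B)" "jeq S ((x, e + d - c, B) # \<Delta>) t t' C"
      by (simp_all add: pat_ctx_def)
    have *: "e + d - c - d = e - c" by simp
    from jeq.BoxE_cong[OF st, unfolded *, OF assms(4)] PBox show ?thesis by simp
  qed
  ultimately show ?thesis by (simp add: typed_jeq_def)
qed

lemma typed_jeq_Gate:
  assumes "g \<in> gates S" "length \<Gamma>s = length (wires S g)" "length ts = length (wires S g)"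
    "length ts' = length (wires S g)"
    "\<forall>i < length (wires S g). typed_jeq S (\<Gamma>s ! i) (ts ! i) (ts' ! i) (Qubit (wires S g ! i))"
    "distinct_vars (concat (map (shift_ctx (- duration S g)) \<Gamma>s))"
  shows "typed_jeq S (concat (map (shift_ctx (- duration S g)) \<Gamma>s)) (Gate g ts) (Gate g ts')
    (tensor_ty (wires S g))"
proof -
  have *: "typed S (concat (map (shift_ctx (- duration S g)) \<Gamma>s)) (Gate g ts) (tensor_ty (wires S g))"
    if l: "length ts = length (wires S g)"
      and t: "\<forall>i < length (wires S g). typed S (\<Gamma>s ! i) (ts ! i) (Qubit (wires S g ! i))" for ts
  proof -
    from t obtain D where D: "\<forall>i < length (wires S g). derives S (D i) (\<Gamma>s ! i) (ts ! i) (Qubit (wires S g ! i))"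
      unfolding typed_def by metis
    show ?thesis unfolding typed_def
      by (rule exI, rule derives.Gate[of _ _ _ "map D [0..<length (wires S g)]"])
        (use assms l D in auto)
  qed
  show ?thesis
    using assms * unfolding typed_jeq_def by (auto intro!: jeq.Gate_cong)
qed

section \<open>Syntax-directed equality and its passage to the judgement\<close>

context annotated
begin

text \<open>In \<open>eqt_conv\<close>, reflexive instances of the relation play the role of typing assumptions.\<close>

inductive eqt :: "'q env \<Rightarrow> real \<Rightarrow> 'g tm \<Rightarrow> 'g tm \<Rightarrow> 'q ty \<Rightarrow> bool" where
  eqt_conv: "conv s t \<Longrightarrow> fv s = fv t \<Longrightarrow> eqt \<rho> c s s A \<Longrightarrow> eqt \<rho> c t t A \<Longrightarrow> eqt \<rho> c s t A"
| eqt_sym: "eqt \<rho> c s t A \<Longrightarrow> eqt \<rho> c t s A"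
| eqt_trans: "eqt \<rho> c s t A \<Longrightarrow> eqt \<rho> c t u A \<Longrightarrow> eqt \<rho> c s u A"
| eqt_V: "\<rho> x = (c, A) \<Longrightarrow> set_ty A \<subseteq> qubits S \<Longrightarrow> eqt \<rho> c (V x) (V x) A"
| eqt_Star: "eqt \<rho> c Star Star One"
| eqt_Gate: "g \<in> gates S \<Longrightarrow> length ts = length (wires S g) \<Longrightarrow> length ts' = length (wires S g) \<Longrightarrow>
    \<forall>i < length ts. eqt \<rho> (c - duration S g) (ts ! i) (ts' ! i) (Qubit (wires S g ! i)) \<Longrightarrow>
    pairwise_disjoint ts \<Longrightarrow> A = tensor_ty (wires S g) \<Longrightarrow> eqt \<rho> c (Gate g ts) (Gate g ts') A"
| eqt_Tup: "eqt \<rho> c s s' A \<Longrightarrow> eqt \<rho> c t t' B \<Longrightarrow> fv s \<inter> fv t = {} \<Longrightarrow>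
    eqt \<rho> c (Tup s t) (Tup s' t') (Tens A B)"
| eqt_BoxTm: "eqt \<rho> (c + d) t t' A \<Longrightarrow> eqt \<rho> c (BoxTm d t) (BoxTm d t') (BoxTy d A)"
| eqt_Delay: "eqt \<rho> (c - d) t t' (Qubit q) \<Longrightarrow> d \<ge> 0 \<Longrightarrow> eqt \<rho> c (Delay d t) (Delay d t') (Qubit q)"
| eqt_LetIn: "eqt \<rho> e s s' A \<Longrightarrow> pat_typed P e A \<beta> \<Longrightarrow>
    eqt (override_on \<rho> \<beta> (set_pat P)) c t t' B \<Longrightarrow>
    set_pat P \<subseteq> fv t \<Longrightarrow> fv s \<inter> (fv t - set_pat P) = {} \<Longrightarrow>
    eqt \<rho> c (LetIn P s t) (LetIn P s' t') B"

lemma eqt_fv: "eqt \<rho> c s t A \<Longrightarrow> fv s = fv t"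
proof (induction rule: eqt.induct)
  case (eqt_Gate g ts ts' \<rho> c A)
  then have "map fv ts = map fv ts'" by (auto intro: nth_equalityI)
  then show ?case by (simp del: set_map)
qed auto

lemma wt_imp_eqt: "wt \<rho> c t A \<Longrightarrow> eqt \<rho> c t t A"
  by (induction rule: wt.induct) (auto intro: eqt.intros)

lemma eqt_imp_wt: "eqt \<rho> c s t A \<Longrightarrow> wt \<rho> c s A \<and> wt \<rho> c t A"
proof (induction rule: eqt.induct)
  case (eqt_Gate g ts ts' \<rho> c A)
  then have "fv (ts' ! i) = fv (ts ! i)" if "i < length ts" for i
    using that by (auto dest!: eqt_fv)
  then have "pairwise_disjoint ts'"
    using eqt_Gate.hyps unfolding pairwise_disjoint_def by simp
  with eqt_Gate show ?case by (auto intro: wt.intros)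
next
  case (eqt_Tup \<rho> c s s' A t t' B)
  then show ?case by (auto intro!: wt.intros dest!: eqt_fv)
next
  case (eqt_LetIn \<rho> e s s' A P \<beta> c t t' B)
  then have "fv s = fv s'" "fv t = fv t'" by (auto dest!: eqt_fv)
  with eqt_LetIn show ?case by (metis wt_LetIn)
qed (auto intro: wt.intros)

text \<open>The return to judgements with contexts. In a rule with several premises the declarations
  are sorted by the subterm that uses them, the congruence rule is applied to the sorted context,
  and exchanges lead back to \<open>\<Gamma>\<close>.\<close>

lemma eqt_imp_jeq:
  "eqt \<rho> c s t A \<Longrightarrow> declares \<Gamma> \<rho> c (fv s) \<Longrightarrow> typed_jeq S \<Gamma> s t A"
proof (induction arbitrary: \<Gamma> rule: eqt.induct)
  case (eqt_conv s t \<rho> c A)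
  then show ?case unfolding typed_jeq_def by (metis jeq.Conv)
next
  case (eqt_sym \<rho> c s t A)
  then have "typed_jeq S \<Gamma> s t A" using eqt_fv by metis
  then show ?case unfolding typed_jeq_def by (metis jeq.Sym)
next
  case (eqt_trans \<rho> c s t A u)
  then have "typed_jeq S \<Gamma> s t A" "typed_jeq S \<Gamma> t u A" using eqt_fv by metis+
  then show ?case unfolding typed_jeq_def by (metis jeq.Trans)
next
  case (eqt_V \<rho> x c A)
  \<comment> \<open>Distinct names, all equal to \<open>x\<close>, leave room for a single
    declaration.\<close>
  from eqt_V.prems have "card (set (map fst \<Gamma>)) = length (map fst \<Gamma>)" "set (map fst \<Gamma>) = {x}"
    unfolding declares_def distinct_vars_def by (simp_all add: distinct_card del: set_map) simp
  then have "length \<Gamma> = Suc 0" by simp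
  then obtain a where "\<Gamma> = [a]" by (auto simp: length_Suc_conv)
  with eqt_V.prems obtain d B where "\<Gamma> = [(x, d, B)]"
    by (cases a) (auto simp: declares_def)
  with eqt_V have "\<Gamma> = [(x, 0, A)]"
    by (auto simp: declares_def)
  moreover have "typed S [(x, 0, A)] (V x) A"
    unfolding typed_def using eqt_V by (auto intro: derives.Var)
  ultimately show ?case by (simp add: typed_jeq_def jeq.Refl)
next
  case (eqt_Star \<rho> c)
  have "typed S [] Star One"
    unfolding typed_def by (auto intro: derives.UnitI)
  with eqt_Star show ?case by (simp add: declares_def typed_jeq_def jeq.Refl)
next
  case (eqt_Gate g ts ts' \<rho> c A)
  let ?d = "duration S g"
  from eqt_Gate.prems eqt_Gate.hyps obtain \<Gamma>s where \<Gamma>s: "length \<Gamma>s = length ts"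
    "\<forall>i < length ts. declares (\<Gamma>s ! i) \<rho> c (fv (ts ! i))" "mset \<Gamma> = mset (concat \<Gamma>s)"
    using declares_split_list[of \<Gamma> \<rho> c ts] by auto
  \<comment> \<open>The contexts relative to the offset \<open>c - ?d\<close> of the arguments; the
    rule for gates takes the duration off again.\<close>
  let ?\<Gamma>s = "map (shift_ctx ?d) \<Gamma>s"
  have shift_back: "map (shift_ctx (- ?d)) ?\<Gamma>s = \<Gamma>s"
    by (simp add: comp_def)
  have "typed_jeq S (concat (map (shift_ctx (- ?d)) ?\<Gamma>s)) (Gate g ts) (Gate g ts') (tensor_ty (wires S g))"
  proof (rule typed_jeq_Gate)
    show "\<forall>i < length (wires S g). typed_jeq S (?\<Gamma>s ! i) (ts ! i) (ts' ! i) (Qubit (wires S g ! i))"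
    proof (intro allI impI)
      fix i assume i: "i < length (wires S g)"
      then have "declares (?\<Gamma>s ! i) \<rho> (c - ?d) (fv (ts ! i))"
        using \<Gamma>s eqt_Gate.hyps by (simp add: declares_shift)
      with eqt_Gate.IH eqt_Gate.hyps i show "typed_jeq S (?\<Gamma>s ! i) (ts ! i) (ts' ! i) (Qubit (wires S g ! i))"
        by simp
    qed
    have "distinct (map fst (concat \<Gamma>s))"
      using eqt_Gate.prems \<Gamma>s(3) unfolding declares_def distinct_vars_def
      by (metis mset_eq_imp_distinct_iff mset_map)
    then show "distinct_vars (concat (map (shift_ctx (- ?d)) ?\<Gamma>s))"
      unfolding shift_back distinct_vars_def .
  qed (use \<Gamma>s eqt_Gate.hyps in auto)
  then show ?case
    unfolding shift_back using \<Gamma>s(3) eqt_Gate.hyps by (auto intro: typed_jeq_mset)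
next
  case (eqt_Tup \<rho> c s s' A t t' B)
  from eqt_Tup.prems have "declares \<Gamma> \<rho> c (fv s \<union> fv t)" by simp
  from declares_split[OF this eqt_Tup.hyps(3)] obtain \<Gamma>1 \<Gamma>2 where
    1: "declares \<Gamma>1 \<rho> c (fv s)" "declares \<Gamma>2 \<rho> c (fv t)" "mset \<Gamma> = mset (\<Gamma>1 @ \<Gamma>2)"
      "distinct_vars (\<Gamma>1 @ \<Gamma>2)" by metis
  have "typed_jeq S (\<Gamma>1 @ \<Gamma>2) (Tup s t) (Tup s' t') (Tens A B)"
    using eqt_Tup.IH(1)[OF 1(1)] eqt_Tup.IH(2)[OF 1(2)] 1(4) unfolding typed_jeq_def typed_def
    by (blast intro: derives.TensI jeq.TensI_cong)
  then show ?case using 1(3) by (auto intro: typed_jeq_mset)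
next
  case (eqt_BoxTm \<rho> c d t t' A)
  have "declares (shift_ctx (- d) \<Gamma>) \<rho> (c + d) (fv t)"
    using eqt_BoxTm.prems by (simp add: declares_shift)
  from eqt_BoxTm.IH[OF this]
  have "typed_jeq S (shift_ctx d (shift_ctx (- d) \<Gamma>)) (BoxTm d t) (BoxTm d t') (BoxTy d A)"
    unfolding typed_jeq_def typed_def by (blast intro: derives.BoxI jeq.BoxI_cong)
  then show ?case by simp
next
  case (eqt_Delay \<rho> c d t t' q)
  have "declares (shift_ctx d \<Gamma>) \<rho> (c - d) (fv t)"
    using eqt_Delay.prems by (simp add: declares_shift)
  from eqt_Delay.IH[OF this] eqt_Delay.hyps
  have "typed_jeq S (shift_ctx (- d) (shift_ctx d \<Gamma>)) (Delay d t) (Delay d t') (Qubit q)"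
    unfolding typed_jeq_def typed_def by (blast intro: derives.Delay jeq.Delay_cong)
  then show ?case by simp
next
  case (eqt_LetIn \<rho> e s s' A P \<beta> c t t' B)
  from eqt_LetIn.prems have "declares \<Gamma> \<rho> c (fv s \<union> (fv t - set_pat P))" by simp
  from declares_split[OF this eqt_LetIn.hyps(5)] obtain \<Gamma>1 \<Gamma>2 where
    1: "declares \<Gamma>1 \<rho> c (fv s)" "declares \<Gamma>2 \<rho> c (fv t - set_pat P)" "mset \<Gamma> = mset (\<Gamma>1 @ \<Gamma>2)"
      "distinct_vars (\<Gamma>1 @ \<Gamma>2)" by metis
  \<comment> \<open>A declaration of grade \<open>d\<close> relative to \<open>c\<close> has grade
    \<open>c + d - e\<close> relative to the offset \<open>e\<close> of the scrutinee; the typing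
    rule translates it back.\<close>
  let ?\<Gamma>1 = "shift_ctx (c - e) \<Gamma>1"
  have "declares ?\<Gamma>1 \<rho> e (fv s)" using 1(1) by (simp add: declares_shift)
  note s = eqt_LetIn.IH(1)[OF this]
  note t = eqt_LetIn.IH(2)[OF declares_pat_ctx[OF 1(2) eqt_LetIn.hyps(2,4)]]
  have "typed_jeq S (shift_ctx (e - c) ?\<Gamma>1 @ \<Gamma>2) (LetIn P s t) (LetIn P s' t') B"
    by (rule typed_jeq_LetIn[OF s eqt_LetIn.hyps(2) t]) (use 1(4) in simp)
  then show ?case using 1(3) by (auto intro: typed_jeq_mset)
qed

end

lemma bv_subst_upd: "bv (subst t (V(x := s))) \<subseteq> bv t \<union> bv s"
proof -
  \<comment> \<open>A binder masks the substitution on its own variables, so the induction has to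
    allow every \<open>\<sigma>\<close> that takes each variable to itself or to
    \<open>s\<close>.\<close>
  have "bv (subst t \<sigma>) \<subseteq> bv t \<union> bv s" if "\<forall>y. \<sigma> y = V y \<or> \<sigma> y = s" for \<sigma>
    using that
  proof (induction t arbitrary: \<sigma>)
    case (V y)
    then have "\<sigma> y = V y \<or> \<sigma> y = s" by blast
    then show ?case by (elim disjE) simp_all
  next
    case (LetIn P u t)
    have "bv (subst t (\<lambda>x. if x \<in> set_pat P then V x else \<sigma> x)) \<subseteq> bv t \<union> bv s"
      by (rule LetIn.IH(2)) (use LetIn.prems in simp)
    with LetIn.IH(1)[OF LetIn.prems] show ?case by auto
  next
    case (Gate g ts)
    have "bv (subst t \<sigma>) \<subseteq> bv t \<union> bv s" if "t \<in> set ts" for t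
      using Gate.IH[OF that Gate.prems] .
    then show ?case by (simp add: image_image) blast
  next
    case (Tup s t)
    from Tup.IH(1)[OF Tup.prems] Tup.IH(2)[OF Tup.prems] show ?case by auto
  next
    case (BoxTm d t)
    from BoxTm.IH[OF BoxTm.prems] show ?case by simp
  next
    case (Delay d t)
    from Delay.IH[OF Delay.prems] show ?case by simp
  qed simp
  then show ?thesis by simp
qed

context annotated
begin

lemma eqt_refl: "wt \<rho> c t A \<Longrightarrow> eqt \<rho> c t t A"
  by (rule wt_imp_eqt)

lemma eqt_convI: "conv s t \<Longrightarrow> fv s = fv t \<Longrightarrow> wt \<rho> c s A \<Longrightarrow> wt \<rho> c t A \<Longrightarrow> eqt \<rho> c s t A"
  by (rule eqt_conv) (simp_all add: wt_imp_eqt)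

lemma eqt_wt: "eqt \<rho> c s t A \<Longrightarrow> wt \<rho> c s A" "eqt \<rho> c s t A \<Longrightarrow> wt \<rho> c t A"
  using eqt_imp_wt by blast+

lemma eqt_cong_env: "eqt \<rho> c s t A \<Longrightarrow> \<forall>x \<in> fv s. \<rho> x = \<rho>' x \<Longrightarrow> eqt \<rho>' c s t A"
proof (induction arbitrary: \<rho>' rule: eqt.induct)
  case (eqt_conv s t \<rho> c A)
  then show ?case by (metis eqt.eqt_conv)
next
  case (eqt_sym \<rho> c s t A)
  then show ?case by (metis eqt.eqt_sym eqt_fv)
next
  case (eqt_trans \<rho> c s t A u)
  then show ?case by (metis eqt.eqt_trans eqt_fv)
next
  case (eqt_Gate g ts ts' \<rho> c A)
  have "eqt \<rho>' (c - duration S g) (ts ! i) (ts' ! i) (Qubit (wires S g ! i))" if "i < length ts" for i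
  proof -
    have "\<forall>x \<in> fv (ts ! i). \<rho> x = \<rho>' x"
    proof
      fix x assume "x \<in> fv (ts ! i)"
      then have "x \<in> fv (Gate g ts)" using that by auto
      with eqt_Gate.prems show "\<rho> x = \<rho>' x" by blast
    qed
    with eqt_Gate.IH that show ?thesis by blast
  qed
  with eqt_Gate.hyps show ?case by (blast intro: eqt.eqt_Gate)
next
  case (eqt_LetIn \<rho> e s s' A P \<beta> c t t' B)
  have "eqt \<rho>' e s s' A"
    by (rule eqt_LetIn.IH(1)) (use eqt_LetIn.prems in auto)
  moreover have "eqt (override_on \<rho>' \<beta> (set_pat P)) c t t' B"
    by (rule eqt_LetIn.IH(2)) (use eqt_LetIn.prems in \<open>auto simp: override_on_def\<close>)
  ultimately show ?case
    using eqt_LetIn.hyps by (blast intro: eqt.eqt_LetIn)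
qed (auto intro: eqt.intros)

lemma eqt_shift: "eqt \<rho> c s t A \<Longrightarrow> eqt (shift_env d \<rho>) (d + c) s t A"
proof (induction rule: eqt.induct)
  case (eqt_LetIn \<rho> e s s' A P \<beta> c t t' B)
  from eqt_LetIn.IH(2) have "eqt (override_on (shift_env d \<rho>) (shift_env d \<beta>) (set_pat P)) (d + c) t t' B"
    by (simp only: shift_env_override_on)
  with eqt_LetIn.IH(1) eqt_LetIn.hyps pat_typed_shift[OF eqt_LetIn.hyps(2), of d] show ?case
    by (blast intro: eqt.eqt_LetIn)
next
  case (eqt_Gate g ts ts' \<rho> c A)
  have *: "d + c - duration S g = d + (c - duration S g)" by simp
  show ?case
    by (rule eqt.eqt_Gate) (use eqt_Gate in \<open>auto simp: *\<close>)
next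
  case (eqt_BoxTm \<rho> c e t t' A)
  then show ?case by (auto intro!: eqt.eqt_BoxTm simp: algebra_simps)
next
  case (eqt_Delay \<rho> c e t t' q)
  have "eqt (shift_env d \<rho>) (d + c - e) t t' (Qubit q)"
    using eqt_Delay.IH by (simp only: add_diff_eq)
  with eqt_Delay.hyps show ?case by (intro eqt.eqt_Delay)
qed (auto intro: eqt.intros)

text \<open>An environment may declare arbitrary types. For the variables that occur in a typed
  term, membership of their qubits in \<open>S\<close> is recovered from the typing.\<close>

lemma wt_var_ty: "wt \<rho> c t A \<Longrightarrow> x \<in> fv t \<Longrightarrow> set_ty (snd (\<rho> x)) \<subseteq> qubits S"
proof (induction rule: wt.induct)
  case (wt_Gate g ts \<rho> c A)
  then obtain i where "i < length ts" "x \<in> fv (ts ! i)" by (auto simp: in_set_conv_nth)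
  with wt_Gate show ?case by blast
next
  case (wt_LetIn \<rho> e s A P \<beta> c t B)
  then show ?case by (cases "x \<in> fv s") auto
qed auto


section \<open>Renaming of bound variables\<close>

text \<open>\<open>red\<close> is used as a rewrite relation on raw terms: typing has to be checked only for the left end
  of a chain of rewrite steps.\<close>

definition red :: "'g tm \<Rightarrow> 'g tm \<Rightarrow> bool" (infix "\<leadsto>" 50) where
  "s \<leadsto> t \<longleftrightarrow> fv s = fv t \<and> (\<forall>\<rho> c A. wt \<rho> c s A \<longrightarrow> eqt \<rho> c s t A)"

text \<open>\<open>\<leadsto>\<close> is not symmetric, since its right side may be typable where
  its left side is not: eta for a pair pattern goes only from the \<open>let\<close> to
  \<open>t\<close>, as \<open>t\<close> need not have a tensor type.\<close>

definition req :: "'g tm \<Rightarrow> 'g tm \<Rightarrow> bool" (infix "\<simeq>" 50) where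
  "s \<simeq> t \<longleftrightarrow> s \<leadsto> t \<and> t \<leadsto> s"

lemma redI: "fv s = fv t \<Longrightarrow> (\<And>\<rho> c A. wt \<rho> c s A \<Longrightarrow> eqt \<rho> c s t A) \<Longrightarrow> s \<leadsto> t"
  by (simp add: red_def)

lemma red_fv: "s \<leadsto> t \<Longrightarrow> fv s = fv t"
  by (simp add: red_def)

lemma red_eqt: "s \<leadsto> t \<Longrightarrow> wt \<rho> c s A \<Longrightarrow> eqt \<rho> c s t A"
  by (simp add: red_def)

lemma red_refl [simp]: "t \<leadsto> t"
  by (simp add: red_def eqt_refl)

lemma red_trans [trans]: "s \<leadsto> t \<Longrightarrow> t \<leadsto> u \<Longrightarrow> s \<leadsto> u"
  unfolding red_def by (metis eqt_trans eqt_wt(2))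

lemma reqI:
  assumes "fv s = fv t" "\<And>\<rho> c A. wt \<rho> c s A \<Longrightarrow> wt \<rho> c t A" "\<And>\<rho> c A. wt \<rho> c t A \<Longrightarrow> wt \<rho> c s A"
    and "\<And>\<rho> c A. wt \<rho> c s A \<Longrightarrow> wt \<rho> c t A \<Longrightarrow> eqt \<rho> c s t A"
  shows "s \<simeq> t"
  unfolding req_def red_def using assms by (metis eqt_sym)

lemma req_red: "s \<simeq> t \<Longrightarrow> s \<leadsto> t" "s \<simeq> t \<Longrightarrow> t \<leadsto> s"
  by (simp_all add: req_def)

lemma req_refl [simp]: "t \<simeq> t"
  by (simp add: req_def)

lemma req_sym: "s \<simeq> t \<Longrightarrow> t \<simeq> s"
  by (simp add: req_def)

lemma req_trans [trans]: "s \<simeq> t \<Longrightarrow> t \<simeq> u \<Longrightarrow> s \<simeq> u"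
  unfolding req_def by (meson red_trans)

lemma req_red_trans [trans]: "s \<simeq> t \<Longrightarrow> t \<leadsto> u \<Longrightarrow> s \<leadsto> u" "s \<leadsto> t \<Longrightarrow> t \<simeq> u \<Longrightarrow> s \<leadsto> u"
  unfolding req_def by (meson red_trans)+

lemma red_LetIn:
  assumes "s \<leadsto> s'" "t \<leadsto> t'"
  shows "LetIn P s t \<leadsto> LetIn P s' t'"
proof (rule redI)
  show "fv (LetIn P s t) = fv (LetIn P s' t')"
    using assms by (simp add: red_fv)
  fix \<rho> c A assume "wt \<rho> c (LetIn P s t) A"
  then obtain e B \<beta> where "wt \<rho> e s B" "pat_typed P e B \<beta>" "wt (override_on \<rho> \<beta> (set_pat P)) c t A"
    "set_pat P \<subseteq> fv t" "fv s \<inter> (fv t - set_pat P) = {}"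
    by (elim wt_LetInE)
  with assms show "eqt \<rho> c (LetIn P s t) (LetIn P s' t') A"
    by (intro eqt_LetIn[of _ e _ _ B _ \<beta>] red_eqt)
qed

lemma red_Tup: "s \<leadsto> s' \<Longrightarrow> t \<leadsto> t' \<Longrightarrow> Tup s t \<leadsto> Tup s' t'"
  unfolding red_def by (auto intro: eqt_Tup)

lemma red_BoxTm: "t \<leadsto> t' \<Longrightarrow> BoxTm d t \<leadsto> BoxTm d t'"
  unfolding red_def by (auto intro: eqt_BoxTm)

lemma red_Delay: "t \<leadsto> t' \<Longrightarrow> Delay d t \<leadsto> Delay d t'"
  unfolding red_def by (auto intro: eqt_Delay)

lemma red_Gate:
  assumes "length ts = length ts'" "\<And>i. i < length ts \<Longrightarrow> ts ! i \<leadsto> ts' ! i"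
  shows "Gate g ts \<leadsto> Gate g ts'"
proof (rule redI)
  have "map fv ts = map fv ts'"
    using assms red_fv by (metis (no_types, lifting) length_map nth_equalityI nth_map)
  then show "fv (Gate g ts) = fv (Gate g ts')"
    by (simp del: set_map)
  fix \<rho> c A assume "wt \<rho> c (Gate g ts) A"
  then show "eqt \<rho> c (Gate g ts) (Gate g ts') A"
    by (elim wt_GateE, intro eqt_Gate) (use assms in \<open>auto intro: red_eqt\<close>)
qed

lemma req_LetIn: "s \<simeq> s' \<Longrightarrow> t \<simeq> t' \<Longrightarrow> LetIn P s t \<simeq> LetIn P s' t'"
  unfolding req_def by (auto intro: red_LetIn)

lemma req_Tup: "s \<simeq> s' \<Longrightarrow> t \<simeq> t' \<Longrightarrow> Tup s t \<simeq> Tup s' t'"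
  unfolding req_def by (auto intro: red_Tup)

lemma set_rename_pat:
  "x \<in> set_pat P \<Longrightarrow> y \<notin> set_pat P \<Longrightarrow>
    set_pat (map_pat (id(x := y)) P) = insert y (set_pat P - {x})"
  by (auto simp: pat.set_map)

lemma fv_subst_var:
  "y \<notin> bv t \<Longrightarrow> fv (subst t (V(x := V y))) = (if x \<in> fv t then insert y (fv t - {x}) else fv t)"
  by (subst fv_subst) (auto simp: capture_free_def split: if_splits)

lemma red_alpha:
  assumes x: "x \<in> set_pat P" and y: "y \<notin> set_pat P \<union> fv t \<union> bv t"
  shows "LetIn P s t \<leadsto> LetIn (map_pat (id(x := y)) P) s (subst t (V(x := V y)))"
proof (rule redI)
  let ?P = "map_pat (id(x := y)) P" and ?t = "subst t (V(x := V y))"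
  have P: "set_pat ?P = insert y (set_pat P - {x})"
    using x y by (intro set_rename_pat) auto
  have fvt: "fv ?t = (if x \<in> fv t then insert y (fv t - {x}) else fv t)"
    using y by (intro fv_subst_var) auto
  show fv: "fv (LetIn P s t) = fv (LetIn ?P s ?t)"
    using x y unfolding fv.simps P fvt by auto
  fix \<rho> c A assume wt: "wt \<rho> c (LetIn P s t) A"
  then obtain e B \<beta> where w: "wt \<rho> e s B" "pat_typed P e B \<beta>" "wt (override_on \<rho> \<beta> (set_pat P)) c t A"
    "set_pat P \<subseteq> fv t" "fv s \<inter> (fv t - set_pat P) = {}"
    by auto
  let ?\<beta> = "\<beta>(y := \<beta> x)"
  have ptd: "pat_typed ?P e B ?\<beta>"
    using w(2) x y by (cases P) auto
  have "wt (override_on \<rho> ?\<beta> (set_pat ?P)) c ?t A"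
  proof (rule wt_subst[OF w(3)]; (intro ballI impI)?)
    show "capture_free t (V(x := V y))" using y by (intro capture_free_upd) auto
  next
    fix z assume z: "z \<in> fv t"
    have "set_ty (snd (override_on \<rho> \<beta> (set_pat P) z)) \<subseteq> qubits S"
      using wt_var_ty[OF w(3) z] .
    then show "wt (override_on \<rho> ?\<beta> (set_pat ?P)) (fst (override_on \<rho> \<beta> (set_pat P) z))
        ((V(x := V y)) z) (snd (override_on \<rho> \<beta> (set_pat P) z))"
      using x y z unfolding P by (auto simp: override_on_def intro!: wt_V)
  qed (use x y in auto)
  then have wt': "wt \<rho> c (LetIn ?P s ?t) A"
  proof (rule wt_LetIn[OF w(1) ptd])
    have "x \<in> fv t" using w(4) x by auto
    then have fvt': "fv ?t = insert y (fv t - {x})" using fvt by simp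
    show "set_pat ?P \<subseteq> fv ?t" "fv s \<inter> (fv ?t - set_pat ?P) = {}"
      using w(4,5) x unfolding P fvt' by auto
  qed
  show "eqt \<rho> c (LetIn P s t) (LetIn ?P s ?t) A"
    by (rule eqt_convI[OF conv.alpha[OF x y] fv wt wt'])
qed

text \<open>Each renaming removes one clash between \<open>P\<close> and \<open>X\<close>. The new
  pattern and body serve all scrutinees at once, which matters when the scrutinee is the hole of a
  context (\<open>hole_scrut\<close>).\<close>

lemma fresh_pat:
  assumes "finite X" "bv t \<inter> X = {}"
  shows "\<exists>P' t'. set_pat P' \<inter> X = {} \<and> bv t' \<inter> X = {} \<and> (\<forall>s. LetIn P s t \<leadsto> LetIn P' s t')"
  using assms(2)
proof (induction "card (set_pat P \<inter> X)" arbitrary: P t)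
  case 0
  then have "set_pat P \<inter> X = {}" using assms(1) by simp
  with 0 show ?case by (intro exI[of _ P] exI[of _ t]) simp
next
  case (Suc n)
  then have "set_pat P \<inter> X \<noteq> {}" by auto
  then obtain x where x: "x \<in> set_pat P" "x \<in> X" by blast
  have "finite (X \<union> set_pat P \<union> fv t \<union> bv t)" using assms(1) by simp
  then obtain y where y: "y \<notin> X \<union> set_pat P \<union> fv t \<union> bv t"
    by (meson ex_new_if_finite infinite_UNIV_nat)
  let ?P = "map_pat (id(x := y)) P" and ?t = "subst t (V(x := V y))"
  have "set_pat ?P \<inter> X = (set_pat P \<inter> X) - {x}"
    using x y by (subst set_rename_pat) auto
  then have "n = card (set_pat ?P \<inter> X)" using Suc.hyps(2) x by (simp add: card_Diff_singleton)
  moreover have "bv ?t \<inter> X = {}"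
    using Suc.prems by (subst bv_subst_var) auto
  ultimately obtain P' t' where *: "set_pat P' \<inter> X = {}" "bv t' \<inter> X = {}" "\<forall>s. LetIn ?P s ?t \<leadsto> LetIn P' s t'"
    using Suc.hyps(1) by blast
  have "LetIn P s t \<leadsto> LetIn P' s t'" for s
    using red_trans[OF red_alpha[OF x(1), of y t s] *(3)[rule_format]] y by auto
  with * show ?case by blast
qed

text \<open>The variable convention, as a provable equality instead of an identification of terms.
  Through it the conditions on bound variables in the beta rules can always be met.\<close>

lemma fresh_bv:
  "wt \<rho> c t A \<Longrightarrow> finite X \<Longrightarrow> \<exists>t'. eqt \<rho> c t t' A \<and> bv t' \<inter> X = {}"
proof (induction rule: wt.induct)
  case (wt_Gate g ts \<rho> c A)
  then have "\<forall>i < length ts. \<exists>t'. eqt \<rho> (c - duration S g) (ts ! i) t' (Qubit (wires S g ! i)) \<and> bv t' \<inter> X = {}"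
    by blast
  then obtain f where f: "\<forall>i < length ts. eqt \<rho> (c - duration S g) (ts ! i) (f i) (Qubit (wires S g ! i)) \<and> bv (f i) \<inter> X = {}"
    by metis
  let ?ts = "map f [0..<length ts]"
  have "eqt \<rho> c (Gate g ts) (Gate g ?ts) A"
    using f wt_Gate.hyps by (intro eqt_Gate) auto
  moreover have "bv (Gate g ?ts) \<inter> X = {}"
    using f by auto
  ultimately show ?case by blast
next
  case (wt_Tup \<rho> c s A t B)
  then obtain s' t' where *: "eqt \<rho> c s s' A" "bv s' \<inter> X = {}" "eqt \<rho> c t t' B" "bv t' \<inter> X = {}"
    by blast
  then have "eqt \<rho> c (Tup s t) (Tup s' t') (Tens A B)" "bv (Tup s' t') \<inter> X = {}"
    using wt_Tup.hyps by (auto intro: eqt_Tup)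
  then show ?case by blast
next
  case (wt_BoxTm \<rho> c d t A)
  then obtain t' where "eqt \<rho> (c + d) t t' A" "bv t' \<inter> X = {}" by blast
  then have "eqt \<rho> c (BoxTm d t) (BoxTm d t') (BoxTy d A)" "bv (BoxTm d t') \<inter> X = {}"
    by (auto intro: eqt_BoxTm)
  then show ?case by blast
next
  case (wt_Delay \<rho> c d t q)
  then obtain t' where "eqt \<rho> (c - d) t t' (Qubit q)" "bv t' \<inter> X = {}" by blast
  then have "eqt \<rho> c (Delay d t) (Delay d t') (Qubit q)" "bv (Delay d t') \<inter> X = {}"
    using wt_Delay.hyps by (auto intro: eqt_Delay)
  then show ?case by blast
next
  case (wt_LetIn \<rho> e s A P \<beta> c t B)
  then obtain s' t' where *: "eqt \<rho> e s s' A" "bv s' \<inter> X = {}"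
    "eqt (override_on \<rho> \<beta> (set_pat P)) c t t' B" "bv t' \<inter> X = {}"
    by blast
  from fresh_pat[OF wt_LetIn.prems *(4)] obtain P' t''
    where P': "set_pat P' \<inter> X = {}" "bv t'' \<inter> X = {}" "LetIn P s' t' \<leadsto> LetIn P' s' t''" by blast
  have 1: "eqt \<rho> c (LetIn P s t) (LetIn P s' t') B"
    using * wt_LetIn.hyps by (blast intro: eqt_LetIn)
  from eqt_trans[OF 1 red_eqt[OF P'(3) eqt_wt(2)[OF 1]]]
  have "eqt \<rho> c (LetIn P s t) (LetIn P' s' t'') B" .
  moreover have "bv (LetIn P' s' t'') \<inter> X = {}"
    using P' * by auto
  ultimately show ?case by blast
qed (auto intro: eqt.intros)


section \<open>Generating equations without capture conditions\<close>

lemma wt_subst_let: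
  assumes "wt \<rho> c (LetIn (PVar x) s t) A" "bv t \<inter> fv s = {}"
  shows "wt \<rho> c (subst t (V(x := s))) A" "fv (LetIn (PVar x) s t) = fv (subst t (V(x := s)))"
proof -
  from assms(1) obtain e B \<beta> where w: "wt \<rho> e s B" "\<beta> x = (e, B)" "wt (override_on \<rho> \<beta> {x}) c t A"
    "x \<in> fv t" "fv s \<inter> (fv t - {x}) = {}"
    by auto
  show "wt \<rho> c (subst t (V(x := s))) A"
  proof (rule wt_subst[OF w(3)]; (intro ballI impI)?)
    fix z assume z: "z \<in> fv t"
    show "wt \<rho> (fst (override_on \<rho> \<beta> {x} z)) ((V(x := s)) z) (snd (override_on \<rho> \<beta> {x} z))"
      using w wt_var_ty[OF w(3) z] by (auto simp: override_on_def intro!: wt_V)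
  qed (use w assms(2) in \<open>auto simp: capture_free_upd\<close>)
  show "fv (LetIn (PVar x) s t) = fv (subst t (V(x := s)))"
    using fv_subst_upd[OF assms(2) w(4)] by simp
qed

lemma eqt_beta_let:
  assumes "wt \<rho> c (LetIn (PVar x) s t) A" "bv t \<inter> fv s = {}"
  shows "eqt \<rho> c (LetIn (PVar x) s t) (subst t (V(x := s))) A"
  by (rule eqt_convI[OF conv.beta_let[OF assms(2)] wt_subst_let(2)[OF assms] assms(1) wt_subst_let(1)[OF assms]])

text \<open>A variable matches every type at every grade, so eta for it is reversible, in contrast
  to the other patterns.\<close>

lemma req_let_var: "LetIn (PVar x) s (V x) \<simeq> s"
proof (rule reqI)
  show wt: "wt \<rho> c (LetIn (PVar x) s (V x)) A" if "wt \<rho> c s A" for \<rho> c A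
    by (rule wt_LetIn[OF that, of _ "\<lambda>_. (c, A)"]) (use wt_set_ty[OF that] in \<open>auto intro: wt_V\<close>)
  show "wt \<rho> c s A" if "wt \<rho> c (LetIn (PVar x) s (V x)) A" for \<rho> c A
    using wt_subst_let(1)[OF that] by simp
  show "eqt \<rho> c (LetIn (PVar x) s (V x)) s A" if "wt \<rho> c (LetIn (PVar x) s (V x)) A" for \<rho> c A
    using eqt_beta_let[OF that] by simp
qed simp

text \<open>Substituting \<open>x\<close> for \<open>x\<close> changes nothing, but before beta
  applies, \<open>t\<close> has to be put into a form that does not bind \<open>x\<close>.\<close>

lemma red_let_same: "x \<in> fv t \<Longrightarrow> LetIn (PVar x) (V x) t \<leadsto> t"
proof (rule redI)
  fix \<rho> c A assume wt: "wt \<rho> c (LetIn (PVar x) (V x) t) A"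
  then obtain e B \<beta> where w: "wt \<rho> e (V x) B" "\<beta> x = (e, B)" "wt (override_on \<rho> \<beta> {x}) c t A"
    by (elim wt_LetInE) simp
  then have t: "wt \<rho> c t A"
    by (auto intro: wt_cong_env simp: override_on_def)
  from fresh_bv[OF t, of "{x}"] obtain t' where t': "eqt \<rho> c t t' A" "bv t' \<inter> {x} = {}" by auto
  have "override_on \<rho> \<beta> {x} = \<rho>" using w by (auto simp: override_on_def)
  with t' wt have 1: "eqt \<rho> c (LetIn (PVar x) (V x) t) (LetIn (PVar x) (V x) t') A"
    by (auto intro!: eqt_LetIn[of _ e _ _ B _ \<beta>] eqt_refl w)
  have "eqt \<rho> c (LetIn (PVar x) (V x) t') (subst t' (V(x := V x))) A"
    by (rule eqt_beta_let[OF eqt_wt(2)[OF 1]]) (use t' in auto)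
  then have "eqt \<rho> c (LetIn (PVar x) (V x) t') t' A" by simp
  with 1 t' show "eqt \<rho> c (LetIn (PVar x) (V x) t) t A"
    by (meson eqt_trans eqt_sym)
qed auto

text \<open>The typing side of a commuting conversion. It holds for all pairs of patterns, also for
  those whose equation has still to be derived.\<close>

lemma wt_CC:
  assumes "set_pat P \<inter> (fv u - set_pat R) = {}"
  shows "wt \<rho> c (LetIn P s (LetIn R t u)) A \<longleftrightarrow> wt \<rho> c (LetIn R (LetIn P s t) u) A"
proof
  assume "wt \<rho> c (LetIn P s (LetIn R t u)) A"
  then obtain e B \<beta> e' B' \<beta>' where
    "wt \<rho> e s B" "pat_typed P e B \<beta>" "set_pat P \<subseteq> fv t \<union> (fv u - set_pat R)"
    "fv s \<inter> (fv t \<union> (fv u - set_pat R) - set_pat P) = {}"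
    "wt (override_on \<rho> \<beta> (set_pat P)) e' t B'" "pat_typed R e' B' \<beta>'"
    and u: "wt (override_on (override_on \<rho> \<beta> (set_pat P)) \<beta>' (set_pat R)) c u A"
    and "set_pat R \<subseteq> fv u" "fv t \<inter> (fv u - set_pat R) = {}"
    by (elim wt_LetInE) simp
  moreover from u have "wt (override_on \<rho> \<beta>' (set_pat R)) c u A"
    by (rule wt_cong_env) (use assms in \<open>auto simp: override_on_def\<close>)
  ultimately show "wt \<rho> c (LetIn R (LetIn P s t) u) A"
    using assms by (intro wt_LetIn[of \<rho> e' _ B' R \<beta>'] wt_LetIn[of \<rho> e s B P \<beta>]) auto
next
  assume "wt \<rho> c (LetIn R (LetIn P s t) u) A"
  then obtain e B \<beta> e' B' \<beta>' where
    "wt \<rho> e s B" "pat_typed P e B \<beta>" "set_pat P \<subseteq> fv t" "fv s \<inter> (fv t - set_pat P) = {}"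
    "wt (override_on \<rho> \<beta> (set_pat P)) e' t B'" "pat_typed R e' B' \<beta>'"
    and u: "wt (override_on \<rho> \<beta>' (set_pat R)) c u A"
    and "set_pat R \<subseteq> fv u" "(fv s \<union> (fv t - set_pat P)) \<inter> (fv u - set_pat R) = {}"
    by (elim wt_LetInE) simp
  moreover from u have "wt (override_on (override_on \<rho> \<beta> (set_pat P)) \<beta>' (set_pat R)) c u A"
    by (rule wt_cong_env) (use assms in \<open>auto simp: override_on_def\<close>)
  ultimately show "wt \<rho> c (LetIn P s (LetIn R t u)) A"
    using assms by (intro wt_LetIn[of _ e' _ B' R \<beta>'] wt_LetIn[of \<rho> e s B P \<beta>]) auto
qed

lemma wt_EX:
  assumes "set_pat P \<inter> fv t = {}" "set_pat R \<inter> fv s = {}" "set_pat P \<inter> set_pat R = {}"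
    and "wt \<rho> c (LetIn P s (LetIn R t u)) A"
  shows "wt \<rho> c (LetIn R t (LetIn P s u)) A"
proof -
  from assms(4) obtain e B \<beta> e' B' \<beta>' where
    s: "wt \<rho> e s B" and "pat_typed P e B \<beta>" "set_pat P \<subseteq> fv t \<union> (fv u - set_pat R)"
    "fv s \<inter> (fv t \<union> (fv u - set_pat R) - set_pat P) = {}"
    and t: "wt (override_on \<rho> \<beta> (set_pat P)) e' t B'" and "pat_typed R e' B' \<beta>'"
    and u: "wt (override_on (override_on \<rho> \<beta> (set_pat P)) \<beta>' (set_pat R)) c u A"
    and "set_pat R \<subseteq> fv u" "fv t \<inter> (fv u - set_pat R) = {}"
    by (elim wt_LetInE) simp
  moreover from s have "wt (override_on \<rho> \<beta>' (set_pat R)) e s B"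
    by (rule wt_cong_env) (use assms in \<open>auto simp: override_on_def\<close>)
  moreover from t have "wt \<rho> e' t B'"
    by (rule wt_cong_env) (use assms in \<open>auto simp: override_on_def\<close>)
  moreover from u have "wt (override_on (override_on \<rho> \<beta>' (set_pat R)) \<beta> (set_pat P)) c u A"
    by (rule wt_cong_env) (use assms in \<open>auto simp: override_on_def\<close>)
  ultimately show ?thesis
    using assms by (intro wt_LetIn[of _ e' _ B' R \<beta>'] wt_LetIn[of _ e s B P \<beta>]) auto
qed

end

context annotated
begin

section \<open>Naming the hole of a one-hole context\<close>

lemma fresh_bv_env:
  assumes "wt \<rho> c t A" "finite X"
  obtains t' where "eqt \<rho> c t t' A" "bv t' \<inter> X = {}" "fv t' = fv t"
  using fresh_bv[OF assms] eqt_fv by metis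

lemma wt_letI:
  assumes "wt \<rho> e s B" "wt (\<rho>(x := (e, B))) c t A" "x \<in> fv t" "fv s \<inter> (fv t - {x}) = {}"
  shows "wt \<rho> c (LetIn (PVar x) s t) A"
proof (rule wt_LetIn[of _ e _ B _ "\<lambda>_. (e, B)"])
  have "override_on \<rho> (\<lambda>_. (e, B)) (set_pat (PVar x)) = \<rho>(x := (e, B))"
    by (auto simp: override_on_def)
  with assms show "wt (override_on \<rho> (\<lambda>_. (e, B)) (set_pat (PVar x))) c t A" by simp
qed (use assms in auto)

lemma wt_letE:
  assumes "wt \<rho> c (LetIn (PVar x) s t) A"
  obtains e B where "wt \<rho> e s B" "wt (\<rho>(x := (e, B))) c t A" "x \<in> fv t" "fv s \<inter> (fv t - {x}) = {}"
proof -
  from assms obtain e B \<beta> where *: "wt \<rho> e s B" "\<beta> x = (e, B)" "wt (override_on \<rho> \<beta> {x}) c t A"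
    "x \<in> fv t" "fv s \<inter> (fv t - {x}) = {}"
    by (elim wt_LetInE) simp
  moreover have "override_on \<rho> \<beta> {x} = \<rho>(x := (e, B))"
    using * by (auto simp: override_on_def)
  ultimately show thesis using that by simp
qed

lemma wt_upd_notin: "x \<notin> fv t \<Longrightarrow> wt (\<rho>(x := a)) c t A \<longleftrightarrow> wt \<rho> c t A"
  by (metis fun_upd_other wt_cong_env)

text \<open>The hole of a one-hole context can be named by a \<open>let\<close>. All commuting conversions below are
  obtained from this by moving \<open>let\<close>s through \<open>let\<close>s.\<close>

definition hole_context :: "('g tm \<Rightarrow> 'g tm) \<Rightarrow> var set \<Rightarrow> bool" where
  "hole_context K F \<longleftrightarrow>
    finite F \<and> (\<forall>t. fv (K t) = F \<union> fv t) \<and>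
    (\<forall>t h. h \<notin> F \<longrightarrow> K t \<simeq> LetIn (PVar h) t (K (V h))) \<and>
    (\<forall>t t'. t \<leadsto> t' \<longrightarrow> K t \<leadsto> K t')"

text \<open>The last assumption provides a variant \<open>C\<close> of \<open>K (V h)\<close> into
  which \<open>t\<close> can be substituted without capture; beta for a plain \<open>let\<close>
  then links the two sides.\<close>

lemma let_holeI:
  assumes "\<And>t. fv (K t) = F \<union> fv t" "h \<notin> F"
    and "\<And>\<rho> c A. wt \<rho> c (K t) A \<Longrightarrow> \<exists>e B. wt \<rho> e t B \<and> F \<inter> fv t = {} \<and> wt (\<rho>(h := (e, B))) c (K (V h)) A"
    and "\<And>\<rho> e B c A. wt \<rho> e t B \<Longrightarrow> F \<inter> fv t = {} \<Longrightarrow> wt (\<rho>(h := (e, B))) c (K (V h)) A \<Longrightarrow> wt \<rho> c (K t) A"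
    and "\<And>\<rho> e B c A. wt \<rho> e t B \<Longrightarrow> wt (\<rho>(h := (e, B))) c (K (V h)) A \<Longrightarrow> wt \<rho> c (K t) A \<Longrightarrow>
      \<exists>C. eqt (\<rho>(h := (e, B))) c (K (V h)) C A \<and> bv C \<inter> fv t = {} \<and> eqt \<rho> c (K t) (subst C (V(h := t))) A"
  shows "K t \<simeq> LetIn (PVar h) t (K (V h))"
proof (rule reqI)
  show "fv (K t) = fv (LetIn (PVar h) t (K (V h)))"
    using assms(1)[of t] assms(1)[of "V h"] assms(2) by auto
  show "wt \<rho> c (LetIn (PVar h) t (K (V h))) A" if "wt \<rho> c (K t) A" for \<rho> c A
    using assms(3)[OF that] assms(1)[of "V h"] by (auto intro!: wt_letI)
  show "wt \<rho> c (K t) A" if w: "wt \<rho> c (LetIn (PVar h) t (K (V h))) A" for \<rho> c A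
    using w
  proof (rule wt_letE)
    fix e B assume "wt \<rho> e t B" "wt (\<rho>(h := (e, B))) c (K (V h)) A" "fv t \<inter> (fv (K (V h)) - {h}) = {}"
    with assms(4) assms(1)[of "V h"] assms(2) show "wt \<rho> c (K t) A" by (simp add: Int_commute)
  qed
  fix \<rho> c A assume K: "wt \<rho> c (K t) A" and w: "wt \<rho> c (LetIn (PVar h) t (K (V h))) A"
  from w obtain e B where e: "wt \<rho> e t B" "wt (\<rho>(h := (e, B))) c (K (V h)) A"
    "fv t \<inter> (fv (K (V h)) - {h}) = {}" "h \<in> fv (K (V h))"
    by (rule wt_letE)
  from assms(5)[OF e(1,2) K] obtain C where C: "eqt (\<rho>(h := (e, B))) c (K (V h)) C A"
    "bv C \<inter> fv t = {}" "eqt \<rho> c (K t) (subst C (V(h := t))) A" by blast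
  have 1: "eqt \<rho> c (LetIn (PVar h) t (K (V h))) (LetIn (PVar h) t C) A"
  proof (rule eqt_LetIn[of _ e _ _ B _ "\<lambda>_. (e, B)"])
    have "override_on \<rho> (\<lambda>_. (e, B)) (set_pat (PVar h)) = \<rho>(h := (e, B))"
      by (auto simp: override_on_def)
    with C show "eqt (override_on \<rho> (\<lambda>_. (e, B)) (set_pat (PVar h))) c (K (V h)) C A" by simp
  qed (use e in \<open>auto intro: eqt_refl\<close>)
  from eqt_trans[OF 1 eqt_beta_let[OF eqt_wt(2)[OF 1] C(2)]] C(3)
  show "eqt \<rho> c (K t) (LetIn (PVar h) t (K (V h))) A"
    by (meson eqt_sym eqt_trans)
qed

lemma hole_Tup1: "hole_context (\<lambda>t. Tup t u) (fv u)"
proof -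
  have "Tup t u \<simeq> LetIn (PVar h) t (Tup (V h) u)" if h: "h \<notin> fv u" for t h
  proof (rule let_holeI[where K = "\<lambda>t. Tup t u" and F = "fv u", OF _ h])
    fix \<rho> c A assume "wt \<rho> c (Tup t u) A"
    then obtain B C where "A = Tens B C" "wt \<rho> c t B" "wt \<rho> c u C" "fv t \<inter> fv u = {}"
      by (elim wt_TupE)
    with h wt_set_ty[of \<rho> c t B] show "\<exists>e B. wt \<rho> e t B \<and> fv u \<inter> fv t = {} \<and> wt (\<rho>(h := (e, B))) c (Tup (V h) u) A"
      by (intro exI[of _ c] exI[of _ B]) (auto intro!: wt_Tup wt_V simp: wt_upd_notin)
  next
    fix \<rho> e B c A assume "wt \<rho> e t B" "fv u \<inter> fv t = {}" "wt (\<rho>(h := (e, B))) c (Tup (V h) u) A"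
    with h show "wt \<rho> c (Tup t u) A"
      by (elim wt_TupE) (auto intro!: wt_Tup simp: wt_upd_notin)
  next
    fix \<rho> e B c A assume "wt (\<rho>(h := (e, B))) c (Tup (V h) u) A" and K: "wt \<rho> c (Tup t u) A"
    then obtain A1 A2 where A: "A = Tens A1 A2" "wt \<rho> c t A1" "wt \<rho> c u A2" "fv t \<inter> fv u = {}"
      "wt (\<rho>(h := (e, B))) c (V h) A1"
      by (elim wt_TupE) simp
    \<comment> \<open>The neighbour of the hole is put into a variant whose bound variables avoid
      those free in \<open>t\<close>, as beta demands.\<close>
    from A(3) obtain u' where u': "eqt \<rho> c u u' A2" "bv u' \<inter> fv t = {}" "fv u' = fv u"
      by (rule fresh_bv_env[of _ _ _ _ "fv t"]) auto
    have "eqt (\<rho>(h := (e, B))) c u u' A2"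
      using u'(1) by (rule eqt_cong_env) (use h in auto)
    then have "eqt (\<rho>(h := (e, B))) c (Tup (V h) u) (Tup (V h) u') A"
      using A h by (auto intro!: eqt_Tup eqt_V)
    moreover have "eqt \<rho> c (Tup t u) (subst (Tup (V h) u') (V(h := t))) A"
      using A u' h by (auto intro!: eqt_Tup eqt_refl)
    ultimately show "\<exists>C. eqt (\<rho>(h := (e, B))) c (Tup (V h) u) C A \<and> bv C \<inter> fv t = {} \<and>
        eqt \<rho> c (Tup t u) (subst C (V(h := t))) A"
      using u'(2) by (intro exI[of _ "Tup (V h) u'"]) auto
  qed auto
  then show ?thesis
    by (auto simp: hole_context_def red_Tup)
qed

lemma hole_Tup2: "hole_context (\<lambda>t. Tup u t) (fv u)"
proof -
  have "Tup u t \<simeq> LetIn (PVar h) t (Tup u (V h))" if h: "h \<notin> fv u" for t h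
  proof (rule let_holeI[where K = "\<lambda>t. Tup u t" and F = "fv u", OF _ h])
    fix \<rho> c A assume "wt \<rho> c (Tup u t) A"
    then obtain B C where "A = Tens C B" "wt \<rho> c t B" "wt \<rho> c u C" "fv u \<inter> fv t = {}"
      by (elim wt_TupE)
    with h wt_set_ty[of \<rho> c t B] show "\<exists>e B. wt \<rho> e t B \<and> fv u \<inter> fv t = {} \<and> wt (\<rho>(h := (e, B))) c (Tup u (V h)) A"
      by (intro exI[of _ c] exI[of _ B]) (auto intro!: wt_Tup wt_V simp: wt_upd_notin)
  next
    fix \<rho> e B c A assume "wt \<rho> e t B" "fv u \<inter> fv t = {}" "wt (\<rho>(h := (e, B))) c (Tup u (V h)) A"
    with h show "wt \<rho> c (Tup u t) A"
      by (elim wt_TupE) (auto intro!: wt_Tup simp: wt_upd_notin)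
  next
    fix \<rho> e B c A assume "wt (\<rho>(h := (e, B))) c (Tup u (V h)) A" and K: "wt \<rho> c (Tup u t) A"
    then obtain A1 A2 where A: "A = Tens A2 A1" "wt \<rho> c t A1" "wt \<rho> c u A2" "fv u \<inter> fv t = {}"
      "wt (\<rho>(h := (e, B))) c (V h) A1"
      by (elim wt_TupE) simp
    from A(3) obtain u' where u': "eqt \<rho> c u u' A2" "bv u' \<inter> fv t = {}" "fv u' = fv u"
      by (rule fresh_bv_env[of _ _ _ _ "fv t"]) auto
    have "eqt (\<rho>(h := (e, B))) c u u' A2"
      using u'(1) by (rule eqt_cong_env) (use h in auto)
    then have "eqt (\<rho>(h := (e, B))) c (Tup u (V h)) (Tup u' (V h)) A"
      using A h by (auto intro!: eqt_Tup eqt_V)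
    moreover have "eqt \<rho> c (Tup u t) (subst (Tup u' (V h)) (V(h := t))) A"
      using A u' h by (auto intro!: eqt_Tup eqt_refl)
    ultimately show "\<exists>C. eqt (\<rho>(h := (e, B))) c (Tup u (V h)) C A \<and> bv C \<inter> fv t = {} \<and>
        eqt \<rho> c (Tup u t) (subst C (V(h := t))) A"
      using u'(2) by (intro exI[of _ "Tup u' (V h)"]) auto
  qed auto
  then show ?thesis
    by (auto simp: hole_context_def red_Tup)
qed

lemma hole_BoxTm: "hole_context (BoxTm d) {}"
proof -
  have "BoxTm d t \<simeq> LetIn (PVar h) t (BoxTm d (V h))" for t h
  proof (rule let_holeI[where F = "{}"])
    fix \<rho> c A assume "wt \<rho> c (BoxTm d t) A"
    then obtain B where "A = BoxTy d B" "wt \<rho> (c + d) t B"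
      by (elim wt_BoxTmE)
    with wt_set_ty[of \<rho> "c + d" t B] show "\<exists>e B. wt \<rho> e t B \<and> {} \<inter> fv t = {} \<and> wt (\<rho>(h := (e, B))) c (BoxTm d (V h)) A"
      by (intro exI[of _ "c + d"] exI[of _ B]) (auto intro!: wt_BoxTm wt_V)
  next
    fix \<rho> e B c A assume "wt \<rho> e t B" "wt (\<rho>(h := (e, B))) c (BoxTm d (V h)) A"
    then show "wt \<rho> c (BoxTm d t) A"
      by (elim wt_BoxTmE) (auto intro!: wt_BoxTm)
  next
    fix \<rho> e B c A assume 1: "wt (\<rho>(h := (e, B))) c (BoxTm d (V h)) A" and K: "wt \<rho> c (BoxTm d t) A"
    then show "\<exists>C. eqt (\<rho>(h := (e, B))) c (BoxTm d (V h)) C A \<and> bv C \<inter> fv t = {} \<and>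
        eqt \<rho> c (BoxTm d t) (subst C (V(h := t))) A"
      using eqt_refl[OF 1] eqt_refl[OF K] by (intro exI[of _ "BoxTm d (V h)"]) simp
  qed auto
  then show ?thesis
    by (auto simp: hole_context_def red_BoxTm)
qed

lemma hole_Delay: "hole_context (Delay d) {}"
proof -
  have "Delay d t \<simeq> LetIn (PVar h) t (Delay d (V h))" for t h
  proof (rule let_holeI[where F = "{}"])
    fix \<rho> c A assume "wt \<rho> c (Delay d t) A"
    then obtain q where "A = Qubit q" "wt \<rho> (c - d) t (Qubit q)" "0 \<le> d"
      by (elim wt_DelayE)
    with wt_set_ty[of \<rho> "c - d" t "Qubit q"] show "\<exists>e B. wt \<rho> e t B \<and> {} \<inter> fv t = {} \<and> wt (\<rho>(h := (e, B))) c (Delay d (V h)) A"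
      by (intro exI[of _ "c - d"] exI[of _ "Qubit q"]) (auto intro!: wt_Delay wt_V)
  next
    fix \<rho> e B c A assume "wt \<rho> e t B" "wt (\<rho>(h := (e, B))) c (Delay d (V h)) A"
    then show "wt \<rho> c (Delay d t) A"
      by (elim wt_DelayE) (auto intro!: wt_Delay)
  next
    fix \<rho> e B c A assume 1: "wt (\<rho>(h := (e, B))) c (Delay d (V h)) A" and K: "wt \<rho> c (Delay d t) A"
    then show "\<exists>C. eqt (\<rho>(h := (e, B))) c (Delay d (V h)) C A \<and> bv C \<inter> fv t = {} \<and>
        eqt \<rho> c (Delay d t) (subst C (V(h := t))) A"
      using eqt_refl[OF 1] eqt_refl[OF K] by (intro exI[of _ "Delay d (V h)"]) simp
  qed auto
  then show ?thesis
    by (auto simp: hole_context_def red_Delay)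
qed

lemma fv_Gate_nth: "fv (Gate g ts) = (\<Union>j<length ts. fv (ts ! j))"
proof -
  have "set ts = (!) ts ` {..<length ts}"
    by (simp add: nth_image lessThan_atLeast0)
  then show ?thesis by (metis fv.simps(3) image_image set_map)
qed

lemma fv_Gate_update:
  assumes "i < length ts"
  shows "fv (Gate g (ts[i := t])) = (\<Union>j \<in> {..<length ts} - {i}. fv (ts ! j)) \<union> fv t"
proof -
  have *: "(\<Union>j<n. F j) = (\<Union>j \<in> {..<n} - {i}. F j) \<union> F i" if "i < n" for n and F :: "nat \<Rightarrow> var set"
  proof -
    have "insert i ({..<n} - {i}) = {..<n}" by (rule insert_Diff) (simp add: that)
    from UN_insert[of F i "{..<n} - {i}", unfolded this] show ?thesis by (simp only: Un_commute)
  qed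
  have "(\<Union>j \<in> {..<length ts} - {i}. fv (ts[i := t] ! j)) = (\<Union>j \<in> {..<length ts} - {i}. fv (ts ! j))"
    by (intro SUP_cong refl) simp
  then show ?thesis
    unfolding fv_Gate_nth length_list_update *[OF assms] using assms by (simp only: nth_list_update_eq)
qed

lemma pairwise_disjoint_update:
  assumes "i < length ts"
  shows "pairwise_disjoint (ts[i := t]) \<longleftrightarrow>
    (\<forall>j < length ts. j \<noteq> i \<longrightarrow> fv (ts ! j) \<inter> fv t = {}) \<and>
    (\<forall>j < length ts. \<forall>k < length ts. j \<noteq> i \<longrightarrow> k \<noteq> i \<longrightarrow> j \<noteq> k \<longrightarrow> fv (ts ! j) \<inter> fv (ts ! k) = {})"
    (is "?L \<longleftrightarrow> ?A \<and> ?B")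
proof
  assume L: ?L
  have "fv (ts ! j) \<inter> fv t = {}" if "j < length ts" "j \<noteq> i" for j
    using L that assms unfolding pairwise_disjoint_def by (metis length_list_update nth_list_update_eq nth_list_update_neq)
  moreover have "fv (ts ! j) \<inter> fv (ts ! k) = {}"
    if "j < length ts" "k < length ts" "j \<noteq> i" "k \<noteq> i" "j \<noteq> k" for j k
    using L that assms unfolding pairwise_disjoint_def by (metis length_list_update nth_list_update_neq)
  ultimately show "?A \<and> ?B" by simp
next
  assume R: "?A \<and> ?B"
  show ?L
    unfolding pairwise_disjoint_def length_list_update
  proof (intro allI impI)
    fix j k assume jk: "j < length ts" "k < length ts" "j \<noteq> k"
    show "fv (ts[i := t] ! j) \<inter> fv (ts[i := t] ! k) = {}"
    proof (cases "j = i")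
      case True
      then have "fv (ts ! k) \<inter> fv t = {}" using R jk by simp
      with True jk show ?thesis by (simp add: Int_commute)
    next
      case False
      with R jk show ?thesis by (cases "k = i") simp_all
    qed
  qed
qed

lemma hole_Gate:
  assumes i: "i < length ts"
  shows "hole_context (\<lambda>t. Gate g (ts[i := t])) (\<Union>j \<in> {..<length ts} - {i}. fv (ts ! j))"
proof -
  let ?F = "\<Union>j \<in> {..<length ts} - {i}. fv (ts ! j)" and ?K = "\<lambda>t. Gate g (ts[i := t])"
  have fv: "fv (?K t) = ?F \<union> fv t" for t
    by (rule fv_Gate_update[OF i])
  let ?d = "duration S g"
  have inv: "g \<in> gates S \<and> length ts = length (wires S g) \<and> A = tensor_ty (wires S g) \<and>
      pairwise_disjoint (ts[i := t]) \<and> wt \<rho> (c - ?d) t (Qubit (wires S g ! i)) \<and>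
      (\<forall>j < length ts. j \<noteq> i \<longrightarrow> wt \<rho> (c - ?d) (ts ! j) (Qubit (wires S g ! j)))"
    if "wt \<rho> c (?K t) A" for \<rho> c t A
    using that
  proof (rule wt_GateE, goal_cases)
    case 1
    then have *: "wt \<rho> (c - ?d) (ts[i := t] ! j) (Qubit (wires S g ! j))" if "j < length ts" for j
      using that by simp
    from *[OF i] have "wt \<rho> (c - ?d) t (Qubit (wires S g ! i))" using i by simp
    moreover have "wt \<rho> (c - ?d) (ts ! j) (Qubit (wires S g ! j))" if "j < length ts" "j \<noteq> i" for j
      using *[OF that(1)] that(2) by simp
    ultimately show ?case using 1 by simp
  qed
  have intr: "wt \<rho> c (?K t) A"
    if "g \<in> gates S" "length ts = length (wires S g)" "A = tensor_ty (wires S g)"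
      "pairwise_disjoint (ts[i := t])" "wt \<rho> (c - ?d) t (Qubit (wires S g ! i))"
      "\<forall>j < length ts. j \<noteq> i \<longrightarrow> wt \<rho> (c - ?d) (ts ! j) (Qubit (wires S g ! j))" for \<rho> c t A
  proof (rule wt_Gate)
    show "\<forall>j < length (ts[i := t]). wt \<rho> (c - ?d) (ts[i := t] ! j) (Qubit (wires S g ! j))"
    proof (intro allI impI)
      fix j assume "j < length (ts[i := t])"
      with that show "wt \<rho> (c - ?d) (ts[i := t] ! j) (Qubit (wires S g ! j))"
        by (cases "j = i") simp_all
    qed
  qed (use that in simp_all)
  have "?K t \<simeq> LetIn (PVar h) t (?K (V h))" if h: "h \<notin> ?F" for t h
  proof (rule let_holeI[where K = ?K and F = ?F, OF fv h])
    have hj: "h \<notin> fv (ts ! j)" if "j < length ts" "j \<noteq> i" for j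
      using h that by simp
    fix \<rho> c A assume "wt \<rho> c (?K t) A"
    note K = inv[OF this]
    then have t: "wt \<rho> (c - ?d) t (Qubit (wires S g ! i))" by (elim conjE)
    have dis: "?F \<inter> fv t = {}"
    proof -
      have "fv (ts ! j) \<inter> fv t = {}" if "j < length ts" "j \<noteq> i" for j
        using K that unfolding pairwise_disjoint_update[OF i] by simp
      then show ?thesis by auto
    qed
    let ?\<rho> = "\<rho>(h := (c - ?d, Qubit (wires S g ! i)))"
    have "wt ?\<rho> c (?K (V h)) A"
    proof (rule intr)
      show "pairwise_disjoint (ts[i := V h])"
        using K hj unfolding pairwise_disjoint_update[OF i] by simp
      show "wt ?\<rho> (c - ?d) (V h) (Qubit (wires S g ! i))"
        using wt_set_ty[OF t] by (intro wt_V) simp_all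
      show "\<forall>j < length ts. j \<noteq> i \<longrightarrow> wt ?\<rho> (c - ?d) (ts ! j) (Qubit (wires S g ! j))"
        using K hj by (simp add: wt_upd_notin)
    qed (use K in simp_all)
    with t dis show "\<exists>e B. wt \<rho> e t B \<and> ?F \<inter> fv t = {} \<and> wt (\<rho>(h := (e, B))) c (?K (V h)) A"
      by (intro exI conjI)
  next
    have hj: "h \<notin> fv (ts ! j)" if "j < length ts" "j \<noteq> i" for j
      using h that by simp
    fix \<rho> e B c A assume t: "wt \<rho> e t B" and dis: "?F \<inter> fv t = {}" and "wt (\<rho>(h := (e, B))) c (?K (V h)) A"
    note K = inv[OF this(3)]
    then have "wt (\<rho>(h := (e, B))) (c - ?d) (V h) (Qubit (wires S g ! i))" by (elim conjE)
    then have eB: "e = c - ?d" "B = Qubit (wires S g ! i)" by (auto elim: wt_VE)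
    show "wt \<rho> c (?K t) A"
    proof (rule intr)
      show "\<forall>j < length ts. j \<noteq> i \<longrightarrow> wt \<rho> (c - ?d) (ts ! j) (Qubit (wires S g ! j))"
        using K hj by (simp add: wt_upd_notin)
      have "fv (ts ! j) \<inter> fv t = {}" if "j < length ts" "j \<noteq> i" for j
        using dis that by auto
      then show "pairwise_disjoint (ts[i := t])"
        using K unfolding pairwise_disjoint_update[OF i] by simp
    qed (use K t eB in simp_all)
  next
    fix \<rho> e B c A assume 1: "wt (\<rho>(h := (e, B))) c (?K (V h)) A" and K: "wt \<rho> c (?K t) A"
    note K' = inv[OF K] and h' = inv[OF 1]
    have "\<forall>j. \<exists>u. j < length ts \<longrightarrow> j \<noteq> i \<longrightarrow>
        eqt \<rho> (c - ?d) (ts ! j) u (Qubit (wires S g ! j)) \<and> bv u \<inter> fv t = {}"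
    proof
      fix j
      show "\<exists>u. j < length ts \<longrightarrow> j \<noteq> i \<longrightarrow>
          eqt \<rho> (c - ?d) (ts ! j) u (Qubit (wires S g ! j)) \<and> bv u \<inter> fv t = {}"
      proof (cases "j < length ts \<and> j \<noteq> i")
        case True
        with K' have "wt \<rho> (c - ?d) (ts ! j) (Qubit (wires S g ! j))" by simp
        from fresh_bv[OF this, of "fv t"] show ?thesis by auto
      qed auto
    qed
    then obtain f where f: "eqt \<rho> (c - ?d) (ts ! j) (f j) (Qubit (wires S g ! j))" "bv (f j) \<inter> fv t = {}"
      if "j < length ts" "j \<noteq> i" for j
      by metis
    \<comment> \<open>As for pairs, every argument outside the hole is exchanged for a variant that
      cannot capture variables of \<open>t\<close>.\<close>
    let ?us = "\<lambda>v. map (\<lambda>j. if j = i then v else f j) [0..<length ts]"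
    have hf: "h \<notin> fv (f j)" if "j < length ts" "j \<noteq> i" for j
    proof -
      have "h \<notin> fv (ts ! j)" using h that by simp
      then show ?thesis using eqt_fv[OF f(1)[OF that]] by simp
    qed
    have "eqt (\<rho>(h := (e, B))) c (?K (V h)) (Gate g (?us (V h))) A"
    proof (rule eqt_Gate)
      show "\<forall>j < length (ts[i := V h]). eqt (\<rho>(h := (e, B))) (c - ?d) (ts[i := V h] ! j) (?us (V h) ! j) (Qubit (wires S g ! j))"
      proof (intro allI impI)
        fix j assume "j < length (ts[i := V h])"
        then have j: "j < length ts" by simp
        show "eqt (\<rho>(h := (e, B))) (c - ?d) (ts[i := V h] ! j) (?us (V h) ! j) (Qubit (wires S g ! j))"
        proof (cases "j = i")
          case True
          then show ?thesis using h' j by (simp add: eqt_refl)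
        next
          case False
          have "h \<notin> fv (ts ! j)" using h j False by simp
          with False j eqt_cong_env[OF f(1)[OF j False], of "\<rho>(h := (e, B))"] show ?thesis by auto
        qed
      qed
    qed (use h' in simp_all)
    moreover have "eqt \<rho> c (?K t) (Gate g (?us t)) A"
    proof (rule eqt_Gate)
      show "\<forall>j < length (ts[i := t]). eqt \<rho> (c - ?d) (ts[i := t] ! j) (?us t ! j) (Qubit (wires S g ! j))"
      proof (intro allI impI)
        fix j assume "j < length (ts[i := t])"
        then have j: "j < length ts" by simp
        show "eqt \<rho> (c - ?d) (ts[i := t] ! j) (?us t ! j) (Qubit (wires S g ! j))"
          using K' f(1)[OF j] j by (cases "j = i") (simp_all add: eqt_refl)
      qed
    qed (use K' in simp_all)
    moreover have "subst (Gate g (?us (V h))) (V(h := t)) = Gate g (?us t)"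
      using hf by simp
    moreover have "bv u \<inter> fv t = {}" if "u \<in> set (?us (V h))" for u
    proof -
      from that obtain j where "j < length ts" "u = (if j = i then V h else f j)" by auto
      then show ?thesis using f(2)[of j] by (cases "j = i") simp_all
    qed
    then have "bv (Gate g (?us (V h))) \<inter> fv t = {}" by (simp only: bv.simps set_map) blast
    ultimately show "\<exists>C. eqt (\<rho>(h := (e, B))) c (?K (V h)) C A \<and> bv C \<inter> fv t = {} \<and>
        eqt \<rho> c (?K t) (subst C (V(h := t))) A"
      by (intro exI[of _ "Gate g (?us (V h))"] conjI) (simp_all only:)
  qed
  moreover have "?K t \<leadsto> ?K t'" if "t \<leadsto> t'" for t t'
  proof (rule red_Gate)
    fix j assume "j < length (ts[i := t])"
    with that show "ts[i := t] ! j \<leadsto> ts[i := t'] ! j" by (cases "j = i") simp_all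
  qed simp
  moreover have "finite ?F" by simp
  ultimately show ?thesis
    unfolding hole_context_def using fv by simp
qed

lemma hole_scrut: "hole_context (\<lambda>t. LetIn R t u) (fv u - set_pat R)"
proof -
  let ?K = "\<lambda>t. LetIn R t u" and ?F = "fv u - set_pat R"
  have "?K t \<simeq> LetIn (PVar h) t (?K (V h))" if h: "h \<notin> ?F" for t h
  proof (rule let_holeI[where K = ?K and F = ?F, OF _ h])
    fix \<rho> c A assume "wt \<rho> c (?K t) A"
    then obtain e B \<beta> where w: "wt \<rho> e t B" "pat_typed R e B \<beta>" "wt (override_on \<rho> \<beta> (set_pat R)) c u A"
      "set_pat R \<subseteq> fv u" "fv t \<inter> (fv u - set_pat R) = {}"
      by (elim wt_LetInE)
    have "wt (override_on (\<rho>(h := (e, B))) \<beta> (set_pat R)) c u A"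
      using w(3) by (rule wt_cong_env) (use h in \<open>auto simp: override_on_def\<close>)
    with w h have "wt (\<rho>(h := (e, B))) c (?K (V h)) A"
      by (intro wt_LetIn[of _ e _ B _ \<beta>] wt_V wt_set_ty[OF w(1)]) auto
    moreover have "?F \<inter> fv t = {}" using w(5) by (simp only: Int_commute)
    ultimately show "\<exists>e B. wt \<rho> e t B \<and> ?F \<inter> fv t = {} \<and> wt (\<rho>(h := (e, B))) c (?K (V h)) A"
      using w(1) by (intro exI conjI)
  next
    fix \<rho> e B c A assume t: "wt \<rho> e t B" "?F \<inter> fv t = {}" and "wt (\<rho>(h := (e, B))) c (?K (V h)) A"
    then obtain \<beta> where w: "pat_typed R e B \<beta>" "wt (override_on (\<rho>(h := (e, B))) \<beta> (set_pat R)) c u A"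
      "set_pat R \<subseteq> fv u"
      by (elim wt_LetInE wt_VE) simp
    have "wt (override_on \<rho> \<beta> (set_pat R)) c u A"
      using w(2) by (rule wt_cong_env) (use h in \<open>auto simp: override_on_def\<close>)
    with w t show "wt \<rho> c (?K t) A"
      by (intro wt_LetIn[of _ e _ B _ \<beta>]) auto
  next
    fix \<rho> e B c A assume t: "wt \<rho> e t B" and wh: "wt (\<rho>(h := (e, B))) c (?K (V h)) A" and K: "wt \<rho> c (?K t) A"
    from wh obtain \<beta> where w: "pat_typed R e B \<beta>" "wt (override_on (\<rho>(h := (e, B))) \<beta> (set_pat R)) c u A"
      "set_pat R \<subseteq> fv u"
      by (elim wt_LetInE wt_VE) simp
    have u: "wt (override_on \<rho> \<beta> (set_pat R)) c u A"
      using w(2) by (rule wt_cong_env) (use h in \<open>auto simp: override_on_def\<close>)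
    from K have dis: "fv t \<inter> ?F = {}" by (elim wt_LetInE)
    from u obtain u' where u': "eqt (override_on \<rho> \<beta> (set_pat R)) c u u' A" "bv u' \<inter> (fv t \<union> {h}) = {}" "fv u' = fv u"
      by (rule fresh_bv_env[of _ _ _ _ "fv t \<union> {h}"]) auto
    have "finite (fv t \<union> {h})" by simp
    \<comment> \<open>Besides the binders inside \<open>u\<close>, the pattern \<open>R\<close>
      itself may bind \<open>h\<close> or a variable of \<open>t\<close>, so it has to be renamed as
      well.\<close>
    from fresh_pat[OF this u'(2)] obtain R' u'' where
      R': "set_pat R' \<inter> (fv t \<union> {h}) = {}" "bv u'' \<inter> (fv t \<union> {h}) = {}" "\<And>s. LetIn R s u' \<leadsto> LetIn R' s u''"
      by blast
    have 1: "eqt \<rho> c (?K t) (LetIn R t u') A"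
      using t w u' dis by (intro eqt_LetIn[of _ e _ _ B _ \<beta>] eqt_refl) auto
    have "eqt (override_on (\<rho>(h := (e, B))) \<beta> (set_pat R)) c u u' A"
      using u'(1) by (rule eqt_cong_env) (use h in \<open>auto simp: override_on_def\<close>)
    then have 2: "eqt (\<rho>(h := (e, B))) c (?K (V h)) (LetIn R (V h) u') A"
      using w h u' wt_set_ty[OF t] by (intro eqt_LetIn[of _ e _ _ B _ \<beta>] eqt_V) auto
    have hu: "h \<notin> fv u''"
    proof -
      have "fv (LetIn R Star u') = fv (LetIn R' Star u'')" using R'(3) red_fv by blast
      then show ?thesis using R'(1) u'(3) h by auto
    qed
    have "subst (LetIn R' (V h) u'') (V(h := t)) = LetIn R' t u''"
      using hu R'(1) by (subst subst_LetIn_upd) auto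
    moreover have "bv (LetIn R' (V h) u'') \<inter> fv t = {}" using R' by auto
    moreover have "eqt (\<rho>(h := (e, B))) c (?K (V h)) (LetIn R' (V h) u'') A"
      using eqt_trans[OF 2 red_eqt[OF R'(3) eqt_wt(2)[OF 2]]] .
    moreover have "eqt \<rho> c (?K t) (LetIn R' t u'') A"
      using eqt_trans[OF 1 red_eqt[OF R'(3) eqt_wt(2)[OF 1]]] .
    ultimately show "\<exists>C. eqt (\<rho>(h := (e, B))) c (?K (V h)) C A \<and> bv C \<inter> fv t = {} \<and>
        eqt \<rho> c (?K t) (subst C (V(h := t))) A"
      by (intro exI[of _ "LetIn R' (V h) u''"]) simp
  qed auto
  then show ?thesis
    by (auto simp: hole_context_def intro: red_LetIn)
qed

end

primrec pat_tm :: "var pat \<Rightarrow> 'g tm" where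
  "pat_tm (PVar x) = V x"
| "pat_tm PUnit = Star"
| "pat_tm (PPair x y) = Tup (V x) (V y)"
| "pat_tm (PBox d x) = BoxTm d (V x)"

lemma fv_pat_tm [simp]: "fv (pat_tm P) = set_pat P"
  by (cases P) auto

text \<open>Distinctness is asked of the new pattern only; that of the old one follows from
  typing.\<close>

fun renaming_of :: "var pat \<Rightarrow> var pat \<Rightarrow> bool" where
  "renaming_of (PVar x) (PVar x') \<longleftrightarrow> True"
| "renaming_of PUnit PUnit \<longleftrightarrow> True"
| "renaming_of (PPair x y) (PPair x' y') \<longleftrightarrow> x' \<noteq> y'"
| "renaming_of (PBox d x) (PBox d' x') \<longleftrightarrow> d = d'"
| "renaming_of _ _ \<longleftrightarrow> False"

lemma override_on_upd:
  "x \<notin> X \<Longrightarrow> override_on (\<rho>(x := a)) \<beta> X = (override_on \<rho> \<beta> X)(x := a)"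
  by (auto simp: override_on_def)

lemma ex_fresh: "finite X \<Longrightarrow> \<exists>x :: nat. x \<notin> X"
  by (meson ex_new_if_finite infinite_UNIV_nat)

context annotated
begin

section \<open>Commuting conversions for all pairs of patterns\<close>

lemma eqt_letI:
  assumes "eqt \<rho> e s s' B" "eqt (\<rho>(x := (e, B))) c t t' A" "x \<in> fv t" "fv s \<inter> (fv t - {x}) = {}"
  shows "eqt \<rho> c (LetIn (PVar x) s t) (LetIn (PVar x) s' t') A"
proof (rule eqt_LetIn[of _ e _ _ B _ "\<lambda>_. (e, B)"])
  have "override_on \<rho> (\<lambda>_. (e, B)) (set_pat (PVar x)) = \<rho>(x := (e, B))"
    by (auto simp: override_on_def)
  with assms show "eqt (override_on \<rho> (\<lambda>_. (e, B)) (set_pat (PVar x))) c t t' A" by simp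
qed (use assms in auto)

text \<open>By beta both sides become \<open>C\<close> with \<open>t[x := s]\<close> in place of
  \<open>h\<close>. The work lies in variants of \<open>t\<close> and \<open>C\<close> for which
  none of the substitutions captures.\<close>

lemma let_let:
  assumes x: "x \<notin> fv C - {h}"
  shows "LetIn (PVar x) s (LetIn (PVar h) t C) \<simeq> LetIn (PVar h) (LetIn (PVar x) s t) C"
proof (rule reqI)
  show "fv (LetIn (PVar x) s (LetIn (PVar h) t C)) = fv (LetIn (PVar h) (LetIn (PVar x) s t) C)"
    using x by auto
  have CC: "wt \<rho> c (LetIn (PVar x) s (LetIn (PVar h) t C)) A \<longleftrightarrow> wt \<rho> c (LetIn (PVar h) (LetIn (PVar x) s t) C) A" for \<rho> c A
    by (rule wt_CC) (use x in simp)
  show "wt \<rho> c (LetIn (PVar h) (LetIn (PVar x) s t) C) A" if "wt \<rho> c (LetIn (PVar x) s (LetIn (PVar h) t C)) A" for \<rho> c A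
    using that CC by metis
  show "wt \<rho> c (LetIn (PVar x) s (LetIn (PVar h) t C)) A" if "wt \<rho> c (LetIn (PVar h) (LetIn (PVar x) s t) C) A" for \<rho> c A
    using that CC by metis
  fix \<rho> c A assume l: "wt \<rho> c (LetIn (PVar x) s (LetIn (PVar h) t C)) A"
    and r: "wt \<rho> c (LetIn (PVar h) (LetIn (PVar x) s t) C) A"
  from r obtain e' B' where r': "wt \<rho> e' (LetIn (PVar x) s t) B'" "wt (\<rho>(h := (e', B'))) c C A" "h \<in> fv C"
    "fv (LetIn (PVar x) s t) \<inter> (fv C - {h}) = {}"
    by (rule wt_letE)
  from r'(1) obtain e B where t: "wt \<rho> e s B" "wt (\<rho>(x := (e, B))) e' t B'" "x \<in> fv t" "fv s \<inter> (fv t - {x}) = {}"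
    by (rule wt_letE)
  from t(2) obtain t' where t': "eqt (\<rho>(x := (e, B))) e' t t' B'" "bv t' \<inter> fv s = {}" "fv t' = fv t"
    by (rule fresh_bv_env[of _ _ _ _ "fv s"]) auto
  from r'(2) obtain C' where C': "eqt (\<rho>(h := (e', B'))) c C C' A" "bv C' \<inter> (fv s \<union> fv t) = {}" "fv C' = fv C"
    by (rule fresh_bv_env[of _ _ _ _ "fv s \<union> fv t"]) auto
  let ?t = "subst t' (V(x := s))"
  have fvt: "fv ?t = fv s \<union> (fv t - {x})"
    using fv_subst_upd[OF t'(2)] t(3) t'(3) by simp
  have 1: "eqt \<rho> e' (LetIn (PVar x) s t) (LetIn (PVar x) s t') B'"
    using t t' by (intro eqt_letI eqt_refl)
  have 2: "eqt \<rho> e' (LetIn (PVar x) s t) ?t B'"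
    using eqt_trans[OF 1 eqt_beta_let[OF eqt_wt(2)[OF 1] t'(2)]] .
  have 3: "eqt \<rho> c (LetIn (PVar h) (LetIn (PVar x) s t) C) (LetIn (PVar h) ?t C') A"
    using 2 C'(1) r'(3,4) by (rule eqt_letI)
  have R: "eqt \<rho> c (LetIn (PVar h) (LetIn (PVar x) s t) C) (subst C' (V(h := ?t))) A"
  proof (rule eqt_trans[OF 3 eqt_beta_let[OF eqt_wt(2)[OF 3]]])
    show "bv C' \<inter> fv ?t = {}" using C'(2) fvt by auto
  qed
  have 4: "eqt (\<rho>(x := (e, B))) c (LetIn (PVar h) t C) (LetIn (PVar h) t' C') A"
  proof (rule eqt_letI[OF t'(1) _ r'(3)])
    show "eqt (\<rho>(x := (e, B), h := (e', B'))) c C C' A"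
      using C'(1) by (rule eqt_cong_env) (use x in auto)
    show "fv t \<inter> (fv C - {h}) = {}" using r'(4) x by auto
  qed
  have 5: "eqt (\<rho>(x := (e, B))) c (LetIn (PVar h) t C) (subst C' (V(h := t'))) A"
    by (rule eqt_trans[OF 4 eqt_beta_let[OF eqt_wt(2)[OF 4]]]) (use C'(2) t'(3) in auto)
  have 6: "eqt \<rho> c (LetIn (PVar x) s (LetIn (PVar h) t C)) (LetIn (PVar x) s (subst C' (V(h := t')))) A"
    using eqt_refl[OF t(1)] 5 by (rule eqt_letI) (use t(3,4) r'(4) x in auto)
  have L: "eqt \<rho> c (LetIn (PVar x) s (LetIn (PVar h) t C)) (subst (subst C' (V(h := t'))) (V(x := s))) A"
  proof (rule eqt_trans[OF 6 eqt_beta_let[OF eqt_wt(2)[OF 6]]])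
    show "bv (subst C' (V(h := t'))) \<inter> fv s = {}"
      using bv_subst_upd[of C' h t'] C'(2) t'(2) by auto
  qed
  \<comment> \<open>Apart from \<open>h\<close>, no free variable of \<open>C\<close> is
    \<open>x\<close>, so the outer substitution acts only inside the term put in for
    \<open>h\<close>.\<close>
  have "subst (subst C' (V(h := t'))) (V(x := s)) = subst C' (\<lambda>z. subst ((V(h := t')) z) (V(x := s)))"
    by (rule subst_subst, rule capture_free_upd) (use C'(2) t'(3) in auto)
  also have "\<dots> = subst C' (V(h := ?t))"
    by (rule subst_cong_fv) (use x C'(3) in auto)
  finally show "eqt \<rho> c (LetIn (PVar x) s (LetIn (PVar h) t C)) (LetIn (PVar h) (LetIn (PVar x) s t) C) A"
    using L R by (metis eqt_sym eqt_trans)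
qed

text \<open>\<open>x\<close> does not occur in \<open>r\<close>, so on both sides beta only replaces
  \<open>x\<close> by \<open>s\<close> in the body \<open>t\<close> of the match on
  \<open>r\<close>.\<close>

lemma let_exchange:
  assumes x: "x \<notin> fv r" "x \<notin> set_pat R" and R: "set_pat R \<inter> fv s = {}"
  shows "LetIn (PVar x) s (LetIn R r t) \<simeq> LetIn R r (LetIn (PVar x) s t)"
proof (rule reqI)
  show "fv (LetIn (PVar x) s (LetIn R r t)) = fv (LetIn R r (LetIn (PVar x) s t))"
    using assms by auto
  show "wt \<rho> c (LetIn R r (LetIn (PVar x) s t)) A" if "wt \<rho> c (LetIn (PVar x) s (LetIn R r t)) A" for \<rho> c A
    using that by (rule wt_EX[rotated 3]) (use assms in auto)
  show "wt \<rho> c (LetIn (PVar x) s (LetIn R r t)) A" if "wt \<rho> c (LetIn R r (LetIn (PVar x) s t)) A" for \<rho> c A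
    using that by (rule wt_EX[rotated 3]) (use assms in auto)
  fix \<rho> c A assume l: "wt \<rho> c (LetIn (PVar x) s (LetIn R r t)) A"
  from l obtain e B where s: "wt \<rho> e s B" "wt (\<rho>(x := (e, B))) c (LetIn R r t) A" "x \<in> fv (LetIn R r t)"
    "fv s \<inter> (fv (LetIn R r t) - {x}) = {}"
    by (rule wt_letE)
  from s(2) obtain e' B' \<beta> where r: "wt (\<rho>(x := (e, B))) e' r B'" "pat_typed R e' B' \<beta>"
    "wt (override_on (\<rho>(x := (e, B))) \<beta> (set_pat R)) c t A" "set_pat R \<subseteq> fv t" "fv r \<inter> (fv t - set_pat R) = {}"
    by (elim wt_LetInE)
  have r1: "wt \<rho> e' r B'" using r(1) x(1) by (simp add: wt_upd_notin)
  have t1: "wt ((override_on \<rho> \<beta> (set_pat R))(x := (e, B))) c t A"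
    using r(3) x(2) by (simp add: override_on_upd)
  from r1 obtain r' where r': "eqt \<rho> e' r r' B'" "bv r' \<inter> fv s = {}" "fv r' = fv r"
    by (rule fresh_bv_env[of _ _ _ _ "fv s"]) auto
  from t1 obtain t' where t': "eqt ((override_on \<rho> \<beta> (set_pat R))(x := (e, B))) c t t' A" "bv t' \<inter> fv s = {}" "fv t' = fv t"
    by (rule fresh_bv_env[of _ _ _ _ "fv s"]) auto
  have xt: "x \<in> fv t" using s(3) x by auto
  have 1: "eqt (\<rho>(x := (e, B))) c (LetIn R r t) (LetIn R r' t') A"
  proof (rule eqt_LetIn[OF _ r(2) _ r(4,5)])
    show "eqt (\<rho>(x := (e, B))) e' r r' B'"
      using r'(1) by (rule eqt_cong_env) (use x in auto)
    show "eqt (override_on (\<rho>(x := (e, B))) \<beta> (set_pat R)) c t t' A"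
      using t'(1) x by (simp add: override_on_upd)
  qed
  have 2: "eqt \<rho> c (LetIn (PVar x) s (LetIn R r t)) (LetIn (PVar x) s (LetIn R r' t')) A"
    using eqt_refl[OF s(1)] 1 s(3,4) by (rule eqt_letI)
  have L: "eqt \<rho> c (LetIn (PVar x) s (LetIn R r t)) (subst (LetIn R r' t') (V(x := s))) A"
    by (rule eqt_trans[OF 2 eqt_beta_let[OF eqt_wt(2)[OF 2]]]) (use r'(2) t'(2) R in auto)
  have eq: "subst (LetIn R r' t') (V(x := s)) = LetIn R r' (subst t' (V(x := s)))"
    using x r'(3) by (subst subst_LetIn_upd) simp_all
  have s1: "wt (override_on \<rho> \<beta> (set_pat R)) e s B"
    using s(1) by (rule wt_cong_env) (use R in \<open>auto simp: override_on_def\<close>)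
  have st: "fv s \<inter> (fv t - {x}) = {}" using s(4) R x by auto
  have 3: "eqt (override_on \<rho> \<beta> (set_pat R)) c (LetIn (PVar x) s t) (LetIn (PVar x) s t') A"
    using eqt_refl[OF s1] t'(1) xt st by (rule eqt_letI)
  have 4: "eqt (override_on \<rho> \<beta> (set_pat R)) c (LetIn (PVar x) s t) (subst t' (V(x := s))) A"
    by (rule eqt_trans[OF 3 eqt_beta_let[OF eqt_wt(2)[OF 3] t'(2)]])
  have "eqt \<rho> c (LetIn R r (LetIn (PVar x) s t)) (LetIn R r' (subst t' (V(x := s)))) A"
    using r'(1) r(2) 4
  proof (rule eqt_LetIn)
    show "set_pat R \<subseteq> fv (LetIn (PVar x) s t)" using r(4) x by auto
    show "fv r \<inter> (fv (LetIn (PVar x) s t) - set_pat R) = {}" using r(5) s(4) x by auto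
  qed
  with L show "eqt \<rho> c (LetIn (PVar x) s (LetIn R r t)) (LetIn R r (LetIn (PVar x) s t)) A"
    unfolding eq by (meson eqt_sym eqt_trans)
qed

text \<open>Pairing with the unit value makes a \<open>let\<close> of a variable an instance of a \<open>let\<close> of a pair, to which
  the commuting conversions of the language apply.\<close>

lemma let_as_pair:
  assumes v: "v \<notin> fv u" "v \<noteq> y"
  shows "LetIn (PVar y) t u \<simeq> LetIn (PPair y v) (Tup t Star) (LetIn PUnit (V v) u)"
proof (rule reqI)
  let ?r = "LetIn (PPair y v) (Tup t Star) (LetIn PUnit (V v) u)"
  show fv: "fv (LetIn (PVar y) t u) = fv ?r" using v by auto
  show tr: "wt \<rho> c ?r A" if "wt \<rho> c (LetIn (PVar y) t u) A" for \<rho> c A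
    using that
  proof (rule wt_letE)
    fix e B assume w: "wt \<rho> e t B" "wt (\<rho>(y := (e, B))) c u A" "y \<in> fv u" "fv t \<inter> (fv u - {y}) = {}"
    let ?\<beta> = "(\<lambda>_. (e, One))(y := (e, B))"
    let ?\<rho> = "override_on \<rho> ?\<beta> (set_pat (PPair y v))"
    have "wt ?\<rho> c u A"
      using w(2) by (rule wt_cong_env) (use v in \<open>auto simp: override_on_def\<close>)
    then have "wt ?\<rho> c (LetIn PUnit (V v) u) A"
      using v by (intro wt_LetIn[of _ e _ One _ ?\<beta>] wt_V) auto
    then show "wt \<rho> c ?r A"
      using w v by (intro wt_LetIn[of \<rho> e _ "Tens B One" _ ?\<beta>] wt_Tup wt_Star) auto
  qed
  show "wt \<rho> c (LetIn (PVar y) t u) A" if "wt \<rho> c ?r A" for \<rho> c A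
  proof -
    from that obtain e A' \<beta> where w: "wt \<rho> e (Tup t Star) A'" "pat_typed (PPair y v) e A' \<beta>"
      "wt (override_on \<rho> \<beta> {y, v}) c (LetIn PUnit (V v) u) A" "set_pat (PPair y v) \<subseteq> fv (LetIn PUnit (V v) u)"
      "fv (Tup t Star) \<inter> (fv (LetIn PUnit (V v) u) - set_pat (PPair y v)) = {}"
      by (rule wt_LetInE) (simp del: pat_typed.simps fv.simps)
    from w(1,2) obtain B where B: "wt \<rho> e t B" "\<beta> y = (e, B)" by (elim wt_TupE) auto
    from w(3) have u: "wt (override_on \<rho> \<beta> {y, v}) c u A" by (elim wt_LetInE) simp
    have "wt (\<rho>(y := (e, B))) c u A"
      using u by (rule wt_cong_env) (use v B in \<open>auto simp: override_on_def\<close>)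
    with B(1) show ?thesis
      by (rule wt_letI) (use w(4,5) v in auto)
  qed
  fix \<rho> c A assume l: "wt \<rho> c (LetIn (PVar y) t u) A"
  from l obtain e B where w: "wt \<rho> e t B" "wt (\<rho>(y := (e, B))) c u A" "y \<in> fv u" "fv t \<inter> (fv u - {y}) = {}"
    by (rule wt_letE)
  from w(2) obtain u' where u': "eqt (\<rho>(y := (e, B))) c u u' A" "bv u' \<inter> fv t = {}" "fv u' = fv u"
    by (rule fresh_bv_env[of _ _ _ _ "fv t"]) auto
  have 1: "eqt \<rho> c (LetIn (PVar y) t u) (LetIn (PVar y) t u') A"
    using eqt_refl[OF w(1)] u'(1) w(3,4) by (rule eqt_letI)
  have 2: "eqt \<rho> c (LetIn (PVar y) t u) (subst u' (V(y := t))) A"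
    by (rule eqt_trans[OF 1 eqt_beta_let[OF eqt_wt(2)[OF 1] u'(2)]])
  have fv2: "fv (LetIn (PVar y) t u) = fv (subst u' (V(y := t)))" using eqt_fv[OF 2] .
  let ?u = "subst u' (V(y := t))"
  have wu: "wt \<rho> c ?u A" using eqt_wt(2)[OF 2] .
  \<comment> \<open>Beta for the pair will leave \<open>let * = * in ?u\<close> on the right side;
    \<open>beta_unit\<close> takes this to \<open>?u\<close>, the beta reduct of the left
    side.\<close>
  have "wt \<rho> c (LetIn PUnit Star ?u) A"
    by (rule wt_LetIn[of _ c _ One _ "\<lambda>_. (c, One)"]) (use wu in \<open>auto intro: wt_Star\<close>)
  then have 3: "eqt \<rho> c (LetIn PUnit Star ?u) ?u A"
    using wu by (intro eqt_convI conv.beta_unit) auto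
  let ?r' = "LetIn (PPair y v) (Tup t Star) (LetIn PUnit (V v) u')"
  let ?\<beta> = "(\<lambda>_. (e, One))(y := (e, B))"
  let ?\<rho> = "override_on \<rho> ?\<beta> (set_pat (PPair y v))"
  have "eqt ?\<rho> c u u' A"
    using u'(1) by (rule eqt_cong_env) (use v in \<open>auto simp: override_on_def\<close>)
  then have "eqt ?\<rho> c (LetIn PUnit (V v) u) (LetIn PUnit (V v) u') A"
    using v by (intro eqt_LetIn[of _ e _ _ One _ ?\<beta>] eqt_V) auto
  then have 4: "eqt \<rho> c ?r ?r' A"
    using w v by (intro eqt_LetIn[of \<rho> e _ _ "Tens B One" _ ?\<beta>] eqt_Tup eqt_refl wt_Star) auto
  have "conv ?r' (subst (LetIn PUnit (V v) u') (V(y := t, v := Star)))"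
    by (rule conv.beta_pair) (use u'(2) in auto)
  moreover have "subst (LetIn PUnit (V v) u') (V(y := t, v := Star)) = LetIn PUnit Star ?u"
    using v u'(3) by (auto intro!: subst_cong_fv)
  ultimately have "conv ?r' (LetIn PUnit Star ?u)" by simp
  moreover have "fv ?r' = fv (LetIn PUnit Star ?u)"
    using fv fv2 eqt_fv[OF 4] by simp
  ultimately have 5: "eqt \<rho> c ?r' (LetIn PUnit Star ?u) A"
    using eqt_wt(2)[OF 4] eqt_wt(1)[OF 3] by (intro eqt_convI)
  from 2 3 4 5 show "eqt \<rho> c (LetIn (PVar y) t u) ?r A"
    by (meson eqt_sym eqt_trans)
qed

lemma pair_Star_comm:
  assumes "\<not> is_PVar P"
  shows "LetIn P s (Tup t Star) \<simeq> Tup (LetIn P s t) Star"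
proof (rule reqI)
  show tr: "wt \<rho> c (Tup (LetIn P s t) Star) A" if "wt \<rho> c (LetIn P s (Tup t Star)) A" for \<rho> c A
  proof -
    from that obtain e B \<beta> where w: "wt \<rho> e s B" "pat_typed P e B \<beta>" "wt (override_on \<rho> \<beta> (set_pat P)) c (Tup t Star) A"
      "set_pat P \<subseteq> fv (Tup t Star)" "fv s \<inter> (fv (Tup t Star) - set_pat P) = {}"
      by (elim wt_LetInE)
    from w(3) obtain A' where A: "A = Tens A' One" "wt (override_on \<rho> \<beta> (set_pat P)) c t A'"
      by (elim wt_TupE wt_StarE) simp
    have "wt \<rho> c (LetIn P s t) A'" using w(1,2) A(2) by (rule wt_LetIn) (use w in auto)
    then show ?thesis unfolding A(1) by (rule wt_Tup[OF _ wt_Star]) simp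
  qed
  show "wt \<rho> c (LetIn P s (Tup t Star)) A" if "wt \<rho> c (Tup (LetIn P s t) Star) A" for \<rho> c A
  proof -
    from that obtain A' where A: "A = Tens A' One" "wt \<rho> c (LetIn P s t) A'"
      by (elim wt_TupE wt_StarE) simp
    from A(2) obtain e B \<beta> where w: "wt \<rho> e s B" "pat_typed P e B \<beta>" "wt (override_on \<rho> \<beta> (set_pat P)) c t A'"
      "set_pat P \<subseteq> fv t" "fv s \<inter> (fv t - set_pat P) = {}"
      by (elim wt_LetInE)
    have "wt (override_on \<rho> \<beta> (set_pat P)) c (Tup t Star) A"
      unfolding A(1) using w(3) by (rule wt_Tup[OF _ wt_Star]) simp
    with w(1,2) show ?thesis by (rule wt_LetIn) (use w in auto)
  qed
  show "eqt \<rho> c (LetIn P s (Tup t Star)) (Tup (LetIn P s t) Star) A"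
    if "wt \<rho> c (LetIn P s (Tup t Star)) A" "wt \<rho> c (Tup (LetIn P s t) Star) A" for \<rho> c A
    using _ _ that by (rule eqt_convI) (use assms in \<open>auto intro: conv.comm_tup1\<close>)
qed auto

text \<open>Among the targets that bind variables, only the pair pattern has a postulated conversion
  for every \<open>P\<close> other than a variable; box through box has none. This is why
  \<open>let_as_pair\<close> makes a detour through pairs.\<close>

lemma comm_pair:
  assumes "\<not> is_PVar P" "set_pat P \<inter> (fv u - {x, y}) = {}"
  shows "LetIn P s (LetIn (PPair x y) t u) \<simeq> LetIn (PPair x y) (LetIn P s t) u"
proof (rule reqI)
  have CC: "wt \<rho> c (LetIn P s (LetIn (PPair x y) t u)) A \<longleftrightarrow> wt \<rho> c (LetIn (PPair x y) (LetIn P s t) u) A" for \<rho> c A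
    by (rule wt_CC) (use assms in simp)
  show "wt \<rho> c (LetIn (PPair x y) (LetIn P s t) u) A" if "wt \<rho> c (LetIn P s (LetIn (PPair x y) t u)) A" for \<rho> c A
    using that CC by metis
  show "wt \<rho> c (LetIn P s (LetIn (PPair x y) t u)) A" if "wt \<rho> c (LetIn (PPair x y) (LetIn P s t) u) A" for \<rho> c A
    using that CC by metis
  show fv: "fv (LetIn P s (LetIn (PPair x y) t u)) = fv (LetIn (PPair x y) (LetIn P s t) u)"
    using assms(2) by auto
  show "eqt \<rho> c (LetIn P s (LetIn (PPair x y) t u)) (LetIn (PPair x y) (LetIn P s t) u) A"
    if "wt \<rho> c (LetIn P s (LetIn (PPair x y) t u)) A" "wt \<rho> c (LetIn (PPair x y) (LetIn P s t) u) A" for \<rho> c A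
    using conv.comm_let[OF assms(1), of "PPair x y" u s t] assms fv that by (intro eqt_convI) simp_all
qed

lemma let_comm:
  assumes "set_pat P \<inter> (fv u - {y}) = {}"
  shows "LetIn P s (LetIn (PVar y) t u) \<simeq> LetIn (PVar y) (LetIn P s t) u"
proof (cases "is_PVar P")
  case True
  then obtain x where "P = PVar x" by (cases P) auto
  with let_let[of x u y s t] assms show ?thesis by auto
next
  case False
  obtain v where v: "v \<notin> fv u \<union> {y} \<union> set_pat P"
    using ex_fresh[of "fv u \<union> {y} \<union> set_pat P"] by auto
  let ?W = "LetIn PUnit (V v) u"
  have "LetIn P s (LetIn (PVar y) t u) \<simeq> LetIn P s (LetIn (PPair y v) (Tup t Star) ?W)"
    using v by (intro req_LetIn req_refl let_as_pair) auto
  also have "\<dots> \<simeq> LetIn (PPair y v) (LetIn P s (Tup t Star)) ?W"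
    by (rule comm_pair[OF False]) (use assms v in auto)
  also have "\<dots> \<simeq> LetIn (PPair y v) (Tup (LetIn P s t) Star) ?W"
    by (intro req_LetIn req_refl pair_Star_comm False)
  also have "\<dots> \<simeq> LetIn (PVar y) (LetIn P s t) u"
    using v by (intro req_sym[OF let_as_pair]) auto
  finally show ?thesis .
qed

lemma let_exchange_pat:
  assumes "set_pat P \<inter> fv t = {}" "set_pat R \<inter> fv s = {}" "set_pat P \<inter> set_pat R = {}"
  shows "LetIn P s (LetIn R t u) \<simeq> LetIn R t (LetIn P s u)"
proof (cases "is_PVar P \<or> is_PVar R")
  case True
  then show ?thesis
  proof
    assume "is_PVar P"
    then obtain x where "P = PVar x" by (cases P) auto
    with let_exchange[of x t R s u] assms show ?thesis by auto
  next
    assume "is_PVar R"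
    then obtain x where "R = PVar x" by (cases R) auto
    with req_sym[OF let_exchange[of x s P t u]] assms show ?thesis by auto
  qed
next
  case False
  show ?thesis
  proof (rule reqI)
    show fv: "fv (LetIn P s (LetIn R t u)) = fv (LetIn R t (LetIn P s u))" using assms by auto
    show "wt \<rho> c (LetIn R t (LetIn P s u)) A" if "wt \<rho> c (LetIn P s (LetIn R t u)) A" for \<rho> c A
      using assms that by (rule wt_EX)
    show "wt \<rho> c (LetIn P s (LetIn R t u)) A" if "wt \<rho> c (LetIn R t (LetIn P s u)) A" for \<rho> c A
      using that by (rule wt_EX[rotated 3]) (use assms in auto)
    show "eqt \<rho> c (LetIn P s (LetIn R t u)) (LetIn R t (LetIn P s u)) A"
      if "wt \<rho> c (LetIn P s (LetIn R t u)) A" "wt \<rho> c (LetIn R t (LetIn P s u)) A" for \<rho> c A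
      using _ fv that by (rule eqt_convI) (use assms False in \<open>auto intro: conv.comm_exchange\<close>)
  qed
qed


section \<open>Commuting contexts\<close>

text \<open>\<open>F\<close> holds the free variables of \<open>K\<close> outside its hole,
  \<open>X\<close> the variables that \<open>K\<close> binds in the hole. A \<open>let\<close> can
  cross \<open>K\<close> if its pattern avoids both and its scrutinee avoids
  \<open>X\<close>.\<close>

definition commuting :: "('g tm \<Rightarrow> 'g tm) \<Rightarrow> var set \<Rightarrow> var set \<Rightarrow> bool" where
  "commuting K F X \<longleftrightarrow> finite F \<and> finite X \<and> (\<forall>t. fv (K t) = F \<union> (fv t - X)) \<and>
    (\<forall>P s t. set_pat P \<inter> (F \<union> X) = {} \<longrightarrow> fv s \<inter> X = {} \<longrightarrow> LetIn P s (K t) \<simeq> K (LetIn P s t)) \<and>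
    (\<forall>t t'. t \<leadsto> t' \<longrightarrow> K t \<leadsto> K t')"

text \<open>Once the hole has a name, crossing \<open>K\<close> is the conversion for plain
  \<open>let\<close>s. This yields conversions absent from the rules: through a delay, and of a box
  pattern into the scrutinee of another box pattern.\<close>

lemma commuting_hole:
  assumes "hole_context K F"
  shows "commuting K F {}"
proof -
  have "LetIn P s (K t) \<simeq> K (LetIn P s t)" if P: "set_pat P \<inter> F = {}" for P s t
  proof -
    have K: "finite F" "\<And>t. fv (K t) = F \<union> fv t" "\<And>t h. h \<notin> F \<Longrightarrow> K t \<simeq> LetIn (PVar h) t (K (V h))"
      using assms by (auto simp: hole_context_def)
    obtain h where h: "h \<notin> F \<union> set_pat P" using ex_fresh[of "F \<union> set_pat P"] K(1) by auto
    have "LetIn P s (K t) \<simeq> LetIn P s (LetIn (PVar h) t (K (V h)))"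
      using h by (intro req_LetIn req_refl K(3)) auto
    also have "\<dots> \<simeq> LetIn (PVar h) (LetIn P s t) (K (V h))"
      by (rule let_comm) (use K(2)[of "V h"] P in auto)
    also have "\<dots> \<simeq> K (LetIn P s t)"
      using h by (intro req_sym[OF K(3)]) auto
    finally show ?thesis .
  qed
  then show ?thesis
    using assms by (auto simp: commuting_def hole_context_def)
qed

lemma commuting_Tup1: "commuting (\<lambda>t. Tup t u) (fv u) {}"
  and commuting_Tup2: "commuting (\<lambda>t. Tup u t) (fv u) {}"
  and commuting_BoxTm: "commuting (BoxTm d) {} {}"
  and commuting_Delay: "commuting (Delay d) {} {}"
  and commuting_scrut: "commuting (\<lambda>t. LetIn R t u) (fv u - set_pat R) {}"
  by (intro commuting_hole hole_Tup1 hole_Tup2 hole_BoxTm hole_Delay hole_scrut)+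

lemma commuting_body: "commuting (LetIn R r) (fv r) (set_pat R)"
proof -
  have "LetIn P s (LetIn R r t) \<simeq> LetIn R r (LetIn P s t)"
    if "set_pat P \<inter> (fv r \<union> set_pat R) = {}" "fv s \<inter> set_pat R = {}" for P s t
    by (rule let_exchange_pat) (use that in auto)
  then show ?thesis
    by (auto simp: commuting_def intro: red_LetIn)
qed

lemma commutingD:
  assumes "commuting K F X"
  shows "finite F" "finite X" "fv (K t) = F \<union> (fv t - X)"
    and "set_pat P \<inter> (F \<union> X) = {} \<Longrightarrow> fv s \<inter> X = {} \<Longrightarrow> LetIn P s (K t) \<simeq> K (LetIn P s t)"
    and "t \<leadsto> t' \<Longrightarrow> K t \<leadsto> K t'" and "t \<simeq> t' \<Longrightarrow> K t \<simeq> K t'"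
  using assms by (auto simp: commuting_def req_def)

lemma comm_scrut:
  "set_pat P \<inter> (fv u - set_pat R) = {} \<Longrightarrow> LetIn P s (LetIn R t u) \<simeq> LetIn R (LetIn P s t) u"
  by (rule commutingD(4)[OF commuting_scrut]) auto


section \<open>Computation rules\<close>

lemma beta_unit: "LetIn PUnit Star t \<leadsto> t"
proof (rule redI)
  fix \<rho> c A assume w: "wt \<rho> c (LetIn PUnit Star t) A"
  then have "wt \<rho> c t A" by (elim wt_LetInE) simp
  with w show "eqt \<rho> c (LetIn PUnit Star t) t A"
    by (intro eqt_convI conv.beta_unit) auto
qed auto

text \<open>Keeping a plain \<open>let\<close> in place of the substitution removes every condition
  on bound variables, because \<open>s\<close> is then outside the scope of all binders of
  \<open>t\<close>.\<close>

lemma beta_box: "LetIn (PBox d x) (BoxTm d s) t \<leadsto> LetIn (PVar x) s t"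
proof (rule redI)
  fix \<rho> c A assume w: "wt \<rho> c (LetIn (PBox d x) (BoxTm d s) t) A"
  then obtain e B' \<beta> where b: "wt \<rho> e (BoxTm d s) B'" "pat_typed (PBox d x) e B' \<beta>"
    "wt (override_on \<rho> \<beta> {x}) c t A" "x \<in> fv t" "fv s \<inter> (fv t - {x}) = {}"
    by (elim wt_LetInE) simp
  from b(1,2) obtain B where B: "wt \<rho> (e + d) s B" "\<beta> x = (e + d, B)" "B' = BoxTy d B"
    by (elim wt_BoxTmE) auto
  have "override_on \<rho> \<beta> {x} = \<rho>(x := (e + d, B))" using B by (auto simp: override_on_def)
  with b have t: "wt (\<rho>(x := (e + d, B))) c t A" by simp
  then obtain t' where t': "eqt (\<rho>(x := (e + d, B))) c t t' A" "bv t' \<inter> fv s = {}" "fv t' = fv t"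
    by (rule fresh_bv_env[of _ _ _ _ "fv s"]) auto
  have 1: "eqt \<rho> c (LetIn (PVar x) s t) (LetIn (PVar x) s t') A"
    using eqt_refl[OF B(1)] t'(1) b(4,5) by (rule eqt_letI)
  have 2: "eqt \<rho> c (LetIn (PVar x) s t) (subst t' (V(x := s))) A"
    by (rule eqt_trans[OF 1 eqt_beta_let[OF eqt_wt(2)[OF 1] t'(2)]])
  have 3: "eqt \<rho> c (LetIn (PBox d x) (BoxTm d s) t) (LetIn (PBox d x) (BoxTm d s) t') A"
    using eqt_refl[OF b(1)] b(2)
    by (rule eqt_LetIn) (use b t' \<open>override_on \<rho> \<beta> {x} = _\<close> in auto)
  have "eqt \<rho> c (LetIn (PBox d x) (BoxTm d s) t') (subst t' (V(x := s))) A"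
  proof (rule eqt_convI[OF conv.beta_box[OF t'(2)] _ eqt_wt(2)[OF 3] eqt_wt(2)[OF 2]])
    show "fv (LetIn (PBox d x) (BoxTm d s) t') = fv (subst t' (V(x := s)))"
      using eqt_fv[OF 2] t'(3) by simp
  qed
  with 2 3 show "eqt \<rho> c (LetIn (PBox d x) (BoxTm d s) t) (LetIn (PVar x) s t) A"
    by (meson eqt_sym eqt_trans)
qed simp

text \<open>The one remaining condition comes from \<open>t\<close> being placed in the scope of
  \<open>x\<close>. It also makes the simultaneous substitution for \<open>x\<close> and
  \<open>y\<close> equal to the two successive ones.\<close>

lemma beta_pair:
  assumes x: "x \<notin> fv t"
  shows "LetIn (PPair x y) (Tup s t) u \<leadsto> LetIn (PVar x) s (LetIn (PVar y) t u)"
proof (rule redI)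
  show fv: "fv (LetIn (PPair x y) (Tup s t) u) = fv (LetIn (PVar x) s (LetIn (PVar y) t u))"
    using x by auto
  fix \<rho> c A assume w: "wt \<rho> c (LetIn (PPair x y) (Tup s t) u) A"
  then obtain e B' \<beta> where b: "wt \<rho> e (Tup s t) B'" "pat_typed (PPair x y) e B' \<beta>"
    "wt (override_on \<rho> \<beta> {x, y}) c u A" "{x, y} \<subseteq> fv u" "fv (Tup s t) \<inter> (fv u - {x, y}) = {}"
    by (rule wt_LetInE) (simp del: pat_typed.simps fv.simps)
  from b(1,2) obtain B C where B: "wt \<rho> e s B" "wt \<rho> e t C" "\<beta> x = (e, B)" "\<beta> y = (e, C)" "x \<noteq> y"
    "fv s \<inter> fv t = {}" "B' = Tens B C"
    by (elim wt_TupE) auto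
  have ov: "override_on \<rho> \<beta> {x, y} = \<rho>(x := (e, B), y := (e, C))" using B by (auto simp: override_on_def)
  with b have u: "wt (\<rho>(x := (e, B), y := (e, C))) c u A" by simp
  from u obtain u' where u': "eqt (\<rho>(x := (e, B), y := (e, C))) c u u' A" "bv u' \<inter> (fv s \<union> fv t) = {}" "fv u' = fv u"
    by (rule fresh_bv_env[of _ _ _ _ "fv s \<union> fv t"]) auto
  from B(2) obtain t' where t': "eqt \<rho> e t t' C" "bv t' \<inter> fv s = {}" "fv t' = fv t"
    by (rule fresh_bv_env[of _ _ _ _ "fv s"]) auto
  have t'x: "eqt (\<rho>(x := (e, B))) e t t' C"
    using t'(1) by (rule eqt_cong_env) (use x in auto)
  have 1: "eqt (\<rho>(x := (e, B))) c (LetIn (PVar y) t u) (LetIn (PVar y) t' u') A"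
    using t'x u'(1) by (rule eqt_letI) (use b(4,5) x in auto)
  have 2: "eqt (\<rho>(x := (e, B))) c (LetIn (PVar y) t u) (subst u' (V(y := t'))) A"
    by (rule eqt_trans[OF 1 eqt_beta_let[OF eqt_wt(2)[OF 1]]]) (use u'(2) t'(3) in auto)
  have 3: "eqt \<rho> c (LetIn (PVar x) s (LetIn (PVar y) t u)) (LetIn (PVar x) s (subst u' (V(y := t')))) A"
    using eqt_refl[OF B(1)] 2 by (rule eqt_letI) (use b(4,5) B(5,6) in auto)
  have 4: "eqt \<rho> c (LetIn (PVar x) s (LetIn (PVar y) t u)) (subst (subst u' (V(y := t'))) (V(x := s))) A"
  proof (rule eqt_trans[OF 3 eqt_beta_let[OF eqt_wt(2)[OF 3]]])
    show "bv (subst u' (V(y := t'))) \<inter> fv s = {}"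
      using bv_subst_upd[of u' y t'] u'(2) t'(2) by auto
  qed
  have "subst (subst u' (V(y := t'))) (V(x := s)) = subst u' (\<lambda>z. subst ((V(y := t')) z) (V(x := s)))"
    by (rule subst_subst, rule capture_free_upd) (use u'(2) t'(3) in auto)
  also have "\<dots> = subst u' (V(x := s, y := t'))"
    by (rule subst_cong_fv) (use x t'(3) B(5) in auto)
  finally have 5: "eqt \<rho> c (LetIn (PVar x) s (LetIn (PVar y) t u)) (subst u' (V(x := s, y := t'))) A"
    using 4 by simp
  have 6: "eqt \<rho> c (LetIn (PPair x y) (Tup s t) u) (LetIn (PPair x y) (Tup s t') u') A"
  proof (rule eqt_LetIn[OF _ b(2)])
    show "eqt \<rho> e (Tup s t) (Tup s t') B'"
      unfolding B(7) using eqt_refl[OF B(1)] t'(1) B(6) by (rule eqt_Tup)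
    show "eqt (override_on \<rho> \<beta> (set_pat (PPair x y))) c u u' A"
      using u'(1) ov by simp
  qed (use b in auto)
  have "eqt \<rho> c (LetIn (PPair x y) (Tup s t') u') (subst u' (V(x := s, y := t'))) A"
  proof (rule eqt_convI[OF conv.beta_pair _ eqt_wt(2)[OF 6] eqt_wt(2)[OF 5]])
    show "bv u' \<inter> (fv s \<union> fv t') = {}" using u'(2) t'(3) by simp
    show "fv (LetIn (PPair x y) (Tup s t') u') = fv (subst u' (V(x := s, y := t')))"
      using eqt_fv[OF 5] eqt_fv[OF 6] fv by simp
  qed
  with 5 6 show "eqt \<rho> c (LetIn (PPair x y) (Tup s t) u) (LetIn (PVar x) s (LetIn (PVar y) t u)) A"
    by (meson eqt_sym eqt_trans)
qed

section \<open>Eta laws and the renaming of whole patterns\<close>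

lemma pat_typed_renaming:
  assumes "pat_typed P e B \<beta>" "renaming_of P P'"
  obtains \<beta>' where "pat_typed P' e B \<beta>'"
proof (cases P)
  case (PVar x)
  with assms obtain x' where "P' = PVar x'" by (cases P') auto
  then have "pat_typed P' e B (\<lambda>_. (e, B))" by simp
  then show thesis by (rule that)
next
  case PUnit
  with assms have "P' = PUnit" "B = One" by (cases P'; simp)+
  then have "pat_typed P' e B (\<lambda>_. (e, B))" by simp
  then show thesis by (rule that)
next
  case (PPair x y)
  with assms obtain x' y' where P': "P' = PPair x' y'" "x' \<noteq> y'" by (cases P') auto
  from PPair assms obtain B1 B2 where "B = Tens B1 B2" by auto
  with P' have "pat_typed P' e B ((\<lambda>_. (e, B1))(y' := (e, B2)))" by simp
  then show thesis by (rule that)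
next
  case (PBox d x)
  with assms obtain x' where P': "P' = PBox d x'" by (cases P') auto
  from PBox assms obtain B1 where "B = BoxTy d B1" by auto
  with P' have "pat_typed P' e B (\<lambda>_. (e + d, B1))" by simp
  then show thesis by (rule that)
qed

lemma wt_pat_tm:
  assumes "wt \<rho> e s B" "pat_typed P e B \<beta>" "renaming_of P P'"
  shows "wt \<rho> e (LetIn P' s (pat_tm P')) B"
proof -
  have ty: "set_ty B \<subseteq> qubits S" using wt_set_ty[OF assms(1)] .
  from assms(2,3) obtain \<beta>' where \<beta>': "pat_typed P' e B \<beta>'" by (rule pat_typed_renaming)
  then have "wt (override_on \<rho> \<beta>' (set_pat P')) e (pat_tm P') B"
    using ty by (cases P') (auto intro!: wt_V wt_Star wt_Tup wt_BoxTm)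
  from wt_LetIn[OF assms(1) \<beta>' this] show ?thesis by simp
qed

text \<open>For the unit pattern this needs the type of \<open>t\<close>: in \<open>let * = t in *\<close> the grade of \<open>t\<close> is arbitrary.\<close>

lemma eqt_eta:
  assumes "wt \<rho> e t B" "pat_typed P e B \<beta>"
  shows "eqt \<rho> e (LetIn P t (pat_tm P)) t B"
proof -
  have "renaming_of P P" using assms(2) by (cases P) auto
  note w = wt_pat_tm[OF assms this]
  show ?thesis
  proof (cases "is_PVar P")
    case True
    then obtain x where "P = PVar x" by (cases P) auto
    with red_eqt[OF req_red(1)[OF req_let_var]] w show ?thesis by simp
  next
    case False
    have "conv (LetIn P t (pat_tm P)) t"
      using False by (cases P) (auto intro: conv.eta_unit conv.eta_pair conv.eta_box)
    then show ?thesis by (rule eqt_convI) (use w assms in simp_all)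
  qed
qed

text \<open>For the patterns that bind variables, the type and offset of the rebuilt value determine
  those of the scrutinee. A rebuilt \<open>*\<close> says nothing about the grade of the unit it
  came from.\<close>

lemma eta: 
  assumes "P \<noteq> PUnit"
  shows "LetIn P t (pat_tm P) \<leadsto> t"
proof (rule redI)
  fix \<rho> c A assume w: "wt \<rho> c (LetIn P t (pat_tm P)) A"
  then obtain e B \<beta> where b: "wt \<rho> e t B" "pat_typed P e B \<beta>"
    "wt (override_on \<rho> \<beta> (set_pat P)) c (pat_tm P) A"
    by (elim wt_LetInE)
  have "e = c \<and> B = A"
    using b(2,3) assms by (cases P) auto
  with eqt_eta[OF b(1,2)] show "eqt \<rho> c (LetIn P t (pat_tm P)) t A" by simp
qed simp

text \<open>Renames all variables of a pattern at once without substituting in \<open>t\<close>: the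
  scrutinee is eta-expanded with the new names, and the new \<open>let\<close> is moved
  outwards.\<close>

lemma alpha_pat:
  assumes "renaming_of P P'" "set_pat P' \<inter> (fv t - set_pat P) = {}"
  shows "LetIn P s t \<simeq> LetIn P' s (LetIn P (pat_tm P') t)"
proof -
  have CC: "LetIn P' s (LetIn P (pat_tm P') t) \<simeq> LetIn P (LetIn P' s (pat_tm P')) t"
    by (rule comm_scrut) (rule assms(2))
  have "LetIn P' s (LetIn P (pat_tm P') t) \<leadsto> LetIn P s t"
  proof (cases "P = PUnit")
    case True
    with assms(1) have "P' = PUnit" by (cases P') auto
    with True show ?thesis by (auto intro: red_LetIn beta_unit)
  next
    case False
    with assms(1) have "P' \<noteq> PUnit" by (cases P) auto
    from req_red_trans(1)[OF CC red_LetIn[OF eta[OF this] red_refl]] show ?thesis .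
  qed
  \<comment> \<open>In this direction the typing of the left side is given, so the scrutinee can be
    expanded by \<open>eqt_eta\<close> even for the unit pattern.\<close>
  moreover have "LetIn P s t \<leadsto> LetIn P (LetIn P' s (pat_tm P')) t"
  proof (rule redI)
    show "fv (LetIn P s t) = fv (LetIn P (LetIn P' s (pat_tm P')) t)" by simp
    fix \<rho> c A assume "wt \<rho> c (LetIn P s t) A"
    then obtain e B \<beta> where b: "wt \<rho> e s B" "pat_typed P e B \<beta>" "wt (override_on \<rho> \<beta> (set_pat P)) c t A"
      "set_pat P \<subseteq> fv t" "fv s \<inter> (fv t - set_pat P) = {}"
      by (elim wt_LetInE)
    obtain \<beta>' where "pat_typed P' e B \<beta>'"
      using wt_pat_tm[OF b(1,2) assms(1)] pat_typed_renaming[OF b(2) assms(1)] by blast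
    from eqt_sym[OF eqt_eta[OF b(1) this]] b
    show "eqt \<rho> c (LetIn P s t) (LetIn P (LetIn P' s (pat_tm P')) t) A"
      by (intro eqt_LetIn[of _ e _ _ B _ \<beta>] eqt_refl)
  qed
  ultimately show ?thesis
    using red_trans[OF _ req_red(2)[OF CC]] by (simp add: req_def)
qed

end

section \<open>Nested patterns\<close>

text \<open>Nested patterns are not part of the language. A tree serves both as a pattern, unfolded
  into \<open>let\<close>s by \<open>plet\<close>, and as the value \<open>pval\<close> that it
  matches.\<close>

datatype ptree = PL var | PO | PT ptree ptree | PB real ptree

primrec pvars :: "ptree \<Rightarrow> var list" where
  "pvars (PL x) = [x]"
| "pvars PO = []"
| "pvars (PT p q) = pvars p @ pvars q"
| "pvars (PB d p) = pvars p"

primrec pval :: "ptree \<Rightarrow> 'g tm" where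
  "pval (PL x) = V x"
| "pval PO = Star"
| "pval (PT p q) = Tup (pval p) (pval q)"
| "pval (PB d p) = BoxTm d (pval p)"

primrec prename :: "(var \<Rightarrow> var) \<Rightarrow> ptree \<Rightarrow> ptree" where
  "prename f (PL x) = PL (f x)"
| "prename f PO = PO"
| "prename f (PT p q) = PT (prename f p) (prename f q)"
| "prename f (PB d p) = PB d (prename f p)"

primrec ptyped :: "ptree \<Rightarrow> real \<Rightarrow> 'q ty \<Rightarrow> 'q env \<Rightarrow> bool" where
  "ptyped (PL x) e A \<beta> \<longleftrightarrow> \<beta> x = (e, A)"
| "ptyped PO e A \<beta> \<longleftrightarrow> A = One"
| "ptyped (PT p q) e A \<beta> \<longleftrightarrow> (\<exists>B C. A = Tens B C \<and> ptyped p e B \<beta> \<and> ptyped q e C \<beta>)"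
| "ptyped (PB d p) e A \<beta> \<longleftrightarrow> (\<exists>B. A = BoxTy d B \<and> ptyped p (e + d) B \<beta>)"

text \<open>It lies above all of \<open>X\<close>, so that its successor is fresh too and a pair
  pattern gets both names at once; the inserted \<open>0\<close> covers the empty set.\<close>

definition fresh_var :: "var set \<Rightarrow> var" where
  "fresh_var X = Suc (Max (insert 0 X))"

lemma fresh_var: "finite X \<Longrightarrow> fresh_var X \<notin> X" "finite X \<Longrightarrow> Suc (fresh_var X) \<notin> X"
proof -
  assume "finite X"
  then have "x \<le> Max (insert 0 X)" if "x \<in> X" for x using that by simp
  then show "fresh_var X \<notin> X" "Suc (fresh_var X) \<notin> X" unfolding fresh_var_def by fastforce+
qed

text \<open>The auxiliary names depend only on the variables of the pattern and the free variables
  of \<open>u\<close>. Hence they survive a rewriting of \<open>u\<close>, but moving a term into or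
  out of \<open>u\<close> can change them; \<open>movable_PT\<close> and \<open>plet_PB\<close> show
  that the choice is immaterial.\<close>

primrec plet :: "ptree \<Rightarrow> 'g tm \<Rightarrow> 'g tm \<Rightarrow> 'g tm" where
  "plet (PL x) t u = LetIn (PVar x) t u"
| "plet PO t u = LetIn PUnit t u"
| "plet (PT p q) t u = (let z = fresh_var (set (pvars p) \<union> set (pvars q) \<union> fv u) in
     LetIn (PPair z (Suc z)) t (plet p (V z) (plet q (V (Suc z)) u)))"
| "plet (PB d p) t u = (let z = fresh_var (set (pvars p) \<union> fv u) in
     LetIn (PBox d z) t (plet p (V z) u))"

lemma fv_pval [simp]: "fv (pval p) = set (pvars p)"
  by (induction p) auto

lemma bv_pval [simp]: "bv (pval p) = {}"
  by (induction p) auto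

lemma pvars_prename [simp]: "pvars (prename f p) = map f (pvars p)"
  by (induction p) auto

lemma subst_pval: "subst (pval p) (\<lambda>x. V (f x)) = pval (prename f p)"
  by (induction p) auto

lemma ptyped_cong: "\<forall>x \<in> set (pvars p). \<beta> x = \<beta>' x \<Longrightarrow> ptyped p e A \<beta> = ptyped p e A \<beta>'"
  by (induction p arbitrary: e A) auto

lemma ptyped_prename: "ptyped (prename f p) e A \<beta> = ptyped p e A (\<beta> \<circ> f)"
  by (induction p arbitrary: e A) auto

lemma fv_plet [simp]: "fv (plet p t u) = fv t \<union> (fv u - set (pvars p))"
proof (induction p arbitrary: t u)
  case (PT p q)
  let ?X = "set (pvars p) \<union> set (pvars q) \<union> fv u"
  have "fresh_var ?X \<notin> ?X" "Suc (fresh_var ?X) \<notin> ?X" using fresh_var[of ?X] by auto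
  then show ?case by (auto simp: Let_def PT.IH)
next
  case (PB d p)
  let ?X = "set (pvars p) \<union> fv u"
  have "fresh_var ?X \<notin> ?X" using fresh_var[of ?X] by auto
  then show ?case by (auto simp: Let_def PB.IH)
qed auto

context annotated
begin

section \<open>Nested matches: independence of auxiliary names, and commutation\<close>

lemma red_plet: "t \<leadsto> t' \<Longrightarrow> u \<leadsto> u' \<Longrightarrow> plet p t u \<leadsto> plet p t' u'"
proof (induction p arbitrary: t t' u u')
  case (PT p q)
  then show ?case by (simp add: Let_def red_fv[OF PT.prems(2)] red_LetIn)
next
  case (PB d p)
  then show ?case by (simp add: Let_def red_fv[OF PB.prems(2)] red_LetIn)
qed (auto intro: red_LetIn)

lemma req_plet: "t \<simeq> t' \<Longrightarrow> u \<simeq> u' \<Longrightarrow> plet p t u \<simeq> plet p t' u'"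
  by (simp add: req_def red_plet)

lemma plet_comm_scrut:
  assumes P: "set_pat P \<inter> (fv u - set (pvars p)) = {}"
  shows "LetIn P s (plet p t u) \<simeq> plet p (LetIn P s t) u"
proof (cases p)
  case (PL x)
  have "set_pat P \<inter> (fv u - set_pat (PVar x)) = {}" using P PL by simp
  from comm_scrut[OF this] PL show ?thesis by simp
next
  case PO
  have "set_pat P \<inter> (fv u - set_pat PUnit) = {}" using P PO by simp
  from comm_scrut[OF this] PO show ?thesis by simp
next
  case (PT p1 p2)
  let ?z = "fresh_var (set (pvars p1) \<union> set (pvars p2) \<union> fv u)"
  have "set_pat P \<inter> (fv (plet p1 (V ?z) (plet p2 (V (Suc ?z)) u)) - set_pat (PPair ?z (Suc ?z))) = {}"
    using P PT by auto
  from comm_scrut[OF this] PT show ?thesis by (simp add: Let_def)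
next
  case (PB d p1)
  let ?z = "fresh_var (set (pvars p1) \<union> fv u)"
  have "set_pat P \<inter> (fv (plet p1 (V ?z) u) - set_pat (PBox d ?z)) = {}"
    using P PB by auto
  from comm_scrut[OF this] PB show ?thesis by (simp add: Let_def)
qed

text \<open>The \<open>let\<close> moves into the scrutinee, where \<open>let z = s in z\<close> is
  \<open>s\<close>.\<close>

lemma plet_let_var:
  assumes "z \<notin> fv u - set (pvars p)"
  shows "LetIn (PVar z) s (plet p (V z) u) \<simeq> plet p s u"
proof -
  have "LetIn (PVar z) s (plet p (V z) u) \<simeq> plet p (LetIn (PVar z) s (V z)) u"
    by (rule plet_comm_scrut) (use assms in simp)
  also have "\<dots> \<simeq> plet p s u" by (intro req_plet req_let_var req_refl)
  finally show ?thesis .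
qed

text \<open>That a \<open>let\<close> crosses \<open>plet p\<close> is an assumption here, because
  it becomes available only in the induction that also uses the present lemma.\<close>

lemma rename_pair:
  assumes comm: "\<And>W. LetIn (PVar w') (V z') (plet p (V w) W) \<simeq> plet p (V w) (LetIn (PVar w') (V z') W)"
    and fresh: "{w, w', z, z'} \<inter> (set (pvars p) \<union> set (pvars q) \<union> fv u) = {}" "distinct [w, w', z, z']"
  shows "LetIn (PPair w w') t (plet p (V w) (plet q (V w') u)) \<leadsto>
    LetIn (PPair z z') t (plet p (V z) (plet q (V z') u))"
proof -
  let ?W = "plet p (V w) (plet q (V w') u)"
  have "LetIn (PPair w w') t ?W \<simeq> LetIn (PPair z z') t (LetIn (PPair w w') (pat_tm (PPair z z')) ?W)"
    by (rule alpha_pat) (use fresh in auto)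
  also have "\<dots> \<leadsto> LetIn (PPair z z') t (LetIn (PVar w) (V z) (LetIn (PVar w') (V z') ?W))"
    unfolding pat_tm.simps by (intro red_LetIn red_refl beta_pair) (use fresh in auto)
  also have "\<dots> \<simeq> LetIn (PPair z z') t (LetIn (PVar w) (V z) (plet p (V w) (LetIn (PVar w') (V z') (plet q (V w') u))))"
    by (intro req_LetIn req_refl comm)
  also have "\<dots> \<simeq> LetIn (PPair z z') t (LetIn (PVar w) (V z) (plet p (V w) (plet q (V z') u)))"
    by (intro req_LetIn req_plet req_refl plet_let_var) (use fresh in auto)
  also have "\<dots> \<simeq> LetIn (PPair z z') t (plet p (V z) (plet q (V z') u))"
    by (intro req_LetIn req_refl plet_let_var) (use fresh in auto)
  finally show ?thesis .
qed

lemma rename_box: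
  assumes fresh: "{w, z} \<inter> (set (pvars p) \<union> fv u) = {}" "w \<noteq> z"
  shows "LetIn (PBox d w) t (plet p (V w) u) \<leadsto> LetIn (PBox d z) t (plet p (V z) u)"
proof -
  have "LetIn (PBox d w) t (plet p (V w) u) \<simeq> LetIn (PBox d z) t (LetIn (PBox d w) (pat_tm (PBox d z)) (plet p (V w) u))"
    by (rule alpha_pat) (use fresh in auto)
  also have "\<dots> \<leadsto> LetIn (PBox d z) t (LetIn (PVar w) (V z) (plet p (V w) u))"
    unfolding pat_tm.simps by (intro red_LetIn red_refl beta_box)
  also have "\<dots> \<simeq> LetIn (PBox d z) t (plet p (V z) u)"
    by (intro req_LetIn req_refl plet_let_var) (use fresh in auto)
  finally show ?thesis .
qed

lemma plet_PB:
  assumes "z \<notin> set (pvars p) \<union> fv u"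
  shows "plet (PB d p) t u \<simeq> LetIn (PBox d z) t (plet p (V z) u)"
proof -
  let ?w = "fresh_var (set (pvars p) \<union> fv u)"
  have w: "?w \<notin> set (pvars p) \<union> fv u" by (rule fresh_var) simp
  show ?thesis
  proof (cases "?w = z")
    case False
    with w assms show ?thesis
      using rename_box[of ?w z p u d t] rename_box[of z ?w p u d t] by (simp add: Let_def req_def)
  qed (simp add: Let_def)
qed

text \<open>All commuting contexts are covered at once: the induction uses the property for the
  given \<open>K\<close> and, to change auxiliary names, for the body of a plain \<open>let\<close>
  (\<open>commuting_body\<close>).\<close>

definition movable :: "ptree \<Rightarrow> bool" where
  "movable p \<longleftrightarrow> (\<forall>K F X s t. commuting K F X \<longrightarrow> set (pvars p) \<inter> (F \<union> X) = {} \<longrightarrow> fv s \<inter> X = {} \<longrightarrow>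
    plet p s (K t) \<simeq> K (plet p s t))"

lemma movable_rename:
  assumes p: "movable p"
    and fresh: "{w, w', z, z'} \<inter> (set (pvars p) \<union> set (pvars q) \<union> fv u) = {}" "distinct [w, w', z, z']"
  shows "LetIn (PPair w w') t (plet p (V w) (plet q (V w') u)) \<simeq>
    LetIn (PPair z z') t (plet p (V z) (plet q (V z') u))"
proof -
  have 1: "LetIn (PVar w') (V z') (plet p (V w) W) \<simeq> plet p (V w) (LetIn (PVar w') (V z') W)" for W
    by (rule req_sym, rule p[unfolded movable_def, rule_format, OF commuting_body]) (use fresh in auto)
  have 2: "LetIn (PVar z') (V w') (plet p (V z) W) \<simeq> plet p (V z) (LetIn (PVar z') (V w') W)" for W
    by (rule req_sym, rule p[unfolded movable_def, rule_format, OF commuting_body]) (use fresh in auto)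
  have "{z, z', w, w'} \<inter> (set (pvars p) \<union> set (pvars q) \<union> fv u) = {}" "distinct [z, z', w, w']"
    using fresh by auto
  from rename_pair[OF 1 fresh] rename_pair[OF 2 this] show ?thesis
    unfolding req_def by blast
qed

lemma movable_PT:
  assumes p: "movable p" and fresh: "{z, z'} \<inter> (set (pvars p) \<union> set (pvars q) \<union> fv u) = {}" "z \<noteq> z'"
  shows "plet (PT p q) t u \<simeq> LetIn (PPair z z') t (plet p (V z) (plet q (V z') u))"
proof -
  define X where "X = set (pvars p) \<union> set (pvars q) \<union> fv u"
  define w where "w = fresh_var X"
  define Y where "Y = X \<union> {z, z', w, Suc w}"
  \<comment> \<open>\<open>movable_rename\<close> wants four distinct names, but \<open>z\<close> or
    \<open>z'\<close> may coincide with \<open>w\<close> or \<open>Suc w\<close>; a third pair of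
    names serves as a stopover.\<close>
  define v where "v = fresh_var Y"
  have "finite X" "finite Y" by (simp_all add: X_def Y_def)
  then have wX: "w \<notin> X" "Suc w \<notin> X" and vY: "v \<notin> Y" "Suc v \<notin> Y"
    by (simp_all add: w_def v_def fresh_var)
  have zX: "z \<notin> X" "z' \<notin> X" using fresh(1) by (simp_all add: X_def)
  have vX: "v \<notin> X" "Suc v \<notin> X" using vY by (simp_all add: Y_def)
  have "plet (PT p q) t u = LetIn (PPair w (Suc w)) t (plet p (V w) (plet q (V (Suc w)) u))"
    by (simp add: Let_def w_def X_def)
  also have "\<dots> \<simeq> LetIn (PPair v (Suc v)) t (plet p (V v) (plet q (V (Suc v)) u))"
  proof (rule movable_rename[OF p])
    show "{w, Suc w, v, Suc v} \<inter> (set (pvars p) \<union> set (pvars q) \<union> fv u) = {}"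
      using wX vX unfolding X_def[symmetric] by simp
    show "distinct [w, Suc w, v, Suc v]" using vY by (simp add: Y_def)
  qed
  also have "\<dots> \<simeq> LetIn (PPair z z') t (plet p (V z) (plet q (V z') u))"
  proof (rule movable_rename[OF p])
    show "{v, Suc v, z, z'} \<inter> (set (pvars p) \<union> set (pvars q) \<union> fv u) = {}"
      using zX vX unfolding X_def[symmetric] by simp
    show "distinct [v, Suc v, z, z']" using vY fresh(2) by (simp add: Y_def)
  qed
  finally show ?thesis .
qed

lemma movable: "movable p"
proof (induction p)
  case (PL x)
  show ?case unfolding movable_def by (auto intro: commutingD(4))
next
  case PO
  show ?case unfolding movable_def by (auto intro: commutingD(4))
next
  case (PB d p)
  show ?case unfolding movable_def
  proof (intro allI impI)
    fix K :: "'g tm \<Rightarrow> 'g tm" and F X and s t :: "'g tm"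
    assume K: "commuting K F X" and dis: "set (pvars (PB d p)) \<inter> (F \<union> X) = {}" "fv s \<inter> X = {}"
    note fin = commutingD(1,2)[OF K]
    let ?Y = "set (pvars p) \<union> fv t \<union> F \<union> X"
    obtain z where z: "z \<notin> ?Y" using ex_fresh[of ?Y] fin by auto
    have "plet (PB d p) s (K t) \<simeq> LetIn (PBox d z) s (plet p (V z) (K t))"
      by (rule plet_PB) (use z commutingD(3)[OF K] in auto)
    also have "\<dots> \<simeq> LetIn (PBox d z) s (K (plet p (V z) t))"
      by (intro req_LetIn req_refl PB.IH[unfolded movable_def, rule_format, OF K]) (use dis z in auto)
    also have "\<dots> \<simeq> K (LetIn (PBox d z) s (plet p (V z) t))"
      by (rule commutingD(4)[OF K]) (use dis z in auto)
    also have "\<dots> \<simeq> K (plet (PB d p) s t)"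
      by (intro commutingD(6)[OF K] req_sym[OF plet_PB]) (use z in auto)
    finally show "plet (PB d p) s (K t) \<simeq> K (plet (PB d p) s t)" .
  qed
next
  case (PT p q)
  show ?case unfolding movable_def
  proof (intro allI impI)
    fix K :: "'g tm \<Rightarrow> 'g tm" and F X and s t :: "'g tm"
    assume K: "commuting K F X" and dis: "set (pvars (PT p q)) \<inter> (F \<union> X) = {}" "fv s \<inter> X = {}"
    note fin = commutingD(1,2)[OF K]
    let ?Y = "set (pvars p) \<union> set (pvars q) \<union> fv t \<union> F \<union> X"
    define z where "z = fresh_var ?Y"
    have z: "z \<notin> ?Y" "Suc z \<notin> ?Y" unfolding z_def by (rule fresh_var, use fin in simp)+
    have "plet (PT p q) s (K t) \<simeq> LetIn (PPair z (Suc z)) s (plet p (V z) (plet q (V (Suc z)) (K t)))"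
      by (rule movable_PT[OF PT.IH(1)]) (use z commutingD(3)[OF K] in auto)
    also have "\<dots> \<simeq> LetIn (PPair z (Suc z)) s (plet p (V z) (K (plet q (V (Suc z)) t)))"
      by (intro req_LetIn req_plet req_refl PT.IH(2)[unfolded movable_def, rule_format, OF K]) (use dis z in auto)
    also have "\<dots> \<simeq> LetIn (PPair z (Suc z)) s (K (plet p (V z) (plet q (V (Suc z)) t)))"
      by (intro req_LetIn req_refl PT.IH(1)[unfolded movable_def, rule_format, OF K]) (use dis z in auto)
    also have "\<dots> \<simeq> K (LetIn (PPair z (Suc z)) s (plet p (V z) (plet q (V (Suc z)) t)))"
      by (rule commutingD(4)[OF K]) (use dis z in auto)
    also have "\<dots> \<simeq> K (plet (PT p q) s t)"
      by (intro commutingD(6)[OF K] req_sym[OF movable_PT[OF PT.IH(1)]]) (use z in auto)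
    finally show "plet (PT p q) s (K t) \<simeq> K (plet (PT p q) s t)" .
  qed
qed

lemma plet_commuting:
  assumes "commuting K F X" "set (pvars p) \<inter> (F \<union> X) = {}" "fv s \<inter> X = {}"
  shows "plet p s (K t) \<simeq> K (plet p s t)"
  using movable[of p] assms unfolding movable_def by blast

lemmas plet_PT = movable_PT[OF movable]

lemma commuting_plet_body: "commuting (plet p r) (fv r) (set (pvars p))"
proof -
  have "LetIn P s (plet p r t) \<simeq> plet p r (LetIn P s t)"
    if "set_pat P \<inter> (fv r \<union> set (pvars p)) = {}" "fv s \<inter> set (pvars p) = {}" for P s t
    by (rule req_sym, rule plet_commuting[OF commuting_body]) (use that in auto)
  then show ?thesis by (simp add: commuting_def red_plet)
qed

lemma commuting_plet_scrut: "commuting (\<lambda>t. plet p t u) (fv u - set (pvars p)) {}"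
proof -
  have "LetIn P s (plet p t u) \<simeq> plet p (LetIn P s t) u"
    if "set_pat P \<inter> (fv u - set (pvars p)) = {}" for P s t
    by (rule plet_comm_scrut) (rule that)
  then show ?thesis by (simp add: commuting_def red_plet Un_commute)
qed

lemma plet_plet:
  "set (pvars p) \<inter> (fv u - set (pvars q)) = {} \<Longrightarrow> plet p s (plet q t u) \<simeq> plet q (plet p s t) u"
  by (rule plet_commuting[OF commuting_plet_scrut]) auto

lemma plet_Tup:
  assumes "set (pvars p) \<inter> set (pvars q) = {}" "set (pvars p) \<inter> fv t' = {}" "set (pvars q) \<inter> fv t = {}"
    and "set (pvars p) \<inter> fv s' = {}"
  shows "plet p s (plet q s' (Tup t t')) \<simeq> Tup (plet p s t) (plet q s' t')"
proof -
  have "plet p s (plet q s' (Tup t t')) \<simeq> plet p s (Tup t (plet q s' t'))"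
    by (intro req_plet req_refl plet_commuting[OF commuting_Tup2]) (use assms in auto)
  also have "\<dots> \<simeq> Tup (plet p s t) (plet q s' t')"
    by (rule plet_commuting[OF commuting_Tup1]) (use assms in auto)
  finally show ?thesis .
qed

section \<open>Beta and eta laws for nested matches\<close>

lemma beta_PT:
  assumes "set (pvars p) \<inter> fv t = {}"
  shows "plet (PT p q) (Tup s t) u \<leadsto> plet p s (plet q t u)"
proof -
  let ?Y = "set (pvars p) \<union> set (pvars q) \<union> fv u \<union> fv s \<union> fv t"
  define z where "z = fresh_var ?Y"
  have z: "z \<notin> ?Y" "Suc z \<notin> ?Y" unfolding z_def by (rule fresh_var, simp)+
  have "plet (PT p q) (Tup s t) u \<simeq> LetIn (PPair z (Suc z)) (Tup s t) (plet p (V z) (plet q (V (Suc z)) u))"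
    by (rule plet_PT) (use z in auto)
  also have "\<dots> \<leadsto> LetIn (PVar z) s (LetIn (PVar (Suc z)) t (plet p (V z) (plet q (V (Suc z)) u)))"
    by (rule beta_pair) (use z in auto)
  also have "\<dots> \<simeq> LetIn (PVar z) s (plet p (V z) (LetIn (PVar (Suc z)) t (plet q (V (Suc z)) u)))"
    by (intro req_LetIn req_refl commutingD(4)[OF commuting_plet_body]) (use z assms in auto)
  also have "\<dots> \<simeq> plet p s (LetIn (PVar (Suc z)) t (plet q (V (Suc z)) u))"
    by (rule plet_let_var) (use z in auto)
  also have "\<dots> \<simeq> plet p s (plet q t u)"
    by (intro req_plet req_refl plet_let_var) (use z in auto)
  finally show ?thesis .
qed

lemma beta_PB: "plet (PB d p) (BoxTm d s) u \<leadsto> plet p s u"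
proof -
  let ?Y = "set (pvars p) \<union> fv u"
  obtain z where z: "z \<notin> ?Y" using ex_fresh[of ?Y] by auto
  have "plet (PB d p) (BoxTm d s) u \<simeq> LetIn (PBox d z) (BoxTm d s) (plet p (V z) u)"
    by (rule plet_PB) (rule z)
  also have "\<dots> \<leadsto> LetIn (PVar z) s (plet p (V z) u)" by (rule beta_box)
  also have "\<dots> \<simeq> plet p s u" by (rule plet_let_var) (use z in auto)
  finally show ?thesis .
qed

text \<open>The match falls apart along the tree. At a leaf it is \<open>let x = x in u\<close>,
  which \<open>red_let_same\<close> removes.\<close>

lemma beta_plet: "distinct (pvars p) \<Longrightarrow> set (pvars p) \<subseteq> fv u \<Longrightarrow> plet p (pval p) u \<leadsto> u"
proof (induction p arbitrary: u)
  case (PL x)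
  then show ?case by (simp add: red_let_same)
next
  case PO
  then show ?case by (simp add: beta_unit)
next
  case (PT p q)
  have "plet (PT p q) (Tup (pval p) (pval q)) u \<leadsto> plet p (pval p) (plet q (pval q) u)"
    by (rule beta_PT) (use PT.prems in auto)
  also have "\<dots> \<leadsto> plet p (pval p) u"
    by (intro red_plet red_refl PT.IH(2)) (use PT.prems in auto)
  also have "\<dots> \<leadsto> u" by (rule PT.IH(1)) (use PT.prems in auto)
  finally show ?case by simp
next
  case (PB d p)
  have "plet (PB d p) (BoxTm d (pval p)) u \<leadsto> plet p (pval p) u" by (rule beta_PB)
  also have "\<dots> \<leadsto> u" by (rule PB.IH) (use PB.prems in auto)
  finally show ?case by simp
qed

text \<open>Below a match of the same shape, eta is a rewrite step even where the pattern contains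
  units: the inner match is moved out and its rebuilt value meets the outer pattern, so only beta is
  used for the unit.\<close>

lemma eta_scrut:
  "distinct (pvars (prename f p)) \<Longrightarrow> plet p (plet (prename f p) t (pval (prename f p))) u \<leadsto> plet p t u"
proof (induction p arbitrary: t u)
  case (PL x)
  show ?case by (auto intro!: red_LetIn req_red(1)[OF req_let_var])
next
  case PO
  have "LetIn PUnit (LetIn PUnit t Star) u \<simeq> LetIn PUnit t (LetIn PUnit Star u)"
    by (rule req_sym, rule comm_scrut) simp
  also have "\<dots> \<leadsto> LetIn PUnit t u" by (intro red_LetIn red_refl beta_unit)
  finally show ?case by simp
next
  case (PT p1 p2)
  let ?q1 = "prename f p1" and ?q2 = "prename f p2"
  let ?Y = "set (pvars p1) \<union> set (pvars p2) \<union> set (pvars ?q1) \<union> set (pvars ?q2) \<union> fv u"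
  define z where "z = fresh_var ?Y"
  have z: "z \<notin> ?Y" "Suc z \<notin> ?Y" unfolding z_def by (rule fresh_var, simp)+
  have dis: "distinct (pvars ?q1)" "distinct (pvars ?q2)" "set (pvars ?q1) \<inter> set (pvars ?q2) = {}"
    using PT.prems by simp_all
  let ?X1 = "plet ?q1 (V z) (pval ?q1)" and ?X2 = "plet ?q2 (V (Suc z)) (pval ?q2)"
  let ?P = "PPair z (Suc z)"
  have "plet (PT ?q1 ?q2) t (Tup (pval ?q1) (pval ?q2)) \<simeq>
      LetIn ?P t (plet ?q1 (V z) (plet ?q2 (V (Suc z)) (Tup (pval ?q1) (pval ?q2))))"
    by (rule plet_PT) (use z in auto)
  also have "\<dots> \<simeq> LetIn ?P t (Tup ?X1 ?X2)"
    by (intro req_LetIn req_refl plet_Tup) (use dis z in auto)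
  finally have "plet (PT p1 p2) (plet (PT ?q1 ?q2) t (Tup (pval ?q1) (pval ?q2))) u \<simeq>
      plet (PT p1 p2) (LetIn ?P t (Tup ?X1 ?X2)) u"
    by (intro req_plet req_refl)
  also have "\<dots> \<simeq> LetIn ?P t (plet (PT p1 p2) (Tup ?X1 ?X2) u)"
    by (rule req_sym, rule plet_comm_scrut) (use z in auto)
  also have "\<dots> \<leadsto> LetIn ?P t (plet p1 ?X1 (plet p2 ?X2 u))"
    by (intro red_LetIn red_refl beta_PT) (use z in auto)
  also have "\<dots> \<leadsto> LetIn ?P t (plet p1 (V z) (plet p2 ?X2 u))"
    by (intro red_LetIn red_refl PT.IH(1) dis)
  also have "\<dots> \<leadsto> LetIn ?P t (plet p1 (V z) (plet p2 (V (Suc z)) u))"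
    by (intro red_LetIn red_plet red_refl PT.IH(2) dis)
  also have "\<dots> \<simeq> plet (PT p1 p2) t u"
    by (rule req_sym, rule plet_PT) (use z in auto)
  finally show ?case by simp
next
  case (PB d p)
  let ?q = "prename f p"
  let ?Y = "set (pvars p) \<union> set (pvars ?q) \<union> fv u"
  obtain z where z: "z \<notin> ?Y" using ex_fresh[of ?Y] by auto
  have "plet (PB d ?q) t (BoxTm d (pval ?q)) \<simeq> LetIn (PBox d z) t (plet ?q (V z) (BoxTm d (pval ?q)))"
    by (rule plet_PB) (use z in auto)
  also have "\<dots> \<simeq> LetIn (PBox d z) t (BoxTm d (plet ?q (V z) (pval ?q)))"
    by (intro req_LetIn req_refl plet_commuting[OF commuting_BoxTm]) auto
  finally have "plet (PB d p) (plet (PB d ?q) t (BoxTm d (pval ?q))) u \<simeq>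
      plet (PB d p) (LetIn (PBox d z) t (BoxTm d (plet ?q (V z) (pval ?q)))) u"
    by (intro req_plet req_refl)
  also have "\<dots> \<simeq> LetIn (PBox d z) t (plet (PB d p) (BoxTm d (plet ?q (V z) (pval ?q))) u)"
    by (rule req_sym, rule plet_comm_scrut) (use z in auto)
  also have "\<dots> \<leadsto> LetIn (PBox d z) t (plet p (plet ?q (V z) (pval ?q)) u)"
    by (intro red_LetIn red_refl beta_PB)
  also have "\<dots> \<leadsto> LetIn (PBox d z) t (plet p (V z) u)"
    by (intro red_LetIn red_refl PB.IH) (use PB.prems in simp)
  also have "\<dots> \<simeq> plet (PB d p) t u"
    by (rule req_sym, rule plet_PB) (use z in auto)
  finally show ?case by simp
qed

text \<open>Matching against variables is a renaming, carried out component by component. As the new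
  names avoid the pattern, doing this in succession gives the simultaneous renaming.\<close>

lemma subst_plet:
  assumes "distinct (pvars p)" "set (pvars p) \<subseteq> fv u" "bv u = {}" "f ` set (pvars p) \<inter> set (pvars p) = {}"
  shows "plet p (pval (prename f p)) u \<leadsto> subst u (\<lambda>x. if x \<in> set (pvars p) then V (f x) else V x)"
  using assms
proof (induction p arbitrary: u)
  case (PL x)
  have "LetIn (PVar x) (V (f x)) u \<leadsto> subst u (V(x := V (f x)))"
  proof (rule redI)
    show "fv (LetIn (PVar x) (V (f x)) u) = fv (subst u (V(x := V (f x))))"
      using PL by (subst fv_subst_upd) auto
    show "eqt \<rho> c (LetIn (PVar x) (V (f x)) u) (subst u (V(x := V (f x)))) A"
      if "wt \<rho> c (LetIn (PVar x) (V (f x)) u) A" for \<rho> c A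
      using that by (rule eqt_beta_let) (use PL in simp)
  qed
  moreover have "subst u (\<lambda>y. if y \<in> set (pvars (PL x)) then V (f y) else V y) = subst u (V(x := V (f x)))"
    by (rule subst_cong_fv) simp
  ultimately show ?case by simp
next
  case PO
  then show ?case by (simp add: beta_unit)
next
  case (PT p q)
  let ?\<sigma> = "\<lambda>p x. if x \<in> set (pvars p) then V (f x) else V x :: 'g tm"
  have "plet (PT p q) (Tup (pval (prename f p)) (pval (prename f q))) u \<leadsto>
      plet p (pval (prename f p)) (plet q (pval (prename f q)) u)"
    by (rule beta_PT) (use PT.prems in auto)
  also have "\<dots> \<leadsto> plet p (pval (prename f p)) (subst u (?\<sigma> q))"
    by (intro red_plet red_refl PT.IH(2)) (use PT.prems in auto)
  also have "\<dots> \<leadsto> subst (subst u (?\<sigma> q)) (?\<sigma> p)"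
  proof (rule PT.IH(1))
    have cf: "capture_free u (?\<sigma> q)" using PT.prems by (simp add: capture_free_def)
    show "set (pvars p) \<subseteq> fv (subst u (?\<sigma> q))"
    proof
      fix x assume "x \<in> set (pvars p)"
      with PT.prems have "x \<in> fv u" "x \<notin> set (pvars q)" by auto
      then show "x \<in> fv (subst u (?\<sigma> q))" unfolding fv_subst[OF cf] by force
    qed
    show "bv (subst u (?\<sigma> q)) = {}" using PT.prems by (subst bv_subst_var) auto
  qed (use PT.prems in auto)
  also have "subst (subst u (?\<sigma> q)) (?\<sigma> p) = subst u (\<lambda>x. subst (?\<sigma> q x) (?\<sigma> p))"
    by (rule subst_subst) (use PT.prems in \<open>simp add: capture_free_def\<close>)
  also have "\<dots> = subst u (?\<sigma> (PT p q))"
    by (rule subst_cong_fv) (use PT.prems in auto)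
  finally show ?case by simp
next
  case (PB d p)
  have "plet (PB d p) (BoxTm d (pval (prename f p))) u \<leadsto> plet p (pval (prename f p)) u" by (rule beta_PB)
  also have "\<dots> \<leadsto> subst u (\<lambda>x. if x \<in> set (pvars p) then V (f x) else V x)"
    by (rule PB.IH) (use PB.prems in auto)
  finally show ?case by simp
qed

section \<open>Typing, congruence and renaming for nested matches\<close>

lemma wt_pval: "ptyped p e A \<rho> \<Longrightarrow> distinct (pvars p) \<Longrightarrow> set_ty A \<subseteq> qubits S \<Longrightarrow> wt \<rho> e (pval p) A"
  by (induction p arbitrary: e A) (auto intro!: wt_V wt_Star wt_Tup wt_BoxTm)

lemma eqt_plet:
  assumes "eqt \<rho> e t t' A" "ptyped p e A \<beta>" "distinct (pvars p)"
    and "eqt (override_on \<rho> \<beta> (set (pvars p))) c u u' C" "set (pvars p) \<subseteq> fv u"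
    and "fv t \<inter> (fv u - set (pvars p)) = {}"
  shows "eqt \<rho> c (plet p t u) (plet p t' u') C"
  using assms
proof (induction p arbitrary: \<rho> e t t' A u u')
  case (PL x)
  then show ?case by (auto intro!: eqt_LetIn[of _ e _ _ A _ \<beta>])
next
  case PO
  then show ?case by (auto intro!: eqt_LetIn[of _ e _ _ A _ \<beta>])
next
  case (PT p q)
  \<comment> \<open>Equal terms have the same free variables, so both sides unfold with the same
    auxiliary names.\<close>
  have fvu: "fv u' = fv u" using eqt_fv[OF PT.prems(4)] by simp
  let ?Y = "set (pvars p) \<union> set (pvars q) \<union> fv u"
  define z where "z = fresh_var ?Y"
  have z: "z \<notin> ?Y" "Suc z \<notin> ?Y" unfolding z_def by (rule fresh_var, simp)+
  from PT.prems(2) obtain B C' where A: "A = Tens B C'" "ptyped p e B \<beta>" "ptyped q e C' \<beta>" by auto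
  have ty: "set_ty B \<subseteq> qubits S" "set_ty C' \<subseteq> qubits S"
    using wt_set_ty[OF eqt_wt(1)[OF PT.prems(1)]] A by auto
  let ?\<gamma> = "(\<lambda>_. (e, B))(Suc z := (e, C'))"
  let ?P = "PPair z (Suc z)"
  let ?\<rho> = "override_on \<rho> ?\<gamma> (set_pat ?P)"
  have u: "eqt (override_on (override_on ?\<rho> \<beta> (set (pvars p))) \<beta> (set (pvars q))) c u u' C"
    using PT.prems(4) by (rule eqt_cong_env) (use z in \<open>auto simp: override_on_def\<close>)
  have q: "eqt (override_on ?\<rho> \<beta> (set (pvars p))) c (plet q (V (Suc z)) u) (plet q (V (Suc z)) u') C"
    by (rule PT.IH(2)[OF _ A(3) _ u])
      (use z PT.prems ty in \<open>auto intro!: eqt_V simp: override_on_def\<close>)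
  have p: "eqt ?\<rho> c (plet p (V z) (plet q (V (Suc z)) u)) (plet p (V z) (plet q (V (Suc z)) u')) C"
    by (rule PT.IH(1)[OF _ A(2) _ q])
      (use z PT.prems ty in \<open>auto intro!: eqt_V simp: override_on_def\<close>)
  have "eqt \<rho> c (LetIn ?P t (plet p (V z) (plet q (V (Suc z)) u))) (LetIn ?P t' (plet p (V z) (plet q (V (Suc z)) u'))) C"
    using PT.prems(1) _ p by (rule eqt_LetIn) (use A z PT.prems(6) in auto)
  then show ?case by (simp add: Let_def fvu z_def)
next
  case (PB d p)
  have fvu: "fv u' = fv u" using eqt_fv[OF PB.prems(4)] by simp
  let ?Y = "set (pvars p) \<union> fv u"
  define z where "z = fresh_var ?Y"
  have z: "z \<notin> ?Y" unfolding z_def by (rule fresh_var, simp)+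
  from PB.prems(2) obtain B where A: "A = BoxTy d B" "ptyped p (e + d) B \<beta>" by auto
  have ty: "set_ty B \<subseteq> qubits S"
    using wt_set_ty[OF eqt_wt(1)[OF PB.prems(1)]] A by auto
  let ?\<gamma> = "\<lambda>_. (e + d, B)"
  let ?P = "PBox d z"
  let ?\<rho> = "override_on \<rho> ?\<gamma> (set_pat ?P)"
  have u: "eqt (override_on ?\<rho> \<beta> (set (pvars p))) c u u' C"
    using PB.prems(4) by (rule eqt_cong_env) (use z in \<open>auto simp: override_on_def\<close>)
  have p: "eqt ?\<rho> c (plet p (V z) u) (plet p (V z) u') C"
    by (rule PB.IH[OF _ A(2) _ u])
      (use z PB.prems ty in \<open>auto intro!: eqt_V simp: override_on_def\<close>)
  have "eqt \<rho> c (LetIn ?P t (plet p (V z) u)) (LetIn ?P t' (plet p (V z) u')) C"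
    using PB.prems(1) _ p by (rule eqt_LetIn) (use A z PB.prems(6) in auto)
  then show ?case by (simp add: Let_def fvu z_def)
qed

lemma wt_plet:
  assumes "wt \<rho> e t A" "ptyped p e A \<beta>" "distinct (pvars p)"
    and "wt (override_on \<rho> \<beta> (set (pvars p))) c u C" "set (pvars p) \<subseteq> fv u"
    and "fv t \<inter> (fv u - set (pvars p)) = {}"
  shows "wt \<rho> c (plet p t u) C"
  using eqt_wt(1)[OF eqt_plet[OF eqt_refl[OF assms(1)] assms(2,3) eqt_refl[OF assms(4)] assms(5,6)]] .

lemma wt_pletE:
  assumes "wt \<rho> c (plet p t u) C" "distinct (pvars p)"
  obtains e A \<beta> where "wt \<rho> e t A" "ptyped p e A \<beta>" "wt (override_on \<rho> \<beta> (set (pvars p))) c u C"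
    "set (pvars p) \<subseteq> fv u" "fv t \<inter> (fv u - set (pvars p)) = {}"
  using assms
proof (induction p arbitrary: \<rho> t u thesis)
  case (PL x)
  from PL.prems(2) show ?case
    by (simp, elim wt_LetInE) (rule PL.prems(1), auto)
next
  case PO
  from PO.prems(2) show ?case
    by (simp, elim wt_LetInE) (rule PO.prems(1), auto)
next
  case (PT p q)
  let ?Y = "set (pvars p) \<union> set (pvars q) \<union> fv u"
  define z where "z = fresh_var ?Y"
  have z: "z \<notin> ?Y" "Suc z \<notin> ?Y" unfolding z_def by (rule fresh_var, simp)+
  let ?P = "PPair z (Suc z)"
  have "wt \<rho> c (LetIn ?P t (plet p (V z) (plet q (V (Suc z)) u))) C"
    using PT.prems(2) by (simp add: Let_def z_def)
  then obtain e A \<gamma> where w: "wt \<rho> e t A" "pat_typed ?P e A \<gamma>"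
    "wt (override_on \<rho> \<gamma> (set_pat ?P)) c (plet p (V z) (plet q (V (Suc z)) u)) C"
    "fv t \<inter> (fv (plet p (V z) (plet q (V (Suc z)) u)) - set_pat ?P) = {}"
    by (rule wt_LetInE)
  from w(2) obtain A1 A2 where A: "A = Tens A1 A2" "\<gamma> z = (e, A1)" "\<gamma> (Suc z) = (e, A2)" by auto
  have dp: "distinct (pvars p)" "distinct (pvars q)" "set (pvars p) \<inter> set (pvars q) = {}"
    using PT.prems(3) by auto
  obtain e1 B1 \<beta>1 where 1: "wt (override_on \<rho> \<gamma> (set_pat ?P)) e1 (V z) B1" "ptyped p e1 B1 \<beta>1"
    "wt (override_on (override_on \<rho> \<gamma> (set_pat ?P)) \<beta>1 (set (pvars p))) c (plet q (V (Suc z)) u) C"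
    "set (pvars p) \<subseteq> fv (plet q (V (Suc z)) u)"
    using PT.IH(1)[OF _ w(3) dp(1)] by metis
  obtain e2 B2 \<beta>2 where 2: "wt (override_on (override_on \<rho> \<gamma> (set_pat ?P)) \<beta>1 (set (pvars p))) e2 (V (Suc z)) B2" "ptyped q e2 B2 \<beta>2"
    "wt (override_on (override_on (override_on \<rho> \<gamma> (set_pat ?P)) \<beta>1 (set (pvars p))) \<beta>2 (set (pvars q))) c u C"
    "set (pvars q) \<subseteq> fv u"
    using PT.IH(2)[OF _ 1(3) dp(2)] by metis
  \<comment> \<open>The auxiliary variables carry the two components of the scrutinee; this fixes
    the grades and types that were found for the two halves separately.\<close>
  have eq: "e1 = e" "B1 = A1" "e2 = e" "B2 = A2"
    using 1(1) 2(1) A z by (auto elim!: wt_VE simp: override_on_def)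
  \<comment> \<open>The halves bind disjoint variables, so their declarations can be merged.\<close>
  let ?\<beta> = "override_on \<beta>1 \<beta>2 (set (pvars q))"
  show ?case
  proof (rule PT.prems(1)[OF w(1)])
    have "ptyped p e A1 ?\<beta>"
      using 1(2) eq ptyped_cong[of p ?\<beta> \<beta>1] dp(3) by (auto simp: override_on_def disjoint_iff)
    moreover have "ptyped q e A2 ?\<beta>"
      using 2(2) eq ptyped_cong[of q ?\<beta> \<beta>2] by (auto simp: override_on_def)
    ultimately show "ptyped (PT p q) e A ?\<beta>" using A by auto
    show "wt (override_on \<rho> ?\<beta> (set (pvars (PT p q)))) c u C"
      using 2(3) by (rule wt_cong_env) (use z in \<open>auto simp: override_on_def\<close>)
    show "set (pvars (PT p q)) \<subseteq> fv u" using 1(4) 2(4) z by auto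
    show "fv t \<inter> (fv u - set (pvars (PT p q))) = {}" using w(4) z by auto
  qed
next
  case (PB d p)
  let ?Y = "set (pvars p) \<union> fv u"
  define z where "z = fresh_var ?Y"
  have z: "z \<notin> ?Y" unfolding z_def by (rule fresh_var, simp)
  let ?P = "PBox d z"
  have "wt \<rho> c (LetIn ?P t (plet p (V z) u)) C"
    using PB.prems(2) by (simp add: Let_def z_def)
  then obtain e A \<gamma> where w: "wt \<rho> e t A" "pat_typed ?P e A \<gamma>"
    "wt (override_on \<rho> \<gamma> (set_pat ?P)) c (plet p (V z) u) C"
    "fv t \<inter> (fv (plet p (V z) u) - set_pat ?P) = {}"
    by (rule wt_LetInE)
  from w(2) obtain A1 where A: "A = BoxTy d A1" "\<gamma> z = (e + d, A1)" by auto
  have dp: "distinct (pvars p)" using PB.prems(3) by auto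
  obtain e1 B1 \<beta> where 1: "wt (override_on \<rho> \<gamma> (set_pat ?P)) e1 (V z) B1" "ptyped p e1 B1 \<beta>"
    "wt (override_on (override_on \<rho> \<gamma> (set_pat ?P)) \<beta> (set (pvars p))) c u C"
    "set (pvars p) \<subseteq> fv u"
    using PB.IH[OF _ w(3) dp(1)] by metis
  have eq: "e1 = e + d" "B1 = A1"
    using 1(1) A z by (auto elim!: wt_VE simp: override_on_def)
  show ?case
  proof (rule PB.prems(1)[OF w(1)])
    show "ptyped (PB d p) e A \<beta>" using A 1(2) eq by auto
    show "wt (override_on \<rho> \<beta> (set (pvars (PB d p)))) c u C"
      using 1(3) by (rule wt_cong_env) (use z in \<open>auto simp: override_on_def\<close>)
    show "set (pvars (PB d p)) \<subseteq> fv u" using 1(4) by auto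
    show "fv t \<inter> (fv u - set (pvars (PB d p))) = {}" using w(4) z by auto
  qed
qed

text \<open>The matches of the components are first distributed over the rebuilt tuple; then the
  induction hypothesis contracts each component, and eta for a single pattern remains.\<close>

lemma eqt_plet_eta:
  assumes "wt \<rho> e t A" "ptyped p e A \<beta>" "distinct (pvars p)"
  shows "eqt \<rho> e (plet p t (pval p)) t A"
  using assms
proof (induction p arbitrary: \<rho> e t A)
  case (PL x)
  with eqt_eta[of \<rho> e t A "PVar x" \<beta>] show ?case by simp
next
  case PO
  with eqt_eta[of \<rho> e t A "PUnit" \<beta>] show ?case by simp
next
  case (PT p q)
  let ?Y = "set (pvars p) \<union> set (pvars q)"
  define z where "z = fresh_var ?Y"
  have z: "z \<notin> ?Y" "Suc z \<notin> ?Y" unfolding z_def by (rule fresh_var, simp)+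
  from PT.prems(2) obtain B C where A: "A = Tens B C" "ptyped p e B \<beta>" "ptyped q e C \<beta>" by auto
  have ty: "set_ty B \<subseteq> qubits S" "set_ty C \<subseteq> qubits S" using wt_set_ty[OF PT.prems(1)] A by auto
  let ?P = "PPair z (Suc z)"
  let ?\<gamma> = "(\<lambda>_. (e, B))(Suc z := (e, C))"
  let ?\<rho> = "override_on \<rho> ?\<gamma> (set_pat ?P)"
  have \<gamma>: "pat_typed ?P e A ?\<gamma>" using A by simp
  have w: "wt \<rho> e (plet (PT p q) t (Tup (pval p) (pval q))) A"
  proof (rule wt_plet[OF PT.prems])
    have "wt (override_on \<rho> \<beta> (set (pvars (PT p q)))) e (pval (PT p q)) A"
    proof (rule wt_pval)
      show "ptyped (PT p q) e A (override_on \<rho> \<beta> (set (pvars (PT p q))))"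
        using PT.prems(2) ptyped_cong[of "PT p q" \<beta> "override_on \<rho> \<beta> (set (pvars (PT p q)))"] by simp
    qed (use PT.prems wt_set_ty[OF PT.prems(1)] in auto)
    then show "wt (override_on \<rho> \<beta> (set (pvars (PT p q)))) e (Tup (pval p) (pval q)) A" by simp
  qed auto
  have "plet (PT p q) t (Tup (pval p) (pval q)) \<simeq>
      LetIn ?P t (plet p (V z) (plet q (V (Suc z)) (Tup (pval p) (pval q))))"
    by (rule plet_PT) (use z in auto)
  also have "\<dots> \<simeq> LetIn ?P t (Tup (plet p (V z) (pval p)) (plet q (V (Suc z)) (pval q)))"
    by (intro req_LetIn req_refl plet_Tup) (use PT.prems(3) z in auto)
  finally have 1: "eqt \<rho> e (plet (PT p q) t (Tup (pval p) (pval q)))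
      (LetIn ?P t (Tup (plet p (V z) (pval p)) (plet q (V (Suc z)) (pval q)))) A"
    by (intro red_eqt[OF req_red(1)] w)
  have "eqt ?\<rho> e (plet p (V z) (pval p)) (V z) B"
    by (rule PT.IH(1)[OF _ A(2)]) (use PT.prems(3) ty in \<open>auto intro!: wt_V\<close>)
  moreover have "eqt ?\<rho> e (plet q (V (Suc z)) (pval q)) (V (Suc z)) C"
    by (rule PT.IH(2)[OF _ A(3)]) (use PT.prems(3) ty in \<open>auto intro!: wt_V\<close>)
  ultimately have "eqt ?\<rho> e (Tup (plet p (V z) (pval p)) (plet q (V (Suc z)) (pval q))) (Tup (V z) (V (Suc z))) A"
    unfolding A(1) by (intro eqt_Tup) auto
  then have 2: "eqt \<rho> e (LetIn ?P t (Tup (plet p (V z) (pval p)) (plet q (V (Suc z)) (pval q))))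
      (LetIn ?P t (pat_tm ?P)) A"
    unfolding pat_tm.simps by (intro eqt_LetIn[OF eqt_refl[OF PT.prems(1)] \<gamma>]) auto
  from eqt_trans[OF 1 eqt_trans[OF 2 eqt_eta[OF PT.prems(1) \<gamma>]]] show ?case by simp
next
  case (PB d p)
  let ?Y = "set (pvars p)"
  define z where "z = fresh_var ?Y"
  have z: "z \<notin> ?Y" unfolding z_def by (rule fresh_var, simp)
  from PB.prems(2) obtain B where A: "A = BoxTy d B" "ptyped p (e + d) B \<beta>" by auto
  have ty: "set_ty B \<subseteq> qubits S" using wt_set_ty[OF PB.prems(1)] A by auto
  let ?P = "PBox d z"
  let ?\<gamma> = "\<lambda>_. (e + d, B)"
  let ?\<rho> = "override_on \<rho> ?\<gamma> (set_pat ?P)"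
  have \<gamma>: "pat_typed ?P e A ?\<gamma>" using A by simp
  have w: "wt \<rho> e (plet (PB d p) t (BoxTm d (pval p))) A"
  proof (rule wt_plet[OF PB.prems])
    have "wt (override_on \<rho> \<beta> (set (pvars (PB d p)))) e (pval (PB d p)) A"
    proof (rule wt_pval)
      show "ptyped (PB d p) e A (override_on \<rho> \<beta> (set (pvars (PB d p))))"
        using PB.prems(2) ptyped_cong[of "PB d p" \<beta> "override_on \<rho> \<beta> (set (pvars (PB d p)))"] by simp
    qed (use PB.prems wt_set_ty[OF PB.prems(1)] in auto)
    then show "wt (override_on \<rho> \<beta> (set (pvars (PB d p)))) e (BoxTm d (pval p)) A" by simp
  qed auto
  have "plet (PB d p) t (BoxTm d (pval p)) \<simeq> LetIn ?P t (plet p (V z) (BoxTm d (pval p)))"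
    by (rule plet_PB) (use z in auto)
  also have "\<dots> \<simeq> LetIn ?P t (BoxTm d (plet p (V z) (pval p)))"
    by (intro req_LetIn req_refl plet_commuting[OF commuting_BoxTm]) auto
  finally have 1: "eqt \<rho> e (plet (PB d p) t (BoxTm d (pval p))) (LetIn ?P t (BoxTm d (plet p (V z) (pval p)))) A"
    by (intro red_eqt[OF req_red(1)] w)
  have "eqt ?\<rho> (e + d) (plet p (V z) (pval p)) (V z) B"
    by (rule PB.IH[OF _ A(2)]) (use PB.prems(3) ty in \<open>auto intro!: wt_V\<close>)
  then have "eqt ?\<rho> e (BoxTm d (plet p (V z) (pval p))) (BoxTm d (V z)) A"
    unfolding A(1) by (intro eqt_BoxTm)
  then have 2: "eqt \<rho> e (LetIn ?P t (BoxTm d (plet p (V z) (pval p)))) (LetIn ?P t (pat_tm ?P)) A"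
    unfolding pat_tm.simps by (intro eqt_LetIn[OF eqt_refl[OF PB.prems(1)] \<gamma>]) auto
  from eqt_trans[OF 1 eqt_trans[OF 2 eqt_eta[OF PB.prems(1) \<gamma>]]] show ?case by simp
qed

text \<open>As for single patterns, the scrutinee is eta-expanded with the new names and the new
  match is moved outwards. Injectivity keeps the new variables distinct.\<close>

lemma alpha_plet:
  assumes "distinct (pvars p)" "inj_on f (set (pvars p))" "f ` set (pvars p) \<inter> (fv u - set (pvars p)) = {}"
  shows "plet p t u \<leadsto> plet (prename f p) t (plet p (pval (prename f p)) u)"
proof (rule redI)
  let ?q = "prename f p"
  show "fv (plet p t u) = fv (plet ?q t (plet p (pval ?q) u))" using assms by auto
  fix \<rho> c A assume "wt \<rho> c (plet p t u) A"
  then obtain e B \<beta> where w: "wt \<rho> e t B" "ptyped p e B \<beta>" "wt (override_on \<rho> \<beta> (set (pvars p))) c u A"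
    "set (pvars p) \<subseteq> fv u" "fv t \<inter> (fv u - set (pvars p)) = {}"
    using assms(1) by (rule wt_pletE)
  \<comment> \<open>The new name of a variable gets the declaration of the old one, read back along
    the injective \<open>f\<close>.\<close>
  let ?\<beta> = "\<beta> \<circ> the_inv_into (set (pvars p)) f"
  have "ptyped p e B (?\<beta> \<circ> f)"
    using w(2) ptyped_cong[of p \<beta> "?\<beta> \<circ> f"] assms(2) by (simp add: the_inv_into_f_f)
  then have q: "ptyped ?q e B ?\<beta>" by (simp add: ptyped_prename)
  have dq: "distinct (pvars ?q)" using assms by (simp add: distinct_map)
  have 1: "eqt \<rho> c (plet p t u) (plet p (plet ?q t (pval ?q)) u) A"
    using eqt_sym[OF eqt_plet_eta[OF w(1) q dq]] w(2) assms(1) eqt_refl[OF w(3)] w(4,5) by (rule eqt_plet)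
  have "plet ?q t (plet p (pval ?q) u) \<simeq> plet p (plet ?q t (pval ?q)) u"
    by (rule plet_plet) (use assms(3) in auto)
  from eqt_trans[OF 1 red_eqt[OF req_red(2)[OF this] eqt_wt(2)[OF 1]]]
  show "eqt \<rho> c (plet p t u) (plet ?q t (plet p (pval ?q) u)) A" .
qed

end

section \<open>Points of a type\<close>

text \<open>Every type is a tensor product of shifted qubits. \<open>flat\<close> lists them, and \<open>ty_pat A n\<close> names them
  \<open>n\<close>, \<open>n + 1\<close>, \dots\<close>

primrec flat :: "'q ty \<Rightarrow> (real \<times> 'q ty) list" where
  "flat One = []"
| "flat (Qubit q) = [(0, Qubit q)]"
| "flat (Tens A B) = flat A @ flat B"
| "flat (BoxTy d A) = map (\<lambda>(e, B). (d + e, B)) (flat A)"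

abbreviation width :: "'q ty \<Rightarrow> nat" where
  "width A \<equiv> length (flat A)"

primrec ty_pat :: "'q ty \<Rightarrow> nat \<Rightarrow> ptree" where
  "ty_pat One n = PO"
| "ty_pat (Qubit q) n = PL n"
| "ty_pat (Tens A B) n = PT (ty_pat A n) (ty_pat B (n + width A))"
| "ty_pat (BoxTy d A) n = PB d (ty_pat A n)"

abbreviation flat_env :: "'q ty \<Rightarrow> 'q env" where
  "flat_env A \<equiv> (\<lambda>i. flat A ! i)"

lemma pvars_ty_pat: "pvars (ty_pat A n) = [n..<n + width A]"
proof (induction A arbitrary: n)
  case (Tens A B)
  then show ?case using upt_add_eq_append[of n "n + width A" "width B"] by (simp add: add.assoc)
qed auto

lemma set_pvars_ty_pat [simp]: "set (pvars (ty_pat A n)) = {n..<n + width A}"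
  and distinct_pvars_ty_pat [simp]: "distinct (pvars (ty_pat A n))"
  by (simp_all add: pvars_ty_pat)

lemma prename_ty_pat: "prename (\<lambda>i. i + k) (ty_pat A n) = ty_pat A (n + k)"
  by (induction A arbitrary: n) (auto simp: add_ac)

lemma ptyped_ty_pat:
  assumes "\<forall>i < width A. \<beta> (n + i) = (e + fst (flat A ! i), snd (flat A ! i))"
  shows "ptyped (ty_pat A n) e A \<beta>"
  using assms
proof (induction A arbitrary: n e)
  case (Tens A B)
  have "ptyped (ty_pat A n) e A \<beta>"
  proof (rule Tens.IH(1), intro allI impI)
    fix i assume "i < width A"
    with Tens.prems[rule_format, of i] show "\<beta> (n + i) = (e + fst (flat A ! i), snd (flat A ! i))"
      by (simp add: nth_append)
  qed
  moreover have "ptyped (ty_pat B (n + width A)) e B \<beta>"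
  proof (rule Tens.IH(2), intro allI impI)
    fix i assume "i < width B"
    with Tens.prems[rule_format, of "width A + i"]
    show "\<beta> (n + width A + i) = (e + fst (flat B ! i), snd (flat B ! i))"
      by (simp add: nth_append add.assoc)
  qed
  ultimately show ?case by simp
next
  case (BoxTy d A)
  have "ptyped (ty_pat A n) (e + d) A \<beta>"
  proof (rule BoxTy.IH, intro allI impI)
    fix i assume "i < width A"
    with BoxTy.prems[rule_format, of i] show "\<beta> (n + i) = (e + d + fst (flat A ! i), snd (flat A ! i))"
      by (simp add: case_prod_beta add.assoc)
  qed
  then show ?case by simp
qed auto

lemma ptyped_ty_pat_env: "ptyped (ty_pat A 0) c A (shift_env c (flat_env A))"
  by (rule ptyped_ty_pat) simp

abbreviation ty_val :: "'q ty \<Rightarrow> nat \<Rightarrow> 'g tm" where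
  "ty_val A n \<equiv> pval (ty_pat A n)"

lemma subst_ty_val:
  assumes "width B \<le> w"
  shows "subst (ty_val B 0) (\<lambda>x. if x \<in> {0..<w} then V (x + N) else V x) = ty_val B N"
proof -
  have "subst (ty_val B 0 :: 'g tm) (\<lambda>x. if x \<in> {0..<w} then V (x + N) else V x) =
      subst (ty_val B 0) (\<lambda>x. V (x + N))"
    by (rule subst_cong_fv) (use assms in auto)
  also have "\<dots> = pval (prename (\<lambda>x. x + N) (ty_pat B 0))" by (rule subst_pval)
  finally show ?thesis by (simp add: prename_ty_pat)
qed

lemma flat_tensor_ty: "flat (tensor_ty qs) = map (\<lambda>q. (0, Qubit q)) qs"
  by (induction qs rule: tensor_ty.induct) auto

fun tuple :: "'g tm list \<Rightarrow> 'g tm" where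
  "tuple [] = Star"
| "tuple [t] = t"
| "tuple (t # t' # ts) = Tup t (tuple (t' # ts))"

lemma fv_tuple: "fv (tuple ts) = (\<Union>t \<in> set ts. fv t)"
  by (induction ts rule: tuple.induct) auto

primrec lets :: "nat \<Rightarrow> 'g tm list \<Rightarrow> 'g tm \<Rightarrow> 'g tm" where
  "lets n [] u = u"
| "lets n (t # ts) u = LetIn (PVar n) t (lets (Suc n) ts u)"

context annotated
begin

lemma wt_ty_val:
  assumes "\<forall>i < width A. \<rho> (n + i) = (c + fst (flat B ! i), snd (flat B ! i))" "flat A = flat B"
    "set_ty A \<subseteq> qubits S"
  shows "wt \<rho> c (ty_val A n) A"
  by (rule wt_pval[OF ptyped_ty_pat]) (use assms in auto)

lemma wt_ty_val_env: "flat A = flat B \<Longrightarrow> set_ty A \<subseteq> qubits S \<Longrightarrow> wt (flat_env B) 0 (ty_val A 0) A"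
  by (rule wt_ty_val) auto

section \<open>Morphisms as classes of terms\<close>

text \<open>The environment is the list \<open>flat A\<close> itself, read at offset 0. Past the end
  of the list its value is unspecified; the condition on \<open>fv F\<close> keeps such indices out
  and makes \<open>F\<close> use every shifted qubit of \<open>A\<close>.\<close>

definition morph :: "'q ty \<Rightarrow> 'q ty \<Rightarrow> 'g tm \<Rightarrow> bool" where
  "morph A B F \<longleftrightarrow> set_ty A \<subseteq> qubits S \<and> wt (flat_env A) 0 F B \<and> fv F = {0..<width A}"

text \<open>Domain and codomain are stored with the class: the class alone cannot tell
  \<open>A\<close> from another type with the same list of shifted qubits, such as
  \<open>Tens A One\<close>.\<close>

definition ar :: "'q ty \<Rightarrow> 'q ty \<Rightarrow> 'g tm \<Rightarrow> 'q ty \<times> 'q ty \<times> 'g tm set" where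
  "ar A B F = (A, B, {u. eqt (flat_env A) 0 F u B})"

text \<open>Application by matching instead of substitution: \<open>t\<close> stays outside the
  scope of all binders of \<open>F\<close>, so any argument is admissible.\<close>

abbreviation app :: "'q ty \<Rightarrow> 'g tm \<Rightarrow> 'g tm \<Rightarrow> 'g tm" where
  "app A F t \<equiv> plet (ty_pat A 0) t F"

lemma morphD:
  assumes "morph A B F"
  shows "set_ty A \<subseteq> qubits S" "set_ty B \<subseteq> qubits S" "wt (flat_env A) 0 F B" "fv F = {0..<width A}"
  using assms wt_set_ty[of "flat_env A" 0 F B] by (simp_all add: morph_def)

lemma ar_eq_iff: "morph A B F \<Longrightarrow> ar A B F = ar A' B' F' \<longleftrightarrow> A = A' \<and> B = B' \<and> eqt (flat_env A) 0 F F' B"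
proof
  assume m: "morph A B F" and eq: "ar A B F = ar A' B' F'"
  have "eqt (flat_env A) 0 F F B" using morphD(3)[OF m] by (rule eqt_refl)
  with eq have "A = A'" "B = B'" "eqt (flat_env A) 0 F' F B" by (auto simp: ar_def set_eq_iff)
  then show "A = A' \<and> B = B' \<and> eqt (flat_env A) 0 F F' B" by (auto intro: eqt_sym)
next
  assume "A = A' \<and> B = B' \<and> eqt (flat_env A) 0 F F' B"
  then show "ar A B F = ar A' B' F'"
    by (auto simp: ar_def intro: eqt_sym eqt_trans)
qed

definition rep :: "'q ty \<times> 'q ty \<times> 'g tm set \<Rightarrow> 'g tm" where
  "rep f = (SOME t. t \<in> snd (snd f))"

lemma rep_ar:
  assumes "morph A B F"
  shows "eqt (flat_env A) 0 F (rep (ar A B F)) B" "morph A B (rep (ar A B F))"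
proof -
  have "F \<in> snd (snd (ar A B F))" using eqt_refl[OF morphD(3)[OF assms]] by (simp add: ar_def)
  then have "rep (ar A B F) \<in> snd (snd (ar A B F))" unfolding rep_def by (rule someI)
  then show *: "eqt (flat_env A) 0 F (rep (ar A B F)) B" by (simp add: ar_def)
  show "morph A B (rep (ar A B F))"
    using assms eqt_wt(2)[OF *] eqt_fv[OF *] by (simp add: morph_def)
qed

text \<open>Application respects classes. The equation between \<open>F\<close> and
  \<open>F'\<close> lives at offset 0 and is translated by \<open>c\<close> to the place of the
  argument.\<close>

lemma eqt_app:
  assumes "morph A B F" "eqt (flat_env A) 0 F F' B" "eqt \<rho> c t t' A"
  shows "eqt \<rho> c (app A F t) (app A F' t') B"
proof (rule eqt_plet[OF assms(3) ptyped_ty_pat_env])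
  note m = morphD[OF assms(1)]
  have "eqt (shift_env c (flat_env A)) (c + 0) F F' B" using assms(2) by (rule eqt_shift)
  then have "eqt (shift_env c (flat_env A)) c F F' B" by simp
  then show "eqt (override_on \<rho> (shift_env c (flat_env A)) (set (pvars (ty_pat A 0)))) c F F' B"
    by (rule eqt_cong_env) (use m(4) in \<open>auto simp: override_on_def\<close>)
qed (use morphD[OF assms(1)] in auto)

lemma wt_app: "morph A B F \<Longrightarrow> wt \<rho> c t A \<Longrightarrow> wt \<rho> c (app A F t) B"
  using eqt_wt(1)[OF eqt_app[OF _ eqt_refl eqt_refl]] morphD(3) by blast

lemma fv_app: "morph A B F \<Longrightarrow> fv (app A F t) = fv t"
  by (simp add: morphD(4))

lemma eqt_app_val:
  assumes "morph A B F"
  shows "eqt (flat_env A) 0 (app A F (ty_val A 0)) F B"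
proof (rule red_eqt[OF beta_plet])
  show "wt (flat_env A) 0 (app A F (ty_val A 0)) B"
    by (rule wt_app[OF assms wt_ty_val_env]) (use morphD[OF assms] in auto)
qed (use morphD[OF assms] in auto)

lemma app_LetIn: "morph A B F \<Longrightarrow> app A F (LetIn P s t) \<simeq> LetIn P s (app A F t)"
  by (rule req_sym, rule plet_comm_scrut) (simp add: morphD(4))

text \<open>\<open>evl \<rho> c f t u\<close>: applied to the generalized element \<open>t\<close>, the morphism \<open>f\<close> yields \<open>u\<close>.\<close>

definition evl :: "'q env \<Rightarrow> real \<Rightarrow> 'q ty \<times> 'q ty \<times> 'g tm set \<Rightarrow> 'g tm \<Rightarrow> 'g tm \<Rightarrow> bool" where
  "evl \<rho> c f t u \<longleftrightarrow> (\<exists>A B F. f = ar A B F \<and> morph A B F \<and> wt \<rho> c t A \<and> eqt \<rho> c (app A F t) u B)"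

definition is_morph :: "'q ty \<times> 'q ty \<times> 'g tm set \<Rightarrow> 'q ty \<Rightarrow> 'q ty \<Rightarrow> bool" where
  "is_morph f A B \<longleftrightarrow> (\<exists>F. f = ar A B F \<and> morph A B F)"

lemma is_morphI: "morph A B F \<Longrightarrow> is_morph (ar A B F) A B"
  by (auto simp: is_morph_def)

lemma is_morph_fst [simp]: "is_morph f A B \<Longrightarrow> fst f = A" "is_morph f A B \<Longrightarrow> fst (snd f) = B"
  by (auto simp: is_morph_def ar_def)

lemma is_morph_ty: "is_morph f A B \<Longrightarrow> set_ty A \<subseteq> qubits S" "is_morph f A B \<Longrightarrow> set_ty B \<subseteq> qubits S"
  by (auto simp: is_morph_def dest: morphD)

lemma is_morph_rep:
  assumes "is_morph f A B"
  shows "morph A B (rep f)" "f = ar A B (rep f)"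
proof -
  from assms obtain F where F: "f = ar A B F" "morph A B F" by (auto simp: is_morph_def)
  show "morph A B (rep f)" using rep_ar(2)[OF F(2)] F(1) by simp
  show "f = ar A B (rep f)" using rep_ar(1)[OF F(2)] F ar_eq_iff[OF F(2)] by simp
qed

lemma evlI: "morph A B F \<Longrightarrow> wt \<rho> c t A \<Longrightarrow> eqt \<rho> c (app A F t) u B \<Longrightarrow> evl \<rho> c (ar A B F) t u"
  unfolding evl_def by blast

lemma evl_iff:
  assumes "is_morph f A B"
  shows "evl \<rho> c f t u \<longleftrightarrow> wt \<rho> c t A \<and> eqt \<rho> c (app A (rep f) t) u B"
proof
  note r = is_morph_rep[OF assms]
  assume "evl \<rho> c f t u"
  then obtain A' B' F where F: "f = ar A' B' F" "morph A' B' F" "wt \<rho> c t A'" "eqt \<rho> c (app A' F t) u B'"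
    by (auto simp: evl_def)
  with r(2) have "ar A B (rep f) = ar A' B' F" by simp
  then have "A = A' \<and> B = B' \<and> eqt (flat_env A) 0 (rep f) F B" using ar_eq_iff[OF r(1)] by metis
  then have "A = A'" "B = B'" "eqt (flat_env A) 0 (rep f) F B" by blast+
  with F eqt_app[OF r(1) _ eqt_refl] show "wt \<rho> c t A \<and> eqt \<rho> c (app A (rep f) t) u B"
    by (blast intro: eqt_trans)
next
  note r = is_morph_rep[OF assms]
  assume "wt \<rho> c t A \<and> eqt \<rho> c (app A (rep f) t) u B"
  with r show "evl \<rho> c f t u" unfolding evl_def by blast
qed

lemma evl_wt:
  assumes "is_morph f A B" "evl \<rho> c f t u"
  shows "wt \<rho> c t A" "wt \<rho> c u B" "fv u = fv t"
proof -
  have e: "wt \<rho> c t A" "eqt \<rho> c (app A (rep f) t) u B" using assms by (simp_all add: evl_iff)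
  then show "wt \<rho> c t A" "wt \<rho> c u B" by (auto dest: eqt_wt)
  show "fv u = fv t" using eqt_fv[OF e(2)] fv_app[OF is_morph_rep(1)[OF assms(1)]] by simp
qed

lemma evl_ex: "is_morph f A B \<Longrightarrow> wt \<rho> c t A \<Longrightarrow> \<exists>u. evl \<rho> c f t u"
  by (auto simp: evl_iff intro!: eqt_refl wt_app is_morph_rep)

lemma evl_eqt:
  assumes "is_morph f A B" "eqt \<rho> c t t' A" "evl \<rho> c f t' u" "eqt \<rho> c u u' B"
  shows "evl \<rho> c f t u'"
proof -
  note m = is_morph_rep(1)[OF assms(1)]
  have "eqt \<rho> c (app A (rep f) t) (app A (rep f) t') B"
    by (rule eqt_app[OF m eqt_refl[OF morphD(3)[OF m]] assms(2)])
  with assms show ?thesis by (auto simp: evl_iff dest: eqt_wt intro: eqt_trans)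
qed

lemma evl_det:
  assumes "is_morph f A B" "evl \<rho> c f t u" "evl \<rho> c f t u'"
  shows "eqt \<rho> c u u' B"
  using assms by (auto simp: evl_iff intro: eqt_sym eqt_trans)

text \<open>On the generic element a morphism returns its own representative, by
  \<open>eqt_app_val\<close>.\<close>

lemma morph_ext:
  assumes "is_morph f A B" "is_morph g A B"
    and "evl (flat_env A) 0 f (ty_val A 0) u" "evl (flat_env A) 0 g (ty_val A 0) u"
  shows "f = g"
proof -
  note f = is_morph_rep[OF assms(1)] and g = is_morph_rep[OF assms(2)]
  have "eqt (flat_env A) 0 (app A (rep f) (ty_val A 0)) u B" "eqt (flat_env A) 0 (app A (rep g) (ty_val A 0)) u B"
    using assms by (simp_all add: evl_iff)
  with eqt_app_val[OF f(1)] eqt_app_val[OF g(1)] have "eqt (flat_env A) 0 (rep f) (rep g) B"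
    by (meson eqt_sym eqt_trans)
  with f g ar_eq_iff[OF f(1)] show ?thesis by metis
qed

text \<open>Application is a match on its argument, so a \<open>let\<close> around the argument
  moves outwards. Evaluation thus reduces to arguments whose outermost form is a
  constructor.\<close>

lemma evl_LetIn:
  assumes f: "is_morph f A B" and s: "wt \<rho> e s C" "pat_typed P e C \<beta>"
    and t: "evl (override_on \<rho> \<beta> (set_pat P)) c f t u" and P: "set_pat P \<subseteq> fv t" "fv s \<inter> (fv t - set_pat P) = {}"
  shows "evl \<rho> c f (LetIn P s t) (LetIn P s u)"
proof -
  note m = is_morph_rep(1)[OF f]
  have e: "wt (override_on \<rho> \<beta> (set_pat P)) c t A" "eqt (override_on \<rho> \<beta> (set_pat P)) c (app A (rep f) t) u B"
    using t by (simp_all add: evl_iff[OF f])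
  have w: "wt \<rho> c (LetIn P s t) A" using s e(1) P by (rule wt_LetIn)
  have 1: "eqt \<rho> c (app A (rep f) (LetIn P s t)) (LetIn P s (app A (rep f) t)) B"
    by (rule red_eqt[OF req_red(1)[OF app_LetIn[OF m]] wt_app[OF m w]])
  have "eqt \<rho> c (LetIn P s (app A (rep f) t)) (LetIn P s u) B"
    using eqt_refl[OF s(1)] s(2) e(2) by (rule eqt_LetIn) (use P fv_app[OF m] in simp_all)
  with 1 w show ?thesis by (auto simp: evl_iff[OF f] intro: eqt_trans)
qed


subsection \<open>Composition\<close>

definition ar_comp where
  "ar_comp g f = ar (fst f) (fst (snd g)) (app (fst (snd f)) (rep g) (rep f))"

lemma morph_comp: "morph A B F \<Longrightarrow> morph B C G \<Longrightarrow> morph A C (app B G F)"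
  using wt_app[of B C G "flat_env A" 0 F] fv_app[of B C G F] by (simp add: morph_def)

lemma is_morph_comp: "is_morph f A B \<Longrightarrow> is_morph g B C \<Longrightarrow> is_morph (ar_comp g f) A C"
  unfolding ar_comp_def by (simp add: is_morphI morph_comp is_morph_rep)

lemma evl_comp:
  assumes f: "is_morph f A B" and g: "is_morph g B C" and "evl \<rho> c f t u" "evl \<rho> c g u v"
  shows "evl \<rho> c (ar_comp g f) t v"
proof -
  note mf = is_morph_rep(1)[OF f] and mg = is_morph_rep(1)[OF g]
  have e: "wt \<rho> c t A" "eqt \<rho> c (app A (rep f) t) u B" "eqt \<rho> c (app B (rep g) u) v C"
    using assms by (simp_all add: evl_iff)
  have cf: "ar_comp g f = ar A C (app B (rep g) (rep f))" unfolding ar_comp_def using f g by simp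
  have "app A (app B (rep g) (rep f)) t \<simeq> app B (rep g) (app A (rep f) t)"
    by (rule plet_plet) (simp add: morphD(4)[OF mg])
  from red_eqt[OF req_red(1)[OF this] wt_app[OF morph_comp[OF mf mg] e(1)]]
  have 1: "eqt \<rho> c (app A (app B (rep g) (rep f)) t) (app B (rep g) (app A (rep f) t)) C" .
  have "eqt \<rho> c (app B (rep g) (app A (rep f) t)) (app B (rep g) u) C"
    by (rule eqt_app[OF mg eqt_refl[OF morphD(3)[OF mg]] e(2)])
  with 1 e show ?thesis
    unfolding cf by (intro evlI morph_comp[OF mf mg]) (auto intro: eqt_trans)
qed


subsection \<open>Coherence isomorphisms\<close>

text \<open>Meaningful when \<open>flat A = flat B\<close>: the same shifted qubits in the same
  order, tupled and boxed as \<open>B\<close> prescribes.\<close>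

definition can where
  "can A B = ar A B (ty_val B 0)"

lemma morph_can: "flat A = flat B \<Longrightarrow> set_ty A \<subseteq> qubits S \<Longrightarrow> set_ty B \<subseteq> qubits S \<Longrightarrow> morph A B (ty_val B 0)"
  by (simp add: morph_def wt_ty_val_env)

lemma is_morph_can: "flat A = flat B \<Longrightarrow> set_ty A \<subseteq> qubits S \<Longrightarrow> set_ty B \<subseteq> qubits S \<Longrightarrow> is_morph (can A B) A B"
  unfolding can_def by (intro is_morphI morph_can)

text \<open>The indices of a morphism may clash with variables of its argument, so they are moved
  above a bound. This can be done by an actual renaming because \<open>u\<close> has no binders;
  \<open>width A \<le> N\<close> keeps old and new indices apart.\<close>

lemma app_high:
  assumes "fv u = {0..<width A}" "bv u = {}" "width A \<le> N"
  shows "app A u t \<leadsto> plet (ty_pat A N) t (subst u (\<lambda>x. if x \<in> {0..<width A} then V (x + N) else V x))"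
proof -
  have r: "prename (\<lambda>x. x + N) (ty_pat A 0) = ty_pat A N" by (simp add: prename_ty_pat)
  have "app A u t \<leadsto> plet (ty_pat A N) t (app A u (ty_val A N))"
    using alpha_plet[of "ty_pat A 0" "\<lambda>x. x + N" u t] assms unfolding r by (simp add: inj_on_def)
  also have "\<dots> \<leadsto> plet (ty_pat A N) t (subst u (\<lambda>x. if x \<in> {0..<width A} then V (x + N) else V x))"
    using subst_plet[of "ty_pat A 0" u "\<lambda>x. x + N"] assms unfolding r
    by (intro red_plet red_refl) auto
  finally show ?thesis .
qed

lemma ex_high: "\<exists>N. w \<le> N \<and> {N..} \<inter> fv t = {}"
proof -
  let ?N = "Suc (Max (insert w (fv t)))"
  have "x < ?N" if "x \<in> insert w (fv t)" for x using that by (simp add: le_imp_less_Suc)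
  then show ?thesis by (intro exI[of _ ?N]) fastforce
qed

text \<open>Both generalized elements are unpacked to the same nest of \<open>let\<close>s.\<close>

lemma evl_can:
  assumes "flat A = flat B" "wt \<rho> c t A" "wt \<rho> c u B"
    and "\<And>N X. {N..} \<inter> fv (Tup t u) = {} \<Longrightarrow> \<exists>Y. plet (ty_pat A N) t X \<leadsto> Y \<and> plet (ty_pat B N) u X \<leadsto> Y"
  shows "evl \<rho> c (can A B) t u"
proof -
  have ty: "set_ty A \<subseteq> qubits S" "set_ty B \<subseteq> qubits S" using assms(2,3) wt_set_ty by auto
  note m = morph_can[OF assms(1) ty]
  obtain N where N: "width A \<le> N" "{N..} \<inter> fv (Tup t u) = {}" using ex_high by blast
  obtain Y where Y: "plet (ty_pat A N) t (ty_val B N) \<leadsto> Y" "plet (ty_pat B N) u (ty_val B N) \<leadsto> Y"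
    using assms(4)[OF N(2)] by blast
  have "app A (ty_val B 0) t \<leadsto> plet (ty_pat A N) t (ty_val B N)"
    using app_high[of "ty_val B 0" A N t] N(1) assms(1) by (simp only: subst_ty_val fv_pval bv_pval) simp
  also note Y(1)
  finally have 1: "eqt \<rho> c (app A (ty_val B 0) t) Y B" using wt_app[OF m assms(2)] by (rule red_eqt)
  have "ptyped (ty_pat B N) c B (\<lambda>i. shift_env c (flat_env B) (i - N))"
    by (rule ptyped_ty_pat) simp
  from eqt_plet_eta[OF assms(3) this] have 2: "eqt \<rho> c (plet (ty_pat B N) u (ty_val B N)) u B" by simp
  have 3: "eqt \<rho> c (plet (ty_pat B N) u (ty_val B N)) Y B"
    by (rule red_eqt[OF Y(2) eqt_wt(1)[OF 2]])
  from 1 2 3 have "eqt \<rho> c (app A (ty_val B 0) t) u B" by (meson eqt_sym eqt_trans)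
  then show ?thesis unfolding can_def by (rule evlI[OF m assms(2)])
qed

lemma evl_id: "wt \<rho> c t A \<Longrightarrow> evl \<rho> c (can A A) t t"
  by (rule evl_can[OF refl]) (auto intro: red_refl)

lemma evl_can_red:
  assumes "flat A = flat B" "wt \<rho> c t A" "wt \<rho> c u B"
    and red: "\<And>N X. {N..} \<inter> fv (Tup t u) = {} \<Longrightarrow> plet (ty_pat A N) t X \<leadsto> plet (ty_pat B N) u X"
  shows "evl \<rho> c (can A B) t u" "evl \<rho> c (can B A) u t"
proof -
  show "evl \<rho> c (can A B) t u"
    by (rule evl_can[OF assms(1-3)]) (use red red_refl in blast)
  show "evl \<rho> c (can B A) u t"
  proof (rule evl_can[OF assms(1)[symmetric] assms(3,2)])
    fix N X assume "{N..} \<inter> fv (Tup u t) = {}"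
    then have "{N..} \<inter> fv (Tup t u) = {}" by (simp only: fv.simps Un_commute)
    with red red_refl show "\<exists>Y. plet (ty_pat B N) u X \<leadsto> Y \<and> plet (ty_pat A N) t X \<leadsto> Y" by blast
  qed
qed

lemma beta_ty_pat:
  assumes "{N..} \<inter> fv t = {}"
  shows "plet (ty_pat (Tens A B) N) (Tup s t) X \<leadsto> plet (ty_pat A N) s (plet (ty_pat B (N + width A)) t X)"
  unfolding ty_pat.simps by (rule beta_PT) (use assms in auto)

lemma evl_assoc:
  assumes "wt \<rho> c (Tup (Tup s t) u) (Tens (Tens A B) C)"
  shows "evl \<rho> c (can (Tens (Tens A B) C) (Tens A (Tens B C))) (Tup (Tup s t) u) (Tup s (Tup t u))"
    and "evl \<rho> c (can (Tens A (Tens B C)) (Tens (Tens A B) C)) (Tup s (Tup t u)) (Tup (Tup s t) u)"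
proof -
  have w: "wt \<rho> c (Tup s (Tup t u)) (Tens A (Tens B C))"
    using assms by (elim wt_TupE) (auto intro!: wt_Tup)
  have *: "\<exists>Y. plet (ty_pat (Tens (Tens A B) C) N) (Tup (Tup s t) u) X \<leadsto> Y \<and>
      plet (ty_pat (Tens A (Tens B C)) N) (Tup s (Tup t u)) X \<leadsto> Y"
    if N: "{N..} \<inter> fv (Tup (Tup s t) u) = {}" for N X
  proof -
    let ?Y = "plet (ty_pat A N) s (plet (ty_pat B (N + width A)) t (plet (ty_pat C (N + width A + width B)) u X))"
    have "plet (ty_pat (Tens (Tens A B) C) N) (Tup (Tup s t) u) X \<leadsto>
        plet (ty_pat (Tens A B) N) (Tup s t) (plet (ty_pat C (N + width (Tens A B))) u X)"
      by (rule beta_ty_pat) (use N in auto)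
    also have "\<dots> \<leadsto> plet (ty_pat A N) s (plet (ty_pat B (N + width A)) t (plet (ty_pat C (N + width (Tens A B))) u X))"
      by (rule beta_ty_pat) (use N in auto)
    also have "\<dots> = ?Y" by (simp add: add.assoc)
    finally have 1: "plet (ty_pat (Tens (Tens A B) C) N) (Tup (Tup s t) u) X \<leadsto> ?Y" .
    have "plet (ty_pat (Tens A (Tens B C)) N) (Tup s (Tup t u)) X \<leadsto>
        plet (ty_pat A N) s (plet (ty_pat (Tens B C) (N + width A)) (Tup t u) X)"
      by (rule beta_ty_pat) (use N in auto)
    also have "\<dots> \<leadsto> ?Y"
      by (intro red_plet red_refl beta_ty_pat) (use N in \<open>auto simp: disjoint_iff\<close>)
    finally show ?thesis using 1 by blast
  qed
  show "evl \<rho> c (can (Tens (Tens A B) C) (Tens A (Tens B C))) (Tup (Tup s t) u) (Tup s (Tup t u))"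
  proof (rule evl_can[OF _ assms w])
    fix N X assume "{N..} \<inter> fv (Tup (Tup (Tup s t) u) (Tup s (Tup t u))) = {}"
    then have "{N..} \<inter> fv (Tup (Tup s t) u) = {}" by auto
    from *[OF this, of X] show "\<exists>Y. plet (ty_pat (Tens (Tens A B) C) N) (Tup (Tup s t) u) X \<leadsto> Y \<and>
      plet (ty_pat (Tens A (Tens B C)) N) (Tup s (Tup t u)) X \<leadsto> Y" .
  qed simp
  show "evl \<rho> c (can (Tens A (Tens B C)) (Tens (Tens A B) C)) (Tup s (Tup t u)) (Tup (Tup s t) u)"
  proof (rule evl_can[OF _ w assms])
    fix N X assume "{N..} \<inter> fv (Tup (Tup s (Tup t u)) (Tup (Tup s t) u)) = {}"
    then have "{N..} \<inter> fv (Tup (Tup s t) u) = {}" by auto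
    from *[OF this, of X] show "\<exists>Y. plet (ty_pat (Tens A (Tens B C)) N) (Tup s (Tup t u)) X \<leadsto> Y \<and>
      plet (ty_pat (Tens (Tens A B) C) N) (Tup (Tup s t) u) X \<leadsto> Y" by blast
  qed simp
qed

lemma evl_lunit:
  assumes "wt \<rho> c t A"
  shows "evl \<rho> c (can (Tens One A) A) (Tup Star t) t" "evl \<rho> c (can A (Tens One A)) t (Tup Star t)"
proof -
  have w: "wt \<rho> c (Tup Star t) (Tens One A)" using assms by (auto intro!: wt_Tup wt_Star)
  have *: "plet (ty_pat (Tens One A) N) (Tup Star t) X \<leadsto> plet (ty_pat A N) t X" if "{N..} \<inter> fv t = {}" for N X
  proof -
    from beta_ty_pat[OF that, of One A Star X]
    have "plet (ty_pat (Tens One A) N) (Tup Star t) X \<leadsto> LetIn PUnit Star (plet (ty_pat A N) t X)" by simp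
    also have "\<dots> \<leadsto> plet (ty_pat A N) t X" by (rule beta_unit)
    finally show ?thesis .
  qed
  have **: "plet (ty_pat (Tens One A) N) (Tup Star t) X \<leadsto> plet (ty_pat A N) t X"
    if "{N..} \<inter> fv (Tup (Tup Star t) t) = {}" for N X
    by (rule *) (use that in auto)
  have fl: "flat (Tens One A) = flat A" by simp
  show "evl \<rho> c (can (Tens One A) A) (Tup Star t) t" "evl \<rho> c (can A (Tens One A)) t (Tup Star t)"
    by (rule evl_can_red[OF fl w assms **], assumption)+
qed

lemma evl_runit:
  assumes "wt \<rho> c t A"
  shows "evl \<rho> c (can (Tens A One) A) (Tup t Star) t"
proof -
  have w: "wt \<rho> c (Tup t Star) (Tens A One)" using assms by (auto intro!: wt_Tup wt_Star)
  have *: "plet (ty_pat (Tens A One) N) (Tup t Star) X \<leadsto> plet (ty_pat A N) t X" for N X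
  proof -
    from beta_ty_pat[of N Star A One t X]
    have "plet (ty_pat (Tens A One) N) (Tup t Star) X \<leadsto> plet (ty_pat A N) t (LetIn PUnit Star X)" by simp
    also have "\<dots> \<leadsto> plet (ty_pat A N) t X" by (intro red_plet red_refl beta_unit)
    finally show ?thesis .
  qed
  have fl: "flat (Tens A One) = flat A" by simp
  show ?thesis by (rule evl_can_red(1)[OF fl w assms *])
qed

lemma evl_mul:
  assumes "wt \<rho> c (Tup (BoxTm d s) (BoxTm d t)) (Tens (BoxTy d A) (BoxTy d B))"
  shows "evl \<rho> c (can (Tens (BoxTy d A) (BoxTy d B)) (BoxTy d (Tens A B))) (Tup (BoxTm d s) (BoxTm d t)) (BoxTm d (Tup s t))"
    and "evl \<rho> c (can (BoxTy d (Tens A B)) (Tens (BoxTy d A) (BoxTy d B))) (BoxTm d (Tup s t)) (Tup (BoxTm d s) (BoxTm d t))"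
proof -
  have w: "wt \<rho> c (BoxTm d (Tup s t)) (BoxTy d (Tens A B))"
    using assms by (elim wt_TupE wt_BoxTmE) (auto intro!: wt_Tup wt_BoxTm)
  have *: "\<exists>Y. plet (ty_pat (Tens (BoxTy d A) (BoxTy d B)) N) (Tup (BoxTm d s) (BoxTm d t)) X \<leadsto> Y \<and>
      plet (ty_pat (BoxTy d (Tens A B)) N) (BoxTm d (Tup s t)) X \<leadsto> Y"
    if N: "{N..} \<inter> (fv s \<union> fv t) = {}" for N and X :: "'g tm"
  proof -
    let ?Y = "plet (ty_pat A N) s (plet (ty_pat B (N + width A)) t X)"
    have "plet (ty_pat (Tens (BoxTy d A) (BoxTy d B)) N) (Tup (BoxTm d s) (BoxTm d t)) X \<leadsto>
        plet (ty_pat (BoxTy d A) N) (BoxTm d s) (plet (ty_pat (BoxTy d B) (N + width (BoxTy d A))) (BoxTm d t) X)"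
      by (rule beta_ty_pat) (use N in auto)
    also have "\<dots> \<leadsto> plet (ty_pat A N) s (plet (ty_pat (BoxTy d B) (N + width (BoxTy d A))) (BoxTm d t) X)"
      unfolding ty_pat.simps by (rule beta_PB)
    also have "\<dots> \<leadsto> plet (ty_pat A N) s (plet (ty_pat B (N + width (BoxTy d A))) t X)"
      unfolding ty_pat.simps by (intro red_plet red_refl beta_PB)
    finally have 1: "plet (ty_pat (Tens (BoxTy d A) (BoxTy d B)) N) (Tup (BoxTm d s) (BoxTm d t)) X \<leadsto> ?Y" by simp
    have "plet (ty_pat (BoxTy d (Tens A B)) N) (BoxTm d (Tup s t)) X \<leadsto> plet (ty_pat (Tens A B) N) (Tup s t) X"
      unfolding ty_pat.simps(4) by (rule beta_PB)
    also have "\<dots> \<leadsto> ?Y" by (rule beta_ty_pat) (use N in auto)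
    finally show ?thesis using 1 by blast
  qed
  show "evl \<rho> c (can (Tens (BoxTy d A) (BoxTy d B)) (BoxTy d (Tens A B))) (Tup (BoxTm d s) (BoxTm d t)) (BoxTm d (Tup s t))"
  proof (rule evl_can[OF _ assms w])
    fix N X assume "{N..} \<inter> fv (Tup (Tup (BoxTm d s) (BoxTm d t)) (BoxTm d (Tup s t))) = {}"
    then have "{N..} \<inter> (fv s \<union> fv t) = {}" by simp
    from *[OF this, of X] show "\<exists>Y. plet (ty_pat (Tens (BoxTy d A) (BoxTy d B)) N) (Tup (BoxTm d s) (BoxTm d t)) X \<leadsto> Y \<and>
      plet (ty_pat (BoxTy d (Tens A B)) N) (BoxTm d (Tup s t)) X \<leadsto> Y" .
  qed simp
  show "evl \<rho> c (can (BoxTy d (Tens A B)) (Tens (BoxTy d A) (BoxTy d B))) (BoxTm d (Tup s t)) (Tup (BoxTm d s) (BoxTm d t))"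
  proof (rule evl_can[OF _ w assms])
    fix N X assume "{N..} \<inter> fv (Tup (BoxTm d (Tup s t)) (Tup (BoxTm d s) (BoxTm d t))) = {}"
    then have "{N..} \<inter> (fv s \<union> fv t) = {}" by simp
    from *[OF this, of X] show "\<exists>Y. plet (ty_pat (BoxTy d (Tens A B)) N) (BoxTm d (Tup s t)) X \<leadsto> Y \<and>
      plet (ty_pat (Tens (BoxTy d A) (BoxTy d B)) N) (Tup (BoxTm d s) (BoxTm d t)) X \<leadsto> Y" by blast
  qed simp
qed

lemma evl_unit:
  shows "evl \<rho> c (can One (BoxTy d One)) Star (BoxTm d Star)"
    and "evl \<rho> c (can (BoxTy d One) One) (BoxTm d Star) Star"
proof -
  have w: "wt \<rho> c Star One" "wt \<rho> c (BoxTm d Star) (BoxTy d One)" by (auto intro!: wt_Star wt_BoxTm)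
  have *: "plet (ty_pat (BoxTy d One :: 'q ty) N) (BoxTm d Star) X \<leadsto> plet (ty_pat (One :: 'q ty) N) Star X"
    for N and X :: "'g tm"
    unfolding ty_pat.simps(4) by (rule beta_PB)
  have fl: "flat (BoxTy d One :: 'q ty) = flat One" by simp
  show "evl \<rho> c (can One (BoxTy d One)) Star (BoxTm d Star)" "evl \<rho> c (can (BoxTy d One) One) (BoxTm d Star) Star"
    by (rule evl_can_red[OF fl w(2,1) *])+
qed

lemma evl_shift_mul:
  assumes "wt \<rho> c (BoxTm d (BoxTm e s)) (BoxTy d (BoxTy e A))"
  shows "evl \<rho> c (can (BoxTy d (BoxTy e A)) (BoxTy (d + e) A)) (BoxTm d (BoxTm e s)) (BoxTm (d + e) s)"
    and "evl \<rho> c (can (BoxTy (d + e) A) (BoxTy d (BoxTy e A))) (BoxTm (d + e) s) (BoxTm d (BoxTm e s))"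
proof -
  have w: "wt \<rho> c (BoxTm (d + e) s) (BoxTy (d + e) A)"
    using assms by (elim wt_BoxTmE) (auto intro!: wt_BoxTm simp: add.assoc)
  have *: "plet (ty_pat (BoxTy (d + e) A) N) (BoxTm (d + e) s) X \<leadsto> plet (ty_pat A N) s X" for N X
    unfolding ty_pat.simps by (rule beta_PB)
  have **: "plet (ty_pat (BoxTy d (BoxTy e A)) N) (BoxTm d (BoxTm e s)) X \<leadsto> plet (ty_pat A N) s X" for N X
    unfolding ty_pat.simps by (rule red_trans[OF beta_PB beta_PB])
  have fl: "flat (BoxTy d (BoxTy e A)) = flat (BoxTy (d + e) A)" by (auto simp: add.assoc)
  show "evl \<rho> c (can (BoxTy d (BoxTy e A)) (BoxTy (d + e) A)) (BoxTm d (BoxTm e s)) (BoxTm (d + e) s)"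
    by (rule evl_can[OF fl assms w]) (use * ** in blast)
  show "evl \<rho> c (can (BoxTy (d + e) A) (BoxTy d (BoxTy e A))) (BoxTm (d + e) s) (BoxTm d (BoxTm e s))"
    by (rule evl_can[OF fl[symmetric] w assms]) (use * ** in blast)
qed

lemma evl_shift_unit:
  assumes "wt \<rho> c s A"
  shows "evl \<rho> c (can A (BoxTy 0 A)) s (BoxTm 0 s)"
    and "evl \<rho> c (can (BoxTy 0 A) A) (BoxTm 0 s) s"
proof -
  have w: "wt \<rho> c (BoxTm 0 s) (BoxTy 0 A)" using assms by (auto intro!: wt_BoxTm)
  have *: "plet (ty_pat (BoxTy 0 A) N) (BoxTm 0 s) X \<leadsto> plet (ty_pat A N) s X" for N X
    unfolding ty_pat.simps by (rule beta_PB)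
  have fl: "flat A = flat (BoxTy 0 A)" by (simp add: map_idI)
  show "evl \<rho> c (can A (BoxTy 0 A)) s (BoxTm 0 s)"
    by (rule evl_can[OF fl assms w]) (use * red_refl in blast)
  show "evl \<rho> c (can (BoxTy 0 A) A) (BoxTm 0 s) s"
    by (rule evl_can[OF fl[symmetric] w assms]) (use * red_refl in blast)
qed

text \<open>The symmetry permutes the qubits, so in general it is not of the form
  \<open>can\<close>: the component \<open>B\<close> is read at the indices after those of
  \<open>A\<close> and comes first in the result.\<close>

definition sym_ar where
  "sym_ar A B = ar (Tens A B) (Tens B A) (Tup (ty_val B (width A)) (ty_val A 0))"

lemma morph_sym:
  assumes "set_ty A \<subseteq> qubits S" "set_ty B \<subseteq> qubits S"
  shows "morph (Tens A B) (Tens B A) (Tup (ty_val B (width A)) (ty_val A 0))"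
proof -
  have "wt (flat_env (Tens A B)) 0 (ty_val B (width A)) B" "wt (flat_env (Tens A B)) 0 (ty_val A 0) A"
    by (rule wt_ty_val[OF _ refl], use assms in \<open>simp_all add: nth_append\<close>)+
  then show ?thesis using assms by (auto simp: morph_def intro!: wt_Tup)
qed

lemma is_morph_sym: "set_ty A \<subseteq> qubits S \<Longrightarrow> set_ty B \<subseteq> qubits S \<Longrightarrow> is_morph (sym_ar A B) (Tens A B) (Tens B A)"
  unfolding sym_ar_def by (intro is_morphI morph_sym)

lemma eqt_eta_high:
  assumes "wt \<rho> c t A"
  shows "eqt \<rho> c (plet (ty_pat A N) t (ty_val A N)) t A"
proof -
  have "ptyped (ty_pat A N) c A (\<lambda>i. shift_env c (flat_env A) (i - N))"
    by (rule ptyped_ty_pat) simp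
  from eqt_plet_eta[OF assms this] show ?thesis by simp
qed

lemma evl_sym:
  assumes "wt \<rho> c (Tup s t) (Tens A B)"
  shows "evl \<rho> c (sym_ar A B) (Tup s t) (Tup t s)"
proof -
  from assms have w: "wt \<rho> c s A" "wt \<rho> c t B" "fv s \<inter> fv t = {}" by (auto elim: wt_TupE)
  note m = morph_sym[OF wt_set_ty[OF w(1)] wt_set_ty[OF w(2)]]
  let ?F = "Tup (ty_val B (width A)) (ty_val A 0)"
  obtain N where N: "width (Tens A B) \<le> N" "{N..} \<inter> fv (Tup s t) = {}" using ex_high by blast
  let ?M = "N + width A"
  let ?\<sigma> = "\<lambda>x. if x \<in> {0..<width (Tens A B)} then V (x + N) else V x"
  have "subst ?F ?\<sigma> = subst ?F (\<lambda>x. V (x + N))"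
    by (rule subst_cong_fv) auto
  also have "\<dots> = Tup (ty_val B ?M) (ty_val A N)"
    by (simp add: subst_pval prename_ty_pat add.commute)
  finally have sub: "subst ?F ?\<sigma> = Tup (ty_val B ?M) (ty_val A N)" .
  have "app (Tens A B) ?F (Tup s t) \<leadsto> plet (ty_pat (Tens A B) N) (Tup s t) (Tup (ty_val B ?M) (ty_val A N))"
    unfolding sub[symmetric] by (rule app_high) (use N in auto)
  also have "\<dots> \<leadsto> plet (ty_pat A N) s (plet (ty_pat B ?M) t (Tup (ty_val B ?M) (ty_val A N)))"
    by (rule beta_ty_pat) (use N in auto)
  \<comment> \<open>The two matches are exchanged so that their order agrees with that of the
    components of the result and \<open>plet_Tup\<close> applies.\<close>
  also have "\<dots> \<simeq> plet (ty_pat B ?M) t (plet (ty_pat A N) s (Tup (ty_val B ?M) (ty_val A N)))"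
    by (rule plet_commuting[OF commuting_plet_body]) (use N in \<open>auto simp: disjoint_iff\<close>)
  also have "\<dots> \<simeq> Tup (plet (ty_pat B ?M) t (ty_val B ?M)) (plet (ty_pat A N) s (ty_val A N))"
    by (rule plet_Tup) (use N in \<open>auto simp: disjoint_iff\<close>)
  finally have "eqt \<rho> c (app (Tens A B) ?F (Tup s t))
      (Tup (plet (ty_pat B ?M) t (ty_val B ?M)) (plet (ty_pat A N) s (ty_val A N))) (Tens B A)"
    using wt_app[OF m assms] by (rule red_eqt)
  moreover have "eqt \<rho> c (Tup (plet (ty_pat B ?M) t (ty_val B ?M)) (plet (ty_pat A N) s (ty_val A N))) (Tup t s) (Tens B A)"
    by (rule eqt_Tup[OF eqt_eta_high[OF w(2)] eqt_eta_high[OF w(1)]]) (use w(3) in auto)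
  ultimately show ?thesis unfolding sym_ar_def by (intro evlI[OF m assms]) (rule eqt_trans)
qed


subsection \<open>Tensor products, shifts, gates and delays\<close>

text \<open>A translation of the indices of \<open>F\<close> by \<open>n\<close>, written as a match
  because \<open>F\<close> may contain binders.\<close>

abbreviation raise :: "nat \<Rightarrow> 'q ty \<Rightarrow> 'g tm \<Rightarrow> 'g tm" where
  "raise n A F \<equiv> app A F (ty_val A n)"

definition ar_tens where
  "ar_tens f g = ar (Tens (fst f) (fst g)) (Tens (fst (snd f)) (fst (snd g)))
    (Tup (rep f) (raise (width (fst f)) (fst g) (rep g)))"

lemma morph_tens:
  assumes "morph A B F" "morph A' B' F'"
  shows "morph (Tens A A') (Tens B B') (Tup F (raise (width A) A' F'))"
proof -
  note m = morphD[OF assms(1)] and m' = morphD[OF assms(2)]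
  have "wt (flat_env (Tens A A')) 0 F B"
    using m(3) by (rule wt_cong_env) (use m(4) in \<open>auto simp: nth_append\<close>)
  moreover have "wt (flat_env (Tens A A')) 0 (raise (width A) A' F') B'"
    by (rule wt_app[OF assms(2) wt_ty_val[OF _ refl m'(1)]]) (simp add: nth_append)
  ultimately show ?thesis
    using m m' by (auto simp: morph_def intro!: wt_Tup)
qed

lemma is_morph_tens: "is_morph f A B \<Longrightarrow> is_morph g A' B' \<Longrightarrow> is_morph (ar_tens f g) (Tens A A') (Tens B B')"
  unfolding ar_tens_def by (simp add: is_morphI morph_tens is_morph_rep)

text \<open>The arguments may mention indices that the two representatives use. They are therefore
  named by two fresh variables and put back only after the matches have been distributed over the
  tuple.\<close>

lemma evl_tens:
  assumes f: "is_morph f A B" and g: "is_morph g A' B'"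
    and e: "evl \<rho> c f s u" "evl \<rho> c g t v" and dis: "fv s \<inter> fv t = {}"
  shows "evl \<rho> c (ar_tens f g) (Tup s t) (Tup u v)"
proof -
  let ?F = "rep f" and ?G = "rep g"
  note mf = is_morph_rep(1)[OF f] and mg = is_morph_rep(1)[OF g]
  let ?n = "width A"
  let ?T = "Tup ?F (raise ?n A' ?G)"
  note m = morph_tens[OF mf mg]
  have w: "wt \<rho> c (Tup s t) (Tens A A')"
    using evl_wt(1)[OF f e(1)] evl_wt(1)[OF g e(2)] dis by (rule wt_Tup)
  obtain z where zz: "z \<notin> {0..<?n + width A'} \<union> fv t \<union> fv s" "Suc z \<notin> {0..<?n + width A'} \<union> fv t \<union> fv s"
    using fresh_var[of "{0..<?n + width A'} \<union> fv t \<union> fv s"] by auto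
  let ?P = "PPair z (Suc z)"
  let ?p = "ty_pat A 0" and ?q = "ty_pat A' ?n"
  have q: "prename (\<lambda>i. i + ?n) (ty_pat A' 0) = ?q" by (simp add: prename_ty_pat)
  have fvR: "fv (raise ?n A' ?G) = {?n..<?n + width A'}" by (simp add: morphD(4)[OF mg])
  have "app (Tens A A') ?T (Tup s t) \<simeq> LetIn ?P (Tup s t) (plet ?p (V z) (plet ?q (V (Suc z)) ?T))"
    unfolding ty_pat.simps add_0 by (rule plet_PT) (use zz fvR morphD(4)[OF mf] in auto)
  also have "\<dots> \<simeq> LetIn ?P (Tup s t) (Tup (app A ?F (V z)) (plet ?q (V (Suc z)) (raise ?n A' ?G)))"
    by (intro req_LetIn req_refl plet_Tup) (use zz fvR morphD(4)[OF mf] in auto)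
  also have "\<dots> \<leadsto> LetIn ?P (Tup s t) (Tup (app A ?F (V z)) (app A' ?G (V (Suc z))))"
  proof (intro red_LetIn red_Tup red_refl)
    \<comment> \<open>Unpacking under the raised indices and repacking for \<open>?G\<close> cancel,
      by eta below a match of the same shape.\<close>
    have "plet ?q (V (Suc z)) (raise ?n A' ?G) \<simeq> app A' ?G (plet ?q (V (Suc z)) (pval ?q))"
      by (rule plet_plet) (simp add: morphD(4)[OF mg])
    also have "\<dots> \<leadsto> app A' ?G (V (Suc z))"
      using eta_scrut[of "\<lambda>i. i + ?n" "ty_pat A' 0" "V (Suc z)" ?G] unfolding q by simp
    finally show "plet ?q (V (Suc z)) (raise ?n A' ?G) \<leadsto> app A' ?G (V (Suc z))" .
  qed
  also have "\<dots> \<leadsto> LetIn (PVar z) s (LetIn (PVar (Suc z)) t (Tup (app A ?F (V z)) (app A' ?G (V (Suc z)))))"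
    by (rule beta_pair) (use zz in auto)
  also have "\<dots> \<simeq> LetIn (PVar z) s (Tup (app A ?F (V z)) (LetIn (PVar (Suc z)) t (app A' ?G (V (Suc z)))))"
    by (intro req_LetIn req_refl commutingD(4)[OF commuting_Tup2]) (simp_all add: morphD(4)[OF mf])
  also have "\<dots> \<simeq> LetIn (PVar z) s (Tup (app A ?F (V z)) (app A' ?G t))"
    by (intro req_LetIn req_Tup req_refl plet_let_var) (simp add: morphD(4)[OF mg])
  also have "\<dots> \<simeq> Tup (LetIn (PVar z) s (app A ?F (V z))) (app A' ?G t)"
    by (rule commutingD(4)[OF commuting_Tup1]) (use zz in \<open>auto simp: morphD(4)[OF mg]\<close>)
  also have "\<dots> \<simeq> Tup (app A ?F s) (app A' ?G t)"
    by (intro req_Tup req_refl plet_let_var) (simp add: morphD(4)[OF mf])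
  finally have 1: "eqt \<rho> c (app (Tens A A') ?T (Tup s t)) (Tup (app A ?F s) (app A' ?G t)) (Tens B B')"
    using wt_app[OF m w] by (rule red_eqt)
  have "eqt \<rho> c (Tup (app A ?F s) (app A' ?G t)) (Tup u v) (Tens B B')"
  proof (rule eqt_Tup)
    show "eqt \<rho> c (app A ?F s) u B" "eqt \<rho> c (app A' ?G t) v B'"
      using e by (simp_all only: evl_iff[OF f] evl_iff[OF g])
    show "fv (app A ?F s) \<inter> fv (app A' ?G t) = {}"
      unfolding fv_app[OF mf] fv_app[OF mg] by (rule dis)
  qed
  with 1 have "eqt \<rho> c (app (Tens A A') ?T (Tup s t)) (Tup u v) (Tens B B')" by (rule eqt_trans)
  from evlI[OF m w this] show ?thesis using f g by (simp add: ar_tens_def)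
qed

text \<open>The representative is merely boxed: the environment of \<open>BoxTy d A\<close> is that
  of \<open>A\<close> with all grades raised by \<open>d\<close>, just as the body of a box
  requires.\<close>

definition shift_ar where
  "shift_ar d f = ar (BoxTy d (fst f)) (BoxTy d (fst (snd f))) (BoxTm d (rep f))"

lemma morph_shift:
  assumes "morph A B F"
  shows "morph (BoxTy d A) (BoxTy d B) (BoxTm d F)"
proof -
  note m = morphD[OF assms]
  have "wt (shift_env d (flat_env A)) (d + 0) F B" using m(3) by (rule wt_shift)
  then have "wt (flat_env (BoxTy d A)) (d + 0) F B"
    by (rule wt_cong_env) (use m(4) in \<open>auto simp: case_prod_beta\<close>)
  then show ?thesis using m by (auto simp: morph_def intro!: wt_BoxTm)
qed

lemma is_morph_shift: "is_morph f A B \<Longrightarrow> is_morph (shift_ar d f) (BoxTy d A) (BoxTy d B)"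
  unfolding shift_ar_def by (simp add: is_morphI morph_shift is_morph_rep)

lemma evl_shift:
  assumes f: "is_morph f A B" and e: "evl \<rho> (c + d) f s u"
  shows "evl \<rho> c (shift_ar d f) (BoxTm d s) (BoxTm d u)"
proof -
  let ?F = "rep f"
  note mf = is_morph_rep(1)[OF f]
  note m = morph_shift[OF mf, of d]
  have w: "wt \<rho> c (BoxTm d s) (BoxTy d A)" using evl_wt(1)[OF f e] by (rule wt_BoxTm)
  have "app (BoxTy d A) (BoxTm d ?F) (BoxTm d s) \<leadsto> app A (BoxTm d ?F) s"
    unfolding ty_pat.simps by (rule beta_PB)
  also have "\<dots> \<simeq> BoxTm d (app A ?F s)"
    by (rule plet_commuting[OF commuting_BoxTm]) auto
  finally have "eqt \<rho> c (app (BoxTy d A) (BoxTm d ?F) (BoxTm d s)) (BoxTm d (app A ?F s)) (BoxTy d B)"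
    using wt_app[OF m w] by (rule red_eqt)
  moreover have "eqt \<rho> c (BoxTm d (app A ?F s)) (BoxTm d u) (BoxTy d B)"
    by (rule eqt_BoxTm) (use e in \<open>simp add: evl_iff[OF f]\<close>)
  ultimately have "eqt \<rho> c (app (BoxTy d A) (BoxTm d ?F) (BoxTm d s)) (BoxTm d u) (BoxTy d B)" by (rule eqt_trans)
  from evlI[OF m w this] show ?thesis using f by (simp add: shift_ar_def)
qed

definition delay_morph where
  "delay_morph d q = ar (BoxTy (- d) (Qubit q)) (Qubit q) (Delay d (V 0))"

lemma morph_delay:
  assumes "0 \<le> d" "q \<in> qubits S"
  shows "morph (BoxTy (- d) (Qubit q)) (Qubit q) (Delay d (V 0))"
  using assms by (auto simp: morph_def intro!: wt_Delay wt_V)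

lemma is_morph_delay: "0 \<le> d \<Longrightarrow> q \<in> qubits S \<Longrightarrow> is_morph (delay_morph d q) (BoxTy (- d) (Qubit q)) (Qubit q)"
  unfolding delay_morph_def by (intro is_morphI morph_delay)

lemma evl_delay:
  assumes "0 \<le> d" "wt \<rho> c (BoxTm (- d) s) (BoxTy (- d) (Qubit q))"
  shows "evl \<rho> c (delay_morph d q) (BoxTm (- d) s) (Delay d s)"
proof -
  have q: "q \<in> qubits S" using wt_set_ty[OF assms(2)] by simp
  note m = morph_delay[OF assms(1) q]
  have "app (BoxTy (- d) (Qubit q)) (Delay d (V 0)) (BoxTm (- d) s) \<leadsto> LetIn (PVar 0) s (Delay d (V 0))"
    using beta_PB[of "- d" "PL 0" s "Delay d (V 0)"] by simp
  also have "\<dots> \<simeq> Delay d (LetIn (PVar 0) s (V 0))" by (rule commutingD(4)[OF commuting_Delay]) auto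
  also have "\<dots> \<simeq> Delay d s" by (intro commutingD(6)[OF commuting_Delay] req_let_var)
  finally have "eqt \<rho> c (app (BoxTy (- d) (Qubit q)) (Delay d (V 0)) (BoxTm (- d) s)) (Delay d s) (Qubit q)"
    using wt_app[OF m assms(2)] by (rule red_eqt)
  from evlI[OF m assms(2) this] show ?thesis by (simp add: delay_morph_def)
qed

end

context annotated
begin

section \<open>Gates on tuples of arguments\<close>

lemma plet_tuple:
  assumes "length ts = length qs" "{N..} \<inter> fv (tuple ts) = {}"
  shows "plet (ty_pat (tensor_ty qs) N) (tuple ts) X \<leadsto> lets N ts X"
  using assms
proof (induction ts arbitrary: qs N rule: tuple.induct)
  case 1
  then show ?case by (simp add: beta_unit)
next
  case (2 t)
  then obtain q where "qs = [q]" by (cases qs) auto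
  then show ?case by simp
next
  case (3 t t' ts)
  from 3(2) obtain q q' qs' where qs: "qs = q # q' # qs'" "length (t' # ts) = length (q' # qs')"
    by (cases qs; cases "tl qs") auto
  have "plet (PT (PL N) (ty_pat (tensor_ty (q' # qs')) (N + 1))) (Tup t (tuple (t' # ts))) X \<leadsto>
      plet (PL N) t (plet (ty_pat (tensor_ty (q' # qs')) (N + 1)) (tuple (t' # ts)) X)"
    by (rule beta_PT) (use 3(3) in auto)
  also have "\<dots> \<leadsto> plet (PL N) t (lets (N + 1) (t' # ts) X)"
    by (intro red_plet red_refl 3(1) qs(2)) (use 3(3) in \<open>auto simp: disjoint_iff\<close>)
  finally show ?case using qs by simp
qed

text \<open>\<open>vs\<close> holds the arguments to the left of those treated. In the recursive
  call the last of them is the placeholder \<open>V N\<close>, filled afterwards by moving its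
  \<open>let\<close> into the hole at that position.\<close>

lemma lets_Gate:
  assumes "\<forall>t \<in> set ts. {N..} \<inter> fv t = {}" "\<forall>v \<in> set vs. {N..} \<inter> fv v = {}"
  shows "lets N ts (Gate g (vs @ map V [N..<N + length ts])) \<simeq> Gate g (vs @ ts)"
  using assms
proof (induction ts arbitrary: N vs)
  case Nil
  then show ?case by simp
next
  case (Cons t ts)
  let ?us = "vs @ V N # ts" and ?i = "length vs"
  have N: "N \<notin> fv u" if "u \<in> set vs \<union> set ts" for u
    using Cons.prems that by (auto simp: disjoint_iff)
  have eq: "map V [N..<N + length (t # ts)] = V N # map V [Suc N..<Suc N + length ts]"
    by (simp add: upt_conv_Cons del: upt_Suc)
  have "lets N (t # ts) (Gate g (vs @ map V [N..<N + length (t # ts)])) =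
      LetIn (PVar N) t (lets (Suc N) ts (Gate g ((vs @ [V N]) @ map V [Suc N..<Suc N + length ts])))"
    by (simp only: eq lets.simps append_assoc append_Cons append_Nil)
  also have "\<dots> \<simeq> LetIn (PVar N) t (Gate g ((vs @ [V N]) @ ts))"
    by (intro req_LetIn req_refl Cons.IH) (use Cons.prems in \<open>auto simp: disjoint_iff\<close>)
  also have "LetIn (PVar N) t (Gate g ((vs @ [V N]) @ ts)) = LetIn (PVar N) t (Gate g (?us[?i := V N]))"
    by simp
  also have "\<dots> \<simeq> Gate g (?us[?i := LetIn (PVar N) t (V N)])"
  proof (rule commutingD(4)[OF commuting_hole[OF hole_Gate]])
    have "N \<notin> fv (?us ! j)" if "j < length ?us" "j \<noteq> ?i" for j
    proof -
      have "?us ! j \<in> set vs \<union> set ts"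
        using that by (auto simp: nth_append nth_Cons split: nat.split)
      then show ?thesis by (rule N)
    qed
    then show "set_pat (PVar N) \<inter> ((\<Union>j\<in>{..<length ?us} - {?i}. fv (?us ! j)) \<union> {}) = {}" by auto
  qed simp_all
  also have "\<dots> \<simeq> Gate g (?us[?i := t])"
    by (rule commutingD(6)[OF commuting_hole[OF hole_Gate]]) (simp_all add: req_let_var)
  finally show ?case by simp
qed

lemma wt_tuple:
  assumes "length ts = length qs" "\<forall>i < length ts. wt \<rho> c (ts ! i) (Qubit (qs ! i))" "pairwise_disjoint ts"
  shows "wt \<rho> c (tuple ts) (tensor_ty qs)"
  using assms
proof (induction ts arbitrary: qs rule: tuple.induct)
  case 1
  then show ?case by (auto intro: wt_Star)
next
  case (2 t)
  then obtain q where "qs = [q]" by (cases qs) auto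
  with 2 show ?case by simp
next
  case (3 t t' ts)
  from 3(2) obtain q q' qs' where qs: "qs = q # q' # qs'" "length (t' # ts) = length (q' # qs')"
    by (cases qs; cases "tl qs") auto
  have t: "wt \<rho> c t (Qubit q)" using 3(3)[rule_format, of 0] qs by simp
  have "wt \<rho> c (tuple (t' # ts)) (tensor_ty (q' # qs'))"
  proof (rule 3(1)[OF qs(2)])
    show "\<forall>i < length (t' # ts). wt \<rho> c ((t' # ts) ! i) (Qubit ((q' # qs') ! i))"
    proof (intro allI impI)
      fix i assume "i < length (t' # ts)"
      with 3(3)[rule_format, of "Suc i"] qs show "wt \<rho> c ((t' # ts) ! i) (Qubit ((q' # qs') ! i))" by simp
    qed
    show "pairwise_disjoint (t' # ts)" unfolding pairwise_disjoint_def
    proof (intro allI impI)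
      fix i j assume "i < length (t' # ts)" "j < length (t' # ts)" "i \<noteq> j"
      with 3(4)[unfolded pairwise_disjoint_def, rule_format, of "Suc i" "Suc j"]
      show "fv ((t' # ts) ! i) \<inter> fv ((t' # ts) ! j) = {}" by simp
    qed
  qed
  moreover have "fv t \<inter> fv (tuple (t' # ts)) = {}"
  proof -
    have "fv t \<inter> fv u = {}" if "u \<in> set (t' # ts)" for u
    proof -
      from that obtain j where "j < length (t' # ts)" "u = (t' # ts) ! j" by (metis in_set_conv_nth)
      with 3(4)[unfolded pairwise_disjoint_def, rule_format, of 0 "Suc j"] show ?thesis by simp
    qed
    then show ?thesis unfolding fv_tuple by auto
  qed
  ultimately show ?case using t qs by (auto intro: wt_Tup)
qed

abbreviation gate_ty :: "'g \<Rightarrow> 'q ty" where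
  "gate_ty g \<equiv> tensor_ty (wires S g)"

definition gate_morph where
  "gate_morph g = ar (BoxTy (- duration S g) (gate_ty g)) (gate_ty g) (Gate g (map V [0..<length (wires S g)]))"

lemma gate_ty: "g \<in> gates S \<Longrightarrow> set_ty (gate_ty g) \<subseteq> qubits S"
  using wf by (auto simp: wf_signature_def wires_finite_ty)

lemma morph_gate:
  assumes "g \<in> gates S"
  shows "morph (BoxTy (- duration S g) (gate_ty g)) (gate_ty g) (Gate g (map V [0..<length (wires S g)]))"
proof -
  let ?k = "length (wires S g)" and ?d = "duration S g"
  have "wt (flat_env (BoxTy (- ?d) (gate_ty g))) (0 - ?d) (V i) (Qubit (wires S g ! i))" if "i < ?k" for i
  proof (rule wt_V)
    show "flat (BoxTy (- ?d) (gate_ty g)) ! i = (0 - ?d, Qubit (wires S g ! i))"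
      using that by (simp add: flat_tensor_ty)
    show "set_ty (Qubit (wires S g ! i)) \<subseteq> qubits S"
      using gate_ty[OF assms] that by (auto simp: wires_finite_ty)
  qed
  then have "wt (flat_env (BoxTy (- ?d) (gate_ty g))) 0 (Gate g (map V [0..<?k])) (gate_ty g)"
    using assms by (intro wt_Gate) (auto simp: pairwise_disjoint_def)
  then show ?thesis
    using gate_ty[OF assms] by (auto simp: morph_def flat_tensor_ty)
qed

lemma is_morph_gate: "g \<in> gates S \<Longrightarrow> is_morph (gate_morph g) (BoxTy (- duration S g) (gate_ty g)) (gate_ty g)"
  unfolding gate_morph_def by (intro is_morphI morph_gate)

lemma evl_gate:
  assumes w: "wt \<rho> c (Gate g ts) A"
  shows "evl \<rho> c (gate_morph g) (BoxTm (- duration S g) (tuple ts)) (Gate g ts)"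
proof -
  let ?d = "duration S g" and ?k = "length (wires S g)"
  from w have g: "g \<in> gates S" "length ts = ?k" "pairwise_disjoint ts" "A = gate_ty g"
    "\<forall>i < length ts. wt \<rho> (c - ?d) (ts ! i) (Qubit (wires S g ! i))"
    by (auto elim: wt_GateE)
  note m = morph_gate[OF g(1)]
  have "wt \<rho> (c - ?d) (tuple ts) (gate_ty g)" by (rule wt_tuple[OF g(2) g(5,3)])
  then have t: "wt \<rho> c (BoxTm (- ?d) (tuple ts)) (BoxTy (- ?d) (gate_ty g))" by (auto intro: wt_BoxTm)
  let ?A = "BoxTy (- ?d) (gate_ty g)" and ?G = "Gate g (map V [0..<?k])"
  have wA: "width ?A = ?k" by (simp add: flat_tensor_ty)
  obtain N where N: "width ?A \<le> N" "{N..} \<inter> fv (tuple ts) = {}" using ex_high by blast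
  have "map (\<lambda>x. if x \<in> {0..<width ?A} then V (x + N) else V x) [0..<?k] = map V [N..<N + ?k]"
    unfolding wA by (rule nth_equalityI) (auto simp: add.commute)
  then have sub: "subst ?G (\<lambda>x. if x \<in> {0..<width ?A} then V (x + N) else V x) = Gate g (map V [N..<N + ?k])"
    by (simp add: o_def del: atLeastLessThan_iff)
  have "app ?A ?G (BoxTm (- ?d) (tuple ts)) \<leadsto>
      plet (ty_pat ?A N) (BoxTm (- ?d) (tuple ts)) (Gate g (map V [N..<N + ?k]))"
    unfolding sub[symmetric] by (rule app_high) (use N(1) wA in auto)
  also have "\<dots> \<leadsto> plet (ty_pat (gate_ty g) N) (tuple ts) (Gate g (map V [N..<N + ?k]))"
    unfolding ty_pat.simps by (rule beta_PB)
  also have "\<dots> \<leadsto> lets N ts (Gate g (map V [N..<N + ?k]))"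
    by (rule plet_tuple[OF g(2) N(2)])
  also have "\<dots> \<simeq> Gate g ts"
    using lets_Gate[of ts N "[]" g] N(2) g(2) by (auto simp: fv_tuple)
  finally have "eqt \<rho> c (app ?A ?G (BoxTm (- ?d) (tuple ts))) (Gate g ts) (gate_ty g)"
    using wt_app[OF m t] by (rule red_eqt)
  from evlI[OF m t this] show ?thesis by (simp add: gate_morph_def)
qed


section \<open>The term model\<close>

text \<open>Types with the same list of shifted qubits stay different objects. Thus the
  interpretation of a type is the type itself, and no choice of normal forms enters.\<close>

definition term_model :: "('q, 'g) small_model" where
  "term_model =
    \<lparr>Obj = {A. set_ty A \<subseteq> qubits S}, Arr = {f. \<exists>A B. is_morph f A B},
     Dom = fst, Cod = (\<lambda>f. fst (snd f)), Id = (\<lambda>A. can A A), Comp = ar_comp,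
     Unit = One, tens_ob = Tens, tens_ar = ar_tens,
     assoc = (\<lambda>A B C. can (Tens (Tens A B) C) (Tens A (Tens B C))),
     lunit = (\<lambda>A. can (Tens One A) A), runit = (\<lambda>A. can (Tens A One) A), symm = sym_ar,
     qubit_ob = Qubit,
     Shift = (\<lambda>d. \<lparr>f_ob = BoxTy d, f_ar = shift_ar d,
       f_mul = (\<lambda>A B. can (Tens (BoxTy d A) (BoxTy d B)) (BoxTy d (Tens A B))),
       f_unit = can One (BoxTy d One)\<rparr>),
     Shift_mul = (\<lambda>d e A. can (BoxTy d (BoxTy e A)) (BoxTy (d + e) A)),
     Shift_unit = (\<lambda>A. can A (BoxTy 0 A)),
     gate_ar = gate_morph, delay_ar = delay_morph\<rparr>"

lemma term_model_simps [simp]: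
  "Obj term_model = {A. set_ty A \<subseteq> qubits S}"
  "Arr term_model = {f. \<exists>A B. is_morph f A B}"
  "Dom term_model = fst" "Cod term_model = (\<lambda>f. fst (snd f))"
  "Id term_model = (\<lambda>A. can A A)" "Comp term_model = ar_comp"
  "Unit term_model = One" "tens_ob term_model = Tens" "tens_ar term_model = ar_tens"
  "assoc term_model = (\<lambda>A B C. can (Tens (Tens A B) C) (Tens A (Tens B C)))"
  "lunit term_model = (\<lambda>A. can (Tens One A) A)" "runit term_model = (\<lambda>A. can (Tens A One) A)"
  "symm term_model = sym_ar" "qubit_ob term_model = Qubit"
  "f_ob (Shift term_model d) = BoxTy d" "f_ar (Shift term_model d) = shift_ar d"
  "f_mul (Shift term_model d) = (\<lambda>A B. can (Tens (BoxTy d A) (BoxTy d B)) (BoxTy d (Tens A B)))"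
  "f_unit (Shift term_model d) = can One (BoxTy d One)"
  "Shift_mul term_model = (\<lambda>d e A. can (BoxTy d (BoxTy e A)) (BoxTy (d + e) A))"
  "Shift_unit term_model = (\<lambda>A. can A (BoxTy 0 A))"
  "gate_ar term_model = gate_morph" "delay_ar term_model = delay_morph"
  by (simp_all add: term_model_def)

lemma hom_term_model [simp]: "f \<in> hom term_model A B \<longleftrightarrow> is_morph f A B"
  by (auto simp: hom_def)

text \<open>Generic elements at any indices and any offset. Unlike the element
  \<open>ty_val A 0\<close> at offset 0, this notion passes to the components of a tensor product
  and to the content of a box, so that equations can be checked on arguments in constructor
  form.\<close>

definition pnt :: "'q env \<Rightarrow> real \<Rightarrow> 'g tm \<Rightarrow> 'q ty \<Rightarrow> bool" where
  "pnt \<rho> c t A \<longleftrightarrow> wt \<rho> c t A \<and> (\<exists>n. t = ty_val A n)"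

lemma pnt_wt: "pnt \<rho> c t A \<Longrightarrow> wt \<rho> c t A"
  by (simp add: pnt_def)

lemma pnt_TensE:
  assumes "pnt \<rho> c t (Tens A B)"
  obtains s u where "t = Tup s u" "pnt \<rho> c s A" "pnt \<rho> c u B" "fv s \<inter> fv u = {}"
  using assms unfolding pnt_def ty_pat.simps pval.simps by (elim conjE exE) (auto elim!: wt_TupE)

lemma pnt_OneE: "pnt \<rho> c t One \<Longrightarrow> t = Star"
  by (auto simp: pnt_def)

lemma pnt_BoxE:
  assumes "pnt \<rho> c t (BoxTy d A)"
  obtains s where "t = BoxTm d s" "pnt \<rho> (c + d) s A"
  using assms unfolding pnt_def ty_pat.simps pval.simps by (elim conjE exE) (auto elim!: wt_BoxTmE)

lemma morph_eqI:
  assumes "is_morph f A B" "is_morph g A B"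
    and "\<And>\<rho> c t. pnt \<rho> c t A \<Longrightarrow> \<exists>u. evl \<rho> c f t u \<and> evl \<rho> c g t u"
  shows "f = g"
proof -
  have "pnt (flat_env A) 0 (ty_val A 0) A"
    unfolding pnt_def using wt_ty_val_env[OF refl is_morph_ty(1)[OF assms(1)]] by blast
  from assms(3)[OF this] show ?thesis using morph_ext[OF assms(1,2)] by blast
qed

lemma evl_obtain:
  assumes "is_morph f A B" "wt \<rho> c t A"
  obtains u where "evl \<rho> c f t u" "wt \<rho> c u B" "fv u = fv t"
  using evl_ex[OF assms] evl_wt[OF assms(1)] by blast

lemmas evl_intros = evl_comp evl_tens evl_shift evl_sym evl_assoc evl_lunit evl_runit evl_mul evl_unit
  evl_shift_mul evl_shift_unit evl_id

lemmas morph_intros = is_morph_comp is_morph_tens is_morph_shift is_morph_sym is_morph_can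

section \<open>Category laws and canonical isomorphisms\<close>

lemma comp_can_id:
  assumes "is_morph f A B"
  shows "ar_comp f (can A A) = f" "ar_comp (can B B) f = f"
proof -
  note ty = is_morph_ty[OF assms]
  note id = is_morph_can[OF refl ty(1)] is_morph_can[OF refl ty(2)]
  show "ar_comp f (can A A) = f"
  proof (rule morph_eqI)
    fix \<rho> c t assume t: "pnt \<rho> c t A"
    from evl_obtain[OF assms pnt_wt[OF t]] obtain u where u: "evl \<rho> c f t u" by blast
    have "evl \<rho> c (ar_comp f (can A A)) t u"
      by (rule evl_comp[OF id(1) assms evl_id u]) (use ty pnt_wt[OF t] in auto)
    with u show "\<exists>u. evl \<rho> c (ar_comp f (can A A)) t u \<and> evl \<rho> c f t u" by blast
  qed (use assms id ty in \<open>auto intro: is_morph_comp\<close>)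
  show "ar_comp (can B B) f = f"
  proof (rule morph_eqI)
    fix \<rho> c t assume t: "pnt \<rho> c t A"
    from evl_obtain[OF assms pnt_wt[OF t]] obtain u where u: "evl \<rho> c f t u" "wt \<rho> c u B" by blast
    have "evl \<rho> c (ar_comp (can B B) f) t u"
      by (rule evl_comp[OF assms id(2) u(1) evl_id]) (use ty u in auto)
    with u show "\<exists>u. evl \<rho> c (ar_comp (can B B) f) t u \<and> evl \<rho> c f t u" by blast
  qed (use assms id ty in \<open>auto intro: is_morph_comp\<close>)
qed

lemma comp_assoc:
  assumes f: "is_morph f A B" and g: "is_morph g B C" and h: "is_morph h C D"
  shows "ar_comp (ar_comp h g) f = ar_comp h (ar_comp g f)"
proof (rule morph_eqI)
  fix \<rho> c t assume t: "pnt \<rho> c t A"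
  from evl_obtain[OF f pnt_wt[OF t]] obtain x where x: "evl \<rho> c f t x" "wt \<rho> c x B" by blast
  from evl_obtain[OF g x(2)] obtain y where y: "evl \<rho> c g x y" "wt \<rho> c y C" by blast
  from evl_obtain[OF h y(2)] obtain z where z: "evl \<rho> c h y z" by blast
  have "evl \<rho> c (ar_comp (ar_comp h g) f) t z" "evl \<rho> c (ar_comp h (ar_comp g f)) t z"
    by (rule evl_comp is_morph_comp f g h x y z)+
  then show "\<exists>u. evl \<rho> c (ar_comp (ar_comp h g) f) t u \<and> evl \<rho> c (ar_comp h (ar_comp g f)) t u" by blast
qed (rule is_morph_comp f g h)+

text \<open>\<open>A\<close> and \<open>B\<close> have the same environment, so the tuple for
  \<open>B\<close> already is the generic element to which the second arrow is applied.\<close>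

lemma can_can:
  assumes "flat A = flat B" "flat B = flat C" "set_ty A \<subseteq> qubits S" "set_ty B \<subseteq> qubits S" "set_ty C \<subseteq> qubits S"
  shows "ar_comp (can B C) (can A B) = can A C"
proof -
  note m1 = morph_can[OF assms(1,3,4)] and m2 = morph_can[OF assms(2,4,5)] and m3 = morph_can[OF trans[OF assms(1,2)] assms(3,5)]
  have AB: "is_morph (can A B) A B" and BC: "is_morph (can B C) B C"
    using assms by (auto intro: is_morph_can)
  note r1 = rep_ar[OF m1, folded can_def] and r2 = rep_ar[OF m2, folded can_def]
  have "ar_comp (can B C) (can A B) = ar A C (app B (rep (can B C)) (rep (can A B)))"
    unfolding ar_comp_def using AB BC by simp
  also have "\<dots> = ar A C (ty_val C 0)"
  proof -
    have "eqt (flat_env A) 0 (app B (ty_val C 0) (ty_val B 0)) (app B (rep (can B C)) (rep (can A B))) C"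
      by (rule eqt_app[OF m2 r2(1) r1(1)])
    moreover have "eqt (flat_env A) 0 (app B (ty_val C 0) (ty_val B 0)) (ty_val C 0) C"
      using eqt_app_val[OF m2] assms(1) by simp
    ultimately have "eqt (flat_env A) 0 (ty_val C 0) (app B (rep (can B C)) (rep (can A B))) C"
      by (meson eqt_sym eqt_trans)
    then show ?thesis using ar_eq_iff[OF m3] by metis
  qed
  finally show ?thesis by (simp add: can_def)
qed

lemma inverse_can:
  assumes "flat A = flat B" "set_ty A \<subseteq> qubits S" "set_ty B \<subseteq> qubits S"
  shows "inverse_arrows term_model (can A B) (can B A)"
  using assms is_morph_can[OF assms] is_morph_can[OF assms(1)[symmetric] assms(3,2)]
  by (auto simp: inverse_arrows_def can_can)

lemma is_iso_can:
  "flat A = flat B \<Longrightarrow> set_ty A \<subseteq> qubits S \<Longrightarrow> set_ty B \<subseteq> qubits S \<Longrightarrow> is_iso term_model (can A B)"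
  unfolding is_iso_def by (blast intro: inverse_can)

lemma arr_inv_can:
  assumes "flat A = flat B" "set_ty A \<subseteq> qubits S" "set_ty B \<subseteq> qubits S"
  shows "arr_inv term_model (can A B) = can B A"
  unfolding arr_inv_def
proof (rule the_equality)
  show "inverse_arrows term_model (can A B) (can B A)" by (rule inverse_can[OF assms])
  fix g assume g: "inverse_arrows term_model (can A B) g"
  note AB = is_morph_can[OF assms] and BA = is_morph_can[OF assms(1)[symmetric] assms(3,2)]
  from g AB have gm: "is_morph g B A" and eq: "ar_comp g (can A B) = can A A"
    by (simp_all add: inverse_arrows_def)
  have "g = ar_comp g (can B B)" using comp_can_id(1)[OF gm] by simp
  also have "\<dots> = ar_comp g (ar_comp (can A B) (can B A))" using assms by (simp add: can_can)
  also have "\<dots> = ar_comp (ar_comp g (can A B)) (can B A)" by (rule comp_assoc[OF BA AB gm, symmetric])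
  also have "\<dots> = can B A" unfolding eq by (rule comp_can_id(2)[OF BA])
  finally show "g = can B A" .
qed

section \<open>Symmetric monoidal structure\<close>

lemma wt_Tup_iff [simp]: "wt \<rho> c (Tup s t) (Tens A B) \<longleftrightarrow> wt \<rho> c s A \<and> wt \<rho> c t B \<and> fv s \<inter> fv t = {}"
  by (auto intro: wt_Tup elim: wt_TupE)

lemma wt_BoxTm_iff [simp]: "wt \<rho> c (BoxTm d t) (BoxTy d A) \<longleftrightarrow> wt \<rho> (c + d) t A"
  by (auto intro: wt_BoxTm elim: wt_BoxTmE)

lemma wt_Star_One [simp]: "wt \<rho> c Star One"
  by (rule wt_Star)

lemma tens_id:
  assumes ty: "set_ty A \<subseteq> qubits S" "set_ty B \<subseteq> qubits S"
  shows "ar_tens (can A A) (can B B) = can (Tens A B) (Tens A B)"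
proof (rule morph_eqI)
  fix \<rho> c t assume "pnt \<rho> c t (Tens A B)"
  then obtain s u where t: "t = Tup s u" "fv s \<inter> fv u = {}" and p: "pnt \<rho> c s A" "pnt \<rho> c u B"
    by (rule pnt_TensE)
  note W = ty t(2) p[THEN pnt_wt]
  show "\<exists>v. evl \<rho> c (ar_tens (can A A) (can B B)) t v \<and> evl \<rho> c (can (Tens A B) (Tens A B)) t v"
    unfolding t(1)
    \<comment> \<open>The witness stays schematic: evaluating the left side computes it, and the
      evaluation of the right side has to arrive at the same term. The equations below are checked
      in the same manner.\<close>
    by (rule exI, rule conjI, (rule evl_intros morph_intros | (simp add: W; fail))+)
qed (use ty in \<open>auto intro!: morph_intros\<close>)

lemma tens_comp:
  assumes f: "is_morph f A B" "is_morph g B C" "is_morph f' A' B'" "is_morph g' B' C'"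
  shows "ar_tens (ar_comp g f) (ar_comp g' f') = ar_comp (ar_tens g g') (ar_tens f f')"
proof (rule morph_eqI)
  fix \<rho> c t assume "pnt \<rho> c t (Tens A A')"
  then obtain s u where t: "t = Tup s u" "fv s \<inter> fv u = {}" and p: "pnt \<rho> c s A" "pnt \<rho> c u A'"
    by (rule pnt_TensE)
  from evl_obtain[OF f(1) pnt_wt[OF p(1)]] obtain x where x: "evl \<rho> c f s x" "wt \<rho> c x B" "fv x = fv s" .
  from evl_obtain[OF f(2) x(2)] obtain y where y: "evl \<rho> c g x y" "wt \<rho> c y C" "fv y = fv x" .
  from evl_obtain[OF f(3) pnt_wt[OF p(2)]] obtain x' where x': "evl \<rho> c f' u x'" "wt \<rho> c x' B'" "fv x' = fv u" .
  from evl_obtain[OF f(4) x'(2)] obtain y' where y': "evl \<rho> c g' x' y'" "wt \<rho> c y' C'" "fv y' = fv x'" .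
  show "\<exists>v. evl \<rho> c (ar_tens (ar_comp g f) (ar_comp g' f')) t v \<and> evl \<rho> c (ar_comp (ar_tens g g') (ar_tens f f')) t v"
    unfolding t(1)
    by (rule exI, rule conjI, (rule f x(1) y(1) x'(1) y'(1) evl_intros morph_intros | (simp add: x y x' y' t; fail))+)
qed (rule morph_intros f)+

lemma assoc_nat:
  assumes f: "is_morph f A A'" "is_morph g B B'" "is_morph h C C'"
  shows "ar_comp (can (Tens (Tens A' B') C') (Tens A' (Tens B' C'))) (ar_tens (ar_tens f g) h) =
    ar_comp (ar_tens f (ar_tens g h)) (can (Tens (Tens A B) C) (Tens A (Tens B C)))"
proof (rule morph_eqI)
  note ty = f[THEN is_morph_ty(1)] f[THEN is_morph_ty(2)]
  fix \<rho> c t assume "pnt \<rho> c t (Tens (Tens A B) C)"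
  then obtain t' u where t': "t = Tup t' u" "fv t' \<inter> fv u = {}" and pt: "pnt \<rho> c t' (Tens A B)" "pnt \<rho> c u C"
    by (rule pnt_TensE)
  from pt(1) obtain r s where t: "t' = Tup r s" "fv r \<inter> fv s = {}" and p: "pnt \<rho> c r A" "pnt \<rho> c s B"
    by (rule pnt_TensE)
  from evl_obtain[OF f(1) pnt_wt[OF p(1)]] obtain x where x: "evl \<rho> c f r x" "wt \<rho> c x A'" "fv x = fv r" .
  from evl_obtain[OF f(2) pnt_wt[OF p(2)]] obtain y where y: "evl \<rho> c g s y" "wt \<rho> c y B'" "fv y = fv s" .
  from evl_obtain[OF f(3) pnt_wt[OF pt(2)]] obtain z where z: "evl \<rho> c h u z" "wt \<rho> c z C'" "fv z = fv u" .
  have dis: "fv r \<inter> fv u = {}" "fv s \<inter> fv u = {}" using t'(2) t by auto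
  note W = ty x y z t(2) dis p[THEN pnt_wt] pt(2)[THEN pnt_wt] Int_Un_distrib Int_Un_distrib2
  show "\<exists>v. evl \<rho> c (ar_comp (can (Tens (Tens A' B') C') (Tens A' (Tens B' C'))) (ar_tens (ar_tens f g) h)) t v \<and>
      evl \<rho> c (ar_comp (ar_tens f (ar_tens g h)) (can (Tens (Tens A B) C) (Tens A (Tens B C)))) t v"
    unfolding t'(1) t(1)
    by (rule exI, rule conjI, (rule f x(1) y(1) z(1) evl_intros morph_intros | (simp add: W; fail))+)
qed (rule morph_intros f | (simp add: f[THEN is_morph_ty(1)] f[THEN is_morph_ty(2)]; fail))+

lemma lunit_nat:
  assumes f: "is_morph f A B"
  shows "ar_comp (can (Tens One B) B) (ar_tens (can One One) f) = ar_comp f (can (Tens One A) A)"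
proof (rule morph_eqI)
  fix \<rho> c t assume "pnt \<rho> c t (Tens One A)"
  then obtain r s where t: "t = Tup r s" "fv r \<inter> fv s = {}" and p: "pnt \<rho> c r One" "pnt \<rho> c s A"
    by (rule pnt_TensE)
  have r: "r = Star" by (rule pnt_OneE[OF p(1)])
  from evl_obtain[OF f pnt_wt[OF p(2)]] obtain x where x: "evl \<rho> c f s x" "wt \<rho> c x B" "fv x = fv s" .
  note W = is_morph_ty[OF f] x p(2)[THEN pnt_wt]
  show "\<exists>v. evl \<rho> c (ar_comp (can (Tens One B) B) (ar_tens (can One One) f)) t v \<and>
      evl \<rho> c (ar_comp f (can (Tens One A) A)) t v"
    unfolding t(1) r
    by (rule exI, rule conjI, (rule f x(1) evl_intros morph_intros | (simp add: W; fail))+)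
qed (rule morph_intros f | (simp add: is_morph_ty[OF f]; fail))+

lemma runit_nat:
  assumes f: "is_morph f A B"
  shows "ar_comp (can (Tens B One) B) (ar_tens f (can One One)) = ar_comp f (can (Tens A One) A)"
proof (rule morph_eqI)
  fix \<rho> c t assume "pnt \<rho> c t (Tens A One)"
  then obtain r s where t: "t = Tup r s" "fv r \<inter> fv s = {}" and p: "pnt \<rho> c r A" "pnt \<rho> c s One"
    by (rule pnt_TensE)
  have s: "s = Star" by (rule pnt_OneE[OF p(2)])
  from evl_obtain[OF f pnt_wt[OF p(1)]] obtain x where x: "evl \<rho> c f r x" "wt \<rho> c x B" "fv x = fv r" .
  note W = is_morph_ty[OF f] x p(1)[THEN pnt_wt]
  show "\<exists>v. evl \<rho> c (ar_comp (can (Tens B One) B) (ar_tens f (can One One))) t v \<and>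
      evl \<rho> c (ar_comp f (can (Tens A One) A)) t v"
    unfolding t(1) s
    by (rule exI, rule conjI, (rule f x(1) evl_intros morph_intros | (simp add: W; fail))+)
qed (rule morph_intros f | (simp add: is_morph_ty[OF f]; fail))+

lemma symm_nat:
  assumes f: "is_morph f A A'" "is_morph g B B'"
  shows "ar_comp (sym_ar A' B') (ar_tens f g) = ar_comp (ar_tens g f) (sym_ar A B)"
proof (rule morph_eqI)
  fix \<rho> c t assume "pnt \<rho> c t (Tens A B)"
  then obtain r s where t: "t = Tup r s" "fv r \<inter> fv s = {}" and p: "pnt \<rho> c r A" "pnt \<rho> c s B"
    by (rule pnt_TensE)
  from evl_obtain[OF f(1) pnt_wt[OF p(1)]] obtain x where x: "evl \<rho> c f r x" "wt \<rho> c x A'" "fv x = fv r" .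
  from evl_obtain[OF f(2) pnt_wt[OF p(2)]] obtain y where y: "evl \<rho> c g s y" "wt \<rho> c y B'" "fv y = fv s" .
  note W = f[THEN is_morph_ty(1)] f[THEN is_morph_ty(2)] x y p[THEN pnt_wt] t(2) Int_commute[of "fv s" "fv r"]
  show "\<exists>v. evl \<rho> c (ar_comp (sym_ar A' B') (ar_tens f g)) t v \<and>
      evl \<rho> c (ar_comp (ar_tens g f) (sym_ar A B)) t v"
    unfolding t(1)
    by (rule exI, rule conjI, (rule f x(1) y(1) evl_intros morph_intros | (simp add: W; fail))+)
qed (rule morph_intros f | (simp add: f[THEN is_morph_ty(1)] f[THEN is_morph_ty(2)]; fail))+

lemma symm_symm:
  assumes ty: "set_ty A \<subseteq> qubits S" "set_ty B \<subseteq> qubits S"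
  shows "ar_comp (sym_ar B A) (sym_ar A B) = can (Tens A B) (Tens A B)"
proof (rule morph_eqI)
  fix \<rho> c t assume "pnt \<rho> c t (Tens A B)"
  then obtain r s where t: "t = Tup r s" "fv r \<inter> fv s = {}" and p: "pnt \<rho> c r A" "pnt \<rho> c s B"
    by (rule pnt_TensE)
  note W = ty p[THEN pnt_wt] t(2) Int_commute[of "fv s" "fv r"]
  show "\<exists>v. evl \<rho> c (ar_comp (sym_ar B A) (sym_ar A B)) t v \<and> evl \<rho> c (can (Tens A B) (Tens A B)) t v"
    unfolding t(1)
    by (rule exI, rule conjI, (rule evl_intros morph_intros | (simp add: W; fail))+)
qed (rule morph_intros | (simp add: ty; fail))+

lemma pentagon:
  assumes ty: "set_ty A \<subseteq> qubits S" "set_ty B \<subseteq> qubits S" "set_ty C \<subseteq> qubits S" "set_ty D \<subseteq> qubits S"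
  shows "ar_comp (ar_tens (can A A) (can (Tens (Tens B C) D) (Tens B (Tens C D))))
      (ar_comp (can (Tens (Tens A (Tens B C)) D) (Tens A (Tens (Tens B C) D)))
        (ar_tens (can (Tens (Tens A B) C) (Tens A (Tens B C))) (can D D))) =
    ar_comp (can (Tens (Tens A B) (Tens C D)) (Tens A (Tens B (Tens C D))))
      (can (Tens (Tens (Tens A B) C) D) (Tens (Tens A B) (Tens C D)))" (is "?l = ?r")
proof (rule morph_eqI)
  fix \<rho> c t assume "pnt \<rho> c t (Tens (Tens (Tens A B) C) D)"
  then obtain t1 t2 x4 where t: "t = Tup t1 x4" "fv t1 \<inter> fv x4 = {}" and p4: "pnt \<rho> c x4 D" and p1: "pnt \<rho> c t1 (Tens (Tens A B) C)"
    by (rule pnt_TensE)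
  from p1 obtain t2 x3 where t1: "t1 = Tup t2 x3" "fv t2 \<inter> fv x3 = {}" and p3: "pnt \<rho> c x3 C" and p2: "pnt \<rho> c t2 (Tens A B)"
    by (rule pnt_TensE)
  from p2 obtain x1 x2 where t2: "t2 = Tup x1 x2" "fv x1 \<inter> fv x2 = {}" and p: "pnt \<rho> c x1 A" "pnt \<rho> c x2 B"
    by (rule pnt_TensE)
  have dis: "fv x1 \<inter> fv x3 = {}" "fv x2 \<inter> fv x3 = {}" "fv x1 \<inter> fv x4 = {}" "fv x2 \<inter> fv x4 = {}" "fv x3 \<inter> fv x4 = {}"
    using t t1 t2 by auto
  note W = ty p[THEN pnt_wt] p3[THEN pnt_wt] p4[THEN pnt_wt] t2(2) dis Int_Un_distrib Int_Un_distrib2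
  show "\<exists>v. evl \<rho> c ?l t v \<and> evl \<rho> c ?r t v"
    unfolding t(1) t1(1) t2(1)
    by (rule exI, rule conjI, (rule evl_intros morph_intros | (simp add: W; fail))+)
qed (rule morph_intros | (simp add: ty; fail))+

lemma triangle:
  assumes ty: "set_ty A \<subseteq> qubits S" "set_ty B \<subseteq> qubits S"
  shows "ar_comp (ar_tens (can A A) (can (Tens One B) B)) (can (Tens (Tens A One) B) (Tens A (Tens One B))) =
    ar_tens (can (Tens A One) A) (can B B)" (is "?l = ?r")
proof (rule morph_eqI)
  fix \<rho> c t assume "pnt \<rho> c t (Tens (Tens A One) B)"
  then obtain t1 x3 where t: "t = Tup t1 x3" "fv t1 \<inter> fv x3 = {}" and p3: "pnt \<rho> c x3 B" and p1: "pnt \<rho> c t1 (Tens A One)"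
    by (rule pnt_TensE)
  from p1 obtain x1 x2 where t1: "t1 = Tup x1 x2" "fv x1 \<inter> fv x2 = {}" and p: "pnt \<rho> c x1 A" "pnt \<rho> c x2 One"
    by (rule pnt_TensE)
  have x2: "x2 = Star" by (rule pnt_OneE[OF p(2)])
  have dis: "fv x1 \<inter> fv x3 = {}" using t t1 by auto
  note W = ty p(1)[THEN pnt_wt] p3[THEN pnt_wt] dis
  show "\<exists>v. evl \<rho> c ?l t v \<and> evl \<rho> c ?r t v"
    unfolding t(1) t1(1) x2
    by (rule exI, rule conjI, (rule evl_intros morph_intros | (simp add: W; fail))+)
qed (rule morph_intros | (simp add: ty; fail))+

lemma hexagon:
  assumes ty: "set_ty A \<subseteq> qubits S" "set_ty B \<subseteq> qubits S" "set_ty C \<subseteq> qubits S"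
  shows "ar_comp (ar_tens (can B B) (sym_ar A C)) (ar_comp (can (Tens (Tens B A) C) (Tens B (Tens A C)))
      (ar_tens (sym_ar A B) (can C C))) =
    ar_comp (can (Tens (Tens B C) A) (Tens B (Tens C A))) (ar_comp (sym_ar A (Tens B C))
      (can (Tens (Tens A B) C) (Tens A (Tens B C))))" (is "?l = ?r")
proof (rule morph_eqI)
  fix \<rho> c t assume "pnt \<rho> c t (Tens (Tens A B) C)"
  then obtain t1 x3 where t: "t = Tup t1 x3" "fv t1 \<inter> fv x3 = {}" and p3: "pnt \<rho> c x3 C" and p1: "pnt \<rho> c t1 (Tens A B)"
    by (rule pnt_TensE)
  from p1 obtain x1 x2 where t1: "t1 = Tup x1 x2" "fv x1 \<inter> fv x2 = {}" and p: "pnt \<rho> c x1 A" "pnt \<rho> c x2 B"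
    by (rule pnt_TensE)
  have dis: "fv x1 \<inter> fv x3 = {}" "fv x2 \<inter> fv x3 = {}" "fv x2 \<inter> fv x1 = {}" "fv x3 \<inter> fv x1 = {}" "fv x3 \<inter> fv x2 = {}"
    using t t1 by auto
  note W = ty p[THEN pnt_wt] p3[THEN pnt_wt] t1(2) dis Int_Un_distrib Int_Un_distrib2
  show "\<exists>v. evl \<rho> c ?l t v \<and> evl \<rho> c ?r t v"
    unfolding t(1) t1(1)
    by (rule exI, rule conjI, (rule evl_intros morph_intros | (simp add: W; fail))+)
qed (rule morph_intros | (simp add: ty; fail))+

lemma symmetric_monoidal_category_term_model: "symmetric_monoidal_category term_model"
proof unfold_locales
  fix f assume "f \<in> Arr term_model"
  then obtain A B where "is_morph f A B" by auto
  with is_morph_ty[OF this] show "Dom term_model f \<in> Obj term_model" "Cod term_model f \<in> Obj term_model"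
    by simp_all
qed (simp_all add: morph_intros comp_can_id comp_assoc tens_id tens_comp assoc_nat lunit_nat runit_nat symm_nat
    symm_symm pentagon triangle hexagon is_iso_can)

section \<open>Shifts as strong symmetric monoidal endofunctors\<close>

lemma shift_id:
  assumes ty: "set_ty A \<subseteq> qubits S"
  shows "shift_ar d (can A A) = can (BoxTy d A) (BoxTy d A)"
proof (rule morph_eqI)
  fix \<rho> c t assume "pnt \<rho> c t (BoxTy d A)"
  then obtain s where t: "t = BoxTm d s" and p: "pnt \<rho> (c + d) s A" by (rule pnt_BoxE)
  note W = ty p[THEN pnt_wt]
  show "\<exists>v. evl \<rho> c (shift_ar d (can A A)) t v \<and> evl \<rho> c (can (BoxTy d A) (BoxTy d A)) t v"
    unfolding t
    by (rule exI, rule conjI, (rule evl_shift evl_id morph_intros | (simp add: W; fail))+)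
qed (rule morph_intros | (simp add: ty; fail))+

lemma shift_comp:
  assumes f: "is_morph f A B" "is_morph g B C"
  shows "shift_ar d (ar_comp g f) = ar_comp (shift_ar d g) (shift_ar d f)"
proof (rule morph_eqI)
  fix \<rho> c t assume "pnt \<rho> c t (BoxTy d A)"
  then obtain s where t: "t = BoxTm d s" and p: "pnt \<rho> (c + d) s A" by (rule pnt_BoxE)
  from evl_obtain[OF f(1) pnt_wt[OF p]] obtain x where x: "evl \<rho> (c + d) f s x" "wt \<rho> (c + d) x B" "fv x = fv s" .
  from evl_obtain[OF f(2) x(2)] obtain y where y: "evl \<rho> (c + d) g x y" "wt \<rho> (c + d) y C" "fv y = fv x" .
  show "\<exists>v. evl \<rho> c (shift_ar d (ar_comp g f)) t v \<and> evl \<rho> c (ar_comp (shift_ar d g) (shift_ar d f)) t v"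
    unfolding t
    by (rule exI, rule conjI, (rule f x(1) y(1) evl_intros morph_intros)+)
qed (rule morph_intros f)+

lemma mul_nat:
  assumes f: "is_morph f A A'" "is_morph g B B'"
  shows "ar_comp (can (Tens (BoxTy d A') (BoxTy d B')) (BoxTy d (Tens A' B'))) (ar_tens (shift_ar d f) (shift_ar d g)) =
    ar_comp (shift_ar d (ar_tens f g)) (can (Tens (BoxTy d A) (BoxTy d B)) (BoxTy d (Tens A B)))" (is "?l = ?r")
proof (rule morph_eqI)
  fix \<rho> c t assume "pnt \<rho> c t (Tens (BoxTy d A) (BoxTy d B))"
  then obtain r s where t: "t = Tup (BoxTm d r) (BoxTm d s)" "fv r \<inter> fv s = {}" and p: "pnt \<rho> (c + d) r A" "pnt \<rho> (c + d) s B"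
    by (elim pnt_TensE pnt_BoxE) simp
  from evl_obtain[OF f(1) pnt_wt[OF p(1)]] obtain x where x: "evl \<rho> (c + d) f r x" "wt \<rho> (c + d) x A'" "fv x = fv r" .
  from evl_obtain[OF f(2) pnt_wt[OF p(2)]] obtain y where y: "evl \<rho> (c + d) g s y" "wt \<rho> (c + d) y B'" "fv y = fv s" .
  note W = f[THEN is_morph_ty(1)] f[THEN is_morph_ty(2)] x y p[THEN pnt_wt] t(2)
  show "\<exists>v. evl \<rho> c ?l t v \<and> evl \<rho> c ?r t v"
    unfolding t(1)
    by (rule exI, rule conjI, (rule f x(1) y(1) evl_intros morph_intros | (simp add: W; fail))+)
qed (rule morph_intros f | (simp add: f[THEN is_morph_ty(1)] f[THEN is_morph_ty(2)]; fail))+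

lemma mul_assoc:
  assumes ty: "set_ty A \<subseteq> qubits S" "set_ty B \<subseteq> qubits S" "set_ty C \<subseteq> qubits S"
  shows "ar_comp (shift_ar d (can (Tens (Tens A B) C) (Tens A (Tens B C))))
      (ar_comp (can (Tens (BoxTy d (Tens A B)) (BoxTy d C)) (BoxTy d (Tens (Tens A B) C)))
        (ar_tens (can (Tens (BoxTy d A) (BoxTy d B)) (BoxTy d (Tens A B))) (can (BoxTy d C) (BoxTy d C)))) =
    ar_comp (can (Tens (BoxTy d A) (BoxTy d (Tens B C))) (BoxTy d (Tens A (Tens B C))))
      (ar_comp (ar_tens (can (BoxTy d A) (BoxTy d A)) (can (Tens (BoxTy d B) (BoxTy d C)) (BoxTy d (Tens B C))))
        (can (Tens (Tens (BoxTy d A) (BoxTy d B)) (BoxTy d C)) (Tens (BoxTy d A) (Tens (BoxTy d B) (BoxTy d C)))))"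
    (is "?l = ?r")
proof (rule morph_eqI)
  fix \<rho> c t assume "pnt \<rho> c t (Tens (Tens (BoxTy d A) (BoxTy d B)) (BoxTy d C))"
  then obtain x1 x2 x3 where t: "t = Tup (Tup (BoxTm d x1) (BoxTm d x2)) (BoxTm d x3)"
    "fv x1 \<inter> fv x2 = {}" "(fv x1 \<union> fv x2) \<inter> fv x3 = {}"
    and p: "pnt \<rho> (c + d) x1 A" "pnt \<rho> (c + d) x2 B" "pnt \<rho> (c + d) x3 C"
    by (elim pnt_TensE pnt_BoxE) simp
  have dis: "fv x1 \<inter> fv x3 = {}" "fv x2 \<inter> fv x3 = {}" using t by auto
  note W = ty p[THEN pnt_wt] t(2) dis Int_Un_distrib Int_Un_distrib2
  show "\<exists>v. evl \<rho> c ?l t v \<and> evl \<rho> c ?r t v"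
    unfolding t(1)
    by (rule exI, rule conjI, (rule evl_intros morph_intros | (simp add: W; fail))+)
qed (rule morph_intros | (simp add: ty; fail))+

lemma mul_lunit:
  assumes ty: "set_ty A \<subseteq> qubits S"
  shows "ar_comp (shift_ar d (can (Tens One A) A))
      (ar_comp (can (Tens (BoxTy d One) (BoxTy d A)) (BoxTy d (Tens One A)))
        (ar_tens (can One (BoxTy d One)) (can (BoxTy d A) (BoxTy d A)))) =
    can (Tens One (BoxTy d A)) (BoxTy d A)" (is "?l = ?r")
proof (rule morph_eqI)
  fix \<rho> c t assume "pnt \<rho> c t (Tens One (BoxTy d A))"
  then obtain s where t: "t = Tup Star (BoxTm d s)" and p: "pnt \<rho> (c + d) s A"
    by (elim pnt_TensE pnt_BoxE) (auto dest: pnt_OneE)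
  note W = ty p[THEN pnt_wt]
  show "\<exists>v. evl \<rho> c ?l t v \<and> evl \<rho> c ?r t v"
    unfolding t
    by (rule exI, rule conjI, (rule evl_intros morph_intros | (simp add: W; fail))+)
qed (rule morph_intros | (simp add: ty; fail))+

lemma mul_runit:
  assumes ty: "set_ty A \<subseteq> qubits S"
  shows "ar_comp (shift_ar d (can (Tens A One) A))
      (ar_comp (can (Tens (BoxTy d A) (BoxTy d One)) (BoxTy d (Tens A One)))
        (ar_tens (can (BoxTy d A) (BoxTy d A)) (can One (BoxTy d One)))) =
    can (Tens (BoxTy d A) One) (BoxTy d A)" (is "?l = ?r")
proof (rule morph_eqI)
  fix \<rho> c t assume "pnt \<rho> c t (Tens (BoxTy d A) One)"
  then obtain s where t: "t = Tup (BoxTm d s) Star" and p: "pnt \<rho> (c + d) s A"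
    by (elim pnt_TensE pnt_BoxE) (auto dest: pnt_OneE)
  note W = ty p[THEN pnt_wt]
  show "\<exists>v. evl \<rho> c ?l t v \<and> evl \<rho> c ?r t v"
    unfolding t
    by (rule exI, rule conjI, (rule evl_intros morph_intros | (simp add: W; fail))+)
qed (rule morph_intros | (simp add: ty; fail))+

lemma mul_symm:
  assumes ty: "set_ty A \<subseteq> qubits S" "set_ty B \<subseteq> qubits S"
  shows "ar_comp (shift_ar d (sym_ar A B)) (can (Tens (BoxTy d A) (BoxTy d B)) (BoxTy d (Tens A B))) =
    ar_comp (can (Tens (BoxTy d B) (BoxTy d A)) (BoxTy d (Tens B A))) (sym_ar (BoxTy d A) (BoxTy d B))" (is "?l = ?r")
proof (rule morph_eqI)
  fix \<rho> c t assume "pnt \<rho> c t (Tens (BoxTy d A) (BoxTy d B))"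
  then obtain r s where t: "t = Tup (BoxTm d r) (BoxTm d s)" "fv r \<inter> fv s = {}" and p: "pnt \<rho> (c + d) r A" "pnt \<rho> (c + d) s B"
    by (elim pnt_TensE pnt_BoxE) simp
  note W = ty p[THEN pnt_wt] t(2) Int_commute[of "fv s" "fv r"]
  show "\<exists>v. evl \<rho> c ?l t v \<and> evl \<rho> c ?r t v"
    unfolding t(1)
    by (rule exI, rule conjI, (rule evl_intros morph_intros | (simp add: W; fail))+)
qed (rule morph_intros | (simp add: ty; fail))+

lemma endofunctor_term_model: "strong_symmetric_monoidal_endofunctor term_model (Shift term_model d)"
  by (intro strong_symmetric_monoidal_endofunctor.intro symmetric_monoidal_category_term_model
      strong_symmetric_monoidal_endofunctor_axioms.intro)
    (simp_all add: morph_intros shift_id shift_comp mul_nat mul_assoc mul_lunit mul_runit mul_symm is_iso_can)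

end

context annotated
begin

section \<open>Monoidality of \<open>Shift\<close> in its real parameter\<close>

lemma flat_BoxTy_0 [simp]: "flat (BoxTy 0 A) = flat A"
  by (simp add: map_idI)

lemma flat_BoxTy_add: "flat (BoxTy (d + e) A) = flat (BoxTy d (BoxTy e A))"
  by (auto simp: add.assoc)

text \<open>Unification does not reassociate sums of grades, so the evaluation of nested boxes needs
  this form as a separate rule.\<close>

lemma evl_add_assoc: "evl \<rho> (c + d + e) f t u \<Longrightarrow> evl \<rho> (c + (d + e)) f t u"
  by (simp add: add.assoc)

lemma wt_add_assoc: "wt \<rho> (c + d + e) t A \<Longrightarrow> wt \<rho> (c + (d + e)) t A"
  by (simp add: add.assoc)

lemma is_morph_shift_mul:
  assumes "set_ty A \<subseteq> qubits S"
  shows "is_morph (can (BoxTy d (BoxTy e A)) (BoxTy (d + e) A)) (BoxTy d (BoxTy e A)) (BoxTy (d + e) A)"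
    and "is_morph (can (BoxTy (d + e) A) (BoxTy d (BoxTy e A))) (BoxTy (d + e) A) (BoxTy d (BoxTy e A))"
  by (rule is_morph_can[OF flat_BoxTy_add[symmetric]], simp_all add: assms)
    (rule is_morph_can[OF flat_BoxTy_add], simp_all add: assms)

lemma shift_mul_nat:
  assumes f: "is_morph f A B"
  shows "ar_comp (can (BoxTy d (BoxTy e B)) (BoxTy (d + e) B)) (shift_ar d (shift_ar e f)) =
    ar_comp (shift_ar (d + e) f) (can (BoxTy d (BoxTy e A)) (BoxTy (d + e) A))" (is "?l = ?r")
proof (rule morph_eqI)
  fix \<rho> c t assume "pnt \<rho> c t (BoxTy d (BoxTy e A))"
  then obtain s where t: "t = BoxTm d (BoxTm e s)" and p: "pnt \<rho> (c + d + e) s A"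
    by (elim pnt_BoxE) simp
  from evl_obtain[OF f pnt_wt[OF p]] obtain x where x: "evl \<rho> (c + d + e) f s x" "wt \<rho> (c + d + e) x B" "fv x = fv s" .
  note W = is_morph_ty[OF f] x pnt_wt[OF p]
  show "\<exists>v. evl \<rho> c ?l t v \<and> evl \<rho> c ?r t v"
    unfolding t
    by (rule exI, rule conjI, (rule f x(1) evl_add_assoc[OF x(1)] is_morph_shift_mul evl_comp evl_shift evl_shift_mul
          is_morph_comp is_morph_shift | (simp add: W; fail))+)
qed (rule f is_morph_comp is_morph_shift is_morph_shift_mul | (simp add: is_morph_ty[OF f]; fail))+

lemma shift_mul_mul:
  assumes ty: "set_ty A \<subseteq> qubits S" "set_ty B \<subseteq> qubits S"
  shows "ar_comp (can (BoxTy d (BoxTy e (Tens A B))) (BoxTy (d + e) (Tens A B)))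
      (ar_comp (shift_ar d (can (Tens (BoxTy e A) (BoxTy e B)) (BoxTy e (Tens A B))))
        (can (Tens (BoxTy d (BoxTy e A)) (BoxTy d (BoxTy e B))) (BoxTy d (Tens (BoxTy e A) (BoxTy e B))))) =
    ar_comp (can (Tens (BoxTy (d + e) A) (BoxTy (d + e) B)) (BoxTy (d + e) (Tens A B)))
      (ar_tens (can (BoxTy d (BoxTy e A)) (BoxTy (d + e) A)) (can (BoxTy d (BoxTy e B)) (BoxTy (d + e) B)))" (is "?l = ?r")
proof (rule morph_eqI)
  fix \<rho> c t assume "pnt \<rho> c t (Tens (BoxTy d (BoxTy e A)) (BoxTy d (BoxTy e B)))"
  then obtain r s where t: "t = Tup (BoxTm d (BoxTm e r)) (BoxTm d (BoxTm e s))" "fv r \<inter> fv s = {}"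
    and p: "pnt \<rho> (c + d + e) r A" "pnt \<rho> (c + d + e) s B"
    by (elim pnt_TensE pnt_BoxE) simp
  note W = ty p[THEN pnt_wt] p[THEN pnt_wt, THEN wt_add_assoc] t(2)
  show "\<exists>v. evl \<rho> c ?l t v \<and> evl \<rho> c ?r t v"
    unfolding t
    by (rule exI, rule conjI, (rule is_morph_shift_mul evl_comp evl_tens evl_shift evl_mul evl_shift_mul
          is_morph_comp is_morph_shift is_morph_tens | (rule is_morph_can; simp add: W; fail) | (simp add: W; fail))+)
qed (rule is_morph_comp is_morph_shift is_morph_tens is_morph_shift_mul |
    (rule is_morph_can; simp add: ty; fail) | (simp add: ty; fail))+

lemma shift_mul_unit:
  "ar_comp (can (BoxTy d (BoxTy e One)) (BoxTy (d + e) One))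
      (ar_comp (shift_ar d (can One (BoxTy e One))) (can One (BoxTy d One))) = can One (BoxTy (d + e) One)" (is "?l = ?r")
proof (rule morph_eqI)
  fix \<rho> c t assume "pnt \<rho> c t One"
  then have t: "t = Star" by (rule pnt_OneE)
  show "\<exists>v. evl \<rho> c ?l t v \<and> evl \<rho> c ?r t v"
    unfolding t
    by (rule exI, rule conjI, (rule is_morph_shift_mul evl_comp evl_shift evl_unit evl_shift_mul
          is_morph_comp is_morph_shift | (rule is_morph_can; simp; fail) | (simp; fail))+)
qed (rule is_morph_comp is_morph_shift is_morph_shift_mul | (rule is_morph_can; simp; fail) | (simp; fail))+

lemma shift_unit_nat:
  assumes f: "is_morph f A B"
  shows "ar_comp (can B (BoxTy 0 B)) f = ar_comp (shift_ar 0 f) (can A (BoxTy 0 A))" (is "?l = ?r")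
proof (rule morph_eqI)
  fix \<rho> c t assume "pnt \<rho> c t A"
  note p = pnt_wt[OF this]
  from evl_obtain[OF f p] obtain x where x: "evl \<rho> c f t x" "wt \<rho> c x B" "fv x = fv t" .
  have x': "evl \<rho> (c + 0) f t x" using x(1) by simp
  note W = is_morph_ty[OF f] x p
  show "\<exists>v. evl \<rho> c ?l t v \<and> evl \<rho> c ?r t v"
    by (rule exI, rule conjI, (rule f x(1) x' evl_comp evl_shift evl_shift_unit
          is_morph_comp is_morph_shift | (rule is_morph_can; simp add: W del: flat.simps(4); fail) | (simp add: W; fail))+)
qed (rule f is_morph_comp is_morph_shift | (rule is_morph_can; simp add: is_morph_ty[OF f] del: flat.simps(4); fail))+

lemma shift_unit_mul:
  assumes ty: "set_ty A \<subseteq> qubits S" "set_ty B \<subseteq> qubits S"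
  shows "ar_comp (can (Tens A B) (BoxTy 0 (Tens A B))) (can (Tens A B) (Tens A B)) =
    ar_comp (can (Tens (BoxTy 0 A) (BoxTy 0 B)) (BoxTy 0 (Tens A B))) (ar_tens (can A (BoxTy 0 A)) (can B (BoxTy 0 B)))" (is "?l = ?r")
proof (rule morph_eqI)
  fix \<rho> c t assume "pnt \<rho> c t (Tens A B)"
  then obtain r s where t: "t = Tup r s" "fv r \<inter> fv s = {}" and p: "pnt \<rho> c r A" "pnt \<rho> c s B"
    by (rule pnt_TensE)
  note W = ty p[THEN pnt_wt] t(2)
  show "\<exists>v. evl \<rho> c ?l t v \<and> evl \<rho> c ?r t v"
    unfolding t
    by (rule exI, rule conjI, (rule evl_id evl_comp evl_tens evl_mul evl_shift_unit
          is_morph_comp is_morph_tens | (rule is_morph_can; simp add: W del: flat.simps(4); fail) |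
          (rule is_morph_can; simp add: W; fail) | (simp add: W; fail))+)
qed (rule is_morph_comp is_morph_tens | (rule is_morph_can; simp add: ty del: flat.simps(4); fail) |
    (rule is_morph_can; simp add: ty; fail))+

lemma shift_unit_unit: "ar_comp (can One (BoxTy 0 One)) (can One One) = can One (BoxTy 0 One)"
  by (rule can_can) auto

lemma shift_assoc:
  assumes ty: "set_ty A \<subseteq> qubits S"
  shows "ar_comp (can (BoxTy (b + d) (BoxTy e A)) (BoxTy (b + d + e) A)) (can (BoxTy b (BoxTy d (BoxTy e A))) (BoxTy (b + d) (BoxTy e A))) =
    ar_comp (can (BoxTy b (BoxTy (d + e) A)) (BoxTy (b + (d + e)) A)) (shift_ar b (can (BoxTy d (BoxTy e A)) (BoxTy (d + e) A)))" (is "?l = ?r")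
proof (rule morph_eqI)
  fix \<rho> c t assume "pnt \<rho> c t (BoxTy b (BoxTy d (BoxTy e A)))"
  then obtain s where t: "t = BoxTm b (BoxTm d (BoxTm e s))" and p: "pnt \<rho> (c + b + d + e) s A"
    by (elim pnt_BoxE) simp
  note p = pnt_wt[OF p]
  have W: "wt \<rho> (c + (b + d) + e) s A" "wt \<rho> (c + b + (d + e)) s A" "wt \<rho> (c + (b + d + e)) s A"
    using p by (simp_all add: add.assoc)
  have "evl \<rho> c ?l t (BoxTm (b + d + e) s)"
    unfolding t by (rule evl_comp evl_shift_mul is_morph_shift_mul | (simp add: ty p W; fail))+
  moreover have "evl \<rho> c ?r t (BoxTm (b + (d + e)) s)"
    unfolding t by (rule evl_comp evl_shift evl_shift_mul is_morph_shift_mul is_morph_shift | (simp add: ty p W; fail))+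
  ultimately show "\<exists>v. evl \<rho> c ?l t v \<and> evl \<rho> c ?r t v" by (auto simp: add.assoc)
next
  show "is_morph ?l (BoxTy b (BoxTy d (BoxTy e A))) (BoxTy (b + d + e) A)"
    by (rule is_morph_comp is_morph_shift_mul | (simp add: ty; fail))+
  \<comment> \<open>The codomains of the two sides are written with differently bracketed sums of
    grades; as real numbers the sums agree, hence so do the types.\<close>
  have "is_morph ?r (BoxTy b (BoxTy d (BoxTy e A))) (BoxTy (b + (d + e)) A)"
    by (rule is_morph_comp is_morph_shift is_morph_shift_mul | (simp add: ty; fail))+
  then show "is_morph ?r (BoxTy b (BoxTy d (BoxTy e A))) (BoxTy (b + d + e) A)" by (simp add: add.assoc)
qed

lemma shift_lunit:
  assumes ty: "set_ty A \<subseteq> qubits S"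
  shows "ar_comp (can (BoxTy 0 (BoxTy d A)) (BoxTy (0 + d) A)) (can (BoxTy d A) (BoxTy 0 (BoxTy d A))) = can (BoxTy d A) (BoxTy d A)"
proof -
  have "flat (BoxTy d A) = flat (BoxTy 0 (BoxTy d A))" "flat (BoxTy 0 (BoxTy d A)) = flat (BoxTy d A)"
    by (simp_all del: flat.simps(4))
  from can_can[OF this] ty show ?thesis by simp
qed

lemma shift_runit:
  assumes ty: "set_ty A \<subseteq> qubits S"
  shows "ar_comp (can (BoxTy d (BoxTy 0 A)) (BoxTy (d + 0) A)) (shift_ar d (can A (BoxTy 0 A))) = can (BoxTy d A) (BoxTy d A)" (is "?l = ?r")
proof (rule morph_eqI)
  have m: "is_morph (can A (BoxTy 0 A)) A (BoxTy 0 A)"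
    by (rule is_morph_can) (simp_all add: ty del: flat.simps(4))
  have m': "is_morph (shift_ar d (can A (BoxTy 0 A))) (BoxTy d A) (BoxTy d (BoxTy 0 A))"
    by (rule is_morph_shift[OF m])
  show "is_morph ?l (BoxTy d A) (BoxTy d A)"
    using is_morph_comp[OF m' is_morph_shift_mul(1)[OF ty]] by simp
  show "is_morph ?r (BoxTy d A) (BoxTy d A)"
    by (rule is_morph_can) (simp_all add: ty)
  fix \<rho> c t assume "pnt \<rho> c t (BoxTy d A)"
  then obtain s where t: "t = BoxTm d s" and p: "pnt \<rho> (c + d) s A" by (rule pnt_BoxE)
  note p = pnt_wt[OF p]
  have "evl \<rho> c ?l t (BoxTm (d + 0) s)"
    unfolding t
  proof (rule evl_comp[OF m' is_morph_shift_mul(1)[OF ty]])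
    show "evl \<rho> c (shift_ar d (can A (BoxTy 0 A))) (BoxTm d s) (BoxTm d (BoxTm 0 s))"
      by (rule evl_shift[OF m evl_shift_unit(1)[OF p]])
    show "evl \<rho> c (can (BoxTy d (BoxTy 0 A)) (BoxTy (d + 0) A)) (BoxTm d (BoxTm 0 s)) (BoxTm (d + 0) s)"
      by (rule evl_shift_mul) (use p in simp)
  qed
  moreover have "evl \<rho> c ?r t (BoxTm d s)"
    unfolding t by (rule evl_id) (use p in simp)
  ultimately show "\<exists>v. evl \<rho> c ?l t v \<and> evl \<rho> c ?r t v" by auto
qed

lemma tensor_obs_Qubit: "tensor_obs term_model (map Qubit qs) = tensor_ty qs"
  by (induction qs rule: tensor_ty.induct) simp_all

lemma shift_mul_iso:
  "monoidal_natural_isomorphism term_model (comp_endofunctor term_model (Shift term_model d) (Shift term_model e))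
    (Shift term_model (d + e)) (Shift_mul term_model d e)"
  by (intro monoidal_natural_isomorphism.intro symmetric_monoidal_category_term_model
      monoidal_natural_isomorphism_axioms.intro)
    (simp_all add: comp_endofunctor_def is_morph_shift_mul shift_mul_nat shift_mul_mul shift_mul_unit is_iso_can
      flat_BoxTy_add del: flat.simps(4))

lemma shift_unit_iso:
  "monoidal_natural_isomorphism term_model (id_endofunctor term_model) (Shift term_model 0) (Shift_unit term_model)"
  by (intro monoidal_natural_isomorphism.intro symmetric_monoidal_category_term_model
      monoidal_natural_isomorphism_axioms.intro)
    (simp_all add: id_endofunctor_def is_morph_can shift_unit_nat shift_unit_mul shift_unit_unit is_iso_can
      del: flat.simps(4))

theorem categorical_model_term_model: "categorical_model S term_model"
proof (intro categorical_model.intro symmetric_monoidal_category_term_model categorical_model_axioms.intro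
    shift_mul_iso shift_unit_iso endofunctor_term_model)
  fix g assume "g \<in> gates S"
  then show "gate_ar term_model g \<in> hom term_model
      (f_ob (Shift term_model (- duration S g)) (tensor_obs term_model (map (qubit_ob term_model) (wires S g))))
      (tensor_obs term_model (map (qubit_ob term_model) (wires S g)))"
    by (simp add: is_morph_gate tensor_obs_Qubit)
qed (simp_all add: shift_assoc shift_lunit[simplified] shift_runit[simplified] is_morph_delay)


section \<open>Interpretation in the term model\<close>

abbreviation cty :: "'q ctx \<Rightarrow> 'q ty" where
  "cty \<equiv> ctx_sem term_model"

text \<open>Each variable is boxed with its grade, so that all components of the tuple sit at one
  offset.\<close>

primrec ctx_val :: "'q ctx \<Rightarrow> 'g tm" where
  "ctx_val [] = Star"
| "ctx_val (a # \<Gamma>) = Tup (BoxTm (fst (snd a)) (V (fst a))) (ctx_val \<Gamma>)"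

definition ok_ctx :: "'q ctx \<Rightarrow> bool" where
  "ok_ctx \<Gamma> \<longleftrightarrow> (\<forall>a \<in> set \<Gamma>. set_ty (snd (snd a)) \<subseteq> qubits S)"

text \<open>The counterpart of \<open>declares\<close> on the side of the model: the set of names is
  implicit, and the types are required to be objects, which makes \<open>ctx_val\<close>
  typable.\<close>

definition ctx_env :: "'q ctx \<Rightarrow> 'q env \<Rightarrow> real \<Rightarrow> bool" where
  "ctx_env \<Gamma> \<rho> c \<longleftrightarrow> distinct_vars \<Gamma> \<and> ok_ctx \<Gamma> \<and> (\<forall>(x, d, A) \<in> set \<Gamma>. \<rho> x = (c + d, A))"

lemma ty_sem_term_model [simp]: "ty_sem term_model A = A"
  by (induction A) simp_all

lemma decl_sem_term_model [simp]: "decl_sem term_model a = BoxTy (fst (snd a)) (snd (snd a))"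
  by (cases a) simp

lemma set_ty_cty [simp]: "set_ty (cty \<Gamma>) \<subseteq> qubits S \<longleftrightarrow> ok_ctx \<Gamma>"
  by (induction \<Gamma>) (auto simp: ok_ctx_def)

lemma fv_ctx_val [simp]: "fv (ctx_val \<Gamma>) = fst ` set \<Gamma>"
  by (induction \<Gamma>) auto

lemma ok_ctx_simps [simp]:
  "ok_ctx []" "ok_ctx (a # \<Gamma>) \<longleftrightarrow> set_ty (snd (snd a)) \<subseteq> qubits S \<and> ok_ctx \<Gamma>"
  "ok_ctx (\<Gamma> @ \<Delta>) \<longleftrightarrow> ok_ctx \<Gamma> \<and> ok_ctx \<Delta>"
  by (auto simp: ok_ctx_def)

lemma ok_ctx_concat [simp]: "ok_ctx (concat \<Gamma>s) \<longleftrightarrow> (\<forall>\<Gamma> \<in> set \<Gamma>s. ok_ctx \<Gamma>)"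
  by (induction \<Gamma>s) auto

lemma ok_ctx_shift [simp]: "ok_ctx (shift_ctx d \<Gamma>) \<longleftrightarrow> ok_ctx \<Gamma>"
  by (induction \<Gamma>) auto

lemma ctx_env_append:
  "ctx_env (\<Gamma> @ \<Delta>) \<rho> c \<longleftrightarrow> ctx_env \<Gamma> \<rho> c \<and> ctx_env \<Delta> \<rho> c \<and> fst ` set \<Gamma> \<inter> fst ` set \<Delta> = {}"
  unfolding ctx_env_def distinct_vars_def by (simp add: ball_Un) blast

lemma ctx_env_Cons:
  "ctx_env ((x, d, A) # \<Gamma>) \<rho> c \<longleftrightarrow>
    x \<notin> fst ` set \<Gamma> \<and> set_ty A \<subseteq> qubits S \<and> \<rho> x = (c + d, A) \<and> ctx_env \<Gamma> \<rho> c"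
  by (auto simp: ctx_env_def distinct_vars_def)

lemma ctx_env_shift: "ctx_env (shift_ctx d \<Gamma>) \<rho> c \<longleftrightarrow> ctx_env \<Gamma> \<rho> (c + d)"
proof -
  have "(\<forall>(x, e, B) \<in> set (shift_ctx d \<Gamma>). \<rho> x = (c + e, B)) \<longleftrightarrow>
      (\<forall>(x, e, B) \<in> set \<Gamma>. \<rho> x = (c + d + e, B))"
    by (induction \<Gamma>) (auto simp: algebra_simps)
  then show ?thesis by (simp add: ctx_env_def distinct_vars_def)
qed

lemma ctx_env_ok: "ctx_env \<Gamma> \<rho> c \<Longrightarrow> ok_ctx \<Gamma>"
  by (simp add: ctx_env_def)

lemma wt_ctx_val: "ctx_env \<Gamma> \<rho> c \<Longrightarrow> wt \<rho> c (ctx_val \<Gamma>) (cty \<Gamma>)"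
proof (induction \<Gamma>)
  case (Cons a \<Gamma>)
  obtain x d A where a: "a = (x, d, A)" by (cases a)
  from Cons show ?case by (auto simp: a ctx_env_Cons intro: wt_V)
qed simp

section \<open>Coherence arrows between contexts, evaluated on tuples of variables\<close>

lemma arr_invs:
  assumes "set_ty A \<subseteq> qubits S"
  shows "arr_inv term_model (can (Tens One A) A) = can A (Tens One A)"
    and "arr_inv term_model (can (BoxTy d (BoxTy e A)) (BoxTy (d + e) A)) = can (BoxTy (d + e) A) (BoxTy d (BoxTy e A))"
    and "arr_inv term_model (can A (BoxTy 0 A)) = can (BoxTy 0 A) A"
    and "arr_inv term_model (can One (BoxTy d One)) = can (BoxTy d One) One"
  using assms by (simp_all add: arr_inv_can flat_BoxTy_add del: flat.simps(4)) (simp add: arr_inv_can)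

lemma arr_inv_assoc:
  assumes "set_ty A \<subseteq> qubits S" "set_ty B \<subseteq> qubits S" "set_ty C \<subseteq> qubits S"
  shows "arr_inv term_model (can (Tens (Tens A B) C) (Tens A (Tens B C))) = can (Tens A (Tens B C)) (Tens (Tens A B) C)"
  by (rule arr_inv_can) (use assms in simp_all)

lemma arr_inv_mul:
  assumes "set_ty A \<subseteq> qubits S" "set_ty B \<subseteq> qubits S"
  shows "arr_inv term_model (can (Tens (BoxTy d A) (BoxTy d B)) (BoxTy d (Tens A B))) =
    can (BoxTy d (Tens A B)) (Tens (BoxTy d A) (BoxTy d B))"
  by (rule arr_inv_can) (use assms in simp_all)

lemma is_morph_ctx_split:
  "ok_ctx \<Gamma> \<Longrightarrow> ok_ctx \<Delta> \<Longrightarrow> is_morph (ctx_split term_model \<Gamma> \<Delta>) (cty (\<Gamma> @ \<Delta>)) (Tens (cty \<Gamma>) (cty \<Delta>))"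
proof (induction \<Gamma>)
  case Nil
  then show ?case by (simp add: arr_invs is_morph_can)
next
  case (Cons a \<Gamma>)
  note IH = Cons.IH[OF _ Cons.prems(2)]
  from Cons show ?case
    by (simp add: arr_inv_assoc) (rule is_morph_comp is_morph_tens IH | (rule is_morph_can; simp; fail) | (simp; fail))+
qed

lemma evl_ctx_split:
  "ctx_env (\<Gamma> @ \<Delta>) \<rho> c \<Longrightarrow> evl \<rho> c (ctx_split term_model \<Gamma> \<Delta>) (ctx_val (\<Gamma> @ \<Delta>)) (Tup (ctx_val \<Gamma>) (ctx_val \<Delta>))"
proof (induction \<Gamma>)
  case Nil
  then have "set_ty (cty \<Delta>) \<subseteq> qubits S" by (simp add: ctx_env_ok)
  with Nil evl_lunit(2)[OF wt_ctx_val] show ?case by (simp add: arr_invs)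
next
  case (Cons a \<Gamma>)
  obtain x d A where a: "a = (x, d, A)" by (cases a)
  from Cons.prems have e: "ctx_env (\<Gamma> @ \<Delta>) \<rho> c" "ctx_env \<Gamma> \<rho> c" "ctx_env \<Delta> \<rho> c" "set_ty A \<subseteq> qubits S" "\<rho> x = (c + d, A)"
    "x \<notin> fst ` set \<Gamma>" "x \<notin> fst ` set \<Delta>" "fst ` set \<Gamma> \<inter> fst ` set \<Delta> = {}"
    by (auto simp: a ctx_env_Cons ctx_env_append)
  have ok: "ok_ctx \<Gamma>" "ok_ctx \<Delta>" using e by (auto dest: ctx_env_ok)
  have ok': "set_ty (cty \<Gamma>) \<subseteq> qubits S" "set_ty (cty \<Delta>) \<subseteq> qubits S" using ok by simp_all
  have x: "wt \<rho> (c + d) (V x) A" using e by (auto intro!: wt_V)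
  note W = x wt_ctx_val[OF e(2)] wt_ctx_val[OF e(3)] e
  show ?case
    unfolding a ctx_split.simps decl_sem_term_model append_Cons ctx_val.simps fst_conv snd_conv
    by (simp add: arr_inv_assoc e(4) ok)
      (rule Cons.IH[OF e(1)] evl_comp evl_tens is_morph_tens is_morph_ctx_split[OF ok] evl_assoc evl_id | (simp add: W ok image_Un; fail) | (rule is_morph_can; simp add: ok e; fail))+
qed

lemma is_morph_ctxs_split:
  "\<forall>\<Gamma> \<in> set \<Gamma>s. ok_ctx \<Gamma> \<Longrightarrow>
    is_morph (ctxs_split term_model \<Gamma>s) (cty (concat \<Gamma>s)) (tensor_obs term_model (map cty \<Gamma>s))"
proof (induction \<Gamma>s rule: ctxs_split.induct)
  case (3 \<Gamma> \<Delta> \<Gamma>s)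
  then have ok: "ok_ctx \<Gamma>" "ok_ctx (concat (\<Delta> # \<Gamma>s))" by simp_all
  from 3 have IH: "is_morph (ctxs_split term_model (\<Delta> # \<Gamma>s)) (cty (concat (\<Delta> # \<Gamma>s))) (tensor_obs term_model (map cty (\<Delta> # \<Gamma>s)))"
    by simp
  have id: "is_morph (can (cty \<Gamma>) (cty \<Gamma>)) (cty \<Gamma>) (cty \<Gamma>)" using ok by (simp add: is_morph_can)
  from is_morph_comp[OF is_morph_ctx_split[OF ok] is_morph_tens[OF id IH]] show ?case by simp
qed (simp_all add: is_morph_can)

lemma evl_ctxs_split:
  "ctx_env (concat \<Gamma>s) \<rho> c \<Longrightarrow> evl \<rho> c (ctxs_split term_model \<Gamma>s) (ctx_val (concat \<Gamma>s)) (tuple (map ctx_val \<Gamma>s))"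
proof (induction \<Gamma>s rule: ctxs_split.induct)
  case (3 \<Gamma> \<Delta> \<Gamma>s)
  let ?\<Delta> = "concat (\<Delta> # \<Gamma>s)"
  from "3.prems" have e: "ctx_env (\<Gamma> @ ?\<Delta>) \<rho> c" "ctx_env \<Gamma> \<rho> c" "ctx_env ?\<Delta> \<rho> c" "fst ` set \<Gamma> \<inter> fst ` set ?\<Delta> = {}"
    by (simp_all add: ctx_env_append)
  have ok: "ok_ctx \<Gamma>" "ok_ctx ?\<Delta>" using e ctx_env_ok by blast+
  then have "\<forall>\<Gamma> \<in> set (\<Delta> # \<Gamma>s). ok_ctx \<Gamma>" by simp
  note m = is_morph_ctxs_split[OF this]
  have id: "is_morph (can (cty \<Gamma>) (cty \<Gamma>)) (cty \<Gamma>) (cty \<Gamma>)" using ok by (simp add: is_morph_can)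
  have "evl \<rho> c (ar_tens (can (cty \<Gamma>) (cty \<Gamma>)) (ctxs_split term_model (\<Delta> # \<Gamma>s)))
      (Tup (ctx_val \<Gamma>) (ctx_val ?\<Delta>)) (Tup (ctx_val \<Gamma>) (tuple (map ctx_val (\<Delta> # \<Gamma>s))))"
    by (rule evl_tens[OF id m evl_id[OF wt_ctx_val[OF e(2)]] "3.IH"[OF e(3)]]) (use e(4) in simp)
  from evl_comp[OF is_morph_ctx_split[OF ok] is_morph_tens[OF id m] evl_ctx_split[OF e(1)] this]
  show ?case by simp
qed (simp_all add: evl_id wt_ctx_val)

text \<open>The typing of the source tuple is assumed in order to obtain the disjointness of its
  components, which \<open>evl_tens\<close> demands at each step.\<close>

lemma tensor_ars:
  assumes "length fs = length As" "length fs = length Bs" "length fs = length ss" "length fs = length ts"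
    and "\<forall>i < length fs. is_morph (fs ! i) (As ! i) (Bs ! i)"
  shows "is_morph (tensor_ars term_model fs) (tensor_obs term_model As) (tensor_obs term_model Bs)" (is ?A)
    and "\<forall>i < length fs. evl \<rho> c (fs ! i) (ss ! i) (ts ! i) \<Longrightarrow> wt \<rho> c (tuple ss) (tensor_obs term_model As) \<Longrightarrow>
      evl \<rho> c (tensor_ars term_model fs) (tuple ss) (tuple ts)" (is "?B \<Longrightarrow> ?C \<Longrightarrow> ?D")
proof -
  have "?A \<and> (?B \<longrightarrow> ?C \<longrightarrow> ?D)"
    using assms
  proof (induction fs arbitrary: As Bs ss ts rule: induct_list012)
    case 1
    then show ?case by (simp add: is_morph_can evl_id)
  next
    case (2 f)
    then obtain A B s t where "As = [A]" "Bs = [B]" "ss = [s]" "ts = [t]"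
      by (cases As; cases Bs; cases ss; cases ts) auto
    with 2 show ?case by simp
  next
    case (3 f f' fs)
    from 3(3) obtain A A' As' where As: "As = A # A' # As'" by (cases As; cases "tl As") auto
    from 3(4) obtain B B' Bs' where Bs: "Bs = B # B' # Bs'" by (cases Bs; cases "tl Bs") auto
    from 3(5) obtain s s' ss' where ss: "ss = s # s' # ss'" by (cases ss; cases "tl ss") auto
    from 3(6) obtain t t' ts' where ts: "ts = t # t' # ts'" by (cases ts; cases "tl ts") auto
    have m: "\<forall>i < length (f' # fs). is_morph ((f' # fs) ! i) ((A' # As') ! i) ((B' # Bs') ! i)"
    proof (intro allI impI)
      fix i assume "i < length (f' # fs)"
      with 3(7)[rule_format, of "Suc i"] As Bs show "is_morph ((f' # fs) ! i) ((A' # As') ! i) ((B' # Bs') ! i)"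
        by simp
    qed
    from 3(7)[rule_format, of 0] have f: "is_morph f A B" using As Bs by simp
    have IH: "is_morph (tensor_ars term_model (f' # fs)) (tensor_obs term_model (A' # As')) (tensor_obs term_model (B' # Bs'))"
      "(\<forall>i < length (f' # fs). evl \<rho> c ((f' # fs) ! i) ((s' # ss') ! i) ((t' # ts') ! i)) \<Longrightarrow>
        wt \<rho> c (tuple (s' # ss')) (tensor_obs term_model (A' # As')) \<Longrightarrow>
        evl \<rho> c (tensor_ars term_model (f' # fs)) (tuple (s' # ss')) (tuple (t' # ts'))"
      using 3(2)[of "A' # As'" "B' # Bs'" "s' # ss'" "t' # ts'"] 3(3-6) m As Bs ss ts
      by auto
    have "evl \<rho> c (ar_tens f (tensor_ars term_model (f' # fs))) (Tup s (tuple (s' # ss'))) (Tup t (tuple (t' # ts')))"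
      if e: "\<forall>i < length (f # f' # fs). evl \<rho> c ((f # f' # fs) ! i) (ss ! i) (ts ! i)"
        and w: "wt \<rho> c (tuple ss) (tensor_obs term_model As)"
    proof (rule evl_tens[OF f IH(1)])
      show "evl \<rho> c f s t" using e[rule_format, of 0] ss ts by simp
      show "evl \<rho> c (tensor_ars term_model (f' # fs)) (tuple (s' # ss')) (tuple (t' # ts'))"
      proof (rule IH(2))
        show "\<forall>i < length (f' # fs). evl \<rho> c ((f' # fs) ! i) ((s' # ss') ! i) ((t' # ts') ! i)"
        proof (intro allI impI)
          fix i assume "i < length (f' # fs)"
          with e[rule_format, of "Suc i"] ss ts show "evl \<rho> c ((f' # fs) ! i) ((s' # ss') ! i) ((t' # ts') ! i)"
            by simp
        qed
      qed (use w ss As in simp)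
      show "fv s \<inter> fv (tuple (s' # ss')) = {}" using w ss As by simp
    qed
    with is_morph_tens[OF f IH(1)] show ?case by (simp add: As Bs ss ts)
  qed
  then show ?A "?B \<Longrightarrow> ?C \<Longrightarrow> ?D" by blast+
qed

lemma is_morph_ctx_shift:
  "ok_ctx \<Gamma> \<Longrightarrow> is_morph (ctx_shift term_model d \<Gamma>) (cty (shift_ctx d \<Gamma>)) (BoxTy d (cty \<Gamma>))"
proof (induction \<Gamma>)
  case Nil
  then show ?case by (simp add: is_morph_can)
next
  case (Cons a \<Gamma>)
  obtain x e A where a: "a = (x, e, A)" by (cases a)
  from Cons have IH: "is_morph (ctx_shift term_model d \<Gamma>) (cty (shift_ctx d \<Gamma>)) (BoxTy d (cty \<Gamma>))"
    and ty: "set_ty A \<subseteq> qubits S" "set_ty (cty \<Gamma>) \<subseteq> qubits S" by (simp_all add: a)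
  have m: "is_morph (can (Tens (BoxTy d (BoxTy e A)) (BoxTy d (cty \<Gamma>))) (BoxTy d (Tens (BoxTy e A) (cty \<Gamma>))))
      (Tens (BoxTy d (BoxTy e A)) (BoxTy d (cty \<Gamma>))) (BoxTy d (Tens (BoxTy e A) (cty \<Gamma>)))"
    by (rule is_morph_can) (use ty in simp_all)
  from is_morph_comp[OF is_morph_tens[OF is_morph_shift_mul(2)[OF ty(1)] IH] m] show ?case
    by (simp add: a arr_invs ty(1))
qed

text \<open>A variable boxed with \<open>d + e\<close> becomes doubly boxed by the inverse of
  \<open>Shift_mul\<close>; the outer boxes of all components are then merged by
  \<open>f_mul\<close>.\<close>

lemma evl_ctx_shift:
  "ctx_env \<Gamma> \<rho> (c + d) \<Longrightarrow> evl \<rho> c (ctx_shift term_model d \<Gamma>) (ctx_val (shift_ctx d \<Gamma>)) (BoxTm d (ctx_val \<Gamma>))"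
proof (induction \<Gamma>)
  case Nil
  then show ?case by (simp add: evl_unit)
next
  case (Cons a \<Gamma>)
  obtain x e A where a: "a = (x, e, A)" by (cases a)
  from Cons.prems have e: "ctx_env \<Gamma> \<rho> (c + d)" "set_ty A \<subseteq> qubits S" "\<rho> x = (c + d + e, A)" "x \<notin> fst ` set \<Gamma>"
    by (auto simp: a ctx_env_Cons)
  have ty: "set_ty A \<subseteq> qubits S" "set_ty (cty \<Gamma>) \<subseteq> qubits S" using e ctx_env_ok by simp_all
  have x: "wt \<rho> (c + d + e) (V x) A" using e by (auto intro!: wt_V)
  have m: "is_morph (can (Tens (BoxTy d (BoxTy e A)) (BoxTy d (cty \<Gamma>))) (BoxTy d (Tens (BoxTy e A) (cty \<Gamma>))))
      (Tens (BoxTy d (BoxTy e A)) (BoxTy d (cty \<Gamma>))) (BoxTy d (Tens (BoxTy e A) (cty \<Gamma>)))"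
    by (rule is_morph_can) (use ty in simp_all)
  note m1 = is_morph_shift_mul(2)[OF ty(1), of d e] and m2 = is_morph_ctx_shift[OF ctx_env_ok[OF e(1)], of d]
  have "evl \<rho> c (ar_tens (can (BoxTy (d + e) A) (BoxTy d (BoxTy e A))) (ctx_shift term_model d \<Gamma>))
      (Tup (BoxTm (d + e) (V x)) (ctx_val (shift_ctx d \<Gamma>))) (Tup (BoxTm d (BoxTm e (V x))) (BoxTm d (ctx_val \<Gamma>)))"
  proof (rule evl_tens[OF m1 m2 _ Cons.IH[OF e(1)]])
    show "evl \<rho> c (can (BoxTy (d + e) A) (BoxTy d (BoxTy e A))) (BoxTm (d + e) (V x)) (BoxTm d (BoxTm e (V x)))"
      by (rule evl_shift_mul) (use x in simp)
    show "fv (BoxTm (d + e) (V x)) \<inter> fv (ctx_val (shift_ctx d \<Gamma>)) = {}" using e(4) by simp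
  qed
  moreover have "evl \<rho> c (can (Tens (BoxTy d (BoxTy e A)) (BoxTy d (cty \<Gamma>))) (BoxTy d (Tens (BoxTy e A) (cty \<Gamma>))))
      (Tup (BoxTm d (BoxTm e (V x))) (BoxTm d (ctx_val \<Gamma>))) (BoxTm d (Tup (BoxTm e (V x)) (ctx_val \<Gamma>)))"
    by (rule evl_mul) (use x wt_ctx_val[OF e(1)] e(4) in simp)
  ultimately have "evl \<rho> c (ar_comp (can (Tens (BoxTy d (BoxTy e A)) (BoxTy d (cty \<Gamma>))) (BoxTy d (Tens (BoxTy e A) (cty \<Gamma>))))
      (ar_tens (can (BoxTy (d + e) A) (BoxTy d (BoxTy e A))) (ctx_shift term_model d \<Gamma>)))
      (Tup (BoxTm (d + e) (V x)) (ctx_val (shift_ctx d \<Gamma>))) (BoxTm d (Tup (BoxTm e (V x)) (ctx_val \<Gamma>)))"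
    by (rule evl_comp[OF is_morph_tens[OF m1 m2] m])
  then show ?case by (simp add: a arr_invs ty(1))
qed

lemma is_morph_shift_sem:
  "ok_ctx \<Gamma> \<Longrightarrow> is_morph f (cty \<Gamma>) A \<Longrightarrow> is_morph (shift_sem term_model d \<Gamma> f) (cty (shift_ctx d \<Gamma>)) (BoxTy d A)"
  unfolding shift_sem_def term_model_simps by (rule is_morph_comp[OF is_morph_ctx_shift is_morph_shift])

lemma evl_shift_sem:
  assumes "is_morph f (cty \<Gamma>) A" "ctx_env \<Gamma> \<rho> (c + d)" "evl \<rho> (c + d) f (ctx_val \<Gamma>) t"
  shows "evl \<rho> c (shift_sem term_model d \<Gamma> f) (ctx_val (shift_ctx d \<Gamma>)) (BoxTm d t)"
  unfolding shift_sem_def term_model_simps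
  by (rule evl_comp[OF is_morph_ctx_shift[OF ctx_env_ok[OF assms(2)]] is_morph_shift[OF assms(1)]
        evl_ctx_shift[OF assms(2)] evl_shift[OF assms(1,3)]])

lemma is_morph_ctx_swap:
  "ok_ctx (\<Gamma> @ a # b # \<Delta>) \<Longrightarrow> is_morph (ctx_swap term_model \<Gamma> a b \<Delta>) (cty (\<Gamma> @ b # a # \<Delta>)) (cty (\<Gamma> @ a # b # \<Delta>))"
proof (induction \<Gamma>)
  case Nil
  then show ?case
    by (simp add: arr_inv_assoc) (rule is_morph_comp is_morph_tens is_morph_sym | (rule is_morph_can; simp; fail) | (simp; fail))+
next
  case (Cons e \<Gamma>)
  then have IH: "is_morph (ctx_swap term_model \<Gamma> a b \<Delta>) (cty (\<Gamma> @ b # a # \<Delta>)) (cty (\<Gamma> @ a # b # \<Delta>))" by simp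
  have "is_morph (can (decl_sem term_model e) (decl_sem term_model e)) (decl_sem term_model e) (decl_sem term_model e)"
    by (rule is_morph_can) (use Cons.prems in simp_all)
  from is_morph_tens[OF this IH] show ?case by simp
qed

lemma evl_ctx_swap:
  "ctx_env (\<Gamma> @ a # b # \<Delta>) \<rho> c \<Longrightarrow>
    evl \<rho> c (ctx_swap term_model \<Gamma> a b \<Delta>) (ctx_val (\<Gamma> @ b # a # \<Delta>)) (ctx_val (\<Gamma> @ a # b # \<Delta>))"
proof (induction \<Gamma>)
  case Nil
  obtain x d A where a: "a = (x, d, A)" by (cases a)
  obtain y e B where b: "b = (y, e, B)" by (cases b)
  from Nil have e: "x \<noteq> y" "x \<notin> fst ` set \<Delta>" "y \<notin> fst ` set \<Delta>" "set_ty A \<subseteq> qubits S" "set_ty B \<subseteq> qubits S"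
    "\<rho> x = (c + d, A)" "\<rho> y = (c + e, B)" and \<Delta>: "ctx_env \<Delta> \<rho> c"
    by (auto simp: a b ctx_env_Cons)
  have x: "wt \<rho> (c + d) (V x) A" "wt \<rho> (c + e) (V y) B" using e by (auto intro!: wt_V)
  have ok: "set_ty (cty \<Delta>) \<subseteq> qubits S" using ctx_env_ok[OF \<Delta>] by simp
  note W = x e wt_ctx_val[OF \<Delta>]
  show ?case
    by (simp add: a b arr_inv_assoc e ok del: set_ty_cty)
      (rule evl_comp evl_tens is_morph_comp is_morph_tens is_morph_sym evl_assoc evl_sym evl_id |
        (simp add: W e(1)[symmetric] ok del: set_ty_cty; fail) | (rule is_morph_can; simp add: ok e del: set_ty_cty; fail))+
next
  case (Cons f \<Gamma>)
  obtain z d A where f: "f = (z, d, A)" by (cases f)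
  from Cons.prems have e: "ctx_env (\<Gamma> @ a # b # \<Delta>) \<rho> c" "set_ty A \<subseteq> qubits S" "\<rho> z = (c + d, A)"
    "z \<notin> fst ` set (\<Gamma> @ b # a # \<Delta>)"
    by (auto simp: f ctx_env_Cons)
  have id: "is_morph (can (BoxTy d A) (BoxTy d A)) (BoxTy d A) (BoxTy d A)"
    by (rule is_morph_can) (use e in simp_all)
  have "evl \<rho> c (can (BoxTy d A) (BoxTy d A)) (BoxTm d (V z)) (BoxTm d (V z))"
    by (rule evl_id) (use e in \<open>auto intro!: wt_V\<close>)
  from evl_tens[OF id is_morph_ctx_swap[OF ctx_env_ok[OF e(1)]] this Cons.IH[OF e(1)]] e(4)
  show ?case by (simp add: f)
qed

end

section \<open>The interpretation of a derivation computes its term\<close>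

lemma distinct_concat_nth:
  "distinct (concat xss) \<Longrightarrow> i < length xss \<Longrightarrow> j < length xss \<Longrightarrow> i \<noteq> j \<Longrightarrow> set (xss ! i) \<inter> set (xss ! j) = {}"
proof (induction xss arbitrary: i j)
  case (Cons xs xss)
  have *: "set xs \<inter> set (xss ! k) = {}" if "k < length xss" for k
    using Cons.prems(1) nth_mem[OF that] by auto
  show ?case
  proof (cases i)
    case 0
    with Cons.prems obtain k where "j = Suc k" "k < length xss" by (cases j) auto
    with 0 * show ?thesis by simp
  next
    case (Suc k)
    with Cons show ?thesis using * by (cases j) (auto simp: Int_commute)
  qed
qed simp

context annotated
begin

text \<open>The \<open>let\<close> in the first component is moved out of the pair, and then out of
  the application.\<close>

lemma evl_LetIn_Tup:
  assumes f: "is_morph f (Tens A B) C" and s: "wt \<rho> e s T" "pat_typed P e T \<beta>"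
    and t: "evl (override_on \<rho> \<beta> (set_pat P)) c f (Tup p q) u"
    and P: "set_pat P \<subseteq> fv p" "set_pat P \<inter> fv q = {}" "fv s \<inter> (fv p \<union> fv q - set_pat P) = {}"
  shows "evl \<rho> c f (Tup (LetIn P s p) q) (LetIn P s u)"
proof -
  have l: "evl \<rho> c f (LetIn P s (Tup p q)) (LetIn P s u)"
    by (rule evl_LetIn[OF f s t]) (use P in auto)
  have "LetIn P s (Tup p q) \<simeq> Tup (LetIn P s p) q"
    by (rule commutingD(4)[OF commuting_Tup1]) (use P in auto)
  from eqt_sym[OF red_eqt[OF req_red(1)[OF this] evl_wt(1)[OF f l]]] l eqt_refl[OF evl_wt(2)[OF f l]]
  show ?thesis by (rule evl_eqt[OF f])
qed

lemma eqt_BoxTm_let: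
  assumes "wt \<rho> (c + d) s T" "pat_typed P (c + d) T \<beta>"
  shows "eqt \<rho> c (BoxTm d s) (LetIn P s (BoxTm d (pat_tm P))) (BoxTy d T)"
proof -
  have "eqt \<rho> c (BoxTm d (LetIn P s (pat_tm P))) (BoxTm d s) (BoxTy d T)"
    by (rule eqt_BoxTm, rule eqt_eta[OF assms])
  moreover have "LetIn P s (BoxTm d (pat_tm P)) \<simeq> BoxTm d (LetIn P s (pat_tm P))"
    by (rule commutingD(4)[OF commuting_BoxTm]) auto
  ultimately show ?thesis
    by (meson eqt_sym eqt_trans eqt_wt(1) red_eqt req_red(2))
qed

text \<open>Coherence arrows are evaluated on tuples and boxes, while the scrutinee \<open>s\<close>
  is an arbitrary term. Its eta-expansion along \<open>P\<close> exposes an argument of the required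
  form.\<close>

lemma evl_BoxTm_let:
  assumes f: "is_morph f (BoxTy d T) C" and s: "wt \<rho> (c + d) s T" "pat_typed P (c + d) T \<beta>"
    and t: "evl (override_on \<rho> \<beta> (set_pat P)) c f (BoxTm d (pat_tm P)) u"
  shows "evl \<rho> c f (BoxTm d s) (LetIn P s u)"
proof -
  have l: "evl \<rho> c f (LetIn P s (BoxTm d (pat_tm P))) (LetIn P s u)"
    by (rule evl_LetIn[OF f s t]) auto
  show ?thesis
    by (rule evl_eqt[OF f eqt_BoxTm_let[OF s] l eqt_refl[OF evl_wt(2)[OF f l]]])
qed

lemma ctx_env_override:
  assumes "fst ` set \<Gamma> \<inter> X = {}"
  shows "ctx_env \<Gamma> (override_on \<rho> \<beta> X) c \<longleftrightarrow> ctx_env \<Gamma> \<rho> c"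
proof -
  have "x \<notin> X" if "(x, d, A) \<in> set \<Gamma>" for x d A using assms that by force
  then show ?thesis by (auto simp: ctx_env_def)
qed

lemma ctx_env_concat: "ctx_env (concat \<Gamma>s) \<rho> c \<Longrightarrow> \<Gamma> \<in> set \<Gamma>s \<Longrightarrow> ctx_env \<Gamma> \<rho> c"
  by (induction \<Gamma>s) (auto simp: ctx_env_append)

text \<open>The interpretation of a derivation, applied to the tuple of the declared variables, yields the
  term itself.\<close>

definition computes :: "'q ty \<times> 'q ty \<times> 'g tm set \<Rightarrow> 'q ctx \<Rightarrow> 'g tm \<Rightarrow> 'q ty \<Rightarrow> bool" where
  "computes f \<Gamma> t A \<longleftrightarrow> ok_ctx \<Gamma> \<and> is_morph f (cty \<Gamma>) A \<and> (\<forall>\<rho> c. ctx_env \<Gamma> \<rho> c \<longrightarrow> evl \<rho> c f (ctx_val \<Gamma>) t)"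

lemma computesD:
  assumes "computes f \<Gamma> t A"
  shows "ok_ctx \<Gamma>" "is_morph f (cty \<Gamma>) A" "ctx_env \<Gamma> \<rho> c \<Longrightarrow> evl \<rho> c f (ctx_val \<Gamma>) t"
    "set_ty A \<subseteq> qubits S" "ctx_env \<Gamma> \<rho> c \<Longrightarrow> wt \<rho> c t A" "ctx_env \<Gamma> \<rho> c \<Longrightarrow> fv t = fst ` set \<Gamma>"
proof -
  show "ok_ctx \<Gamma>" and m: "is_morph f (cty \<Gamma>) A" and e: "ctx_env \<Gamma> \<rho> c \<Longrightarrow> evl \<rho> c f (ctx_val \<Gamma>) t"
    using assms by (simp_all add: computes_def)
  show "set_ty A \<subseteq> qubits S" using is_morph_ty(2)[OF m] .
  show "ctx_env \<Gamma> \<rho> c \<Longrightarrow> wt \<rho> c t A" using evl_wt(2)[OF m e] .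
  show "ctx_env \<Gamma> \<rho> c \<Longrightarrow> fv t = fst ` set \<Gamma>" using evl_wt(3)[OF m e] by simp
qed

text \<open>The common core of the rules for pairs, boxes and plain \<open>let\<close>s:
  \<open>h\<close> carries the shifted type of the scrutinee to the declarations of the bound
  variables, and \<open>k\<close> interprets the body. Both have to be evaluated only on the tuple
  of the bound variables.\<close>

lemma computes_let:
  assumes D: "computes f \<Gamma> s T" and ok: "ok_ctx \<Delta>"
    and h: "is_morph h (BoxTy d T) X" and k: "is_morph k (Tens X (cty \<Delta>)) C"
    and ev: "\<And>\<rho> c. ctx_env (shift_ctx d \<Gamma> @ \<Delta>) \<rho> c \<Longrightarrow> \<exists>\<beta> p. pat_typed P (c + d) T \<beta> \<and>
      evl (override_on \<rho> \<beta> (set_pat P)) c h (BoxTm d (pat_tm P)) p \<and>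
      evl (override_on \<rho> \<beta> (set_pat P)) c k (Tup p (ctx_val \<Delta>)) t"
    and P: "set_pat P \<inter> fst ` set \<Delta> = {}"
  shows "computes (ar_comp k (ar_comp (ar_tens (ar_comp h (shift_sem term_model d \<Gamma> f)) (can (cty \<Delta>) (cty \<Delta>)))
    (ctx_split term_model (shift_ctx d \<Gamma>) \<Delta>))) (shift_ctx d \<Gamma> @ \<Delta>) (LetIn P s t) C"
  unfolding computes_def
proof (intro conjI allI impI)
  note okG = computesD(1)[OF D] and f = computesD(2)[OF D]
  have okS: "ok_ctx (shift_ctx d \<Gamma>)" using okG by simp
  show "ok_ctx (shift_ctx d \<Gamma> @ \<Delta>)" using okG ok by simp
  note ms = is_morph_shift_sem[OF okG f, of d]
  have id: "is_morph (can (cty \<Delta>) (cty \<Delta>)) (cty \<Delta>) (cty \<Delta>)" by (rule is_morph_can) (simp_all add: ok)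
  note mh = is_morph_comp[OF ms h]
  note mt = is_morph_tens[OF mh id] and msp = is_morph_ctx_split[OF okS ok]
  note m1 = is_morph_comp[OF msp mt]
  show "is_morph (ar_comp k (ar_comp (ar_tens (ar_comp h (shift_sem term_model d \<Gamma> f)) (can (cty \<Delta>) (cty \<Delta>)))
      (ctx_split term_model (shift_ctx d \<Gamma>) \<Delta>))) (cty (shift_ctx d \<Gamma> @ \<Delta>)) C"
    by (rule is_morph_comp[OF m1 k])
  fix \<rho> c assume e: "ctx_env (shift_ctx d \<Gamma> @ \<Delta>) \<rho> c"
  then have eG: "ctx_env \<Gamma> \<rho> (c + d)" and eD: "ctx_env \<Delta> \<rho> c" and dis: "fst ` set \<Gamma> \<inter> fst ` set \<Delta> = {}"
    by (simp_all add: ctx_env_append ctx_env_shift)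
  from ev[OF e] obtain \<beta> p where b: "pat_typed P (c + d) T \<beta>"
    "evl (override_on \<rho> \<beta> (set_pat P)) c h (BoxTm d (pat_tm P)) p"
    "evl (override_on \<rho> \<beta> (set_pat P)) c k (Tup p (ctx_val \<Delta>)) t" by blast
  have fp: "fv p = set_pat P" using evl_wt(3)[OF h b(2)] by simp
  have s: "wt \<rho> (c + d) s T" and fs: "fv s = fst ` set \<Gamma>"
    by (rule computesD(5)[OF D eG], rule computesD(6)[OF D eG])
  have 1: "evl \<rho> c h (BoxTm d s) (LetIn P s p)" by (rule evl_BoxTm_let[OF h s b(1,2)])
  have 2: "evl \<rho> c (ar_comp h (shift_sem term_model d \<Gamma> f)) (ctx_val (shift_ctx d \<Gamma>)) (LetIn P s p)"
    by (rule evl_comp[OF ms h evl_shift_sem[OF f eG computesD(3)[OF D eG]] 1])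
  have 3: "evl \<rho> c (ar_tens (ar_comp h (shift_sem term_model d \<Gamma> f)) (can (cty \<Delta>) (cty \<Delta>)))
      (Tup (ctx_val (shift_ctx d \<Gamma>)) (ctx_val \<Delta>)) (Tup (LetIn P s p) (ctx_val \<Delta>))"
    by (rule evl_tens[OF mh id 2 evl_id[OF wt_ctx_val[OF eD]]]) (use dis in simp)
  have 4: "evl \<rho> c k (Tup (LetIn P s p) (ctx_val \<Delta>)) (LetIn P s t)"
    by (rule evl_LetIn_Tup[OF k s b(1,3)]) (use fp P fs dis in auto)
  show "evl \<rho> c (ar_comp k (ar_comp (ar_tens (ar_comp h (shift_sem term_model d \<Gamma> f)) (can (cty \<Delta>) (cty \<Delta>)))
      (ctx_split term_model (shift_ctx d \<Gamma>) \<Delta>))) (ctx_val (shift_ctx d \<Gamma> @ \<Delta>)) (LetIn P s t)"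
    by (rule evl_comp[OF m1 k evl_comp[OF msp mt evl_ctx_split[OF e] 3] 4])
qed

theorem computes_sem: "derives S D \<Gamma> t A \<Longrightarrow> computes (sem S term_model D) \<Gamma> t A"
proof (induction rule: derives.induct)
  case (Swap D \<Gamma> x d A y e B \<Delta> t C)
  note IH = Swap.IH
  show ?case unfolding computes_def
  proof (intro conjI allI impI)
    show "ok_ctx (\<Gamma> @ (y, e, B) # (x, d, A) # \<Delta>)" using computesD(1)[OF IH] by simp
    note m = is_morph_ctx_swap[OF computesD(1)[OF IH]]
    show "is_morph (sem S term_model (D_Swap \<Gamma> (x, d, A) (y, e, B) \<Delta> D)) (cty (\<Gamma> @ (y, e, B) # (x, d, A) # \<Delta>)) C"
      using is_morph_comp[OF m computesD(2)[OF IH]] by simp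
    fix \<rho> c assume "ctx_env (\<Gamma> @ (y, e, B) # (x, d, A) # \<Delta>) \<rho> c"
    then have e: "ctx_env (\<Gamma> @ (x, d, A) # (y, e, B) # \<Delta>) \<rho> c"
      by (auto simp: ctx_env_append ctx_env_Cons)
    show "evl \<rho> c (sem S term_model (D_Swap \<Gamma> (x, d, A) (y, e, B) \<Delta> D)) (ctx_val (\<Gamma> @ (y, e, B) # (x, d, A) # \<Delta>)) t"
      using evl_comp[OF m computesD(2)[OF IH] evl_ctx_swap[OF e] computesD(3)[OF IH e]] by simp
  qed
next
  case (Var A x)
  have m1: "is_morph (can (Tens (BoxTy 0 A) One) (BoxTy 0 A)) (Tens (BoxTy 0 A) One) (BoxTy 0 A)"
    and m2: "is_morph (can (BoxTy 0 A) A) (BoxTy 0 A) A"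
    using Var by (auto intro!: is_morph_can simp del: flat.simps(4))
  show ?case unfolding computes_def
  proof (intro conjI allI impI)
    show "ok_ctx [(x, 0, A)]" using Var by simp
    show "is_morph (sem S term_model (D_Var x A)) (cty [(x, 0, A)]) A"
      using is_morph_comp[OF m1 m2] by (simp add: arr_invs Var)
    fix \<rho> c assume "ctx_env [(x, 0, A)] \<rho> c"
    then have x: "wt \<rho> c (V x) A" using Var by (auto simp: ctx_env_Cons intro!: wt_V)
    have "evl \<rho> c (ar_comp (can (BoxTy 0 A) A) (can (Tens (BoxTy 0 A) One) (BoxTy 0 A))) (Tup (BoxTm 0 (V x)) Star) (V x)"
      by (rule evl_comp[OF m1 m2 evl_runit evl_shift_unit(2)[OF x]]) (use x in simp)
    then show "evl \<rho> c (sem S term_model (D_Var x A)) (ctx_val [(x, 0, A)]) (V x)"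
      by (simp add: arr_invs Var)
  qed
next
  case UnitI
  show ?case by (simp add: computes_def is_morph_can evl_id)
next
  \<comment> \<open>\<open>computes_let\<close> has the wrong shape here: the interpretation tensors
    the scrutinee with the body itself instead of the identity on the rest of the context.\<close>
  case (UnitE D \<Gamma> s E \<Delta> t A d)
  note D = UnitE.IH(1) and E = UnitE.IH(2)
  note okG = computesD(1)[OF D] and okD = computesD(1)[OF E] and f = computesD(2)[OF D] and g = computesD(2)[OF E]
  have okS: "ok_ctx (shift_ctx d \<Gamma>)" using okG by simp
  note tyA = computesD(4)[OF E]
  have mu: "is_morph (can (BoxTy d One) One) (BoxTy d One) One" by (rule is_morph_can) simp_all
  have ml: "is_morph (can (Tens One A) A) (Tens One A) A" by (rule is_morph_can) (use tyA in simp_all)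
  note ms = is_morph_shift_sem[OF okG f, of d]
  note mh = is_morph_comp[OF ms mu]
  note mt = is_morph_tens[OF mh g] and msp = is_morph_ctx_split[OF okS okD]
  note m1 = is_morph_comp[OF msp mt]
  have inv: "arr_inv term_model (can One (BoxTy d One)) = can (BoxTy d One) One"
    by (rule arr_inv_can) simp_all
  show ?case unfolding computes_def
  proof (intro conjI allI impI)
    show "ok_ctx (shift_ctx d \<Gamma> @ \<Delta>)" using okG okD by simp
    show "is_morph (sem S term_model (D_UnitE \<Gamma> \<Delta> d A D E)) (cty (shift_ctx d \<Gamma> @ \<Delta>)) A"
      using is_morph_comp[OF m1 ml] by (simp add: inv)
    fix \<rho> c assume e: "ctx_env (shift_ctx d \<Gamma> @ \<Delta>) \<rho> c"
    then have eG: "ctx_env \<Gamma> \<rho> (c + d)" and eD: "ctx_env \<Delta> \<rho> c" and dis: "fst ` set \<Gamma> \<inter> fst ` set \<Delta> = {}"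
      by (simp_all add: ctx_env_append ctx_env_shift)
    have s: "wt \<rho> (c + d) s One" and fs: "fv s = fst ` set \<Gamma>"
      by (rule computesD(5)[OF D eG], rule computesD(6)[OF D eG])
    have t: "wt \<rho> c t A" and ft: "fv t = fst ` set \<Delta>"
      by (rule computesD(5)[OF E eD], rule computesD(6)[OF E eD])
    have P: "pat_typed PUnit (c + d) One \<rho>" by simp
    have 1: "evl \<rho> c (can (BoxTy d One) One) (BoxTm d s) (LetIn PUnit s Star)"
      by (rule evl_BoxTm_let[OF mu s P]) (simp add: evl_unit)
    have 2: "evl \<rho> c (ar_comp (can (BoxTy d One) One) (shift_sem term_model d \<Gamma> (sem S term_model D)))
        (ctx_val (shift_ctx d \<Gamma>)) (LetIn PUnit s Star)"
      by (rule evl_comp[OF ms mu evl_shift_sem[OF f eG computesD(3)[OF D eG]] 1])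
    have 3: "evl \<rho> c (ar_tens (ar_comp (can (BoxTy d One) One) (shift_sem term_model d \<Gamma> (sem S term_model D))) (sem S term_model E))
        (Tup (ctx_val (shift_ctx d \<Gamma>)) (ctx_val \<Delta>)) (Tup (LetIn PUnit s Star) t)"
      by (rule evl_tens[OF mh g 2 computesD(3)[OF E eD]]) (use dis in simp)
    have 4: "evl \<rho> c (can (Tens One A) A) (Tup (LetIn PUnit s Star) t) (LetIn PUnit s t)"
      by (rule evl_LetIn_Tup[OF ml s P]) (use dis fs ft t evl_lunit(1) in auto)
    show "evl \<rho> c (sem S term_model (D_UnitE \<Gamma> \<Delta> d A D E)) (ctx_val (shift_ctx d \<Gamma> @ \<Delta>)) (LetIn PUnit s t)"
      using evl_comp[OF m1 ml evl_comp[OF msp mt evl_ctx_split[OF e] 3] 4] by (simp add: inv)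
  qed
next
  case (Gate g \<Gamma>s Ds ts)
  let ?n = "length (wires S g)" and ?d = "duration S g"
  let ?fs = "map (sem S term_model) Ds"
  have IH: "computes (sem S term_model (Ds ! i)) (\<Gamma>s ! i) (ts ! i) (Qubit (wires S g ! i))" if "i < ?n" for i
    using Gate that by blast
  have "ok_ctx \<Gamma>" if "\<Gamma> \<in> set \<Gamma>s" for \<Gamma>
    using that computesD(1)[OF IH] Gate.hyps(2) by (metis in_set_conv_nth)
  then have ok: "\<forall>\<Gamma> \<in> set \<Gamma>s. ok_ctx \<Gamma>" by blast
  have ctx: "concat (map (shift_ctx (- ?d)) \<Gamma>s) = shift_ctx (- ?d) (concat \<Gamma>s)"
    by (simp add: shift_ctx_concat)
  note msp = is_morph_ctxs_split[OF ok]
  have "\<forall>i < length ?fs. is_morph (?fs ! i) (map cty \<Gamma>s ! i) (map Qubit (wires S g) ! i)"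
    using computesD(2)[OF IH] Gate.hyps by simp
  note ta = tensor_ars[OF _ _ _ _ this, of "map ctx_val \<Gamma>s" ts]
  have mta: "is_morph (tensor_ars term_model ?fs) (tensor_obs term_model (map cty \<Gamma>s)) (gate_ty g)"
    using ta(1) Gate.hyps by (simp add: tensor_obs_Qubit)
  have okc: "ok_ctx (concat \<Gamma>s)" using ok by simp
  note m1 = is_morph_comp[OF msp mta]
  note m2 = is_morph_shift_sem[OF okc m1, of "- ?d"]
  note mg = is_morph_gate[OF Gate.hyps(1)]
  show ?case unfolding computes_def ctx
  proof (intro conjI allI impI)
    show "ok_ctx (shift_ctx (- ?d) (concat \<Gamma>s))" using ok by simp
    show "is_morph (sem S term_model (D_Gate g \<Gamma>s Ds)) (cty (shift_ctx (- ?d) (concat \<Gamma>s))) (gate_ty g)"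
      using is_morph_comp[OF m2 mg] by simp
    fix \<rho> c assume "ctx_env (shift_ctx (- ?d) (concat \<Gamma>s)) \<rho> c"
    then have e: "ctx_env (concat \<Gamma>s) \<rho> (c + - ?d)" by (simp only: ctx_env_shift)
    have ei: "ctx_env (\<Gamma>s ! i) \<rho> (c + - ?d)" if "i < ?n" for i
      by (rule ctx_env_concat[OF e]) (use that Gate.hyps(2) in simp)
    note sp = evl_ctxs_split[OF e]
    have "evl \<rho> (c + - ?d) (tensor_ars term_model ?fs) (tuple (map ctx_val \<Gamma>s)) (tuple ts)"
    proof (rule ta(2))
      show "\<forall>i < length ?fs. evl \<rho> (c + - ?d) (?fs ! i) (map ctx_val \<Gamma>s ! i) (ts ! i)"
        using computesD(3)[OF IH ei] Gate.hyps by simp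
      show "wt \<rho> (c + - ?d) (tuple (map ctx_val \<Gamma>s)) (tensor_obs term_model (map cty \<Gamma>s))"
        by (rule evl_wt(2)[OF msp sp])
    qed (use Gate.hyps in simp_all)
    from evl_shift_sem[OF m1 e evl_comp[OF msp mta sp this]]
    have 1: "evl \<rho> c (shift_sem term_model (- ?d) (concat \<Gamma>s) (ar_comp (tensor_ars term_model ?fs) (ctxs_split term_model \<Gamma>s)))
      (ctx_val (shift_ctx (- ?d) (concat \<Gamma>s))) (BoxTm (- ?d) (tuple ts))" .
    have "wt \<rho> c (Gate g ts) (gate_ty g)"
    proof (rule wt_Gate[OF Gate.hyps(1,4)])
      show "\<forall>i < length ts. wt \<rho> (c - ?d) (ts ! i) (Qubit (wires S g ! i))"
        using computesD(5)[OF IH ei] Gate.hyps(4) by simp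
      \<comment> \<open>The free variables of an argument are the names of its context, so distinct
        names in the concatenation give disjoint arguments.\<close>
      have d: "distinct (concat (map (map fst) \<Gamma>s))"
        using e by (simp add: ctx_env_def distinct_vars_def map_concat)
      show "pairwise_disjoint ts" unfolding pairwise_disjoint_def
      proof (intro allI impI)
        fix i j assume ij: "i < length ts" "j < length ts" "i \<noteq> j"
        with Gate.hyps have ij': "i < ?n" "j < ?n" by simp_all
        from distinct_concat_nth[OF d, of i j] ij Gate.hyps(2,4)
        show "fv (ts ! i) \<inter> fv (ts ! j) = {}"
          unfolding computesD(6)[OF IH[OF ij'(1)] ei[OF ij'(1)]] computesD(6)[OF IH[OF ij'(2)] ei[OF ij'(2)]]
          by simp
      qed
    qed simp
    from evl_comp[OF m2 mg 1 evl_gate[OF this]]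
    show "evl \<rho> c (sem S term_model (D_Gate g \<Gamma>s Ds)) (ctx_val (shift_ctx (- ?d) (concat \<Gamma>s))) (Gate g ts)" by simp
  qed
next
  case (TensI D \<Gamma> s A E \<Delta> t B)
  note D = TensI.IH(1) and E = TensI.IH(2)
  note okG = computesD(1)[OF D] and okD = computesD(1)[OF E] and f = computesD(2)[OF D] and g = computesD(2)[OF E]
  note msp = is_morph_ctx_split[OF okG okD] and mt = is_morph_tens[OF f g]
  show ?case unfolding computes_def
  proof (intro conjI allI impI)
    show "ok_ctx (\<Gamma> @ \<Delta>)" using okG okD by simp
    show "is_morph (sem S term_model (D_TensI \<Gamma> \<Delta> D E)) (cty (\<Gamma> @ \<Delta>)) (Tens A B)"
      using is_morph_comp[OF msp mt] by simp
    fix \<rho> c assume e: "ctx_env (\<Gamma> @ \<Delta>) \<rho> c"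
    then have eG: "ctx_env \<Gamma> \<rho> c" and eD: "ctx_env \<Delta> \<rho> c" and dis: "fst ` set \<Gamma> \<inter> fst ` set \<Delta> = {}"
      by (simp_all add: ctx_env_append)
    have "evl \<rho> c (ar_tens (sem S term_model D) (sem S term_model E)) (Tup (ctx_val \<Gamma>) (ctx_val \<Delta>)) (Tup s t)"
      by (rule evl_tens[OF f g computesD(3)[OF D eG] computesD(3)[OF E eD]]) (use dis in simp)
    from evl_comp[OF msp mt evl_ctx_split[OF e] this]
    show "evl \<rho> c (sem S term_model (D_TensI \<Gamma> \<Delta> D E)) (ctx_val (\<Gamma> @ \<Delta>)) (Tup s t)" by simp
  qed
next
  case (TensE D \<Gamma> s A B E x d y \<Delta> t C)
  note D = TensE.IH(1) and E = TensE.IH(2)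
  note g = computesD(2)[OF E]
  have ok: "ok_ctx \<Delta>" "set_ty A \<subseteq> qubits S" "set_ty B \<subseteq> qubits S" using computesD(1)[OF E] by simp_all
  have xy: "x \<noteq> y" "x \<notin> fst ` set \<Delta>" "y \<notin> fst ` set \<Delta>"
    using derives_distinct[OF TensE.hyps(2)] by (auto simp: distinct_vars_def)
  let ?h = "can (BoxTy d (Tens A B)) (Tens (BoxTy d A) (BoxTy d B))"
  let ?a = "can (Tens (Tens (BoxTy d A) (BoxTy d B)) (cty \<Delta>)) (Tens (BoxTy d A) (Tens (BoxTy d B) (cty \<Delta>)))"
  have h: "is_morph ?h (BoxTy d (Tens A B)) (Tens (BoxTy d A) (BoxTy d B))"
    by (rule is_morph_can) (use ok in simp_all)
  have a: "is_morph ?a (Tens (Tens (BoxTy d A) (BoxTy d B)) (cty \<Delta>)) (Tens (BoxTy d A) (Tens (BoxTy d B) (cty \<Delta>)))"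
    by (rule is_morph_can) (use ok in simp_all)
  have g': "is_morph (sem S term_model E) (Tens (BoxTy d A) (Tens (BoxTy d B) (cty \<Delta>))) C" using g by simp
  note k = is_morph_comp[OF a g']
  let ?k = "ar_comp (sem S term_model E) ?a"
  have main: "computes (ar_comp ?k (ar_comp (ar_tens (ar_comp ?h (shift_sem term_model d \<Gamma> (sem S term_model D))) (can (cty \<Delta>) (cty \<Delta>)))
    (ctx_split term_model (shift_ctx d \<Gamma>) \<Delta>))) (shift_ctx d \<Gamma> @ \<Delta>) (LetIn (PPair x y) s t) C"
  proof (rule computes_let[OF D ok(1) h k])
    show "set_pat (PPair x y) \<inter> fst ` set \<Delta> = {}" using xy by simp
    fix \<rho> c assume "ctx_env (shift_ctx d \<Gamma> @ \<Delta>) \<rho> c"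
    then have eD: "ctx_env \<Delta> \<rho> c" by (simp add: ctx_env_append)
    let ?\<beta> = "(\<lambda>_. (c + d, A))(y := (c + d, B))"
    let ?\<rho> = "override_on \<rho> ?\<beta> (set_pat (PPair x y))"
    have "ctx_env \<Delta> ?\<rho> c" using eD xy by (subst ctx_env_override) auto
    then have e: "ctx_env ((x, d, A) # (y, d, B) # \<Delta>) ?\<rho> c" using xy ok by (auto simp: ctx_env_Cons)
    have w: "wt ?\<rho> (c + d) (V x) A" "wt ?\<rho> (c + d) (V y) B" using ok xy by (auto intro!: wt_V)
    have "evl ?\<rho> c ?h (BoxTm d (Tup (V x) (V y))) (Tup (BoxTm d (V x)) (BoxTm d (V y)))"
      by (rule evl_mul) (use w xy in simp)
    moreover have "evl ?\<rho> c ?a (Tup (Tup (BoxTm d (V x)) (BoxTm d (V y))) (ctx_val \<Delta>)) (Tup (BoxTm d (V x)) (Tup (BoxTm d (V y)) (ctx_val \<Delta>)))"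
      by (rule evl_assoc) (use w xy wt_ctx_val[OF \<open>ctx_env \<Delta> ?\<rho> c\<close>] in simp)
    moreover have "evl ?\<rho> c (sem S term_model E) (Tup (BoxTm d (V x)) (Tup (BoxTm d (V y)) (ctx_val \<Delta>))) t"
      using computesD(3)[OF E e] by simp
    moreover have "pat_typed (PPair x y) (c + d) (Tens A B) ?\<beta>" using xy by simp
    ultimately show "\<exists>\<beta> p. pat_typed (PPair x y) (c + d) (Tens A B) \<beta> \<and>
      evl (override_on \<rho> \<beta> (set_pat (PPair x y))) c ?h (BoxTm d (pat_tm (PPair x y))) p \<and>
      evl (override_on \<rho> \<beta> (set_pat (PPair x y))) c ?k (Tup p (ctx_val \<Delta>)) t"
      unfolding pat_tm.simps using evl_comp[OF a g'] by blast
  qed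
  have inv: "arr_inv term_model (can (Tens (BoxTy d A) (BoxTy d B)) (BoxTy d (Tens A B))) = ?h"
    by (rule arr_inv_mul) (use ok in simp_all)
  have okS: "ok_ctx (shift_ctx d \<Gamma>)" using computesD(1)[OF D] by simp
  have "is_morph (can (cty \<Delta>) (cty \<Delta>)) (cty \<Delta>) (cty \<Delta>)" by (rule is_morph_can) (simp_all add: ok)
  \<comment> \<open>The interpretation brackets its composition to the right, whereas
    \<open>?k\<close> groups the associativity arrow with the interpretation of the body.\<close>
  from comp_assoc[OF is_morph_comp[OF is_morph_ctx_split[OF okS ok(1)]
        is_morph_tens[OF is_morph_comp[OF is_morph_shift_sem[OF computesD(1,2)[OF D]] h] this]] a g'] main
  show ?case by (simp add: inv)
next
  case (BoxI D \<Gamma> t A d)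
  note D = BoxI.IH
  show ?case unfolding computes_def
    using computesD(1,2)[OF D] is_morph_shift_sem evl_shift_sem[OF computesD(2)[OF D] _ computesD(3)[OF D]]
    by (simp add: ctx_env_shift)
next
  case (BoxE D \<Gamma> s d A E x e \<Delta> t B)
  note D = BoxE.IH(1) and E = BoxE.IH(2)
  note g = computesD(2)[OF E]
  have ok: "ok_ctx \<Delta>" "set_ty A \<subseteq> qubits S" using computesD(1)[OF E] by simp_all
  have x: "x \<notin> fst ` set \<Delta>"
    using derives_distinct[OF BoxE.hyps(2)] by (auto simp: distinct_vars_def)
  let ?d = "e - d"
  \<comment> \<open>The codomain carries the sum \<open>e - d + d\<close> to fit the rules about
    \<open>Shift_mul\<close>; it is simplified to \<open>e\<close> where the body is
    involved.\<close>
  let ?h = "can (BoxTy ?d (BoxTy d A)) (BoxTy (?d + d) A)"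
  note h = is_morph_shift_mul(1)[OF ok(2), of ?d d]
  have k: "is_morph (sem S term_model E) (Tens (BoxTy (?d + d) A) (cty \<Delta>)) B" using g by simp
  have "computes (ar_comp (sem S term_model E) (ar_comp (ar_tens (ar_comp ?h (shift_sem term_model ?d \<Gamma> (sem S term_model D))) (can (cty \<Delta>) (cty \<Delta>)))
    (ctx_split term_model (shift_ctx ?d \<Gamma>) \<Delta>))) (shift_ctx ?d \<Gamma> @ \<Delta>) (LetIn (PBox d x) s t) B"
  proof (rule computes_let[OF D ok(1) h k])
    show "set_pat (PBox d x) \<inter> fst ` set \<Delta> = {}" using x by simp
    fix \<rho> c assume "ctx_env (shift_ctx ?d \<Gamma> @ \<Delta>) \<rho> c"
    then have eD: "ctx_env \<Delta> \<rho> c" by (simp add: ctx_env_append)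
    let ?\<beta> = "\<lambda>_. (c + e, A)"
    let ?\<rho> = "override_on \<rho> ?\<beta> (set_pat (PBox d x))"
    have "ctx_env \<Delta> ?\<rho> c" using eD x by (subst ctx_env_override) auto
    then have e: "ctx_env ((x, e, A) # \<Delta>) ?\<rho> c" using x ok by (auto simp: ctx_env_Cons)
    have "wt ?\<rho> (c + ?d + d) (V x) A" using ok by (auto intro!: wt_V)
    then have "evl ?\<rho> c ?h (BoxTm ?d (BoxTm d (V x))) (BoxTm (?d + d) (V x))"
      by (intro evl_shift_mul) simp
    moreover have "evl ?\<rho> c (sem S term_model E) (Tup (BoxTm (?d + d) (V x)) (ctx_val \<Delta>)) t"
      using computesD(3)[OF E e] by simp
    moreover have "pat_typed (PBox d x) (c + ?d) (BoxTy d A) ?\<beta>" by simp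
    ultimately show "\<exists>\<beta> p. pat_typed (PBox d x) (c + ?d) (BoxTy d A) \<beta> \<and>
      evl (override_on \<rho> \<beta> (set_pat (PBox d x))) c ?h (BoxTm ?d (pat_tm (PBox d x))) p \<and>
      evl (override_on \<rho> \<beta> (set_pat (PBox d x))) c (sem S term_model E) (Tup p (ctx_val \<Delta>)) t"
      unfolding pat_tm.simps by blast
  qed
  then show ?case by simp
next
  case (Delay D \<Gamma> t q d)
  note D = Delay.IH
  have q: "q \<in> qubits S" using computesD(4)[OF D] by simp
  note m1 = is_morph_shift_sem[OF computesD(1,2)[OF D], of "- d"] and m2 = is_morph_delay[OF Delay.hyps(2) q]
  show ?case unfolding computes_def
  proof (intro conjI allI impI)
    show "ok_ctx (shift_ctx (- d) \<Gamma>)" using computesD(1)[OF D] by simp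
    show "is_morph (sem S term_model (D_Delay \<Gamma> d q D)) (cty (shift_ctx (- d) \<Gamma>)) (Qubit q)"
      using is_morph_comp[OF m1 m2] by simp
    fix \<rho> c assume "ctx_env (shift_ctx (- d) \<Gamma>) \<rho> c"
    then have e: "ctx_env \<Gamma> \<rho> (c + - d)" by (simp only: ctx_env_shift)
    note s = evl_shift_sem[OF computesD(2)[OF D] e computesD(3)[OF D e]]
    show "evl \<rho> c (sem S term_model (D_Delay \<Gamma> d q D)) (ctx_val (shift_ctx (- d) \<Gamma>)) (Delay d t)"
      using evl_comp[OF m1 m2 s evl_delay[OF Delay.hyps(2) evl_wt(2)[OF m1 s]]] by simp
  qed
next
  case (Let D \<Gamma> s A E x d \<Delta> t C)
  note D = Let.IH(1) and E = Let.IH(2)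
  note g = computesD(2)[OF E]
  have ok: "ok_ctx \<Delta>" "set_ty A \<subseteq> qubits S" using computesD(1)[OF E] by simp_all
  have x: "x \<notin> fst ` set \<Delta>"
    using derives_distinct[OF Let.hyps(2)] by (auto simp: distinct_vars_def)
  let ?h = "can (BoxTy d A) (BoxTy d A)"
  have h: "is_morph ?h (BoxTy d A) (BoxTy d A)" by (rule is_morph_can) (use ok in simp_all)
  have k: "is_morph (sem S term_model E) (Tens (BoxTy d A) (cty \<Delta>)) C" using g by simp
  have "computes (ar_comp (sem S term_model E) (ar_comp (ar_tens (ar_comp ?h (shift_sem term_model d \<Gamma> (sem S term_model D))) (can (cty \<Delta>) (cty \<Delta>)))
    (ctx_split term_model (shift_ctx d \<Gamma>) \<Delta>))) (shift_ctx d \<Gamma> @ \<Delta>) (LetIn (PVar x) s t) C"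
  proof (rule computes_let[OF D ok(1) h k])
    show "set_pat (PVar x) \<inter> fst ` set \<Delta> = {}" using x by simp
    fix \<rho> c assume "ctx_env (shift_ctx d \<Gamma> @ \<Delta>) \<rho> c"
    then have eD: "ctx_env \<Delta> \<rho> c" by (simp add: ctx_env_append)
    let ?\<beta> = "\<lambda>_. (c + d, A)"
    let ?\<rho> = "override_on \<rho> ?\<beta> (set_pat (PVar x))"
    have "ctx_env \<Delta> ?\<rho> c" using eD x by (subst ctx_env_override) auto
    then have e: "ctx_env ((x, d, A) # \<Delta>) ?\<rho> c" using x ok by (auto simp: ctx_env_Cons)
    have "wt ?\<rho> (c + d) (V x) A" using ok by (auto intro!: wt_V)
    then have "evl ?\<rho> c ?h (BoxTm d (V x)) (BoxTm d (V x))" by (intro evl_id) simp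
    moreover have "evl ?\<rho> c (sem S term_model E) (Tup (BoxTm d (V x)) (ctx_val \<Delta>)) t"
      using computesD(3)[OF E e] by simp
    moreover have "pat_typed (PVar x) (c + d) A ?\<beta>" by simp
    ultimately show "\<exists>\<beta> p. pat_typed (PVar x) (c + d) A \<beta> \<and>
      evl (override_on \<rho> \<beta> (set_pat (PVar x))) c ?h (BoxTm d (pat_tm (PVar x))) p \<and>
      evl (override_on \<rho> \<beta> (set_pat (PVar x))) c (sem S term_model E) (Tup p (ctx_val \<Delta>)) t"
      unfolding pat_tm.simps by blast
  qed
  \<comment> \<open>For a plain \<open>let\<close> there is no coherence arrow on the scrutinee:
    \<open>?h\<close> is the identity and drops out of the composite.\<close>
  then show ?case
    using comp_can_id(2)[OF is_morph_shift_sem[OF computesD(1,2)[OF D], of d]] by simp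
qed

text \<open>On the tuple of the variables of \<open>\<Gamma>\<close> the common interpretation
  evaluates both to \<open>s\<close> and to \<open>t\<close>, and values are unique up to provable
  equality.\<close>

lemma completeness:
  assumes "derives S D \<Gamma> s A" "derives S E \<Gamma> t A" "sem S term_model D = sem S term_model E"
  shows "jeq S \<Gamma> s t A"
proof -
  note D = computes_sem[OF assms(1)] and E = computes_sem[OF assms(2), folded assms(3)]
  \<comment> \<open>As names are distinct, \<open>map_of\<close> finds every declaration; outside
    the context the value is arbitrary. At offset 0 the grades are those written in
    \<open>\<Gamma>\<close>.\<close>
  define \<rho> where "\<rho> x = the (map_of \<Gamma> x)" for x
  have dist: "distinct_vars \<Gamma>" using derives_distinct[OF assms(1)] .
  have \<rho>: "\<rho> x = (0 + d, B)" if "(x, d, B) \<in> set \<Gamma>" for x d B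
    using map_of_is_SomeI[OF dist[unfolded distinct_vars_def] that] by (simp add: \<rho>_def)
  then have e: "ctx_env \<Gamma> \<rho> 0"
    using dist computesD(1)[OF D] by (auto simp: ctx_env_def)
  have "eqt \<rho> 0 s t A"
    by (rule evl_det[OF computesD(2)[OF D] computesD(3)[OF D e] computesD(3)[OF E e]])
  moreover have "declares \<Gamma> \<rho> 0 (fv s)"
    using dist \<rho> computesD(6)[OF D e] by (auto simp: declares_def)
  ultimately have "typed_jeq S \<Gamma> s t A" by (rule eqt_imp_jeq)
  then show ?thesis by (simp add: typed_jeq_def)
qed

end

theorem theorem16:
  fixes S :: "('q, 'g) signature"
    and \<Gamma> :: "'q ctx" and s t :: "'g tm" and A :: "'q ty"
    and D E :: "('q, 'g) deriv"
  assumes "wf_signature S"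
    and "derives S D \<Gamma> s A"
    and "derives S E \<Gamma> t A"
    and "\<And>M :: ('q, 'g) small_model. categorical_model S M \<Longrightarrow> sem S M D = sem S M E"
  shows "jeq S \<Gamma> s t A"
proof -
  interpret annotated S by standard (rule assms(1))
  show ?thesis
    by (rule completeness[OF assms(2,3) assms(4)[OF categorical_model_term_model]])
qed

end
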